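(* The following decision problem (the Spectral Degeneracy Problem) is co-NP-complete: given as input a graph $G$ and a positive rational number $d$, decide whether $G$ is spectrally $d$-degenerate.
   Context: All graphs are finite and simple. $\Delta(H)$ is the maximum degree of $H$; $\rho(H)$ is the spectral radius of $H$, i.e. the largest eigenvalue of its adjacency matrix. A graph $G$ is spectrally $d$-degenerate if every subgraph $H\subseteq G$ satisfies $\rho(H)\le\sqrt{d\,\Delta(H)}$. Both $G$ and $d$ are part of the input ($d$ is given as a fraction of binary integers), and hardness is with respect to polynomial-time reductions. *)

theory Defs
  imports
    "Jordan_Normal_Form.Spectral_Radius"
    "Graph_Theory.Pair_Digraph"
    "Graph_Theory.Digraph_Component"
    "HOL-Computational_Algebra.Polynomial"
begin

section \<open>Deterministic multi-tape Turing machines\<close>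

text \<open>
  States and tape symbols are initial segments of the natural numbers; the symbol 0 is the blank.
  \<open>tm_delta\<close> maps a state and the scanned symbols (one per tape) to the new state and, for each tape,
  the symbol to write and the head movement. Only its values on the finitely many arguments
  mentioned in \<open>turing_machine\<close> matter.
\<close>

datatype move = Left | Stay | Right

record tm =
  tm_tapes :: nat
  tm_symbols :: nat
  tm_states :: nat
  tm_start :: nat
  tm_halt :: nat
  tm_delta :: "nat \<Rightarrow> nat list \<Rightarrow> nat \<times> (nat \<times> move) list"

text \<open>Every machine has at least one tape, a blank, and two further symbols for the input bits.\<close>

definition turing_machine :: "tm \<Rightarrow> bool" where
  "turing_machine M \<longleftrightarrow>
     tm_tapes M \<ge> 1 \<and> tm_symbols M \<ge> 3 \<and> tm_start M < tm_states M \<and> tm_halt M < tm_states M \<and>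
     (\<forall>q rs. q < tm_states M \<and> length rs = tm_tapes M \<and> (\<forall>r\<in>set rs. r < tm_symbols M) \<longrightarrow>
        (case tm_delta M q rs of (q', as) \<Rightarrow>
           q' < tm_states M \<and> length as = tm_tapes M \<and> (\<forall>(s, d)\<in>set as. s < tm_symbols M)))"

text \<open>A tape is infinite in both directions; it is stored together with its head position.\<close>

type_synonym tape = "int \<times> (int \<Rightarrow> nat)"
type_synonym tm_config = "nat \<times> tape list"

fun move_head :: "move \<Rightarrow> int \<Rightarrow> int" where
  "move_head Left h = h - 1"
| "move_head Stay h = h"
| "move_head Right h = h + 1"

definition tape_act :: "tape \<Rightarrow> nat \<times> move \<Rightarrow> tape" where
  "tape_act = (\<lambda>(h, t) (s, d). (move_head d h, t(h := s)))"

definition tm_step :: "tm \<Rightarrow> tm_config \<Rightarrow> tm_config" where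
  "tm_step M = (\<lambda>(q, ts).
     if q = tm_halt M then (q, ts)
     else case tm_delta M q (map (\<lambda>(h, t). t h) ts) of (q', as) \<Rightarrow> (q', map2 tape_act ts as))"

definition bit_symbol :: "bool \<Rightarrow> nat" where
  "bit_symbol b = (if b then 2 else 1)"

definition blank_tape :: tape where
  "blank_tape = (0, \<lambda>_. 0)"

definition input_tape :: "bool list \<Rightarrow> tape" where
  "input_tape x =
     (0, \<lambda>i. if 0 \<le> i \<and> i < int (length x) then bit_symbol (x ! nat i) else 0)"

definition tm_init :: "tm \<Rightarrow> bool list \<Rightarrow> tm_config" where
  "tm_init M x = (tm_start M, input_tape x # replicate (tm_tapes M - 1) blank_tape)"

text \<open>
  The output is read off the first tape, from cell 0 up to the first blank, irrespective of the
  final head positions.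
\<close>

definition holds_output :: "tape \<Rightarrow> bool list \<Rightarrow> bool" where
  "holds_output = (\<lambda>(h, t) y.
     (\<forall>i < length y. t (int i) = bit_symbol (y ! i)) \<and> t (int (length y)) = 0)"

definition tm_outputs_within :: "tm \<Rightarrow> bool list \<Rightarrow> nat \<Rightarrow> bool list \<Rightarrow> bool" where
  "tm_outputs_within M x n y \<longleftrightarrow>
     (case (tm_step M ^^ n) (tm_init M x) of
        (q, ts) \<Rightarrow> q = tm_halt M \<and> holds_output (hd ts) y)"


section \<open>Polynomial time, NP, and co-NP-completeness\<close>

definition polynomial_time :: "(bool list \<Rightarrow> bool list) \<Rightarrow> bool" where
  "polynomial_time f \<longleftrightarrow>
     (\<exists>M (p :: nat poly). turing_machine M \<and>
        (\<forall>x. tm_outputs_within M x (poly p (length x)) (f x)))"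

type_synonym language = "bool list set"

definition class_P :: "language set" where
  "class_P = {L. polynomial_time (\<lambda>x. [x \<in> L])}"

text \<open>Self-delimiting pairing: the bits of \<open>x\<close> are doubled, and \<open>01\<close> marks the end of \<open>x\<close>.\<close>

definition pair_code :: "bool list \<Rightarrow> bool list \<Rightarrow> bool list" where
  "pair_code x y = concat (map (\<lambda>b. [b, b]) x) @ [False, True] @ y"

definition class_NP :: "language set" where
  "class_NP = {L. \<exists>R \<in> class_P. \<exists>p :: nat poly.
     \<forall>x. x \<in> L \<longleftrightarrow> (\<exists>u. length u \<le> poly p (length x) \<and> pair_code x u \<in> R)}"

definition class_coNP :: "language set" where
  "class_coNP = {L. - L \<in> class_NP}"

definition poly_reducible :: "language \<Rightarrow> language \<Rightarrow> bool" where
  "poly_reducible L L' \<longleftrightarrow> (\<exists>f. polynomial_time f \<and> (\<forall>x. x \<in> L \<longleftrightarrow> f x \<in> L'))"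

definition coNP_hard :: "language \<Rightarrow> bool" where
  "coNP_hard L \<longleftrightarrow> (\<forall>L' \<in> class_coNP. poly_reducible L' L)"

definition coNP_complete :: "language \<Rightarrow> bool" where
  "coNP_complete L \<longleftrightarrow> L \<in> class_coNP \<and> coNP_hard L"


section \<open>Spectral degeneracy\<close>

text \<open>
  A finite simple graph is a \<open>pair_graph\<close>: a finite loopless digraph whose arc relation is symmetric,
  so that the edge \<open>uv\<close> is the pair of arcs \<open>(u, v)\<close> and \<open>(v, u)\<close>, and the out-degree
  is the degree. The null graph, which has no eigenvalues and no maximum degree, is excluded.
\<close>

definition simple_graph :: "'a pair_pre_digraph \<Rightarrow> bool" where
  "simple_graph G \<longleftrightarrow> pair_graph G \<and> pverts G \<noteq> {}"

definition max_degree :: "'a pair_pre_digraph \<Rightarrow> nat" where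
  "max_degree G = Max (out_degree (with_proj G) ` pverts G)"

text \<open>Rows and columns are indexed by the vertices in increasing order.\<close>

definition adjacency_matrix :: "'a :: linorder pair_pre_digraph \<Rightarrow> real mat" where
  "adjacency_matrix G =
     (let vs = sorted_list_of_set (pverts G)
      in mat (card (pverts G)) (card (pverts G))
           (\<lambda>(i, j). if (vs ! i, vs ! j) \<in> parcs G then 1 else 0))"

definition graph_spectral_radius :: "'a :: linorder pair_pre_digraph \<Rightarrow> real" where
  "graph_spectral_radius G = Max (spectrum (adjacency_matrix G))"

definition spectrally_degenerate :: "real \<Rightarrow> 'a :: linorder pair_pre_digraph \<Rightarrow> bool" where
  "spectrally_degenerate d G \<longleftrightarrow>
     (\<forall>H. simple_graph H \<and> subgraph (with_proj H) (with_proj G) \<longrightarrow>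
        graph_spectral_radius H \<le> sqrt (d * real (max_degree H)))"


section \<open>The Spectral Degeneracy Problem as a language\<close>

text \<open>Binary notation, least significant bit first and without leading zeros.\<close>

fun binary :: "nat \<Rightarrow> bool list" where
  "binary n = (if n = 0 then [] else odd n # binary (n div 2))"

declare binary.simps [simp del]

text \<open>An input graph has vertex set \<open>{0..<n}\<close> and is given by its adjacency matrix, row by row.\<close>

definition graph_code :: "nat pair_pre_digraph \<Rightarrow> bool list" where
  "graph_code G =
     (let n = card (pverts G) in concat (map (\<lambda>i. map (\<lambda>j. (i, j) \<in> parcs G) [0..<n]) [0..<n]))"

definition instance_code :: "nat pair_pre_digraph \<Rightarrow> nat \<Rightarrow> nat \<Rightarrow> bool list" where
  "instance_code G a b = pair_code (graph_code G) (pair_code (binary a) (binary b))"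

text \<open>
  The rational number \<open>d = a / b\<close> is given by any positive numerator and denominator, not
  necessarily coprime. Strings that do not encode an instance count as no-instances.
\<close>

definition spectral_degeneracy_problem :: language where
  "spectral_degeneracy_problem =
     {instance_code G a b | G a b.
        simple_graph G \<and> pverts G = {0..<card (pverts G)} \<and> a > 0 \<and> b > 0 \<and>
        spectrally_degenerate (real a / real b) G}"

text \<open>Distinct instances have distinct codes, so the language above is the decision problem.\<close>

lemma pair_code_inject: "pair_code x y = pair_code x' y' \<longleftrightarrow> x = x' \<and> y = y'"
proof (induction x arbitrary: x')
  case Nil
  then show ?case by (cases x') (auto simp: pair_code_def)
next
  case (Cons b x)
  then show ?case by (cases x') (auto simp: pair_code_def)
qed

lemma binary_inject: "binary m = binary n \<longleftrightarrow> m = n"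
proof
  show "m = n" if "binary m = binary n" using that
  proof (induction m arbitrary: n rule: less_induct)
    case (less m)
    show ?case
    proof (cases "m = 0 \<or> n = 0")
      case True
      then show ?thesis using less.prems by (auto simp: binary.simps[of m] binary.simps[of n] split: if_splits)
    next
      case False
      then have "odd m = odd n" "binary (m div 2) = binary (n div 2)"
        using less.prems binary.simps[of m] binary.simps[of n] by auto
      then have "odd m = odd n" "m div 2 = n div 2"
        using less.IH[of "m div 2"] False by auto
      then show ?thesis by (metis bit_eq_rec)
    qed
  qed
qed simp

lemma nth_concat_rows:
  "i < n \<Longrightarrow> j < k \<Longrightarrow> concat (map (\<lambda>i. map (f i) [0..<k]) [0..<n]) ! (i*k+j) = f i j"
proof (induction n)
  case (Suc n)
  have l: "length (concat (map (\<lambda>i. map (f i) [0..<k]) [0..<n])) = n*k" 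
    by (simp add: length_concat comp_def sum_list_triv)
  show ?case
  proof (cases "i = n")
    case True then show ?thesis using Suc.prems l by (simp add: nth_append)
  next
    case False
    then have "i < n" using Suc.prems by simp
    then have "i*k+j < n*k" using Suc.prems(2)
      by (metis add.commute add_less_cancel_left less_le_trans mult_Suc mult_le_mono1 Suc_leI)
    then show ?thesis using Suc.IH \<open>i<n\<close> Suc.prems l by (simp add: nth_append)
  qed
qed simp

lemma graph_code_inject:
  assumes "simple_graph G" "pverts G = {0..<card (pverts G)}"
    and "simple_graph H" "pverts H = {0..<card (pverts H)}" and e: "graph_code G = graph_code H"
  shows "G = H"
proof -
  define n k where "n = card (pverts G)" and "k = card (pverts H)"
  have "length (graph_code G) = n * n" "length (graph_code H) = k * k" 
    by (simp_all add: graph_code_def Let_def length_concat comp_def sum_list_triv n_def k_def)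
  then have "n*n = k*k" using e by simp
  then have nk: "n = k" by (metis power2_eq_square power2_eq_imp_eq zero_le)
  have "(i,j) \<in> parcs G \<longleftrightarrow> (i,j) \<in> parcs H" if "i<n" "j<n" for i j
    using nth_concat_rows[OF that, of "\<lambda>i j. (i,j) \<in> parcs G"] nth_concat_rows[OF that, of "\<lambda>i j. (i,j) \<in> parcs H"] e nk
    by (simp add: graph_code_def Let_def n_def k_def)
  moreover have "parcs G \<subseteq> {0..<n} \<times> {0..<n}" "parcs H \<subseteq> {0..<n} \<times> {0..<n}"
  proof -
    have sub: "parcs K \<subseteq> pverts K \<times> pverts K"
      if "simple_graph K" for K :: "nat pair_pre_digraph"
    proof -
      interpret pair_graph K using that by (simp add: simple_graph_def)
      show ?thesis using in_arcsD1 in_arcsD2 by auto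
    qed
    show "parcs G \<subseteq> {0..<n} \<times> {0..<n}" "parcs H \<subseteq> {0..<n} \<times> {0..<n}"
      using sub[OF assms(1)] sub[OF assms(3)] assms(2,4) nk unfolding n_def k_def by metis+
  qed
  ultimately have "parcs G = parcs H" by (intro Set.set_eqI) (auto 4 3)
  moreover have "pverts G = pverts H" using assms(2,4) nk n_def k_def by simp
  ultimately show "G = H" by simp
qed

theorem instance_code_inject:
  assumes "simple_graph G" "pverts G = {0..<card (pverts G)}"
    and "simple_graph H" "pverts H = {0..<card (pverts H)}"
    and "instance_code G a b = instance_code H a' b'"
  shows "G = H \<and> a = a' \<and> b = b'"
  using assms graph_code_inject[of G H]
  by (auto simp: instance_code_def pair_code_inject binary_inject)

end

theory Submission
  imports Defs "HOL-Analysis.Function_Topology"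
begin

text \<open>
  Membership in co-NP: a violating subgraph \<open>H\<close> is certified by its edges together with a vector. For
  the adjacency matrix \<open>A\<close> of \<open>H\<close> and \<open>d = a / b\<close>, the violation means \<open>b |A v|\<^sup>2 > a \<Delta>(H) |v|\<^sup>2\<close> for
  some \<open>v\<close>. As a root of an integral polynomial, an eigenvalue that violates the bound does so with a
  margin that is at worst singly exponential in the size of the input, so a Perron vector can be
  rounded to a nonnegative integral vector with polynomially many bits.

  Hardness: the graph that is built from a system of rows is bipartite, and \<open>d\<close> lies so slightly below \<open>k\<close>
  that only biregular subgraphs with degrees \<open>k\<close> and \<open>\<Delta>\<close> violate the bound. Such a subgraph
  amounts to a nonempty set of variables that meets every row in either no or exactly \<open>k\<close> positions.
  Exactly-\<open>m\<close> constraints, and hence the clauses with slack variables that encode a computation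
  of a nondeterministic machine, reduce to these systems.

  Polynomial-time functions are programmed with composable machine fragments that work on stacks
  holding serialised trees. The resulting closure properties make the running time of the verifier and
  of the reduction a matter of syntax.
\<close>

section \<open>Machine fragments\<close>

text \<open>One estimate carries both halves. For an adjacency matrix \<open>A\<close> the matrix
  \<open>b A^2 - a \<Delta> I\<close> is integral, the product of its nonzero eigenvalues is up to
  sign a nonzero integer, and so none of them is smaller in modulus than \<open>B ^ (- n)\<close> if
  \<open>B \<ge> 1\<close> bounds the absolute row sums. Membership uses this to bound the entries
  of the rounded vector, hardness to choose \<open>d = k - 1 / b\<close> with polynomially many
  bits.

  The obstacle on the hardness side is that \<open>\<Delta>\<close> belongs to the subgraph, so the
  equality \<open>\<rho>\<^sup>2 = k \<Delta>\<close> alone would allow \<open>\<Delta> > k\<close>.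
  Each variable therefore gets at least one auxiliary vertex whose only neighbours are the
  \<open>k\<close> copies of that variable. This requires every variable to occur fewer than
  \<open>k\<close> times in the rows, which in turn shapes the padded rows: a switch occurs once
  more in the row that synchronises all switches, and a constraint lists its entries twice to leave
  room for this.\<close>

type_synonym frag = "nat \<times> (nat \<Rightarrow> nat list \<Rightarrow> nat \<times> (nat \<times> move) list)"

definition scan :: "tape list \<Rightarrow> nat list" where
  "scan = map (\<lambda>(h, t). t h)"

text \<open>A fragment \<open>(n, \<delta>)\<close> is entered in state 0 and left in state \<open>n\<close>, which is not one of its own states.\<close>

inductive reach :: "frag \<Rightarrow> nat \<times> tape list \<Rightarrow> nat \<Rightarrow> nat \<times> tape list \<Rightarrow> bool" for P where
  none: "reach P c 0 c"
| step: "q < fst P \<Longrightarrow> snd P q (scan ts) = (q', as) \<Longrightarrow> reach P (q', map2 tape_act ts as) n c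
         \<Longrightarrow> reach P (q, ts) (Suc n) c"

text \<open>All fragments share one format: tape 0 for input and output, four tapes for stacks, and
  four symbols, namely the blank, 1 and 2 (both the input bits and the nodes of trees) and the
  marker 3. The target \<open>q' = fst P\<close> is the exit.\<close>

definition wf_frag :: "frag \<Rightarrow> bool" where
  "wf_frag P \<longleftrightarrow> (\<forall>q rs. q < fst P \<and> length rs = 5 \<and> (\<forall>r\<in>set rs. r < 4) \<longrightarrow>
     (case snd P q rs of (q', as) \<Rightarrow> q' \<le> fst P \<and> length as = 5 \<and> (\<forall>(s, d)\<in>set as. s < 4)))"

definition exec :: "frag \<Rightarrow> tape list \<Rightarrow> nat \<Rightarrow> tape list \<Rightarrow> bool" where
  "exec P ts n ts' \<longleftrightarrow> reach P (0, ts) n (fst P, ts')"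

definition noop :: "nat list \<Rightarrow> (nat \<times> move) list" where
  "noop = map (\<lambda>r. (r, Stay))"

definition shift :: "nat \<Rightarrow> nat \<times> 'a \<Rightarrow> nat \<times> 'a" where
  "shift k = (\<lambda>(q, as). (q + k, as))"

definition seq :: "frag \<Rightarrow> frag \<Rightarrow> frag" where
  "seq P Q = (fst P + fst Q, \<lambda>q rs. if q < fst P then snd P q rs
     else shift (fst P) (snd Q (q - fst P) rs))"

text \<open>State 0 branches. The exit of \<open>P\<close> becomes state \<open>1 + fst P\<close>,
  which needs a step of its own to jump over the states of \<open>Q\<close>; the exit of
  \<open>Q\<close> already is the exit of the whole. Hence the overhead of 2 steps or 1 step in
  \<open>exec_ifte\<close>.\<close>

definition ifte :: "(nat list \<Rightarrow> bool) \<Rightarrow> frag \<Rightarrow> frag \<Rightarrow> frag" where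
  "ifte c P Q = (2 + fst P + fst Q, \<lambda>q rs.
     if q = 0 then (if c rs then 1 else 2 + fst P, noop rs)
     else if q < 1 + fst P then shift 1 (snd P (q - 1) rs)
     else if q = 1 + fst P then (2 + fst P + fst Q, noop rs)
     else shift (2 + fst P) (snd Q (q - (2 + fst P)) rs))"

definition while :: "(nat list \<Rightarrow> bool) \<Rightarrow> frag \<Rightarrow> frag" where
  "while c P = (2 + fst P, \<lambda>q rs.
     if q = 0 then (if c rs then 1 else 2 + fst P, noop rs)
     else if q < 1 + fst P then shift 1 (snd P (q - 1) rs)
     else (0, noop rs))"

definition skip :: frag where
  "skip = (0, \<lambda>q rs. (0, noop rs))"

definition act :: "nat \<Rightarrow> (nat list \<Rightarrow> nat) \<Rightarrow> move \<Rightarrow> frag" where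
  "act j f d = (1, \<lambda>q rs. (1, (noop rs)[j := (f rs, d)]))"

lemma wf_skip: "wf_frag skip"
  by (simp add: wf_frag_def skip_def)

lemma noop_props: "length (noop rs) = length rs" "(s, d) \<in> set (noop rs) \<Longrightarrow> s \<in> set rs"
  by (auto simp: noop_def)

lemma wf_act:
  assumes "\<And>rs. length rs = 5 \<Longrightarrow> \<forall>r\<in>set rs. r < 4 \<Longrightarrow> f rs < 4"
  shows "wf_frag (act j f d)"
proof -
  have "s < 4" if "length rs = 5" "\<forall>r\<in>set rs. r < 4" "(s, e) \<in> set ((noop rs)[j := (f rs, d)])" for rs s e
  proof -
    have "(s, e) \<in> insert (f rs, d) (set (noop rs))"
      using that(3) set_update_subset_insert by fast
    then show ?thesis using assms[OF that(1,2)] that(2) noop_props(2) by auto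
  qed
  then show ?thesis by (auto simp: wf_frag_def act_def noop_props)
qed

lemma wf_seq: "wf_frag P \<Longrightarrow> wf_frag Q \<Longrightarrow> wf_frag (seq P Q)"
  unfolding wf_frag_def seq_def shift_def
  apply (clarsimp split: prod.splits)
  subgoal for q rs
    apply (cases "q < fst P")
     apply (fastforce split: prod.splits)
    apply (drule spec[where x = "q - fst P"], drule spec[where x = "q - fst P"])
    apply (fastforce split: prod.splits)
    done
  done

lemma wf_ifte: "wf_frag P \<Longrightarrow> wf_frag Q \<Longrightarrow> wf_frag (ifte c P Q)"
proof -
  assume P: "wf_frag P" and Q: "wf_frag Q"
  show "wf_frag (ifte c P Q)" unfolding wf_frag_def
  proof (intro allI impI, elim conjE)
    fix q and rs :: "nat list" assume q: "q < fst (ifte c P Q)" and rs: "length rs = 5" "\<forall>r\<in>set rs. r < 4"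
    consider "q = 0" | "q \<noteq> 0" "q < 1 + fst P" | "q = 1 + fst P" | "q \<ge> 2 + fst P" by linarith
    then show "case snd (ifte c P Q) q rs of (q', as) \<Rightarrow> q' \<le> fst (ifte c P Q) \<and> length as = 5 \<and> (\<forall>(s, d)\<in>set as. s < 4)"
    proof cases
      case 2
      then have "q - 1 < fst P" by auto
      with P rs obtain q' as where "snd P (q - 1) rs = (q', as)" "q' \<le> fst P" "length as = 5" "\<forall>(s, d)\<in>set as. s < 4"
        unfolding wf_frag_def by fast
      with 2 show ?thesis by (simp add: ifte_def shift_def)
    next
      case 4
      then have "q - (2 + fst P) < fst Q" using q by (auto simp: ifte_def)
      with Q rs obtain q' as where "snd Q (q - (2 + fst P)) rs = (q', as)" "q' \<le> fst Q" "length as = 5" "\<forall>(s, d)\<in>set as. s < 4"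
        unfolding wf_frag_def by fast
      with 4 show ?thesis by (simp add: ifte_def shift_def)
    qed (use rs in \<open>auto simp: ifte_def noop_def\<close>)
  qed
qed

lemma wf_while: "wf_frag P \<Longrightarrow> wf_frag (while c P)"
proof -
  assume P: "wf_frag P"
  show "wf_frag (while c P)" unfolding wf_frag_def
  proof (intro allI impI, elim conjE)
    fix q and rs :: "nat list" assume q: "q < fst (while c P)" and rs: "length rs = 5" "\<forall>r\<in>set rs. r < 4"
    consider "q = 0" | "q \<noteq> 0" "q < 1 + fst P" | "q \<noteq> 0" "\<not> q < 1 + fst P" by linarith
    then show "case snd (while c P) q rs of (q', as) \<Rightarrow> q' \<le> fst (while c P) \<and> length as = 5 \<and> (\<forall>(s, d)\<in>set as. s < 4)"
    proof cases
      case 2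
      then have "q - 1 < fst P" by auto
      with P rs obtain q' as where "snd P (q - 1) rs = (q', as)" "q' \<le> fst P" "length as = 5" "\<forall>(s, d)\<in>set as. s < 4"
        unfolding wf_frag_def by fast
      with 2 show ?thesis by (simp add: while_def shift_def)
    qed (use rs in \<open>auto simp: while_def noop_def\<close>)
  qed
qed

lemma reach_trans: "reach P c m c' \<Longrightarrow> reach P c' n c'' \<Longrightarrow> reach P c (m + n) c''"
  by (induction rule: reach.induct) (auto intro: reach.step)

text \<open>Composite fragments contain their parts with states shifted by an offset; each
  composition rule is this embedding plus a few administrative steps.\<close>

lemma reach_embed:
  assumes "reach P c n c'" "\<And>q rs. q < fst P \<Longrightarrow> snd R (q + k) rs = shift k (snd P q rs)" "fst P + k \<le> fst R"
  shows "reach R (fst c + k, snd c) n (fst c' + k, snd c')"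
  using assms(1)
proof induction
  case (none c)
  then show ?case by (simp add: reach.none)
next
  case (step q ts q' as n c)
  then show ?case using assms(2)[of q "scan ts"] assms(3)
    by (auto intro!: reach.step simp: shift_def)
qed

lemma map2_tape_act_update:
  "map2 tape_act ts ((noop (scan ts))[j := a]) = (if j < length ts then ts[j := tape_act (ts ! j) a] else ts)"
  by (rule nth_equalityI)
    (auto simp: noop_def scan_def nth_list_update tape_act_def split: prod.splits)

lemma map2_tape_act_noop: "map2 tape_act ts (noop (scan ts)) = ts"
  by (rule nth_equalityI) (auto simp: noop_def scan_def tape_act_def split: prod.splits)

lemma reach_noop:
  assumes "q < fst P" "snd P q (scan ts) = (q', noop (scan ts))" "reach P (q', ts) n c"
  shows "reach P (q, ts) (Suc n) c"
  using reach.step[OF assms(1,2)] assms(3) by (simp add: map2_tape_act_noop)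

lemma exec_skip: "exec skip ts 0 ts"
  by (simp add: exec_def skip_def reach.none)

lemma exec_act:
  assumes "j < length ts"
  shows "exec (act j f d) ts 1 (ts[j := tape_act (ts ! j) (f (scan ts), d)])"
proof -
  have "reach (act j f d) (0, ts) (Suc 0) (1, ts[j := tape_act (ts ! j) (f (scan ts), d)])"
    by (rule reach.step[where q' = 1 and as = "(noop (scan ts))[j := (f (scan ts), d)]"])
      (use assms in \<open>auto simp: act_def map2_tape_act_update intro: reach.none\<close>)
  then show ?thesis by (simp add: exec_def act_def)
qed

lemma exec_seq:
  assumes "exec P ts m ts1" "exec Q ts1 n ts2"
  shows "exec (seq P Q) ts (m + n) ts2"
proof -
  have "reach (seq P Q) (0 + 0, ts) m (fst P + 0, ts1)"
    using reach_embed[of P "(0, ts)" m "(fst P, ts1)" "seq P Q" 0] assms(1)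
    by (auto simp: exec_def seq_def shift_def split: prod.splits)
  moreover have "reach (seq P Q) (0 + fst P, ts1) n (fst Q + fst P, ts2)"
    using reach_embed[of Q "(0, ts1)" n "(fst Q, ts2)" "seq P Q" "fst P"] assms(2)
    by (auto simp: exec_def seq_def)
  ultimately show ?thesis
    using reach_trans by (fastforce simp: exec_def seq_def add.commute)
qed

lemma exec_ifte:
  assumes "if c (scan ts) then exec P ts n ts' else exec Q ts n ts'"
  shows "exec (ifte c P Q) ts (n + (if c (scan ts) then 2 else 1)) ts'"
proof (cases "c (scan ts)")
  case True
  let ?R = "ifte c P Q"
  have "reach ?R (0 + 1, ts) n (fst P + 1, ts')"
    using reach_embed[of P "(0, ts)" n "(fst P, ts')" ?R 1] assms True
    by (auto simp: exec_def ifte_def)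
  moreover have "reach ?R (fst P + 1, ts') (Suc 0) (fst ?R, ts')"
    by (rule reach_noop[OF _ _ reach.none]) (auto simp: ifte_def)
  ultimately have "reach ?R (1, ts) (n + 1) (fst ?R, ts')" using reach_trans by fastforce
  then have "reach ?R (0, ts) (Suc (n + 1)) (fst ?R, ts')"
    by (rule reach_noop[rotated 2]) (use True in \<open>auto simp: ifte_def\<close>)
  then show ?thesis using True by (simp add: exec_def)
next
  case False
  let ?R = "ifte c P Q"
  have "reach ?R (0 + (2 + fst P), ts) n (fst Q + (2 + fst P), ts')"
    using reach_embed[of Q "(0, ts)" n "(fst Q, ts')" ?R "2 + fst P"] assms False
    by (auto simp: exec_def ifte_def)
  then have "reach ?R (2 + fst P, ts) n (fst ?R, ts')"
    by (simp add: ifte_def add.commute add.left_commute)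
  then have "reach ?R (0, ts) (Suc n) (fst ?R, ts')"
    by (rule reach_noop[rotated 2]) (use False in \<open>auto simp: ifte_def\<close>)
  then show ?thesis using False by (simp add: exec_def)
qed

lemma exec_while_False:
  assumes "\<not> c (scan ts)"
  shows "exec (while c P) ts 1 ts"
proof -
  have "reach (while c P) (0, ts) (Suc 0) (fst (while c P), ts)"
    by (rule reach_noop[OF _ _ reach.none]) (use assms in \<open>auto simp: while_def\<close>)
  then show ?thesis by (simp add: exec_def)
qed

lemma exec_while_True:
  assumes "c (scan ts)" "exec P ts m ts1" "exec (while c P) ts1 n ts2"
  shows "exec (while c P) ts (m + n + 2) ts2"
proof -
  let ?R = "while c P"
  have "reach ?R (0 + 1, ts) m (fst P + 1, ts1)"
    using reach_embed[of P "(0, ts)" m "(fst P, ts1)" ?R 1] assms(2)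
    by (auto simp: exec_def while_def)
  moreover have "reach ?R (fst P + 1, ts1) (Suc n) (fst ?R, ts2)"
    by (rule reach_noop[OF _ _ assms(3)[unfolded exec_def]]) (auto simp: while_def)
  ultimately have "reach ?R (1, ts) (m + Suc n) (fst ?R, ts2)" using reach_trans by fastforce
  then have "reach ?R (0, ts) (Suc (m + Suc n)) (fst ?R, ts2)"
    by (rule reach_noop[rotated 2]) (use assms(1) in \<open>auto simp: while_def\<close>)
  then show ?thesis by (simp add: exec_def)
qed

section \<open>Stack programs\<close>

text \<open>The stack grows to the left of the tape; nothing is assumed about the cells outside it.\<close>

definition stk :: "tape \<Rightarrow> nat list \<Rightarrow> bool" where
  "stk = (\<lambda>(h, t) xs. \<forall>k < length xs. t (h + int k) = xs ! k)"

type_synonym stacks = "tape \<times> nat list list"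

text \<open>The tape for input and output is described exactly, because its content is the result,
  whereas the stack tapes are constrained only where the stacks are.\<close>

definition rep :: "tape list \<Rightarrow> stacks \<Rightarrow> bool" where
  "rep ts = (\<lambda>(io, ss). length ss = 4 \<and> (\<exists>us. ts = io # us \<and> list_all2 stk us ss))"

text \<open>The number of steps is only bounded from above, so branches of different length can be
  merged and bounds can be simplified by \<open>run_mono\<close>.\<close>

definition run :: "frag \<Rightarrow> stacks \<Rightarrow> nat \<Rightarrow> stacks \<Rightarrow> bool" where
  "run P s n s' \<longleftrightarrow> (\<forall>ts. rep ts s \<longrightarrow> (\<exists>ts' m. m \<le> n \<and> exec P ts m ts' \<and> rep ts' s'))"

definition test :: "(nat list \<Rightarrow> bool) \<Rightarrow> stacks \<Rightarrow> bool \<Rightarrow> bool" where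
  "test c s v \<longleftrightarrow> (\<forall>ts. rep ts s \<longrightarrow> c (scan ts) = v)"

definition topis :: "nat \<Rightarrow> nat \<Rightarrow> nat list \<Rightarrow> bool" where
  "topis i x rs \<longleftrightarrow> rs ! Suc i = x"

text \<open>Two steps, as \<open>tape_act\<close> writes before it moves: the head has to reach the
  new cell first. Capping the symbol by \<open>min x 3\<close> makes the fragment well formed for
  every \<open>x\<close>.\<close>

definition push :: "nat \<Rightarrow> nat \<Rightarrow> frag" where
  "push i x = seq (act (Suc i) (\<lambda>rs. rs ! Suc i) Left) (act (Suc i) (\<lambda>_. min x 3) Stay)"

text \<open>Rewrites the scanned symbol and moves on, so a popped symbol stays on the tape. The
  fallback to tape 0 makes the fragment well formed for every \<open>i\<close>.\<close>

definition pop :: "nat \<Rightarrow> frag" where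
  "pop i = act (if i < 4 then Suc i else 0) (\<lambda>rs. rs ! (if i < 4 then Suc i else 0)) Right"

lemma wf_push: "i < 4 \<Longrightarrow> wf_frag (push i x)"
  unfolding push_def by (intro wf_seq wf_act) auto

lemma wf_pop: "wf_frag (pop i)"
  unfolding pop_def by (intro wf_act) auto

lemmas wf_intros = wf_skip wf_act wf_seq wf_ifte wf_while wf_push wf_pop

lemma run_mono: "run P s m s' \<Longrightarrow> m \<le> n \<Longrightarrow> run P s n s'"
  unfolding run_def by (meson le_trans)

lemma run_skip: "run skip s 0 s"
  unfolding run_def using exec_skip by blast

lemma run_seq: "run P s m s1 \<Longrightarrow> run Q s1 n s2 \<Longrightarrow> run (seq P Q) s (m + n) s2"
  unfolding run_def using exec_seq by (meson add_le_mono)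

lemma run_ifte:
  assumes "test c s v" "v \<Longrightarrow> run P s n s'" "\<not> v \<Longrightarrow> run Q s n s'"
  shows "run (ifte c P Q) s (n + 2) s'"
  unfolding run_def
proof (intro allI impI)
  fix ts assume r: "rep ts s"
  then have v: "c (scan ts) = v" using assms(1) by (auto simp: test_def)
  obtain ts' m where "m \<le> n" "if c (scan ts) then exec P ts m ts' else exec Q ts m ts'" "rep ts' s'"
    using assms(2,3) r v unfolding run_def by (cases v) auto
  then show "\<exists>ts' m. m \<le> n + 2 \<and> exec (ifte c P Q) ts m ts' \<and> rep ts' s'"
    using exec_ifte[of c ts P m ts' Q] by (intro exI[of _ ts'] exI[of _ "m + (if c (scan ts) then 2 else 1)"]) auto
qed

lemma run_ifte_True: "test c s True \<Longrightarrow> run P s n s' \<Longrightarrow> run (ifte c P Q) s (n + 2) s'"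
  by (rule run_ifte[where v = True]) auto

lemma run_ifte_False: "test c s False \<Longrightarrow> run Q s n s' \<Longrightarrow> run (ifte c P Q) s (n + 2) s'"
  by (rule run_ifte[where v = False]) auto

lemma run_while_done: "test c s False \<Longrightarrow> run (while c P) s 1 s"
  unfolding run_def test_def using exec_while_False by blast

lemma run_while_step:
  assumes "test c s True" "run P s m s1" "run (while c P) s1 n s2"
  shows "run (while c P) s (m + n + 2) s2"
  unfolding run_def
proof (intro allI impI)
  fix ts assume r: "rep ts s"
  obtain ts1 m' where 1: "m' \<le> m" "exec P ts m' ts1" "rep ts1 s1" using assms(2) r unfolding run_def by blast
  obtain ts2 n' where 2: "n' \<le> n" "exec (while c P) ts1 n' ts2" "rep ts2 s2" using assms(3) 1 unfolding run_def by blast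
  show "\<exists>ts' k. k \<le> m + n + 2 \<and> exec (while c P) ts k ts' \<and> rep ts' s2"
    using exec_while_True[of c ts P m' ts1 n' ts2] 1 2 assms(1) r
    by (intro exI[of _ ts2] exI[of _ "m' + n' + 2"]) (auto simp: test_def)
qed

lemma rep_scan:
  assumes "rep ts (io, ss)" "i < 4" "ss ! i = x # xs"
  shows "scan ts ! Suc i = x"
proof -
  obtain us where us: "ts = io # us" "list_all2 stk us ss" "length ss = 4" using assms(1) by (auto simp: rep_def)
  then have "stk (us ! i) (x # xs)" using assms(2,3) by (metis list_all2_conv_all_nth)
  moreover have "i < length us" using us assms(2) by (simp add: list_all2_lengthD)
  ultimately show ?thesis using us(1) by (auto simp: scan_def stk_def split: prod.splits)
qed

lemma test_topis: "i < 4 \<Longrightarrow> ss ! i = x # xs \<Longrightarrow> test (topis i y) (io, ss) (x = y)"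
  by (auto simp: test_def topis_def rep_scan)

lemma test_not_topis: "i < 4 \<Longrightarrow> ss ! i = x # xs \<Longrightarrow> test (\<lambda>rs. \<not> topis i y rs) (io, ss) (x \<noteq> y)"
  by (auto simp: test_def topis_def rep_scan)

lemma rep_io: "rep ts (io, ss) \<Longrightarrow> length ts = 5 \<and> ts ! 0 = io"
  by (auto simp: rep_def list_all2_lengthD)

lemma test_io: "test (\<lambda>rs. Q (rs ! 0)) ((h, t), ss) (Q (t h))"
  by (auto simp: test_def rep_def scan_def)

lemma rep_update:
  assumes "rep ts (io, ss)" "stk u xs"
  shows "rep (ts[Suc i := u]) (io, ss[i := xs])"
  using assms by (auto simp: rep_def list_all2_update_cong)

lemma stk_push: "stk (h, t) xs \<Longrightarrow> stk (h - 1, t(h - 1 := x)) (x # xs)"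
proof -
  assume s: "stk (h, t) xs"
  have "(t(h - 1 := x)) (h - 1 + int k) = (x # xs) ! k" if "k < Suc (length xs)" for k
    using s that by (cases k) (auto simp: stk_def)
  then show ?thesis by (auto simp: stk_def)
qed

lemma stk_pop: "stk (h, t) (x # xs) \<Longrightarrow> stk (h + 1, t) xs"
proof -
  assume s: "stk (h, t) (x # xs)"
  have "t (h + 1 + int k) = xs ! k" if "k < length xs" for k
    using s that unfolding stk_def by (auto dest!: spec[of _ "Suc k"] simp: algebra_simps)
  then show ?thesis by (auto simp: stk_def)
qed

lemma run_push:
  assumes "i < 4" "x \<le> 3"
  shows "run (push i x) (io, ss) 2 (io, ss[i := x # ss ! i])"
  unfolding run_def
proof (intro allI impI)
  fix ts assume r: "rep ts (io, ss)"
  obtain h t where ht: "ts ! Suc i = (h, t)" by force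
  have l: "length ts = 5" using rep_io r by blast
  have s: "stk (h, t) (ss ! i)"
    using r ht assms(1) unfolding rep_def by (auto simp: list_all2_conv_all_nth dest!: spec[of _ i])
  let ?ts1 = "ts[Suc i := (h - 1, t)]"
  let ?ts2 = "ts[Suc i := (h - 1, t(h - 1 := x))]"
  have "exec (act (Suc i) (\<lambda>rs. rs ! Suc i) Left) ts 1 ?ts1"
    using exec_act[of "Suc i" ts "\<lambda>rs. rs ! Suc i" Left] ht l assms(1)
    by (auto simp: tape_act_def scan_def)
  moreover have "exec (act (Suc i) (\<lambda>_. min x 3) Stay) ?ts1 1 ?ts2"
    using exec_act[of "Suc i" ?ts1 "\<lambda>_. min x 3" Stay] l assms
    by (auto simp: tape_act_def min_def)
  ultimately have "exec (push i x) ts (1 + 1) ?ts2" unfolding push_def by (rule exec_seq)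
  moreover have "rep ?ts2 (io, ss[i := x # ss ! i])" by (intro rep_update r stk_push s)
  ultimately show "\<exists>ts' m. m \<le> 2 \<and> exec (push i x) ts m ts' \<and> rep ts' (io, ss[i := x # ss ! i])"
    by (intro exI[of _ ?ts2] exI[of _ 2]) (simp add: numeral_2_eq_2)
qed

lemma run_pop:
  assumes "i < 4" "ss ! i = x # xs"
  shows "run (pop i) (io, ss) 1 (io, ss[i := xs])"
  unfolding run_def
proof (intro allI impI)
  fix ts assume r: "rep ts (io, ss)"
  obtain h t where ht: "ts ! Suc i = (h, t)" by force
  have l: "length ts = 5" using rep_io r by blast
  have s: "stk (h, t) (x # xs)"
    using r ht assms unfolding rep_def by (auto simp: list_all2_conv_all_nth dest!: spec[of _ i])
  have "exec (pop i) ts 1 (ts[Suc i := (h + 1, t)])"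
    using exec_act[of "Suc i" ts "\<lambda>rs. rs ! Suc i" Right] ht l assms(1)
    by (auto simp: tape_act_def scan_def pop_def)
  moreover have "rep (ts[Suc i := (h + 1, t)]) (io, ss[i := xs])" by (intro rep_update r stk_pop[OF s])
  ultimately show "\<exists>ts' m. m \<le> 1 \<and> exec (pop i) ts m ts' \<and> rep ts' (io, ss[i := xs])" by auto
qed

lemma run_io: "run (act 0 (\<lambda>_. x) d) (io, ss) 1 (tape_act io (x, d), ss)"
  unfolding run_def
proof (intro allI impI)
  fix ts assume r: "rep ts (io, ss)"
  have "exec (act 0 (\<lambda>_. x) d) ts 1 (ts[0 := tape_act io (x, d)])"
    using exec_act[of 0 ts "\<lambda>_. x" d] rep_io[OF r] by auto
  moreover have "rep (ts[0 := tape_act io (x, d)]) (tape_act io (x, d), ss)"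
    using r by (auto simp: rep_def)
  ultimately show "\<exists>ts' m. m \<le> 1 \<and> exec (act 0 (\<lambda>_. x) d) ts m ts' \<and> rep ts' (tape_act io (x, d), ss)" by auto
qed

section \<open>Serialised trees\<close>

datatype tree = Lf | Nd tree tree

text \<open>Preorder notation is a prefix code: trees can be stacked without separators, and two
  adjacent trees become a pair by pushing a single 2.\<close>

fun ser :: "tree \<Rightarrow> nat list" where
  "ser Lf = [1]"
| "ser (Nd a b) = 2 # ser a @ ser b"

abbreviation "tsz t \<equiv> length (ser t)"

lemma tsz_pos: "tsz t \<ge> 1"
  by (cases t) auto

lemma set_ser: "set (ser t) \<subseteq> {1, 2}"
  by (induction t) auto

abbreviation (input) "sA \<equiv> 0 :: nat"
abbreviation (input) "sB \<equiv> Suc 0"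
abbreviation (input) "sC \<equiv> Suc (Suc 0)"
abbreviation (input) "sD \<equiv> Suc (Suc (Suc 0))"

lemma run_push4:
  "x \<le> 3 \<Longrightarrow> run (push sA x) (io, [a, b, c, d]) 2 (io, [x # a, b, c, d])"
  "x \<le> 3 \<Longrightarrow> run (push sB x) (io, [a, b, c, d]) 2 (io, [a, x # b, c, d])"
  "x \<le> 3 \<Longrightarrow> run (push sC x) (io, [a, b, c, d]) 2 (io, [a, b, x # c, d])"
  "x \<le> 3 \<Longrightarrow> run (push sD x) (io, [a, b, c, d]) 2 (io, [a, b, c, x # d])"
  subgoal using run_push[of sA x io "[a, b, c, d]"] by simp
  subgoal using run_push[of sB x io "[a, b, c, d]"] by simp
  subgoal using run_push[of sC x io "[a, b, c, d]"] by simp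
  subgoal using run_push[of sD x io "[a, b, c, d]"] by simp
  done

lemma run_pop4:
  "run (pop sA) (io, [x # a, b, c, d]) 1 (io, [a, b, c, d])"
  "run (pop sB) (io, [a, x # b, c, d]) 1 (io, [a, b, c, d])"
  "run (pop sC) (io, [a, b, x # c, d]) 1 (io, [a, b, c, d])"
  "run (pop sD) (io, [a, b, c, x # d]) 1 (io, [a, b, c, d])"
  subgoal using run_pop[of sA "[x # a, b, c, d]" x a io] by simp
  subgoal using run_pop[of sB "[a, x # b, c, d]" x b io] by simp
  subgoal using run_pop[of sC "[a, b, x # c, d]" x c io] by simp
  subgoal using run_pop[of sD "[a, b, c, x # d]" x d io] by simp
  done

lemma test4:
  "test (topis sA y) (io, [x # a, b, c, d]) (x = y)"
  "test (topis sB y) (io, [a, x # b, c, d]) (x = y)"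
  "test (topis sC y) (io, [a, b, x # c, d]) (x = y)"
  "test (topis sD y) (io, [a, b, c, x # d]) (x = y)"
  "test (\<lambda>rs. \<not> topis sB y rs) (io, [a, x # b, c, d]) (x \<noteq> y)"
  "test (\<lambda>rs. \<not> topis sC y rs) (io, [a, b, x # c, d]) (x \<noteq> y)"
  subgoal using test_topis[of sA "[x # a, b, c, d]" x a y io] by simp
  subgoal using test_topis[of sB "[a, x # b, c, d]" x b y io] by simp
  subgoal using test_topis[of sC "[a, b, x # c, d]" x c y io] by simp
  subgoal using test_topis[of sD "[a, b, c, x # d]" x d y io] by simp
  subgoal using test_not_topis[of sB "[a, x # b, c, d]" x b y io] by simp
  subgoal using test_not_topis[of sC "[a, b, x # c, d]" x c y io] by simp
  done

text \<open>The fourth stack holds a marker 3 for every subtree that is still to be read.\<close>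

definition consume_body :: "(nat \<Rightarrow> frag) \<Rightarrow> frag" where
  "consume_body em = ifte (topis sA 1) (seq (pop sA) (seq (em 1) (pop sD)))
     (seq (pop sA) (seq (em 2) (push sD 3)))"

text \<open>The 1 pushed below the first marker makes the loop test fail at the end, since nothing
  is known about the symbol underneath.\<close>

definition consume :: "(nat \<Rightarrow> frag) \<Rightarrow> frag" where
  "consume em = seq (push sD 1) (seq (push sD 3) (seq (while (topis sD 3) (consume_body em)) (pop sD)))"

lemma wf_consume: "(\<And>s. wf_frag (em s)) \<Longrightarrow> wf_frag (consume em)"
  unfolding consume_def consume_body_def by (intro wf_intros) auto

lemma run_consume:
  assumes em: "\<And>s a b c d. s \<in> {1, 2} \<Longrightarrow> run (em s) (io, [a, b, c, d]) 4 (io, [a, f s b, g s c, d])"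
  shows "run (consume em) (io, [ser t @ a, b, c, d]) (12 * tsz t + 8) (io, [a, fold f (ser t) b, fold g (ser t) c, d])"
proof -
  let ?W = "while (topis sD 3) (consume_body em)"
  have leaf: "run (consume_body em) (io, [1 # a, b, c, 3 # d]) 9 (io, [a, f 1 b, g 1 c, d])" for a b c d
  proof -
    have "run (seq (pop sA) (seq (em 1) (pop sD))) (io, [1 # a, b, c, 3 # d]) (1 + (4 + 1)) (io, [a, f 1 b, g 1 c, d])"
      by (rule run_seq run_pop4 em | simp)+
    then have "run (consume_body em) (io, [1 # a, b, c, 3 # d]) (1 + (4 + 1) + 2) (io, [a, f 1 b, g 1 c, d])"
      unfolding consume_body_def by (intro run_ifte[OF test4(1)]) auto
    then show ?thesis by (rule run_mono) simp
  qed
  have node: "run (consume_body em) (io, [2 # a, b, c, 3 # d]) 9 (io, [a, f 2 b, g 2 c, 3 # 3 # d])" for a b c d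
  proof -
    have "run (seq (pop sA) (seq (em 2) (push sD 3))) (io, [2 # a, b, c, 3 # d]) (1 + (4 + 2)) (io, [a, f 2 b, g 2 c, 3 # 3 # d])"
      by (rule run_seq run_pop4 em run_push4 | simp)+
    then have "run (consume_body em) (io, [2 # a, b, c, 3 # d]) (1 + (4 + 2) + 2) (io, [a, f 2 b, g 2 c, 3 # 3 # d])"
      unfolding consume_body_def by (intro run_ifte[OF test4(1)]) auto
    then show ?thesis by (rule run_mono) simp
  qed
  have test3: "test (topis sD 3) (io, [a, b, c, 3 # d]) True" for a b c d
    using test4(4)[of 3 io a b c 3 d] by simp
  \<comment> \<open>Stated relative to the remaining run of the loop, so that the induction
    hypotheses for the two subtrees of a node can be chained.\<close>
  have loop: "run ?W (io, [ser t @ a, b, c, 3 # d]) (12 * tsz t + n) s"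
    if "run ?W (io, [a, fold f (ser t) b, fold g (ser t) c, d]) n s" for t a b c d n s
    using that
  proof (induction t arbitrary: a b c d n)
    case Lf
    have "run (consume_body em) (io, [ser Lf @ a, b, c, 3 # d]) 9 (io, [a, f 1 b, g 1 c, d])"
      using leaf by simp
    moreover have "run ?W (io, [a, f 1 b, g 1 c, d]) n s"
      using Lf by simp
    ultimately have "run ?W (io, [ser Lf @ a, b, c, 3 # d]) (9 + n + 2) s"
      by (rule run_while_step[OF test3])
    then show ?case by (rule run_mono) simp
  next
    case (Nd l r)
    have "run ?W (io, [ser r @ a, fold f (ser l) (f 2 b), fold g (ser l) (g 2 c), 3 # d]) (12 * tsz r + n) s"
      by (rule Nd.IH(2)) (use Nd.prems in simp)
    then have 1: "run ?W (io, [ser l @ ser r @ a, f 2 b, g 2 c, 3 # 3 # d]) (12 * tsz l + (12 * tsz r + n)) s"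
      by (rule Nd.IH(1))
    have "run (consume_body em) (io, [ser (Nd l r) @ a, b, c, 3 # d]) 9 (io, [ser l @ ser r @ a, f 2 b, g 2 c, 3 # 3 # d])"
      using node by simp
    from run_while_step[OF test3 this 1]
    have "run ?W (io, [ser (Nd l r) @ a, b, c, 3 # d]) (9 + (12 * tsz l + (12 * tsz r + n)) + 2) s" .
    then show ?case by (rule run_mono) simp
  qed
  have "run ?W (io, [a, fold f (ser t) b, fold g (ser t) c, 1 # d]) 1 (io, [a, fold f (ser t) b, fold g (ser t) c, 1 # d])"
    by (rule run_while_done) (use test4(4)[of 3 io _ _ _ 1] in auto)
  note 1 = loop[OF this]
  have "run (consume em) (io, [ser t @ a, b, c, d]) (2 + (2 + ((12 * tsz t + 1) + 1))) (io, [a, fold f (ser t) b, fold g (ser t) c, d])"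
    unfolding consume_def by (rule run_seq run_push4 1 run_pop4 | simp)+
  then show ?thesis by (rule run_mono) simp
qed

definition unload_body :: "nat \<Rightarrow> frag" where
  "unload_body i = ifte (topis i 1) (seq (pop i) (push sA 1)) (seq (pop i) (push sA 2))"

text \<open>Symbols gathered on stack \<open>i\<close> above a marker 3 lie in reverse order; moving
  them to the first stack restores the order.\<close>

definition unload :: "nat \<Rightarrow> frag" where
  "unload i = seq (while (\<lambda>rs. \<not> topis i 3 rs) (unload_body i)) (pop i)"

lemma wf_unload: "wf_frag (unload i)"
  unfolding unload_def unload_body_def by (intro wf_intros) auto

lemma run_unload_loop:
  assumes "set xs \<subseteq> {1, 2}" "i < 4" "i \<noteq> 0" "length ss = 4" "ss ! i = xs @ 3 # y"
  shows "run (while (\<lambda>rs. \<not> topis i 3 rs) (unload_body i)) (io, ss) (7 * length xs + 1) (io, (ss[0 := rev xs @ ss ! 0])[i := 3 # y])"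
  using assms
  proof (induction xs arbitrary: ss)
    case Nil
    have "ss[i := 3 # y] = ss" using Nil.prems(5) list_update_id[of ss i] by simp
    moreover have "test (\<lambda>rs. \<not> topis i 3 rs) (io, ss) False"
      using test_not_topis[of i ss 3 y 3 io] Nil.prems by simp
    ultimately show ?case using run_while_done[of "\<lambda>rs. \<not> topis i 3 rs" "(io, ss)" "unload_body i"] by simp
  next
    case (Cons x xs)
    let ?s1 = "(ss[i := xs @ 3 # y])[0 := x # ss ! 0]"
    have "run (seq (pop i) (push sA x)) (io, ss) (1 + 2) (io, ?s1)"
      using run_pop[of i ss x "xs @ 3 # y" io] run_push[of 0 x io "ss[i := xs @ 3 # y]"] Cons.prems
      by (intro run_seq[where ?s1.0 = "(io, ss[i := xs @ 3 # y])"]) auto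
    then have 1: "run (unload_body i) (io, ss) (1 + 2 + 2) (io, ?s1)"
      unfolding unload_body_def
      by (intro run_ifte[OF test_topis[of i ss x "xs @ 3 # y"]]) (use Cons.prems in auto)
    have 2: "run (while (\<lambda>rs. \<not> topis i 3 rs) (unload_body i)) (io, ?s1) (7 * length xs + 1) (io, (?s1[0 := rev xs @ ?s1 ! 0])[i := 3 # y])"
      by (rule Cons.IH) (use Cons.prems in auto)
    have 3: "(?s1[0 := rev xs @ ?s1 ! 0])[i := 3 # y] = (ss[0 := rev (x # xs) @ ss ! 0])[i := 3 # y]"
      using Cons.prems by (intro nth_equalityI) (auto simp: nth_list_update)
    have "test (\<lambda>rs. \<not> topis i 3 rs) (io, ss) True"
      using test_not_topis[of i ss x "xs @ 3 # y" 3 io] Cons.prems by auto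
    from run_while_step[OF this 1 2]
    have "run (while (\<lambda>rs. \<not> topis i 3 rs) (unload_body i)) (io, ss) ((1 + 2 + 2) + (7 * length xs + 1) + 2)
       (io, (ss[0 := rev (x # xs) @ ss ! 0])[i := 3 # y])" unfolding 3 .
    then show ?case by (rule run_mono) simp
  qed

lemma run_unload:
  assumes "set xs \<subseteq> {1, 2}" "i < 4" "i \<noteq> 0" "length ss = 4" "ss ! i = xs @ 3 # y"
  shows "run (unload i) (io, ss) (7 * length xs + 2) (io, (ss[0 := rev xs @ ss ! 0])[i := y])"
proof -
  note run_unload_loop[OF assms, of io]
  moreover have "run (pop i) (io, (ss[0 := rev xs @ ss ! 0])[i := 3 # y]) 1 (io, (ss[0 := rev xs @ ss ! 0])[i := y])"
    using run_pop[of i "(ss[0 := rev xs @ ss ! 0])[i := 3 # y]" 3 y io] assms by simp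
  ultimately have "run (unload i) (io, ss) ((7 * length xs + 1) + 1) (io, (ss[0 := rev xs @ ss ! 0])[i := y])"
    unfolding unload_def by (rule run_seq)
  then show ?thesis by simp
qed

lemma run_unload_ser:
  "run (unload sB) (io, [a, rev (ser t) @ 3 # b, c, d]) (7 * tsz t + 2) (io, [ser t @ a, b, c, d])"
  "run (unload sC) (io, [a, b, rev (ser t) @ 3 # c, d]) (7 * tsz t + 2) (io, [ser t @ a, b, c, d])"
  using run_unload[of "rev (ser t)" sB "[a, rev (ser t) @ 3 # b, c, d]" b io]
    run_unload[of "rev (ser t)" sC "[a, b, rev (ser t) @ 3 # c, d]" c io] set_ser[of t] by auto

definition dup :: frag where
  "dup = seq (push sB 3) (seq (push sC 3) (seq (consume (\<lambda>s. seq (push sB s) (push sC s)))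
     (seq (unload sB) (unload sC))))"

definition swap :: frag where
  "swap = seq (push sB 3) (seq (consume (push sB)) (seq (push sC 3) (seq (consume (push sC))
     (seq (unload sB) (unload sC)))))"

definition drop_tree :: frag where
  "drop_tree = consume (\<lambda>_. skip)"

lemma wf_tree_ops: "wf_frag dup" "wf_frag swap" "wf_frag drop_tree"
  unfolding dup_def swap_def drop_tree_def
  by (intro wf_intros wf_consume wf_unload; simp)+

lemma fold_Cons: "fold Cons xs ys = rev xs @ ys"
  by (induction xs arbitrary: ys) auto

lemma fold_id: "fold (\<lambda>_ y. y) xs ys = ys"
  by (induction xs) auto

lemma emit_symbols:
  assumes "s \<in> {1, 2}"
  shows "run (push sB s) (io, [a, b, c, d]) 4 (io, [a, s # b, c, d])"
    and "run (push sC s) (io, [a, b, c, d]) 4 (io, [a, b, s # c, d])"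
    and "run (seq (push sB s) (push sC s)) (io, [a, b, c, d]) 4 (io, [a, s # b, s # c, d])"
    and "run skip (io, [a, b, c, d]) 4 (io, [a, b, c, d])"
proof -
  have s: "s \<le> 3" using assms by auto
  show "run (push sB s) (io, [a, b, c, d]) 4 (io, [a, s # b, c, d])"
    by (rule run_mono[OF run_push4(2)[OF s]]) simp
  show "run (push sC s) (io, [a, b, c, d]) 4 (io, [a, b, s # c, d])"
    by (rule run_mono[OF run_push4(3)[OF s]]) simp
  show "run (seq (push sB s) (push sC s)) (io, [a, b, c, d]) 4 (io, [a, s # b, s # c, d])"
    by (rule run_mono[OF run_seq[OF run_push4(2)[OF s] run_push4(3)[OF s]]]) simp
  show "run skip (io, [a, b, c, d]) 4 (io, [a, b, c, d])"
    by (rule run_mono[OF run_skip]) simp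
qed

lemma run_dup: "run dup (io, [ser t @ a, b, c, d]) (50 * tsz t) (io, [ser t @ ser t @ a, b, c, d])"
proof -
  have 1: "run (consume (\<lambda>s. seq (push sB s) (push sC s))) (io, [ser t @ a, 3 # b, 3 # c, d]) (12 * tsz t + 8)
     (io, [a, rev (ser t) @ 3 # b, rev (ser t) @ 3 # c, d])"
    using run_consume[of "\<lambda>s. seq (push sB s) (push sC s)" io Cons Cons, OF emit_symbols(3)]
    by (simp add: fold_Cons)
  have "run dup (io, [ser t @ a, b, c, d])
    (2 + (2 + ((12 * tsz t + 8) + ((7 * tsz t + 2) + (7 * tsz t + 2))))) (io, [ser t @ ser t @ a, b, c, d])"
    unfolding dup_def apply (rule run_seq)
     apply (rule run_push4, simp)
    apply (rule run_seq)
     apply (rule run_push4, simp)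
    apply (rule run_seq[OF 1])
    apply (rule run_seq)
     apply (rule run_unload_ser)
    apply (rule run_unload_ser)
    done
  then show ?thesis by (rule run_mono) (use tsz_pos[of t] in simp)
qed

lemma run_swap: "run swap (io, [ser s @ ser t @ a, b, c, d]) (50 * (tsz s + tsz t)) (io, [ser t @ ser s @ a, b, c, d])"
proof -
  have 1: "run (consume (push sB)) (io, [ser s @ ser t @ a, 3 # b, c, d]) (12 * tsz s + 8) (io, [ser t @ a, rev (ser s) @ 3 # b, c, d])"
    using run_consume[of "push sB" io Cons "\<lambda>_ c. c", OF emit_symbols(1)]
    by (simp add: fold_Cons fold_id)
  have 2: "run (consume (push sC)) (io, [ser t @ a, b', 3 # c, d]) (12 * tsz t + 8) (io, [a, b', rev (ser t) @ 3 # c, d])" for b'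
    using run_consume[of "push sC" io "\<lambda>_ c. c" Cons, OF emit_symbols(2)]
    by (simp add: fold_Cons fold_id)
  have "run swap (io, [ser s @ ser t @ a, b, c, d])
    (2 + ((12 * tsz s + 8) + (2 + ((12 * tsz t + 8) + ((7 * tsz s + 2) + (7 * tsz t + 2)))))) (io, [ser t @ ser s @ a, b, c, d])"
    unfolding swap_def
    apply (rule run_seq)
     apply (rule run_push4, simp)
    apply (rule run_seq[OF 1])
    apply (rule run_seq)
     apply (rule run_push4, simp)
    apply (rule run_seq[OF 2])
    apply (rule run_seq)
     apply (rule run_unload_ser)
    apply (rule run_unload_ser)
    done
  then show ?thesis by (rule run_mono) (use tsz_pos[of t] tsz_pos[of s] in simp)
qed

lemma run_drop: "run drop_tree (io, [ser t @ a, b, c, d]) (20 * tsz t) (io, [a, b, c, d])"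
proof -
  have "run drop_tree (io, [ser t @ a, b, c, d]) (12 * tsz t + 8) (io, [a, b, c, d])"
    unfolding drop_tree_def
    using run_consume[of "\<lambda>_. skip" io "\<lambda>_ c. c" "\<lambda>_ c. c", OF emit_symbols(4)]
    by (simp add: fold_id)
  then show ?thesis by (rule run_mono) (use tsz_pos[of t] in simp)
qed

section \<open>Polynomial-time functions on encoded types\<close>

text \<open>Values of different types may share an encoding on purpose: a nonempty list looks like a
  pair, \<open>Suc n\<close> like \<open>((), n)\<close> and \<open>True\<close> like
  \<open>((), ())\<close>. Constructors and case distinctions thereby reduce to pairing and
  projection.\<close>

class enc =
  fixes enc :: "'a \<Rightarrow> tree"

instantiation unit :: enc
begin
definition enc_unit :: "unit \<Rightarrow> tree" where "enc_unit u = Lf"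
instance ..
end

instantiation bool :: enc
begin
definition enc_bool :: "bool \<Rightarrow> tree" where "enc_bool b = (if b then Nd Lf Lf else Lf)"
instance ..
end

text \<open>Unary, since natural numbers serve as counters, lengths and indices; numbers that may be
  exponentially large are bit lists.\<close>

instantiation nat :: enc
begin
primrec enc_nat :: "nat \<Rightarrow> tree" where
  "enc_nat 0 = Lf"
| "enc_nat (Suc n) = Nd Lf (enc_nat n)"
instance ..
end

instantiation list :: (enc) enc
begin
primrec enc_list :: "'a list \<Rightarrow> tree" where
  "enc_list [] = Lf"
| "enc_list (x # xs) = Nd (enc x) (enc_list xs)"
instance ..
end

instantiation prod :: (enc, enc) enc
begin
definition enc_prod :: "'a \<times> 'b \<Rightarrow> tree" where "enc_prod p = Nd (enc (fst p)) (enc (snd p))"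
instance ..
end

abbreviation "sz x \<equiv> tsz (enc x)"

lemma enc_pair: "enc (x, y) = Nd (enc x) (enc y)"
  by (simp add: enc_prod_def)

lemma sz_pos: "sz x \<ge> 1"
  by (rule tsz_pos)

text \<open>The base is at least 3, so pure powers dominate all polynomials and no coefficients have
  to be carried along.\<close>

definition pbd :: "('a::enc \<Rightarrow> nat) \<Rightarrow> bool" where
  "pbd g \<longleftrightarrow> (\<exists>k. \<forall>x. g x \<le> (sz x + 2) ^ k)"

lemma pbd_mono: "pbd g \<Longrightarrow> (\<And>x. f x \<le> g x) \<Longrightarrow> pbd f"
  unfolding pbd_def by (meson le_trans)

lemma pbd_const: "pbd (\<lambda>x. c)"
proof -
  have "c \<le> (sz x + 2) ^ c" for x :: 'a
  proof -
    have "c \<le> 2 ^ c" by (simp add: less_imp_le)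
    also have "\<dots> \<le> (sz x + 2) ^ c" by (rule power_mono) auto
    finally show ?thesis .
  qed
  then show ?thesis unfolding pbd_def by blast
qed

lemma pbd_sz: "pbd (\<lambda>x. sz x)"
  unfolding pbd_def by (rule exI[of _ 1]) simp

lemma pbd_mult: "pbd f \<Longrightarrow> pbd g \<Longrightarrow> pbd (\<lambda>x. f x * g x)"
  unfolding pbd_def
proof (elim exE)
  fix k l assume "\<forall>x. f x \<le> (sz x + 2) ^ k" "\<forall>x. g x \<le> (sz x + 2) ^ l"
  then have "\<forall>x. f x * g x \<le> (sz x + 2) ^ (k + l)" by (auto simp: power_add intro!: mult_le_mono)
  then show "\<exists>k. \<forall>x. f x * g x \<le> (sz x + 2) ^ k" by blast
qed

lemma pbd_add: "pbd f \<Longrightarrow> pbd g \<Longrightarrow> pbd (\<lambda>x. f x + g x)"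
proof -
  assume "pbd f" "pbd g"
  \<comment> \<open>The sum is dominated by this product, so that only the addition of 1 has to be
    absorbed by an exponent.\<close>
  then have "pbd (\<lambda>x. (f x + 1) * (g x + 1))"
  proof -
    have *: "pbd (\<lambda>x. f x + 1)" if f: "pbd f" for f :: "'a \<Rightarrow> nat"
    proof -
      obtain k where k: "\<And>x. f x \<le> (sz x + 2) ^ k" using f unfolding pbd_def by blast
      have "f x + 1 \<le> (sz x + 2) ^ (k + 1)" for x
      proof -
        have "f x + 1 \<le> (sz x + 2) ^ k * 1 + (sz x + 2) ^ k * 1" using k[of x] by (intro add_mono) auto
        also have "\<dots> \<le> (sz x + 2) ^ k * (sz x + 2)" by simp
        finally show ?thesis by (simp add: mult.commute)
      qed
      then show ?thesis unfolding pbd_def by blast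
    qed
    show ?thesis by (intro pbd_mult * \<open>pbd f\<close> \<open>pbd g\<close>)
  qed
  then show ?thesis by (rule pbd_mono) (simp add: algebra_simps)
qed

lemma pbd_power: "pbd f \<Longrightarrow> pbd (\<lambda>x. f x ^ k)"
  by (induction k) (auto intro: pbd_mult pbd_const)

lemma pbd_comp: "pbd g \<Longrightarrow> pbd (\<lambda>x. sz (f x)) \<Longrightarrow> pbd (\<lambda>x. g (f x))"
proof -
  assume "pbd g" and f: "pbd (\<lambda>x. sz (f x))"
  then obtain k where k: "\<And>y. g y \<le> (sz y + 2) ^ k" unfolding pbd_def by blast
  have "pbd (\<lambda>x. (sz (f x) + 2) ^ k)" by (intro pbd_power pbd_add f pbd_const)
  then show ?thesis by (rule pbd_mono) (rule k)
qed

lemmas pbd_intros = pbd_const pbd_sz pbd_mult pbd_add pbd_power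

text \<open>Quantifying over the remaining stack contents is a frame condition: whatever lies below
  the argument survives. This is what allows one program to run while the results of others are kept
  on the same stack.\<close>

definition pt :: "('a::enc \<Rightarrow> 'b::enc) \<Rightarrow> bool" where
  "pt f \<longleftrightarrow> (\<exists>P k. wf_frag P \<and> (\<forall>x. sz (f x) \<le> (sz x + 2) ^ k \<and>
     (\<forall>io a b c d. run P (io, [ser (enc x) @ a, b, c, d]) ((sz x + 2) ^ k) (io, [ser (enc (f x)) @ a, b, c, d]))))"

lemma ptI:
  assumes "wf_frag P" "pbd g" "pbd (\<lambda>x. sz (f x))"
    "\<And>x io a b c d. run P (io, [ser (enc x) @ a, b, c, d]) (g x) (io, [ser (enc (f x)) @ a, b, c, d])"
  shows "pt f"
proof -
  have "pbd (\<lambda>x. g x + sz (f x))" by (intro pbd_add assms)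
  then obtain k where k: "\<And>x. g x + sz (f x) \<le> (sz x + 2) ^ k" unfolding pbd_def by blast
  have "sz (f x) \<le> (sz x + 2) ^ k" "g x \<le> (sz x + 2) ^ k" for x using k[of x] by auto
  then show ?thesis unfolding pt_def using assms(1) run_mono[OF assms(4)] by blast
qed

lemma pt_ex:
  assumes "pt f"
  shows "\<exists>P g. wf_frag P \<and> pbd g \<and> pbd (\<lambda>x. sz (f x)) \<and>
    (\<forall>x io a b c d. run P (io, [ser (enc x) @ a, b, c, d]) (g x) (io, [ser (enc (f x)) @ a, b, c, d]))"
proof -
  obtain P k where *: "wf_frag P" "\<And>x. sz (f x) \<le> (sz x + 2) ^ k"
    "\<And>x io a b c d. run P (io, [ser (enc x) @ a, b, c, d]) ((sz x + 2) ^ k) (io, [ser (enc (f x)) @ a, b, c, d])"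
    using assms unfolding pt_def by blast
  have p: "pbd (\<lambda>x :: 'a. (sz x + 2) ^ k)" by (intro pbd_intros)
  have "pbd (\<lambda>x. sz (f x))" by (rule pbd_mono[OF p]) (rule *(2))
  with * p show ?thesis by blast
qed

lemma pt_pbd: "pt f \<Longrightarrow> pbd (\<lambda>x. sz (f x))"
  using pt_ex by blast

text \<open>A machine sees only trees, so the program for \<open>F\<close> also computes any
  function that acts in the same way on encodings.\<close>

lemma pt_recode:
  fixes F :: "'c::enc \<Rightarrow> 'd::enc" and f :: "'a::enc \<Rightarrow> 'b::enc"
  assumes "pt F" "\<And>x. \<exists>y. enc y = enc x \<and> enc (f x) = enc (F y)"
  shows "pt f"
proof -
  obtain P k where "wf_frag P" "\<forall>y. sz (F y) \<le> (sz y + 2) ^ k \<and>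
     (\<forall>io a b c d. run P (io, [ser (enc y) @ a, b, c, d]) ((sz y + 2) ^ k) (io, [ser (enc (F y)) @ a, b, c, d]))"
    using assms(1) unfolding pt_def by blast
  then show ?thesis unfolding pt_def using assms(2) by metis
qed

lemma pt_id: "pt (\<lambda>x. x)"
  by (rule ptI[of skip "\<lambda>_. 0"]) (auto intro: wf_skip pbd_intros run_skip)

lemma pt_comp: "pt f \<Longrightarrow> pt g \<Longrightarrow> pt (\<lambda>x. f (g x))"
proof -
  assume f: "pt f" and g: "pt g"
  obtain P p where P: "wf_frag P" "pbd p" "pbd (\<lambda>x. sz (f x))"
    "\<And>x io a b c d. run P (io, [ser (enc x) @ a, b, c, d]) (p x) (io, [ser (enc (f x)) @ a, b, c, d])"
    using pt_ex[OF f] by blast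
  obtain Q q where Q: "wf_frag Q" "pbd q" "pbd (\<lambda>x. sz (g x))"
    "\<And>x io a b c d. run Q (io, [ser (enc x) @ a, b, c, d]) (q x) (io, [ser (enc (g x)) @ a, b, c, d])"
    using pt_ex[OF g] by blast
  show ?thesis
  proof (rule ptI)
    show "wf_frag (seq Q P)" by (intro wf_seq P Q)
    show "pbd (\<lambda>x. q x + p (g x))" by (intro pbd_add Q pbd_comp[OF P(2)])
    show "pbd (\<lambda>x. sz (f (g x)))" by (rule pbd_comp[OF P(3) Q(3)])
    show "run (seq Q P) (io, [ser (enc x) @ a, b, c, d]) (q x + p (g x)) (io, [ser (enc (f (g x))) @ a, b, c, d])" for x io a b c d
      by (rule run_seq[OF Q(4) P(4)])
  qed
qed

lemma pt_pair: "pt f \<Longrightarrow> pt g \<Longrightarrow> pt (\<lambda>x. (f x, g x))"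
proof -
  assume f: "pt f" and g: "pt g"
  obtain P p where P: "wf_frag P" "pbd p" "pbd (\<lambda>x. sz (f x))"
    "\<And>x io a b c d. run P (io, [ser (enc x) @ a, b, c, d]) (p x) (io, [ser (enc (f x)) @ a, b, c, d])"
    using pt_ex[OF f] by blast
  obtain Q q where Q: "wf_frag Q" "pbd q" "pbd (\<lambda>x. sz (g x))"
    "\<And>x io a b c d. run Q (io, [ser (enc x) @ a, b, c, d]) (q x) (io, [ser (enc (g x)) @ a, b, c, d])"
    using pt_ex[OF g] by blast
  show ?thesis
  proof (rule ptI)
    let ?P = "seq dup (seq P (seq swap (seq Q (seq swap (push sA 2)))))"
    let ?p = "\<lambda>x. 50 * sz x + (p x + (50 * (sz (f x) + sz x) + (q x + (50 * (sz (g x) + sz (f x)) + 2))))"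
    show "wf_frag ?P" by (intro wf_intros wf_tree_ops P Q) auto
    show "pbd ?p" by (intro pbd_intros P Q)
    have "pbd (\<lambda>x. 1 + (sz (f x) + sz (g x)))" by (intro pbd_intros P Q)
    then show "pbd (\<lambda>x. sz (f x, g x))" by (simp add: enc_pair)
    show "run ?P (io, [ser (enc x) @ a, b, c, d]) (?p x) (io, [ser (enc (f x, g x)) @ a, b, c, d])" for x io a b c d
    proof -
      have "run ?P (io, [ser (enc x) @ a, b, c, d]) (?p x) (io, [2 # ser (enc (f x)) @ ser (enc (g x)) @ a, b, c, d])"
        by (intro run_seq[OF run_dup] run_seq[OF P(4)] run_seq[OF run_swap] run_seq[OF Q(4)] run_push4) simp
      then show ?thesis by (simp add: enc_pair)
    qed
  qed
qed

lemma pt_const: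
  fixes v :: "'b::enc"
  shows "pt (\<lambda>x :: 'a::enc. v)"
proof -
  define W where "W = foldr (\<lambda>s P. seq P (push sA s)) (ser (enc v)) skip"
  have wf: "wf_frag (foldr (\<lambda>s P. seq P (push sA s)) xs skip)" for xs
    by (induction xs) (auto intro!: wf_intros)
  have W: "run (foldr (\<lambda>s P. seq P (push sA s)) xs skip) (io, [a, b, c, d]) (2 * length xs) (io, [xs @ a, b, c, d])"
    if "set xs \<subseteq> {1, 2}" for xs io a b c d
    using that
  proof (induction xs)
    case Nil
    then show ?case by (simp add: run_skip)
  next
    case (Cons x xs)
    have "run (seq (foldr (\<lambda>s P. seq P (push sA s)) xs skip) (push sA x)) (io, [a, b, c, d]) (2 * length xs + 2) (io, [x # xs @ a, b, c, d])"
      by (rule run_seq[OF Cons.IH run_push4(1)]) (use Cons.prems in auto)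
    then show ?case by simp
  qed
  show ?thesis
  proof (rule ptI)
    show "wf_frag (seq drop_tree W)" unfolding W_def by (intro wf_seq wf_tree_ops wf)
    show "pbd (\<lambda>x. 20 * sz x + 2 * sz v)" by (intro pbd_intros)
    show "run (seq drop_tree W) (io, [ser (enc x) @ a, b, c, d]) (20 * sz x + 2 * sz v) (io, [ser (enc v) @ a, b, c, d])" for x :: 'a and io a b c d
      unfolding W_def by (rule run_seq[OF run_drop W]) (rule set_ser)
  qed (intro pbd_intros)
qed

lemma pt_fst': "pt (fst :: 'a::enc \<times> 'b::enc \<Rightarrow> 'a)"
proof (rule ptI)
  let ?P = "seq (pop sA) (seq swap drop_tree)"
  show "wf_frag ?P" by (intro wf_intros wf_tree_ops)
  show "pbd (\<lambda>x :: 'a \<times> 'b. 1 + (50 * sz x + 20 * sz x))" by (intro pbd_intros)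
  show "pbd (\<lambda>x :: 'a \<times> 'b. sz (fst x))" by (rule pbd_mono[OF pbd_sz]) (simp add: enc_prod_def)
  fix x :: "'a \<times> 'b" and io a b c d
  have "run ?P (io, [2 # ser (enc (fst x)) @ ser (enc (snd x)) @ a, b, c, d]) (1 + (50 * (sz (fst x) + sz (snd x)) + 20 * sz (snd x))) (io, [ser (enc (fst x)) @ a, b, c, d])"
    by (intro run_seq[OF run_pop4(1)] run_seq[OF run_swap] run_drop)
  then show "run ?P (io, [ser (enc x) @ a, b, c, d]) (1 + (50 * sz x + 20 * sz x)) (io, [ser (enc (fst x)) @ a, b, c, d])"
    by (auto intro: run_mono simp: enc_prod_def)
qed

lemma pt_snd': "pt (snd :: 'a::enc \<times> 'b::enc \<Rightarrow> 'b)"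
proof (rule ptI)
  let ?P = "seq (pop sA) drop_tree"
  show "wf_frag ?P" by (intro wf_intros wf_tree_ops)
  show "pbd (\<lambda>x :: 'a \<times> 'b. 1 + 20 * sz x)" by (intro pbd_intros)
  show "pbd (\<lambda>x :: 'a \<times> 'b. sz (snd x))" by (rule pbd_mono[OF pbd_sz]) (simp add: enc_prod_def)
  fix x :: "'a \<times> 'b" and io a b c d
  have "run ?P (io, [2 # ser (enc (fst x)) @ ser (enc (snd x)) @ a, b, c, d]) (1 + 20 * sz (fst x)) (io, [ser (enc (snd x)) @ a, b, c, d])"
    by (intro run_seq[OF run_pop4(1)] run_drop)
  then show "run ?P (io, [ser (enc x) @ a, b, c, d]) (1 + 20 * sz x) (io, [ser (enc (snd x)) @ a, b, c, d])"
    by (auto intro: run_mono simp: enc_prod_def)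
qed

text \<open>
  A case distinction on a value whose encoding is a leaf in the first case. In the other case
  the encodings of \<open>x\<close> and of the scrutinee are combined to that of the pair \<open>(x, y)\<close>.
\<close>

lemma pt_case:
  fixes l :: "'a::enc \<Rightarrow> 'b::enc" and f r :: "'a \<Rightarrow> 'r::enc" and g :: "'a \<times> 'c::enc \<Rightarrow> 'r"
  assumes l: "pt l" and f: "pt f" and g: "pt g"
    and leaf: "\<And>x. enc (l x) = Lf \<Longrightarrow> r x = f x"
    and node: "\<And>x. enc (l x) \<noteq> Lf \<Longrightarrow> \<exists>y. enc y = enc (l x) \<and> r x = g (x, y)"
  shows "pt r"
proof -
  obtain P p where P: "wf_frag P" "pbd p" "pbd (\<lambda>x. sz (l x))"
    "\<And>x io a b c d. run P (io, [ser (enc x) @ a, b, c, d]) (p x) (io, [ser (enc (l x)) @ a, b, c, d])"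
    using pt_ex[OF l] by blast
  obtain Q q where Q: "wf_frag Q" "pbd q" "pbd (\<lambda>x. sz (f x))"
    "\<And>x io a b c d. run Q (io, [ser (enc x) @ a, b, c, d]) (q x) (io, [ser (enc (f x)) @ a, b, c, d])"
    using pt_ex[OF f] by blast
  obtain R k where R: "wf_frag R" "\<And>x. sz (g x) \<le> (sz x + 2) ^ k"
    "\<And>x io a b c d. run R (io, [ser (enc x) @ a, b, c, d]) ((sz x + 2) ^ k) (io, [ser (enc (g x)) @ a, b, c, d])"
    using g unfolding pt_def by blast
  let ?B = "ifte (topis sA 1) (seq drop_tree Q) (seq swap (seq (push sA 2) R))"
  let ?b = "\<lambda>x. 20 * sz (l x) + q x + (50 * (sz (l x) + sz x) + (2 + (1 + sz x + sz (l x) + 2) ^ k))"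
  show ?thesis
  proof (rule ptI)
    show "wf_frag (seq dup (seq P ?B))" by (intro wf_intros wf_tree_ops P Q R) auto
    show "pbd (\<lambda>x. 50 * sz x + (p x + (?b x + 2)))" by (intro pbd_intros P Q)
    have "pbd (\<lambda>x. sz (f x) + (1 + sz x + sz (l x) + 2) ^ k)" by (intro pbd_intros P Q)
    then show "pbd (\<lambda>x. sz (r x))"
    proof (rule pbd_mono)
      show "sz (r x) \<le> sz (f x) + (1 + sz x + sz (l x) + 2) ^ k" for x
      proof (cases "enc (l x) = Lf")
        case True
        then show ?thesis using leaf by simp
      next
        case False
        then obtain y where y: "enc y = enc (l x)" "r x = g (x, y)" using node by blast
        show ?thesis using R(2)[of "(x, y)"] unfolding y(2) by (simp add: enc_pair y(1) trans_le_add2)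
      qed
    qed
    fix x io a b c d
    have "run ?B (io, [ser (enc (l x)) @ ser (enc x) @ a, b, c, d]) (?b x + 2) (io, [ser (enc (r x)) @ a, b, c, d])"
    proof (cases "enc (l x) = Lf")
      case True
      have "run (seq drop_tree Q) (io, [ser (enc (l x)) @ ser (enc x) @ a, b, c, d]) (20 * sz (l x) + q x) (io, [ser (enc (f x)) @ a, b, c, d])"
        by (rule run_seq[OF run_drop Q(4)])
      then have "run (seq drop_tree Q) (io, [ser (enc (l x)) @ ser (enc x) @ a, b, c, d]) (?b x) (io, [ser (enc (r x)) @ a, b, c, d])"
        unfolding leaf[OF True] by (rule run_mono) simp
      moreover have "test (topis sA 1) (io, [ser (enc (l x)) @ ser (enc x) @ a, b, c, d]) True"
        using test4(1)[of 1 io 1 "ser (enc x) @ a" b c d] True by simp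
      ultimately show ?thesis by (intro run_ifte_True)
    next
      case False
      then obtain y where y: "enc y = enc (l x)" "r x = g (x, y)" using node by blast
      have R': "run R (io, [2 # ser (enc x) @ ser (enc (l x)) @ a, b, c, d]) ((1 + sz x + sz (l x) + 2) ^ k) (io, [ser (enc (r x)) @ a, b, c, d])"
        using R(3)[of io "(x, y)" a b c d] unfolding y(2) by (simp add: enc_pair y(1))
      have "run (seq swap (seq (push sA 2) R)) (io, [ser (enc (l x)) @ ser (enc x) @ a, b, c, d])
         (50 * (sz (l x) + sz x) + (2 + (1 + sz x + sz (l x) + 2) ^ k)) (io, [ser (enc (r x)) @ a, b, c, d])"
        by (rule run_seq[OF run_swap run_seq[OF run_push4(1) R']]) simp
      then have "run (seq swap (seq (push sA 2) R)) (io, [ser (enc (l x)) @ ser (enc x) @ a, b, c, d]) (?b x) (io, [ser (enc (r x)) @ a, b, c, d])"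
        by (rule run_mono) simp
      moreover obtain u v where "enc (l x) = Nd u v" using False by (cases "enc (l x)") auto
      then have "test (topis sA 1) (io, [ser (enc (l x)) @ ser (enc x) @ a, b, c, d]) False"
        using test4(1)[of 1 io 2 "ser u @ ser v @ ser (enc x) @ a" b c d] by simp
      ultimately show ?thesis by (intro run_ifte_False)
    qed
    then show "run (seq dup (seq P ?B)) (io, [ser (enc x) @ a, b, c, d]) (50 * sz x + (p x + (?b x + 2))) (io, [ser (enc (r x)) @ a, b, c, d])"
      by (rule run_seq[OF run_dup run_seq[OF P(4)]])
  qed
qed

text \<open>The right spine of the counter determines the number of iterations.\<close>

fun spine :: "tree \<Rightarrow> nat" where
  "spine Lf = 0"
| "spine (Nd l r) = Suc (spine r)"

lemma spine_le: "spine t \<le> tsz t"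
  by (induction t) auto

definition iter_body :: "frag \<Rightarrow> frag" where
  "iter_body P = seq (pop sA) (seq drop_tree (seq swap (seq P swap)))"

lemma run_iter_loop:
  fixes g :: "'s::enc \<Rightarrow> 's"
  assumes P: "\<And>s io a b c d. run P (io, [ser (enc s) @ a, b, c, d]) ((sz s + 2) ^ k) (io, [ser (enc (g s)) @ a, b, c, d])"
    and "\<And>i. i \<le> spine t \<Longrightarrow> sz ((g ^^ i) s) \<le> W" "tsz t \<le> W"
  shows "run (while (topis sA 2) (iter_body P)) (io, [ser t @ ser (enc s) @ a, b, c, d])
     (spine t * (300 * W + (W + 2) ^ k) + 1) (io, [1 # ser (enc ((g ^^ spine t) s)) @ a, b, c, d])"
  using assms(2,3)
proof (induction t arbitrary: s)
  case Lf
  show ?case using run_while_done[of "topis sA 2" "(io, [1 # ser (enc s) @ a, b, c, d])"] test4(1)[of 2 io 1] by simp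
next
  case (Nd l r)
  have szs: "sz s \<le> W" "sz (g s) \<le> W" using Nd.prems(1)[of 0] Nd.prems(1)[of 1] by auto
  have W: "1 \<le> W" using szs sz_pos[of s] by simp
  have "run (iter_body P) (io, [2 # ser l @ ser r @ ser (enc s) @ a, b, c, d])
    (1 + (20 * tsz l + (50 * (tsz r + sz s) + ((sz s + 2) ^ k + 50 * (sz (g s) + tsz r))))) (io, [ser r @ ser (enc (g s)) @ a, b, c, d])"
    unfolding iter_body_def
    by (intro run_seq[OF run_pop4(1)] run_seq[OF run_drop] run_seq[OF run_swap] run_seq[OF P] run_swap)
  moreover have "1 + (20 * tsz l + (50 * (tsz r + sz s) + ((sz s + 2) ^ k + 50 * (sz (g s) + tsz r)))) \<le> 298 * W + (W + 2) ^ k"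
  proof -
    have "(sz s + 2) ^ k \<le> (W + 2) ^ k" using szs by (intro power_mono) auto
    then show ?thesis using szs W Nd.prems(2) by simp
  qed
  ultimately have body: "run (iter_body P) (io, [2 # ser l @ ser r @ ser (enc s) @ a, b, c, d]) (298 * W + (W + 2) ^ k) (io, [ser r @ ser (enc (g s)) @ a, b, c, d])"
    by (rule run_mono)
  have IH: "run (while (topis sA 2) (iter_body P)) (io, [ser r @ ser (enc (g s)) @ a, b, c, d])
     (spine r * (300 * W + (W + 2) ^ k) + 1) (io, [1 # ser (enc ((g ^^ spine r) (g s))) @ a, b, c, d])"
  proof (rule Nd.IH(2))
    show "sz ((g ^^ i) (g s)) \<le> W" if "i \<le> spine r" for i
      using Nd.prems(1)[of "Suc i"] that by (simp add: funpow_swap1)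
    show "tsz r \<le> W" using Nd.prems(2) by simp
  qed
  have "test (topis sA 2) (io, [2 # ser l @ ser r @ ser (enc s) @ a, b, c, d]) True"
    using test4(1)[of 2 io 2] by simp
  from run_while_step[OF this body IH]
  have "run (while (topis sA 2) (iter_body P)) (io, [ser (Nd l r) @ ser (enc s) @ a, b, c, d])
     (298 * W + (W + 2) ^ k + (spine r * (300 * W + (W + 2) ^ k) + 1) + 2) (io, [1 # ser (enc ((g ^^ spine (Nd l r)) s)) @ a, b, c, d])"
    by (simp add: funpow_swap1)
  then show ?case by (rule run_mono) (use W in simp)
qed

text \<open>Polynomially many applications of a polynomial-time function may let the state explode,
  for example by repeated squaring of its size. The bound \<open>B\<close> on all intermediate
  states is therefore a separate hypothesis.\<close>

lemma pt_iter:
  fixes g :: "'s::enc \<Rightarrow> 's" and cnt :: "'a::enc \<Rightarrow> 'c::enc"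
  assumes g: "pt g" and n: "pt cnt" and s: "pt s"
    and bd: "pbd B" "\<And>x i. i \<le> spine (enc (cnt x)) \<Longrightarrow> sz ((g ^^ i) (s x)) \<le> B x"
  shows "pt (\<lambda>x. (g ^^ spine (enc (cnt x))) (s x))"
proof -
  obtain P k where P: "wf_frag P"
    "\<And>x io a b c d. run P (io, [ser (enc x) @ a, b, c, d]) ((sz x + 2) ^ k) (io, [ser (enc (g x)) @ a, b, c, d])"
    using g unfolding pt_def by blast
  obtain Q q where Q: "wf_frag Q" "pbd q" "pbd (\<lambda>x. sz (s x))"
    "\<And>x io a b c d. run Q (io, [ser (enc x) @ a, b, c, d]) (q x) (io, [ser (enc (s x)) @ a, b, c, d])"
    using pt_ex[OF s] by blast
  obtain R r where R: "wf_frag R" "pbd r" "pbd (\<lambda>x. sz (cnt x))"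
    "\<And>x io a b c d. run R (io, [ser (enc x) @ a, b, c, d]) (r x) (io, [ser (enc (cnt x)) @ a, b, c, d])"
    using pt_ex[OF n] by blast
  let ?P = "seq dup (seq Q (seq swap (seq R (seq (while (topis sA 2) (iter_body P)) (pop sA)))))"
  let ?W = "\<lambda>x. B x + sz (cnt x)"
  let ?l = "\<lambda>x. sz (cnt x) * (300 * ?W x + (?W x + 2) ^ k) + 1"
  let ?t = "\<lambda>x. 50 * sz x + (q x + (50 * (sz (s x) + sz x) + (r x + (?l x + 1))))"
  show ?thesis
  proof (rule ptI)
    show "wf_frag ?P" unfolding iter_body_def by (intro wf_intros wf_tree_ops P Q R)
    show "pbd ?t" by (intro pbd_intros Q R bd(1))
    show "pbd (\<lambda>x. sz ((g ^^ spine (enc (cnt x))) (s x)))" by (rule pbd_mono[OF bd(1)]) (rule bd(2), simp)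
    fix x io a b c d
    have "run (while (topis sA 2) (iter_body P)) (io, [ser (enc (cnt x)) @ ser (enc (s x)) @ a, b, c, d])
      (spine (enc (cnt x)) * (300 * ?W x + (?W x + 2) ^ k) + 1) (io, [1 # ser (enc ((g ^^ spine (enc (cnt x))) (s x))) @ a, b, c, d])"
      by (rule run_iter_loop[OF P(2)]) (auto intro: trans_le_add1[OF bd(2)])
    then have l: "run (while (topis sA 2) (iter_body P)) (io, [ser (enc (cnt x)) @ ser (enc (s x)) @ a, b, c, d])
      (?l x) (io, [1 # ser (enc ((g ^^ spine (enc (cnt x))) (s x))) @ a, b, c, d])"
      by (rule run_mono) (intro add_mono mult_le_mono1 spine_le order.refl)
    show "run ?P (io, [ser (enc x) @ a, b, c, d]) (?t x) (io, [ser (enc ((g ^^ spine (enc (cnt x))) (s x))) @ a, b, c, d])"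
      by (intro run_seq[OF run_dup] run_seq[OF Q(4)] run_seq[OF run_swap] run_seq[OF R(4)] run_seq[OF l] run_pop4)
  qed
qed

lemma spine_nat: "spine (enc (n::nat)) = n"
  by (induction n) auto

lemma spine_list: "spine (enc xs) = length (xs :: 'a::enc list)"
  by (induction xs) auto

section \<open>Reading the input and writing the output\<close>

definition read_body :: frag where
  "read_body = seq (ifte (\<lambda>rs. rs ! 0 = 1) (push sB 1) (push sB 2)) (act 0 (\<lambda>_. 0) Right)"

definition parse_body :: frag where
  "parse_body = seq (ifte (topis sB 1) (seq (push sA 1) (push sA 2))
     (seq (push sA 1) (seq (push sA 1) (seq (push sA 2) (push sA 2)))))
     (seq (pop sB) (act 0 (\<lambda>_. 0) Left))"

text \<open>Reading stacks the bits in reverse, so that popping them builds the list from its end,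
  starting with the 1 that encodes the empty list. The cells are erased on the way and the head
  steps back once per bit, which leaves a blank tape with the head on cell 0 for the output.\<close>

definition read_input :: frag where
  "read_input = seq (push sB 3) (seq (while (\<lambda>rs. rs ! 0 \<noteq> 0) read_body)
     (seq (push sA 1) (while (\<lambda>rs. \<not> topis sB 3 rs) parse_body)))"

definition write_body :: frag where
  "write_body = seq (pop sA) (ifte (topis sA 1) (seq (pop sA) (act 0 (\<lambda>_. 1) Right))
     (seq (pop sA) (seq (pop sA) (seq (pop sA) (act 0 (\<lambda>_. 2) Right)))))"

definition write_output :: frag where
  "write_output = while (topis sA 2) write_body"

lemma wf_io: "wf_frag read_input" "wf_frag write_output"
  unfolding read_input_def read_body_def parse_body_def write_output_def write_body_def
  by (intro wf_intros; simp)+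

lemma bit_symbol_le: "bit_symbol b \<le> 3" "bit_symbol b \<noteq> 0"
  by (auto simp: bit_symbol_def)

lemma ser_bool: "ser (enc b) = (if b then [2, 1, 1] else [1])"
  by (simp add: enc_bool_def)

lemma input_tape_Cons:
  "(snd (input_tape x))(int (length x) := bit_symbol b) = snd (input_tape (x @ [b]))"
  by (rule ext) (auto simp: input_tape_def nth_append nat_less_iff not_less)

definition tail_tape :: "bool list \<Rightarrow> nat \<Rightarrow> int \<Rightarrow> nat" where
  "tail_tape x i = (\<lambda>p. if int i \<le> p \<and> p < int (length x) then bit_symbol (x ! nat p) else 0)"

lemma run_read:
  assumes "i \<le> length x"
  shows "run (while (\<lambda>rs. rs ! 0 \<noteq> 0) read_body) ((int i, tail_tape x i), [a, b, c, d]) (7 * (length x - i) + 1)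
    ((int (length x), \<lambda>_. 0), [a, rev (map bit_symbol (List.drop i x)) @ b, c, d])"
  using assms
proof (induction "length x - i" arbitrary: i b)
  case 0
  then have i: "i = length x" by simp
  have 1: "tail_tape x i = (\<lambda>_. 0)" unfolding i tail_tape_def by auto
  show ?case using run_while_done[of "\<lambda>rs. rs ! 0 \<noteq> 0" "((int i, tail_tape x i), [a, b, c, d])" read_body]
      test_io[of "\<lambda>r. r \<noteq> 0" "int i" "tail_tape x i"] i 1 by simp
next
  case (Suc n)
  then have i: "i < length x" by simp
  let ?io = "(int i, tail_tape x i)"
  have s: "tail_tape x i (int i) = bit_symbol (x ! i)" using i by (simp add: tail_tape_def)
  have "run (ifte (\<lambda>rs. rs ! 0 = 1) (push sB 1) (push sB 2)) (?io, [a, b, c, d]) (2 + 2) (?io, [a, bit_symbol (x ! i) # b, c, d])"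
    using run_ifte[OF test_io[of "\<lambda>r. r = 1" "int i" "tail_tape x i" "[a, b, c, d]"], of "push sB 1" 2 _ "push sB 2"]
      run_push4(2)[of 1 ?io a b c d] run_push4(2)[of 2 ?io a b c d] s
    by (cases "x ! i") (simp_all add: bit_symbol_def)
  moreover have "run (act 0 (\<lambda>_. 0) Right) (?io, [a, bit_symbol (x ! i) # b, c, d]) 1 ((int (Suc i), tail_tape x (Suc i)), [a, bit_symbol (x ! i) # b, c, d])"
  proof -
    have "tape_act ?io (0, Right) = (int (Suc i), tail_tape x (Suc i))"
      using i by (auto simp: tape_act_def tail_tape_def fun_eq_iff)
    then show ?thesis using run_io[of 0 Right ?io] by simp
  qed
  ultimately have 1: "run read_body (?io, [a, b, c, d]) ((2 + 2) + 1) ((int (Suc i), tail_tape x (Suc i)), [a, bit_symbol (x ! i) # b, c, d])"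
    unfolding read_body_def by (rule run_seq)
  have t: "test (\<lambda>rs. rs ! 0 \<noteq> 0) (?io, [a, b, c, d]) True"
    using test_io[of "\<lambda>r. r \<noteq> 0" "int i" "tail_tape x i"] s bit_symbol_le by simp
  have 2: "run (while (\<lambda>rs. rs ! 0 \<noteq> 0) read_body) ((int (Suc i), tail_tape x (Suc i)), [a, bit_symbol (x ! i) # b, c, d]) (7 * (length x - Suc i) + 1)
    ((int (length x), \<lambda>_. 0), [a, rev (map bit_symbol (List.drop (Suc i) x)) @ bit_symbol (x ! i) # b, c, d])"
    by (rule Suc.hyps(1)) (use Suc.hyps(2) i in auto)
  have e: "rev (map bit_symbol (List.drop i x)) @ b = rev (map bit_symbol (List.drop (Suc i) x)) @ bit_symbol (x ! i) # b"
    using i by (simp add: Cons_nth_drop_Suc[symmetric])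
  show ?case unfolding e by (rule run_mono[OF run_while_step[OF t 1 2]]) (use i in arith)
qed

lemma run_parse:
  "run (while (\<lambda>rs. \<not> topis sB 3 rs) parse_body) ((h, \<lambda>_. 0), [ser (enc y) @ a, map bit_symbol (rev x) @ 3 # b, c, d]) (14 * length x + 1)
    ((h - int (length x), \<lambda>_. 0), [ser (enc (x @ y)) @ a, 3 # b, c, d])"
proof (induction x arbitrary: h y rule: rev_induct)
  case Nil
  show ?case using run_while_done[of "\<lambda>rs. \<not> topis sB 3 rs" "((h, \<lambda>_. 0), [ser (enc y) @ a, 3 # b, c, d])" parse_body]
      test4(5)[of 3 "(h, \<lambda>_. 0)" "ser (enc y) @ a" 3 b c d] by simp
next
  case (snoc u x)
  let ?io = "(h, \<lambda>_. 0) :: tape"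
  let ?b = "map bit_symbol (rev x) @ 3 # b"
  have p1: "run (seq (push sA 1) (push sA 2)) (?io, [ser (enc y) @ a, b', c, d]) (2 + 2) (?io, [2 # 1 # ser (enc y) @ a, b', c, d])" for b'
    by (intro run_seq[OF run_push4(1)] run_push4) auto
  have p2: "run (seq (push sA 1) (seq (push sA 1) (seq (push sA 2) (push sA 2)))) (?io, [ser (enc y) @ a, b', c, d]) (2 + (2 + (2 + 2))) (?io, [2 # 2 # 1 # 1 # ser (enc y) @ a, b', c, d])" for b'
    by (intro run_seq[OF run_push4(1)] run_push4) auto
  have "run (ifte (topis sB 1) (seq (push sA 1) (push sA 2)) (seq (push sA 1) (seq (push sA 1) (seq (push sA 2) (push sA 2)))))
    (?io, [ser (enc y) @ a, bit_symbol u # ?b, c, d]) (8 + 2) (?io, [ser (enc (u # y)) @ a, bit_symbol u # ?b, c, d])"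
  proof (cases u)
    case True
    have "test (topis sB 1) (?io, [ser (enc y) @ a, bit_symbol u # ?b, c, d]) False"
      using test4(2)[of 1 ?io "ser (enc y) @ a" "bit_symbol u" ?b c d] True by (simp add: bit_symbol_def)
    then show ?thesis using run_mono[OF p2, of 8] True by (intro run_ifte_False) (simp_all add: ser_bool)
  next
    case False
    have "test (topis sB 1) (?io, [ser (enc y) @ a, bit_symbol u # ?b, c, d]) True"
      using test4(2)[of 1 ?io "ser (enc y) @ a" "bit_symbol u" ?b c d] False by (simp add: bit_symbol_def)
    then show ?thesis using run_mono[OF p1, of 8] False by (intro run_ifte_True) (simp_all add: ser_bool)
  qed
  moreover have "run (seq (pop sB) (act 0 (\<lambda>_. 0) Left)) (?io, [ser (enc (u # y)) @ a, bit_symbol u # ?b, c, d]) (1 + 1)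
     ((h - 1, \<lambda>_. 0), [ser (enc (u # y)) @ a, ?b, c, d])"
  proof -
    have "tape_act ?io (0, Left) = (h - 1, \<lambda>_. 0)" by (auto simp: tape_act_def)
    then show ?thesis using run_seq[OF run_pop4(2) run_io[of 0 Left ?io]] by simp
  qed
  ultimately have 1: "run parse_body (?io, [ser (enc y) @ a, bit_symbol u # ?b, c, d]) ((8 + 2) + (1 + 1)) ((h - 1, \<lambda>_. 0), [ser (enc (u # y)) @ a, ?b, c, d])"
    unfolding parse_body_def by (rule run_seq)
  have t: "test (\<lambda>rs. \<not> topis sB 3 rs) (?io, [ser (enc y) @ a, bit_symbol u # ?b, c, d]) True"
    using test4(5)[of 3 ?io "ser (enc y) @ a" "bit_symbol u" ?b c d] by (simp add: bit_symbol_def split: if_splits)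
  have e: "bit_symbol u # ?b = map bit_symbol (rev (x @ [u])) @ 3 # b" "x @ u # y = (x @ [u]) @ y"
    "h - 1 - int (length x) = h - int (length (x @ [u]))" by simp_all
  show ?case by (rule run_mono[OF run_while_step[OF t 1 snoc.IH, unfolded e]]) simp
qed

lemma run_read_input:
  "run read_input (input_tape x, [[], [], [], []]) (21 * length x + 6) (blank_tape, [ser (enc x), [3], [], []])"
proof -
  have i: "input_tape x = (int 0, tail_tape x 0)" by (auto simp: input_tape_def tail_tape_def fun_eq_iff)
  have 1: "run (while (\<lambda>rs. rs ! 0 \<noteq> 0) read_body) (input_tape x, [[], [3], [], []]) (7 * length x + 1)
     ((int (length x), \<lambda>_. 0), [[], map bit_symbol (rev x) @ [3], [], []])"
    using run_read[of 0 x "[]" "[3]" "[]" "[]"] by (simp add: i rev_map)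
  have 2: "run (while (\<lambda>rs. \<not> topis sB 3 rs) parse_body) ((int (length x), \<lambda>_. 0), [[1], map bit_symbol (rev x) @ [3], [], []]) (14 * length x + 1)
     (blank_tape, [ser (enc x), [3], [], []])"
    using run_parse[of "int (length x)" "[]" "[]" x "[]" "[]" "[]"] by (simp add: blank_tape_def)
  have "run read_input (input_tape x, [[], [], [], []]) (2 + ((7 * length x + 1) + (2 + (14 * length x + 1)))) (blank_tape, [ser (enc x), [3], [], []])"
    unfolding read_input_def by (rule run_seq[OF run_push4(2) run_seq[OF 1 run_seq[OF run_push4(1) 2]]]) auto
  then show ?thesis by (rule run_mono) simp
qed

lemma run_write_output:
  "run write_output ((int (length y), snd (input_tape y)), [ser (enc z), b, c, d]) (12 * length z + 1)
    ((int (length (y @ z)), snd (input_tape (y @ z))), [[1], b, c, d])"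
proof (induction z arbitrary: y)
  case Nil
  show ?case using run_while_done[of "topis sA 2" "((int (length y), snd (input_tape y)), [[1], b, c, d])" write_body]
      test4(1)[of 2 _ 1] by (simp add: write_output_def)
next
  case (Cons u z)
  let ?io = "(int (length y), snd (input_tape y))"
  let ?io' = "(int (length (y @ [u])), snd (input_tape (y @ [u])))"
  have act: "tape_act ?io (bit_symbol u, Right) = ?io'"
    by (simp add: tape_act_def input_tape_Cons)
  have F: "run (seq (pop sA) (act 0 (\<lambda>_. 1) Right)) (?io, [1 # ser (enc z), b, c, d]) (1 + 1) (?io', [ser (enc z), b, c, d])" if "\<not> u"
    using run_seq[OF run_pop4(1) run_io[of 1 Right ?io]] act that by (simp add: bit_symbol_def)
  have T: "run (seq (pop sA) (seq (pop sA) (seq (pop sA) (act 0 (\<lambda>_. 2) Right)))) (?io, [2 # 1 # 1 # ser (enc z), b, c, d]) (1 + (1 + (1 + 1))) (?io', [ser (enc z), b, c, d])" if "u"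
    using run_seq[OF run_pop4(1) run_seq[OF run_pop4(1) run_seq[OF run_pop4(1) run_io[of 2 Right ?io]]]] act that by (simp add: bit_symbol_def)
  have "run (ifte (topis sA 1) (seq (pop sA) (act 0 (\<lambda>_. 1) Right)) (seq (pop sA) (seq (pop sA) (seq (pop sA) (act 0 (\<lambda>_. 2) Right)))))
    (?io, [ser (enc u) @ ser (enc z), b, c, d]) (4 + 2) (?io', [ser (enc z), b, c, d])"
  proof (cases u)
    case True
    have "test (topis sA 1) (?io, [ser (enc u) @ ser (enc z), b, c, d]) False"
      using test4(1)[of 1 ?io 2 "1 # 1 # ser (enc z)" b c d] True by (simp add: ser_bool)
    then show ?thesis using run_mono[OF T, of 4] True by (intro run_ifte_False) (simp_all add: ser_bool)
  next
    case False
    have "test (topis sA 1) (?io, [ser (enc u) @ ser (enc z), b, c, d]) True"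
      using test4(1)[of 1 ?io 1 "ser (enc z)" b c d] False by (simp add: ser_bool)
    then show ?thesis using run_mono[OF F, of 4] False by (intro run_ifte_True) (simp_all add: ser_bool)
  qed
  then have 1: "run write_body (?io, [2 # ser (enc u) @ ser (enc z), b, c, d]) (1 + (4 + 2)) (?io', [ser (enc z), b, c, d])"
    unfolding write_body_def by (rule run_seq[OF run_pop4(1)])
  have t: "test (topis sA 2) (?io, [2 # ser (enc u) @ ser (enc z), b, c, d]) True"
    using test4(1)[of 2 ?io 2] by simp
  have e: "2 # ser (enc u) @ ser (enc z) = ser (enc (u # z))" "(y @ [u]) @ z = y @ u # z" by simp_all
  note w = run_while_step[OF t 1 Cons.IH[of "y @ [u]", unfolded write_output_def]]
  show ?case unfolding write_output_def by (rule run_mono[OF w[unfolded e]]) simp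
qed

text \<open>The exit state becomes the halting state. As \<open>turing_machine\<close> constrains
  the transition function in that state too, it is given an idle action there.\<close>

lemma exec_tm:
  assumes P: "wf_frag P"
  defines "M \<equiv> \<lparr>tm_tapes = 5, tm_symbols = 4, tm_states = Suc (fst P), tm_start = 0, tm_halt = fst P,
     tm_delta = \<lambda>q rs. if q < fst P then snd P q rs else (q, noop rs)\<rparr>"
  shows "turing_machine M"
    and "exec P ts m ts' \<Longrightarrow> m \<le> n \<Longrightarrow> (tm_step M ^^ n) (0, ts) = (fst P, ts')"
proof -
  show "turing_machine M"
    unfolding turing_machine_def
  proof (intro conjI allI impI)
    fix q and rs :: "nat list"
    assume *: "q < tm_states M \<and> length rs = tm_tapes M \<and> (\<forall>r\<in>set rs. r < tm_symbols M)"
    show "case tm_delta M q rs of (q', as) \<Rightarrow>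
      q' < tm_states M \<and> length as = tm_tapes M \<and> (\<forall>(s, d)\<in>set as. s < tm_symbols M)"
    proof (cases "q < fst P")
      case True
      then have "q < fst P" "length rs = 5" "\<forall>r\<in>set rs. r < 4" using * by (simp_all add: M_def)
      with P obtain q' as where "snd P q rs = (q', as)" "q' \<le> fst P" "length as = 5" "\<forall>(s, d)\<in>set as. s < 4"
        unfolding wf_frag_def by fast
      with True show ?thesis by (simp add: M_def)
    next
      case False
      with * show ?thesis by (auto simp: M_def noop_def)
    qed
  qed (simp_all add: M_def)
  have halt: "(tm_step M ^^ n) (fst P, ts) = (fst P, ts)" for n ts
    by (induction n) (auto simp: tm_step_def M_def)
  have steps: "(tm_step M ^^ m) c = c'" if "reach P c m c'" for c m c'
    using that
  proof induction
    case (step q ts q' as n c)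
    then have "tm_step M (q, ts) = (q', map2 tape_act ts as)"
      by (simp add: tm_step_def M_def scan_def)
    then show ?case using step.IH by (simp add: funpow_swap1)
  qed simp
  show "(tm_step M ^^ n) (0, ts) = (fst P, ts')" if "exec P ts m ts'" "m \<le> n"
  proof -
    have "(tm_step M ^^ m) (0, ts) = (fst P, ts')" using steps that(1) unfolding exec_def by blast
    moreover have "(tm_step M ^^ n) (0, ts) = (tm_step M ^^ (n - m)) ((tm_step M ^^ m) (0, ts))"
      using that(2) funpow_add[of "n - m" m "tm_step M"] by simp
    ultimately show ?thesis using halt by simp
  qed
qed

lemma sz_bools: "sz (x :: bool list) \<le> 4 * length x + 1"
  by (induction x) (auto simp: ser_bool)

lemma length_le_sz: "length xs \<le> sz xs"
  using spine_le[of "enc xs"] by (simp add: spine_list)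

theorem pt_polynomial_time:
  assumes "pt (f :: bool list \<Rightarrow> bool list)"
  shows "polynomial_time f"
proof -
  obtain P k where P: "wf_frag P" "\<And>x. sz (f x) \<le> (sz x + 2) ^ k"
    "\<And>x io a b c d. run P (io, [ser (enc x) @ a, b, c, d]) ((sz x + 2) ^ k) (io, [ser (enc (f x)) @ a, b, c, d])"
    using assms unfolding pt_def by blast
  let ?P = "seq read_input (seq P write_output)"
  \<comment> \<open>Reading costs \<open>21 * length x + 6\<close>. The time of \<open>P\<close> and
    the length of its output are both at most \<open>(4 * length x + 3) ^ k\<close>, and writing
    takes 12 steps per bit and one more.\<close>
  define p :: "nat poly" where "p = [:7, 21:] + Polynomial.smult 13 ([:3, 4:] ^ k)"
  have wf: "wf_frag ?P" by (intro wf_seq wf_io P)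
  note M = exec_tm[OF wf]
  have "\<exists>ts'. rep ts' ((int (length (f x)), snd (input_tape (f x))), [[1], [3], [], []]) \<and>
     (\<exists>m\<le>poly p (length x). exec ?P (input_tape x # replicate 4 blank_tape) m ts')" for x
  proof -
    have "run P (blank_tape, [ser (enc x), [3], [], []]) ((sz x + 2) ^ k) (blank_tape, [ser (enc (f x)), [3], [], []])"
      using P(3)[of blank_tape x "[]"] by simp
    moreover have e: "(int (length []), snd (input_tape [])) = blank_tape" by (auto simp: input_tape_def blank_tape_def)
    moreover have "run write_output (blank_tape, [ser (enc (f x)), [3], [], []]) (12 * length (f x) + 1)
      ((int (length (f x)), snd (input_tape (f x))), [[1], [3], [], []])"
      using run_write_output[of "[]" "f x"] e by simp
    ultimately have "run ?P (input_tape x, [[], [], [], []]) ((21 * length x + 6) + ((sz x + 2) ^ k + (12 * length (f x) + 1)))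
       ((int (length (f x)), snd (input_tape (f x))), [[1], [3], [], []])"
      by (intro run_seq[OF run_read_input] run_seq)
    moreover have "(21 * length x + 6) + ((sz x + 2) ^ k + (12 * length (f x) + 1)) \<le> poly p (length x)"
    proof -
      have "length (f x) \<le> (sz x + 2) ^ k" using P(2) length_le_sz le_trans by blast
      moreover have "(sz x + 2) ^ k \<le> (3 + length x * 4) ^ k" using sz_bools[of x] by (intro power_mono) auto
      ultimately show ?thesis unfolding p_def by simp
    qed
    ultimately have "run ?P (input_tape x, [[], [], [], []]) (poly p (length x))
       ((int (length (f x)), snd (input_tape (f x))), [[1], [3], [], []])"
      by (rule run_mono)
    moreover have "rep (input_tape x # replicate 4 blank_tape) (input_tape x, [[], [], [], []])"
      by (simp add: rep_def stk_def blank_tape_def numeral_eq_Suc)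
    ultimately show ?thesis unfolding run_def by blast
  qed
  then have "tm_outputs_within \<lparr>tm_tapes = 5, tm_symbols = 4, tm_states = Suc (fst ?P), tm_start = 0, tm_halt = fst ?P,
     tm_delta = \<lambda>q rs. if q < fst ?P then snd ?P q rs else (q, noop rs)\<rparr> x (poly p (length x)) (f x)" for x
  proof -
    obtain ts' m where ts': "rep ts' ((int (length (f x)), snd (input_tape (f x))), [[1], [3], [], []])"
      "m \<le> poly p (length x)" "exec ?P (input_tape x # replicate 4 blank_tape) m ts'"
      using \<open>\<And>x. \<exists>ts'. _ x ts'\<close> by blast
    have "holds_output (hd ts') (f x)"
      using ts'(1) by (auto simp: rep_def holds_output_def input_tape_def)
    then show ?thesis using M(2)[OF ts'(3,2)]
      by (simp add: tm_outputs_within_def tm_init_def)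
  qed
  then show ?thesis unfolding polynomial_time_def using M(1) by blast
qed

section \<open>Closure properties of the polynomial-time functions\<close>

named_theorems pt_intros

lemma pt_cong: "pt f \<Longrightarrow> (\<And>x. f x = g x) \<Longrightarrow> pt g"
  by (erule back_subst[of pt]) auto

lemma pbd_Suc: "pbd f \<Longrightarrow> pbd (\<lambda>x. Suc (f x))"
  using pbd_add[OF pbd_const[of 1]] by simp

lemmas pbd_rules = pbd_intros pbd_Suc

lemma pt_comp2:
  assumes "pt (\<lambda>p. h (fst p) (snd p))" "pt f" "pt g"
  shows "pt (\<lambda>x. h (f x) (g x))"
  using pt_comp[OF assms(1) pt_pair[OF assms(2,3)]] by simp

lemma pt_comp3:
  assumes "pt (\<lambda>p. h (fst p) (fst (snd p)) (snd (snd p)))" "pt e" "pt f" "pt g"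
  shows "pt (\<lambda>x. h (e x) (f x) (g x))"
  using pt_comp[OF assms(1) pt_pair[OF assms(2) pt_pair[OF assms(3,4)]]] by simp

lemma pt_fst: "pt f \<Longrightarrow> pt (\<lambda>x. fst (f x))"
  by (rule pt_comp[OF pt_fst'])

lemma pt_snd: "pt f \<Longrightarrow> pt (\<lambda>x. snd (f x))"
  by (rule pt_comp[OF pt_snd'])

declare pt_const[pt_intros] pt_id[pt_intros] pt_pair[pt_intros] pt_fst[pt_intros] pt_snd[pt_intros]

text \<open>Bodies under binders are uncurried: the environment is the first component of
  \<open>q\<close> and the bound variables follow. All rules for binders have this form, so
  \<open>intro pt_intros\<close> decomposes a definition along its syntax.\<close>

lemma pt_case_prod [pt_intros]:
  assumes "pt f" "pt (\<lambda>q. g (fst q) (fst (snd q)) (snd (snd q)))"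
  shows "pt (\<lambda>x. case f x of (a, b) \<Rightarrow> g x a b)"
  using pt_comp2[of "\<lambda>x p. g x (fst p) (snd p)", OF assms(2) pt_id assms(1)] by (simp add: case_prod_beta)

lemma pt_let [pt_intros]:
  assumes "pt f" "pt (\<lambda>q. g (fst q) (snd q))"
  shows "pt (\<lambda>x. let y = f x in g x y)"
  using pt_comp2[OF assms(2) pt_id assms(1)] by (simp add: Let_def)

lemma pt_if [pt_intros]:
  assumes "pt c" "pt f" "pt g"
  shows "pt (\<lambda>x. if c x then f x else g x)"
  \<comment> \<open>\<open>False\<close> is encoded by the leaf, hence the else branch is the leaf
    case; \<open>True\<close> has the encoding of \<open>((), ())\<close>.\<close>
  by (rule pt_case[where l = c and f = g and g = "\<lambda>p :: _ \<times> unit \<times> unit. f (fst p)"])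
    (auto intro!: assms pt_comp[OF assms(2)] pt_fst pt_id simp: enc_bool_def enc_pair enc_unit_def split: if_splits)

lemma pt_case_list [pt_intros]:
  assumes "pt l" "pt f" "pt (\<lambda>q. g (fst q) (fst (snd q)) (snd (snd q)))"
  shows "pt (\<lambda>x. case l x of [] \<Rightarrow> f x | e # es \<Rightarrow> g x e es)"
proof (rule pt_case[where g = "\<lambda>q. g (fst q) (fst (snd q)) (snd (snd q))", OF assms])
  fix x
  show "(case l x of [] \<Rightarrow> f x | e # es \<Rightarrow> g x e es) = f x" if "enc (l x) = Lf"
    using that by (cases "l x") auto
  show "\<exists>y. enc y = enc (l x) \<and> (case l x of [] \<Rightarrow> f x | e # es \<Rightarrow> g x e es) =
      g (fst (x, y)) (fst (snd (x, y))) (snd (snd (x, y)))" if "enc (l x) \<noteq> Lf"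
    using that by (cases "l x") (auto simp: enc_pair intro!: exI)
qed

lemma pt_case_nat [pt_intros]:
  assumes "pt n" "pt f" "pt (\<lambda>q. g (fst q) (snd q))"
  shows "pt (\<lambda>x. case n x of 0 \<Rightarrow> f x | Suc m \<Rightarrow> g x m)"
proof (rule pt_case[where g = "\<lambda>q :: _ \<times> unit \<times> nat. g (fst q) (snd (snd q))", OF assms(1,2)])
  show "pt (\<lambda>q :: _ \<times> unit \<times> nat. g (fst q) (snd (snd q)))"
    by (rule pt_comp2[OF assms(3)]) (intro pt_intros)+
  fix x
  show "(case n x of 0 \<Rightarrow> f x | Suc m \<Rightarrow> g x m) = f x" if "enc (n x) = Lf"
    using that by (cases "n x") auto
  show "\<exists>y :: unit \<times> nat. enc y = enc (n x) \<and> (case n x of 0 \<Rightarrow> f x | Suc m \<Rightarrow> g x m) = g (fst (x, y)) (snd (snd (x, y)))"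
    if n: "enc (n x) \<noteq> Lf"
  proof -
    obtain m where "n x = Suc m" using n by (cases "n x") auto
    then show ?thesis by (intro exI[of _ "((), m)"]) (simp add: enc_pair enc_unit_def)
  qed
qed

lemma pt_Cons [pt_intros]: "pt f \<Longrightarrow> pt g \<Longrightarrow> pt (\<lambda>x. f x # g x)"
proof -
  assume f: "pt f" and g: "pt g"
  show ?thesis
    by (rule pt_recode[OF pt_pair[OF f g]]) (auto simp: enc_pair)
qed

lemma pt_Suc [pt_intros]: "pt f \<Longrightarrow> pt (\<lambda>x. Suc (f x))"
proof -
  assume f: "pt f"
  show ?thesis
    by (rule pt_recode[OF pt_pair[OF pt_const f], of _ "()"]) (auto simp: enc_pair enc_unit_def)
qed

lemma pt_conj [pt_intros]: "pt f \<Longrightarrow> pt g \<Longrightarrow> pt (\<lambda>x. f x \<and> g x)"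
proof -
  assume "pt f" "pt g"
  then have "pt (\<lambda>x. if f x then g x else False)" by (intro pt_intros)
  then show ?thesis by (rule pt_cong) auto
qed

lemma pt_not [pt_intros]: "pt f \<Longrightarrow> pt (\<lambda>x. \<not> f x)"
proof -
  assume "pt f"
  then have "pt (\<lambda>x. if f x then False else True)" by (intro pt_intros)
  then show ?thesis by (rule pt_cong) auto
qed

lemma pt_disj [pt_intros]: "pt f \<Longrightarrow> pt g \<Longrightarrow> pt (\<lambda>x. f x \<or> g x)"
  using pt_not[OF pt_conj[OF pt_not pt_not], of f g] by simp

lemma pt_imp [pt_intros]: "pt f \<Longrightarrow> pt g \<Longrightarrow> pt (\<lambda>x. f x \<longrightarrow> g x)"
  by (rule pt_cong[OF pt_disj[OF pt_not, of f g]]) auto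

lemma pt_iff [pt_intros]: "pt f \<Longrightarrow> pt g \<Longrightarrow> pt (\<lambda>x. f x = (g x :: bool))"
proof -
  assume "pt f" "pt g"
  then have "pt (\<lambda>x. if f x then g x else \<not> g x)" by (intro pt_intros)
  then show ?thesis by (rule pt_cong) auto
qed

text \<open>Iterates a step on triples of environment, unread rest of the list and accumulator, with
  the list itself as the counter: the right spine of its encoding has the length of the
  list.\<close>

lemma pt_fold_bounded:
  fixes g :: "'a::enc \<Rightarrow> 'e::enc \<Rightarrow> 's::enc \<Rightarrow> 's"
  assumes g: "pt (\<lambda>q. g (fst q) (fst (snd q)) (snd (snd q)))" and l: "pt l" and a: "pt a"
    and B: "pbd B" "\<And>x i. i \<le> length (l x) \<Longrightarrow> sz (fold (g x) (take i (l x)) (a x)) \<le> B x"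
  shows "pt (\<lambda>x. fold (g x) (l x) (a x))"
proof -
  define h :: "'a \<times> 'e list \<times> 's \<Rightarrow> 'a \<times> 'e list \<times> 's" where
    "h = (\<lambda>q. case fst (snd q) of [] \<Rightarrow> q | e # es \<Rightarrow> (fst q, es, g (fst q) e (snd (snd q))))"
  have h: "pt h" unfolding h_def
    by (intro pt_intros pt_comp3[OF g])
  have iter: "(h ^^ i) (x, xs, s) = (x, drop i xs, fold (g x) (take i xs) s)" if "i \<le> length xs" for i x xs s
    using that
  proof (induction i arbitrary: xs s)
    case (Suc i)
    then obtain e es where "xs = e # es" by (cases xs) auto
    moreover from this have "h (x, xs, s) = (x, es, g x e s)" by (simp add: h_def)
    ultimately show ?case using Suc by (simp only: funpow_Suc_right o_apply) simp
  qed simp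
  have 1: "spine (enc (l x)) = length (l x)" for x by (rule spine_list)
  have drop: "sz (drop i xs) \<le> sz xs" for i and xs :: "'e list"
  proof (induction i arbitrary: xs)
    case (Suc i)
    then show ?case by (cases xs) (auto simp: le_SucI trans_le_add2)
  qed simp
  have "pt (\<lambda>x. (h ^^ spine (enc (l x))) (x, l x, a x))"
  proof (rule pt_iter[OF h l])
    show "pt (\<lambda>x. (x, l x, a x))" by (intro pt_intros l a)
    show "pbd (\<lambda>x. 2 + sz x + sz (l x) + B x)" by (intro pbd_rules B(1) pt_pbd l)
    fix x i assume "i \<le> spine (enc (l x))"
    then show "sz ((h ^^ i) (x, l x, a x)) \<le> 2 + sz x + sz (l x) + B x"
      using B(2)[of i x] drop[of i "l x"] by (simp add: 1 iter enc_pair)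
  qed
  then have "pt (\<lambda>x. snd (snd ((h ^^ spine (enc (l x))) (x, l x, a x))))" by (intro pt_intros)
  then show ?thesis by (simp add: 1 iter)
qed

lemma sz_Nil: "sz [] = 1"
  by simp

lemma sz_pair: "sz (x, y) = 1 + sz x + sz y"
  by (simp add: enc_pair)

lemma sz_nat: "sz (n::nat) = 2 * n + 1"
  by (induction n) auto

lemma sz_mem: "e \<in> set xs \<Longrightarrow> sz e \<le> sz xs"
  by (induction xs) auto

text \<open>A growth that is additive and independent of the accumulator cannot compound, so this
  criterion can be checked on a single step.\<close>

lemma pt_fold:
  fixes g :: "'a::enc \<Rightarrow> 'e::enc \<Rightarrow> 's::enc \<Rightarrow> 's"
  assumes g: "pt (\<lambda>q. g (fst q) (fst (snd q)) (snd (snd q)))" and l: "pt l" and a: "pt a"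
    and D: "pbd D" "\<And>x e s. sz (g x e s) \<le> sz s + D (x, e)"
  shows "pt (\<lambda>x. fold (g x) (l x) (a x))"
proof -
  obtain k where k: "\<And>q. D q \<le> (sz q + 2) ^ k" using D(1) unfolding pbd_def by blast
  let ?E = "\<lambda>x. (sz x + sz (l x) + 3) ^ k"
  show ?thesis
  proof (rule pt_fold_bounded[OF g l a])
    show "pbd (\<lambda>x. sz (a x) + sz (l x) * ?E x)" by (intro pbd_rules pt_pbd l a)
    fix x i assume i: "i \<le> length (l x)"
    have le: "D (x, e) \<le> ?E x" if "e \<in> set (l x)" for e
      using le_trans[OF k[of "(x, e)"] power_mono, of "sz x + sz (l x) + 3"] sz_mem[OF that]
      by (simp add: sz_pair)
    have "sz (fold (g x) xs s) \<le> sz s + length xs * ?E x" if "set xs \<subseteq> set (l x)" for xs s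
      using that
    proof (induction xs arbitrary: s)
      case (Cons e xs)
      have "sz (fold (g x) (e # xs) s) \<le> sz (g x e s) + length xs * ?E x" using Cons by simp
      also have "\<dots> \<le> sz s + ?E x + length xs * ?E x" using D(2)[of x e s] le[of e] Cons.prems by simp
      finally show ?case by simp
    qed simp
    from this[of "take i (l x)" "a x"] have "sz (fold (g x) (take i (l x)) (a x)) \<le> sz (a x) + length (take i (l x)) * ?E x"
      by (simp add: set_take_subset)
    also have "\<dots> \<le> sz (a x) + sz (l x) * ?E x"
      using i length_le_sz[of "l x"] by (intro add_left_mono mult_le_mono1) auto
    finally show "sz (fold (g x) (take i (l x)) (a x)) \<le> sz (a x) + sz (l x) * ?E x" .
  qed
qed

lemma pt_funpow_bounded:
  fixes g :: "'a::enc \<Rightarrow> 's::enc \<Rightarrow> 's"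
  assumes g: "pt (\<lambda>q. g (fst q) (snd q))" and n: "pt n" and a: "pt a"
    and B: "pbd B" "\<And>x i. i \<le> n x \<Longrightarrow> sz ((g x ^^ i) (a x)) \<le> B x"
  shows "pt (\<lambda>x. (g x ^^ n x) (a x))"
proof -
  define h :: "'a \<times> 's \<Rightarrow> 'a \<times> 's" where "h = (\<lambda>q. (fst q, g (fst q) (snd q)))"
  have h: "pt h" unfolding h_def by (intro pt_intros g)
  have iter: "(h ^^ i) (x, s) = (x, (g x ^^ i) s)" for i x s
    by (induction i) (auto simp: h_def)
  have "pt (\<lambda>x. (h ^^ spine (enc (n x))) (x, a x))"
    by (rule pt_iter[OF h n, where B = "\<lambda>x. 1 + sz x + B x"])
      (use B(2) in \<open>auto intro!: pt_intros a pbd_rules pbd_add[OF pbd_sz] B(1) simp: iter spine_nat sz_pair\<close>)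
  then have "pt (\<lambda>x. snd ((h ^^ spine (enc (n x))) (x, a x)))" by (intro pt_intros)
  then show ?thesis by (simp add: iter spine_nat)
qed

lemma pt_funpow:
  fixes g :: "'a::enc \<Rightarrow> 's::enc \<Rightarrow> 's"
  assumes g: "pt (\<lambda>q. g (fst q) (snd q))" and n: "pt n" and a: "pt a"
    and D: "pbd D" "\<And>x s. sz (g x s) \<le> sz s + D x"
  shows "pt (\<lambda>x. (g x ^^ n x) (a x))"
proof (rule pt_funpow_bounded[OF g n a])
  show "pbd (\<lambda>x. sz (a x) + sz (n x) * D x)" by (intro pbd_rules pt_pbd n a D(1))
  have *: "sz ((g x ^^ i) s) \<le> sz s + i * D x" for x i s
  proof (induction i)
    case (Suc i)
    then show ?case using D(2)[of x "(g x ^^ i) s"] by simp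
  qed simp
  show "sz ((g x ^^ i) (a x)) \<le> sz (a x) + sz (n x) * D x" if "i \<le> n x" for x i
  proof -
    have "i * D x \<le> sz (n x) * D x" using that by (intro mult_le_mono1) (simp add: sz_nat)
    then show ?thesis using *[where i = i and s = "a x" and x = x] by linarith
  qed
qed

subsection \<open>Unary arithmetic\<close>

lemma pt_add [pt_intros]: "pt f \<Longrightarrow> pt g \<Longrightarrow> pt (\<lambda>x. f x + (g x :: nat))"
proof -
  assume f: "pt f" and g: "pt g"
  have "(Suc ^^ m) n = m + n" for m n by (induction m) auto
  moreover have "pt (\<lambda>x. (Suc ^^ f x) (g x))"
    by (rule pt_funpow[where D = "\<lambda>_. 2"]) (auto intro!: pt_intros f g pbd_rules)
  ultimately show ?thesis by simp
qed

lemma pt_mult [pt_intros]: "pt f \<Longrightarrow> pt g \<Longrightarrow> pt (\<lambda>x. f x * (g x :: nat))"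
proof -
  assume f: "pt f" and g: "pt g"
  have "((\<lambda>s. n + s) ^^ m) 0 = m * n" for m n :: nat by (induction m) auto
  moreover have "pt (\<lambda>x. ((\<lambda>s. g x + s) ^^ f x) 0)"
  proof (rule pt_funpow[where D = "\<lambda>x. sz (g x)"])
    show "sz (g x + s) \<le> sz s + sz (g x)" for x s by (simp add: sz_nat)
  qed (intro pt_intros f pt_pbd[OF g] pt_comp[OF g])+
  ultimately show ?thesis by simp
qed

lemma pt_diff [pt_intros]: "pt f \<Longrightarrow> pt g \<Longrightarrow> pt (\<lambda>x. f x - (g x :: nat))"
proof -
  assume f: "pt f" and g: "pt g"
  have "((\<lambda>s. case s of 0 \<Rightarrow> 0 | Suc r \<Rightarrow> r) ^^ n) m = m - n" for m n :: nat
    by (induction n) (auto split: nat.splits)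
  moreover have "pt (\<lambda>x. ((\<lambda>s. case s of 0 \<Rightarrow> 0 | Suc r \<Rightarrow> r) ^^ g x) (f x))"
    by (rule pt_funpow[where D = "\<lambda>x. 0"]) (auto intro!: pt_intros f g pbd_rules simp: sz_nat split: nat.splits)
  ultimately show ?thesis by simp
qed

lemma pt_eq_0: "pt f \<Longrightarrow> pt (\<lambda>x. f x = (0::nat))"
proof -
  assume f: "pt f"
  have "pt (\<lambda>x. case f x of 0 \<Rightarrow> True | Suc _ \<Rightarrow> False)" by (intro pt_intros f)
  then show ?thesis by (rule pt_cong) (simp split: nat.splits)
qed

lemma pt_le [pt_intros]: "pt f \<Longrightarrow> pt g \<Longrightarrow> pt (\<lambda>x. f x \<le> (g x :: nat))"
  using pt_eq_0[OF pt_diff, of f g] by simp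

lemma pt_less [pt_intros]: "pt f \<Longrightarrow> pt g \<Longrightarrow> pt (\<lambda>x. f x < (g x :: nat))"
  using pt_le[OF pt_Suc, of f g] by (simp add: Suc_le_eq)

lemma pt_eq_nat [pt_intros]: "pt f \<Longrightarrow> pt g \<Longrightarrow> pt (\<lambda>x. f x = (g x :: nat))"
  using pt_conj[OF pt_le pt_le, of f g g f] by (simp add: eq_iff)

lemma pt_eq_prod [pt_intros]:
  "pt (\<lambda>x. fst (f x) = fst (g x)) \<Longrightarrow> pt (\<lambda>x. snd (f x) = snd (g x)) \<Longrightarrow> pt (\<lambda>x. f x = g x)"
  using pt_conj[of "\<lambda>x. fst (f x) = fst (g x)" "\<lambda>x. snd (f x) = snd (g x)"] by (simp add: prod_eq_iff)

lemma pt_poly: "pt f \<Longrightarrow> pt (\<lambda>x. poly p (f x :: nat))"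
  by (induction p) (auto intro!: pt_intros)

subsection \<open>Lists\<close>

lemma pt_rev [pt_intros]: "pt f \<Longrightarrow> pt (\<lambda>x. rev (f x))"
proof -
  assume f: "pt f"
  have "pt (\<lambda>x. fold (\<lambda>e s. e # s) (f x) [])"
    by (rule pt_fold[where D = "\<lambda>q. 1 + sz q"]) (auto intro!: pt_intros f pbd_rules simp: sz_pair)
  then show ?thesis by (simp add: fold_Cons)
qed

lemma pt_append [pt_intros]: "pt f \<Longrightarrow> pt g \<Longrightarrow> pt (\<lambda>x. f x @ g x)"
proof -
  assume f: "pt f" and g: "pt g"
  have "pt (\<lambda>x. fold (\<lambda>e s. e # s) (rev (f x)) (g x))"
    by (rule pt_fold[where D = "\<lambda>q. 1 + sz q"]) (auto intro!: pt_intros f g pbd_rules simp: sz_pair)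
  then show ?thesis by (simp add: fold_Cons)
qed

lemma pt_map [pt_intros]:
  fixes g :: "'a::enc \<Rightarrow> 'b::enc \<Rightarrow> 'c::enc"
  assumes g: "pt (\<lambda>q. g (fst q) (snd q))" and l: "pt l"
  shows "pt (\<lambda>x. map (g x) (l x))"
proof -
  have e: "fold (\<lambda>e s. h e # s) xs s = rev (map h xs) @ s" for h :: "'b \<Rightarrow> 'c" and xs s
    by (induction xs arbitrary: s) auto
  have "pt (\<lambda>x. rev (fold (\<lambda>e s. g x e # s) (l x) []))"
    by (intro pt_rev pt_fold[where D = "\<lambda>q. 1 + sz (g (fst q) (snd q))"])
      (auto intro!: pt_intros l pt_comp2[OF g] pbd_rules pt_pbd[OF g])
  then show ?thesis by (rule pt_cong) (simp add: e)
qed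

lemma sz_append: "sz (xs @ ys) + 1 = sz xs + sz ys"
  by (induction xs) auto

lemma pt_concat [pt_intros]:
  fixes f :: "'a::enc \<Rightarrow> 'b::enc list list"
  shows "pt f \<Longrightarrow> pt (\<lambda>x. concat (f x))"
proof -
  assume f: "pt f"
  have "fold (\<lambda>e s. s @ e) xs s = s @ concat xs" for xs and s :: "'b list"
    by (induction xs arbitrary: s) auto
  moreover have "pt (\<lambda>x. fold (\<lambda>e s. s @ e) (f x) [])"
  proof (rule pt_fold[where D = "\<lambda>q. sz q"])
    show "sz (s @ e) \<le> sz s + sz (x, e)" for x :: 'a and e s :: "'b list"
      using sz_append[of s e] by (simp add: sz_pair)
  qed (auto intro!: pt_intros f pbd_rules)
  ultimately show ?thesis by simp
qed

lemma pt_filter [pt_intros]: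
  fixes g :: "'a::enc \<Rightarrow> 'b::enc \<Rightarrow> bool"
  assumes g: "pt (\<lambda>q. g (fst q) (snd q))" and l: "pt l"
  shows "pt (\<lambda>x. filter (g x) (l x))"
proof -
  have e: "fold (\<lambda>e s. if h e then e # s else s) xs s = rev (filter h xs) @ s" for h and xs s :: "'b list"
    by (induction xs arbitrary: s) auto
  have "pt (\<lambda>x. rev (fold (\<lambda>e s. if g x e then e # s else s) (l x) []))"
    by (intro pt_rev pt_fold[where D = "\<lambda>q. 1 + sz q"])
      (auto intro!: pt_intros l pt_comp2[OF g] pbd_rules simp: sz_pair)
  then show ?thesis by (rule pt_cong) (simp add: e)
qed

lemma sz_bool: "sz (b::bool) \<le> 3"
  by (simp add: ser_bool)

lemma pt_list_all [pt_intros]: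
  fixes g :: "'a::enc \<Rightarrow> 'b::enc \<Rightarrow> bool"
  assumes g: "pt (\<lambda>q. g (fst q) (snd q))" and l: "pt l"
  shows "pt (\<lambda>x. list_all (g x) (l x))"
proof -
  have e: "fold (\<lambda>e s. s \<and> h e) xs s = (s \<and> list_all h xs)" for h and xs :: "'b list" and s
    by (induction xs arbitrary: s) auto
  have "pt (\<lambda>x. fold (\<lambda>e s. s \<and> g x e) (l x) True)"
    by (rule pt_fold[where D = "\<lambda>q. 3"])
      (auto intro!: pt_intros l pt_comp2[OF g] pbd_rules trans_le_add2 sz_bool)
  then show ?thesis by (rule pt_cong) (simp add: e)
qed

lemma pt_list_ex [pt_intros]:
  assumes g: "pt (\<lambda>q. g (fst q) (snd q))" and l: "pt l"
  shows "pt (\<lambda>x. list_ex (g x) (l x))"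
proof -
  have "pt (\<lambda>x. \<not> list_all (\<lambda>e. \<not> g x e) (l x))" by (intro pt_intros g l)
  then show ?thesis by (rule pt_cong) (simp add: list_all_iff list_ex_iff)
qed

lemma pt_length [pt_intros]:
  fixes f :: "'a::enc \<Rightarrow> 'b::enc list"
  shows "pt f \<Longrightarrow> pt (\<lambda>x. length (f x))"
proof -
  assume f: "pt f"
  have e: "fold (\<lambda>e s. Suc s) xs s = s + length xs" for xs :: "'b list" and s by (induction xs arbitrary: s) auto
  have "pt (\<lambda>x. fold (\<lambda>e s. Suc s) (f x) 0)"
    by (rule pt_fold[where D = "\<lambda>q. 2"]) (auto intro!: pt_intros f pbd_rules)
  then show ?thesis by (rule pt_cong) (simp add: e)
qed

lemma pt_replicate [pt_intros]:
  fixes g :: "'a::enc \<Rightarrow> 'b::enc"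
  shows "pt f \<Longrightarrow> pt g \<Longrightarrow> pt (\<lambda>x. replicate (f x) (g x))"
proof -
  assume f: "pt f" and g: "pt g"
  have e: "((\<lambda>s. v # s) ^^ n) [] = replicate n v" for n and v :: 'b by (induction n) auto
  have "pt (\<lambda>x. ((\<lambda>s. g x # s) ^^ f x) [])"
    by (rule pt_funpow[where D = "\<lambda>x. 1 + sz (g x)"])
      (auto intro!: pt_intros f pbd_rules pt_pbd[OF g] pt_comp[OF g])
  then show ?thesis by (rule pt_cong) (simp add: e)
qed

lemma pt_upt [pt_intros]: "pt f \<Longrightarrow> pt (\<lambda>x. [0..<f x])"
proof -
  assume f: "pt f"
  have e: "((\<lambda>s. s @ [length s]) ^^ n) [] = [0..<n]" for n by (induction n) auto
  have "pt (\<lambda>x. ((\<lambda>s. s @ [length s]) ^^ f x) [])"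
  proof (rule pt_funpow_bounded[where B = "\<lambda>x. 1 + f x * (2 + 2 * f x)"])
    have "pbd (\<lambda>x. 1 + sz (f x) * (2 + 2 * sz (f x)))" by (intro pbd_rules pt_pbd f)
    then show "pbd (\<lambda>x. 1 + f x * (2 + 2 * f x))"
      by (rule pbd_mono) (auto intro!: mult_le_mono simp: sz_nat)
    fix x i assume "i \<le> f x"
    moreover have "sz [0..<i] \<le> 1 + i * (2 + 2 * i)" for i
    proof (induction i)
      case 0
      show ?case by (simp add: sz_Nil)
    next
      case (Suc i)
      have "sz [0..<Suc i] + 1 = sz [0..<i] + (2 * i + 3)"
        using sz_append[of "[0..<i]" "[i]"] by (simp add: sz_nat)
      then show ?case using Suc by (simp add: algebra_simps)
    qed
    ultimately have "sz [0..<i] \<le> 1 + f x * (2 + 2 * f x)"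
      by (meson add_left_mono le_trans mult_le_mono order.refl)
    then show "sz (((\<lambda>s. s @ [length s]) ^^ i) []) \<le> 1 + f x * (2 + 2 * f x)"
      by (simp add: e)
  qed (intro pt_intros f)+
  then show ?thesis by (rule pt_cong) (rule e)
qed

lemma pt_tl [pt_intros]: "pt f \<Longrightarrow> pt (\<lambda>x. tl (f x))"
proof -
  assume f: "pt f"
  have "pt (\<lambda>x. case f x of [] \<Rightarrow> [] | e # es \<Rightarrow> es)" by (intro pt_intros f)
  then show ?thesis by (rule pt_cong) (simp split: list.splits)
qed

lemma pt_drop [pt_intros]:
  fixes g :: "'a::enc \<Rightarrow> 'b::enc list"
  shows "pt f \<Longrightarrow> pt g \<Longrightarrow> pt (\<lambda>x. drop (f x) (g x))"
proof -
  assume f: "pt f" and g: "pt g"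
  have "(tl ^^ n) xs = drop n xs" for n and xs :: "'b list"
    by (induction n) (auto simp: drop_Suc tl_drop)
  moreover have "sz (tl xs) \<le> sz xs" for xs :: "'b list" by (cases xs) auto
  then have "pt (\<lambda>x. (tl ^^ f x) (g x))"
    by (intro pt_funpow[where D = "\<lambda>x. 0"]) (auto intro!: pt_intros f g pbd_rules)
  ultimately show ?thesis by simp
qed

text \<open>Indexing with an explicit default, since later definitions rely on the value outside the
  list, for instance on \<open>False\<close> beyond the top bit of a numeral.\<close>

definition nthd :: "'a \<Rightarrow> 'a list \<Rightarrow> nat \<Rightarrow> 'a" where
  "nthd d xs i = (case drop i xs of [] \<Rightarrow> d | y # ys \<Rightarrow> y)"

lemma nthd: "nthd d xs i = (if i < length xs then xs ! i else d)"
proof (cases "i < length xs")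
  case True
  then show ?thesis by (simp add: nthd_def flip: Cons_nth_drop_Suc)
qed (simp add: nthd_def)

lemma pt_nthd [pt_intros]: "pt d \<Longrightarrow> pt f \<Longrightarrow> pt g \<Longrightarrow> pt (\<lambda>x. nthd (d x) (f x) (g x))"
  unfolding nthd_def by (intro pt_intros)

definition nubs :: "'a list \<Rightarrow> 'a list" where
  "nubs xs = fold (\<lambda>e s. if list_ex (\<lambda>y. y = e) s then s else e # s) xs []"

lemma nubs: "distinct (nubs xs)" "set (nubs xs) = set xs"
proof -
  have "distinct (fold (\<lambda>e s. if list_ex (\<lambda>y. y = e) s then s else e # s) xs s) \<and>
    set (fold (\<lambda>e s. if list_ex (\<lambda>y. y = e) s then s else e # s) xs s) = set xs \<union> set s" if "distinct s" for s
    using that by (induction xs arbitrary: s) (auto simp: list_ex_iff)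
  from this[of "[]"] show "distinct (nubs xs)" "set (nubs xs) = set xs" by (auto simp: nubs_def)
qed

lemma pt_nubs:
  assumes "pt (\<lambda>q :: 'b::enc \<times> 'b. fst q = snd q)" "pt (f :: 'a::enc \<Rightarrow> 'b list)"
  shows "pt (\<lambda>x. nubs (f x))"
  unfolding nubs_def
  by (rule pt_fold[where D = "\<lambda>q. 1 + sz q"])
    (auto intro!: pt_intros assms pt_comp2[of "(=)", OF assms(1)] pbd_rules simp: sz_pair)

subsection \<open>Binary arithmetic\<close>

text \<open>Same bit order as \<open>binary\<close>, but zeros in the top positions are allowed: the
  arithmetic below never normalises, and \<open>btrim\<close> restores the canonical form at the
  end.\<close>

fun bval :: "bool list \<Rightarrow> nat" where
  "bval [] = 0"
| "bval (b # bs) = of_bool b + 2 * bval bs"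

lemma bval_append: "bval (xs @ ys) = bval xs + 2 ^ length xs * bval ys"
  by (induction xs) auto

lemma bval_less: "bval xs < 2 ^ length xs"
  by (induction xs) auto

definition badd_step :: "bool \<times> bool list \<times> bool list \<times> bool list \<Rightarrow> bool \<times> bool list \<times> bool list \<times> bool list" where
  "badd_step = (\<lambda>(c, xs, ys, out). let x = nthd False xs 0; y = nthd False ys 0 in
     ((x \<and> y) \<or> (c \<and> (x \<or> y)), tl xs, tl ys, (c = (x = y)) # out))"

definition badd :: "bool list \<Rightarrow> bool list \<Rightarrow> bool list" where
  "badd xs ys = rev (snd (snd (snd ((badd_step ^^ (length xs + length ys + 1)) (False, xs, ys, [])))))"

lemma bval_tl: "bval xs = of_bool (nthd False xs 0) + 2 * bval (tl xs)"
  by (cases xs) (auto simp: nthd)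

lemma badd_steps:
  assumes "(badd_step ^^ n) (c, xs, ys, out) = (c', xs', ys', out')"
  shows "xs' = drop n xs \<and> ys' = drop n ys \<and> length out' = n + length out \<and>
    bval (rev out') + 2 ^ length out' * (of_bool c' + bval xs' + bval ys') =
    bval (rev out) + 2 ^ length out * (of_bool c + bval xs + bval ys)"
  using assms
proof (induction n arbitrary: c' xs' ys' out')
  case (Suc n)
  obtain c1 xs1 ys1 out1 where s: "(badd_step ^^ n) (c, xs, ys, out) = (c1, xs1, ys1, out1)"
    by (metis prod_cases4)
  have e: "(c', xs', ys', out') = badd_step (c1, xs1, ys1, out1)" using Suc.prems s by simp
  show ?case
    using Suc.IH[OF s] e bval_tl[of xs1] bval_tl[of ys1]
    by (cases c1; cases "nthd False xs1 0"; cases "nthd False ys1 0")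
      (auto simp: badd_step_def Let_def drop_Suc tl_drop bval_append algebra_simps)
qed simp

lemma badd: "bval (badd xs ys) = bval xs + bval ys" "length (badd xs ys) = length xs + length ys + 1"
proof -
  let ?n = "length xs + length ys + 1"
  obtain c' xs' ys' out' where s: "(badd_step ^^ ?n) (False, xs, ys, []) = (c', xs', ys', out')"
    by (metis prod_cases4)
  note * = badd_steps[OF s]
  then have e: "bval (rev out') + 2 ^ ?n * of_bool c' = bval xs + bval ys" and l: "length out' = ?n" by auto
  \<comment> \<open>The number of output bits is chosen generously, so that the last carry
    vanishes.\<close>
  have "bval xs + bval ys < 2 ^ length xs * 2 ^ length ys + 2 ^ length xs * 2 ^ length ys"
  proof -
    have "bval xs < 2 ^ length xs * 2 ^ length ys" using bval_less[of xs] by (rule less_le_trans) simp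
    moreover have "bval ys < 2 ^ length xs * 2 ^ length ys" using bval_less[of ys] by (rule less_le_trans) simp
    ultimately show ?thesis by linarith
  qed
  then have "bval xs + bval ys < 2 ^ ?n" by (simp add: power_add)
  then have "\<not> c'" using e by (cases c') auto
  then show "bval (badd xs ys) = bval xs + bval ys" "length (badd xs ys) = length xs + length ys + 1"
    using e l s by (auto simp: badd_def)
qed

lemma sz_tl: "sz (tl xs) \<le> sz xs"
  by (cases xs) auto

lemma pt_badd [pt_intros]:
  assumes "pt f" "pt g"
  shows "pt (\<lambda>x. badd (f x) (g x))"
  unfolding badd_def
proof (intro pt_intros pt_funpow[where D = "\<lambda>x. 10"] assms pbd_rules)
  show "pt (\<lambda>q :: 'a \<times> _. badd_step (snd q))" unfolding badd_step_def by (intro pt_intros)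
  show "sz (badd_step s) \<le> sz s + 10" for s
  proof (cases s)
    case (fields c xs ys out)
    then show ?thesis using sz_tl[of xs] sz_tl[of ys]
      by (simp add: badd_step_def Let_def sz_pair ser_bool)
  qed
qed

text \<open>Horner's scheme from the most significant bit; prefixing \<open>False\<close> doubles
  the accumulator.\<close>

definition bmul :: "bool list \<Rightarrow> bool list \<Rightarrow> bool list" where
  "bmul xs ys = fold (\<lambda>b s. badd (False # s) (if b then ys else [])) (rev xs) []"

lemma bval_bmul: "bval (bmul xs ys) = bval xs * bval ys"
proof -
  have "bval (fold (\<lambda>b s. badd (False # s) (if b then ys else [])) zs s) = 2 ^ length zs * bval s + bval (rev zs) * bval ys" for zs s
    by (induction zs arbitrary: s) (auto simp: badd bval_append algebra_simps)
  from this[of "rev xs" "[]"] show ?thesis by (simp add: bmul_def)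
qed

lemma sz_bools_ge: "2 * length (x :: bool list) + 1 \<le> sz x"
  by (induction x) (auto simp: ser_bool)

lemma pt_bmul [pt_intros]:
  assumes f: "pt f" and g: "pt g"
  shows "pt (\<lambda>x. bmul (f x) (g x))"
  unfolding bmul_def
proof (rule pt_fold_bounded)
  show "pt (\<lambda>q. badd (False # snd (snd q)) (if fst (snd q) then g (fst q) else []))"
    by (intro pt_intros pt_comp[OF g])
  show "pbd (\<lambda>x. 4 * (sz (f x) * (sz (g x) + 2)) + 1)" by (intro pbd_rules pt_pbd f g)
  fix x i assume "i \<le> length (rev (f x))"
  \<comment> \<open>Sizes are controlled through lengths, because \<open>sz\<close> of a bit list
    also depends on the bits. Each round adds \<open>length ys + 2\<close>: one bit for the doubling
    and \<open>length ys + 1\<close> from \<open>badd\<close>.\<close>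
  have *: "length (fold (\<lambda>b s. badd (False # s) (if b then ys else [])) zs s) \<le> length s + length zs * (length ys + 2)" for zs s ys
  proof (induction zs arbitrary: s)
    case (Cons z zs)
    show ?case using Cons[of "badd (False # s) (if z then ys else [])"] by (auto simp: badd)
  qed simp
  let ?r = "fold (\<lambda>b s. badd (False # s) (if b then g x else [])) (take i (rev (f x))) []"
  have "length ?r \<le> length (take i (rev (f x))) * (length (g x) + 2)" using *[of "g x" "take i (rev (f x))" "[]"] by simp
  also have "\<dots> \<le> sz (f x) * (sz (g x) + 2)"
    using length_le_sz[of "f x"] length_le_sz[of "g x"] by (intro mult_le_mono) auto
  finally show "sz ?r \<le> 4 * (sz (f x) * (sz (g x) + 2)) + 1" using sz_bools[of ?r] by linarith
qed (intro pt_intros f)+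

text \<open>Scanning upwards from the least significant bit, the latest difference overrides all
  earlier ones, so \<open>r\<close> always holds the verdict on the bits read so far.\<close>

definition bless_step :: "bool \<times> bool list \<times> bool list \<Rightarrow> bool \<times> bool list \<times> bool list" where
  "bless_step = (\<lambda>(r, xs, ys). let x = nthd False xs 0; y = nthd False ys 0 in
     (if x = y then r else y, tl xs, tl ys))"

definition bless :: "bool list \<Rightarrow> bool list \<Rightarrow> bool" where
  "bless xs ys = fst ((bless_step ^^ (length xs + length ys)) (False, xs, ys))"

lemma bless: "bless xs ys \<longleftrightarrow> bval xs < bval ys"
proof -
  have *: "fst ((bless_step ^^ n) (r, xs, ys)) \<longleftrightarrow> bval xs < bval ys \<or> (r \<and> bval xs = bval ys)"
    if "length xs \<le> n" "length ys \<le> n" for n r xs ys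
    using that
  proof (induction n arbitrary: r xs ys)
    case (Suc n)
    have "(bless_step ^^ Suc n) (r, xs, ys) = (bless_step ^^ n) (bless_step (r, xs, ys))" by (simp add: funpow_swap1)
    then show ?case using Suc.IH[of "tl xs" "tl ys"] Suc.prems bval_tl[of xs] bval_tl[of ys]
      by (cases "nthd False xs 0"; cases "nthd False ys 0") (auto simp: bless_step_def Let_def)
  qed simp
  show ?thesis using *[of xs "length xs + length ys" ys False] by (simp add: bless_def)
qed

lemma pt_bless [pt_intros]:
  assumes "pt f" "pt g"
  shows "pt (\<lambda>x. bless (f x) (g x))"
  unfolding bless_def
proof (intro pt_intros pt_funpow[where D = "\<lambda>x. 10"] assms pbd_rules)
  show "pt (\<lambda>q :: 'a \<times> _. bless_step (snd q))" unfolding bless_step_def by (intro pt_intros)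
  show "sz (bless_step s) \<le> sz s + 10" for s
  proof (cases s)
    case (fields r xs ys)
    then show ?thesis using sz_tl[of xs] sz_tl[of ys]
      by (simp add: bless_step_def Let_def sz_pair ser_bool)
  qed
qed

definition bofnat :: "nat \<Rightarrow> bool list" where
  "bofnat n = ((\<lambda>s. badd [True] s) ^^ n) []"

lemma bval_bofnat: "bval (bofnat n) = n"
  unfolding bofnat_def by (induction n) (auto simp: badd)

lemma pt_bofnat [pt_intros]:
  assumes f: "pt f"
  shows "pt (\<lambda>x. bofnat (f x))"
  unfolding bofnat_def
proof (rule pt_funpow_bounded[where B = "\<lambda>x. 8 * f x + 1"])
  have "pbd (\<lambda>x. 8 * sz (f x) + 1)" by (intro pbd_rules pt_pbd f)
  then show "pbd (\<lambda>x. 8 * f x + 1)" by (rule pbd_mono) (simp add: sz_nat)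
  fix x i assume "i \<le> f x"
  have "length (((\<lambda>s. badd [True] s) ^^ i) []) = 2 * i" by (induction i) (auto simp: badd)
  then show "sz (((\<lambda>s. badd [True] s) ^^ i) []) \<le> 8 * f x + 1"
    using sz_bools[of "((\<lambda>s. badd [True] s) ^^ i) []"] \<open>i \<le> f x\<close> by linarith
qed (intro pt_intros f)+

definition btrim :: "bool list \<Rightarrow> bool list" where
  "btrim xs = fold (\<lambda>b s. if b \<or> s \<noteq> [] then b # s else s) (rev xs) []"

lemma binary_bval:
  assumes "xs = [] \<or> last xs"
  shows "binary (bval xs) = xs"
  using assms
proof (induction xs)
  case Nil
  then show ?case by (simp add: binary.simps[of 0])
next
  case (Cons b xs)
  have "xs = [] \<or> last xs" using Cons.prems by (auto split: if_splits)
  moreover have "bval xs \<noteq> 0 \<or> b"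
  proof (cases "xs = []")
    case False
    then have "last xs" using Cons.prems by auto
    then have "bval xs \<noteq> 0" using False
      by (induction xs) (auto split: if_splits)
    then show ?thesis by simp
  qed (use Cons.prems in auto)
  ultimately show ?case using Cons.IH binary.simps[of "bval (b # xs)"] by (cases b) auto
qed

lemma bval_binary: "bval (binary n) = n"
  by (induction n rule: less_induct) (subst binary.simps, auto)

lemma last_binary: "n > 0 \<Longrightarrow> binary n \<noteq> [] \<and> last (binary n)"
proof (induction n rule: less_induct)
  case (less n)
  show ?case
  proof (cases "n = 1")
    case True
    have "binary 1 = [True]" by (simp add: binary.simps[of "Suc 0"] binary.simps[of 0])
    then show ?thesis using True by simp
  next
    case False
    then show ?thesis using less by (subst (1 2) binary.simps) auto
  qed
qed

lemma btrim: "btrim xs = binary (bval xs)"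
proof -
  have *: "bval (fold (\<lambda>b s. if b \<or> s \<noteq> [] then b # s else s) zs s) = bval (rev zs) + 2 ^ length zs * bval s \<and>
    (let r = fold (\<lambda>b s. if b \<or> s \<noteq> [] then b # s else s) zs s in r = [] \<or> last r)" if "s = [] \<or> last s" for zs s
    using that
  proof (induction zs arbitrary: s)
    case (Cons z zs)
    define s' where "s' = (if z \<or> s \<noteq> [] then z # s else s)"
    have "s' = [] \<or> last s'" "bval s' = of_bool z + 2 * bval s" using Cons.prems by (auto simp: s'_def)
    then show ?case using Cons.IH[of s'] by (simp add: bval_append s'_def[symmetric] algebra_simps)
  qed (auto simp: Let_def)
  from *[of "[]" "rev xs"] have "bval (btrim xs) = bval xs" "btrim xs = [] \<or> last (btrim xs)"
    by (auto simp: btrim_def Let_def)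
  then show ?thesis using binary_bval by metis
qed

lemma pt_null [pt_intros]: "pt f \<Longrightarrow> pt (\<lambda>x. f x = [])"
proof -
  assume f: "pt f"
  have "pt (\<lambda>x. case f x of [] \<Rightarrow> True | e # es \<Rightarrow> False)" by (intro pt_intros f)
  then show ?thesis by (rule pt_cong) (simp split: list.splits)
qed

lemma pt_btrim [pt_intros]: "pt f \<Longrightarrow> pt (\<lambda>x. btrim (f x))"
  unfolding btrim_def
  by (rule pt_fold[where D = "\<lambda>q. 10"]) (auto intro!: pt_intros pbd_rules simp: ser_bool)

section \<open>Spectra of nonnegative symmetric kernels\<close>

text \<open>The first-order condition at a minimum at \<open>t = 0\<close>, in a form that needs no
  derivatives. Replacing \<open>C\<close> by \<open>\<bar>C\<bar> + 1\<close> gives a positive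
  denominator in the witness whatever the sign of \<open>C\<close>.\<close>

lemma quadratic_nonneg_imp_zero:
  fixes B C :: real
  assumes "\<And>t. 0 \<le> 2 * t * B + t\<^sup>2 * C"
  shows "B = 0"
proof (rule ccontr)
  assume B: "B \<noteq> 0"
  define t where "t = - B / (\<bar>C\<bar> + 1)"
  have C: "\<bar>C\<bar> + 1 > 0" by simp
  have tC: "t * (\<bar>C\<bar> + 1) = - B" using C by (simp add: t_def)
  have "2 * t * B + t\<^sup>2 * C \<le> 2 * t * B + t\<^sup>2 * (\<bar>C\<bar> + 1)" by (intro add_left_mono mult_left_mono) auto
  also have "\<dots> = 2 * t * B + t * (t * (\<bar>C\<bar> + 1))" by (simp add: power2_eq_square algebra_simps)
  also have "\<dots> = - (B\<^sup>2 / (\<bar>C\<bar> + 1))" unfolding tC by (simp add: t_def power2_eq_square)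
  also have "\<dots> < 0" using B C by simp
  finally show False using assms[of t] by simp
qed

lemma finite_argmax:
  fixes f :: "'v \<Rightarrow> real"
  assumes "finite V" "V \<noteq> {}"
  shows "\<exists>v\<in>V. \<forall>u\<in>V. f u \<le> f v"
proof -
  have "Max (f ` V) \<in> f ` V" using assms by (intro Max_in) auto
  then obtain v where "v \<in> V" "f v = Max (f ` V)" by auto
  moreover have "f u \<le> Max (f ` V)" if "u \<in> V" for u using assms that by (intro Max_ge) auto
  ultimately show ?thesis by metis
qed

text \<open>Vectors are functions on an arbitrary type, so compactness comes from Tychonoff's
  theorem; outside \<open>V\<close> the coordinates are pinned to 0.\<close>

lemma compact_cube:
  fixes V :: "'v set"
  shows "compact {x :: 'v \<Rightarrow> real. \<forall>v. x v \<in> (if v \<in> V then {-1..1} else {0})}"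
proof -
  have "compactin (product_topology (\<lambda>v. euclidean) UNIV) (PiE UNIV (\<lambda>v :: 'v. if v \<in> V then {-1..1} else {0 :: real}))"
    by (subst compactin_PiE) auto
  moreover have "PiE UNIV (\<lambda>v :: 'v. if v \<in> V then {-1..1} else {0 :: real}) = {x. \<forall>v. x v \<in> (if v \<in> V then {-1..1} else {0})}"
    by (auto simp: PiE_def Pi_def)
  ultimately show ?thesis by (simp add: euclidean_product_topology)
qed

lemma sphere_attains_sup:
  fixes f :: "('v \<Rightarrow> real) \<Rightarrow> real"
  assumes V: "finite V" "V \<noteq> {}" and f: "continuous_on UNIV f"
  shows "\<exists>x. (\<Sum>v\<in>V. (x v)\<^sup>2) = 1 \<and> (\<forall>v. v \<notin> V \<longrightarrow> x v = 0) \<and>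
    (\<forall>y :: 'v \<Rightarrow> real. (\<Sum>v\<in>V. (y v)\<^sup>2) = 1 \<longrightarrow> (\<forall>v. v \<notin> V \<longrightarrow> y v = 0) \<longrightarrow> f y \<le> f x)"
proof -
  let ?C = "{x :: 'v \<Rightarrow> real. \<forall>v. x v \<in> (if v \<in> V then {-1..1} else {0})}"
  let ?S = "{x :: 'v \<Rightarrow> real. (\<Sum>v\<in>V. (x v)\<^sup>2) = 1}"
  have "closed ?S"
    by (intro closed_Collect_eq continuous_intros continuous_on_product_coordinates)
  then have "compact (?C \<inter> ?S)" using compact_cube by (rule compact_Int_closed[rotated])
  moreover obtain a where "a \<in> V" using V by blast
  then have "(\<lambda>v. if v = a then 1 else 0) \<in> ?C \<inter> ?S" using V
    by (auto simp: if_distrib[of "\<lambda>x. x\<^sup>2"] cong: if_cong)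
  then have "?C \<inter> ?S \<noteq> {}" by (metis empty_iff)
  ultimately obtain x where x: "x \<in> ?C \<inter> ?S" "\<And>y. y \<in> ?C \<inter> ?S \<Longrightarrow> f y \<le> f x"
    using continuous_attains_sup[of "?C \<inter> ?S" f] continuous_on_subset[OF f] by blast
  show ?thesis
  proof (intro exI[of _ x] conjI allI impI)
    show "x v = 0" if "v \<notin> V" for v using x(1) that by (auto dest!: spec[of _ v])
    fix y :: "'v \<Rightarrow> real" assume y: "(\<Sum>v\<in>V. (y v)\<^sup>2) = 1" "\<forall>v. v \<notin> V \<longrightarrow> y v = 0"
    have "y v \<in> {-1..1}" if "v \<in> V" for v
    proof -
      have "(y v)\<^sup>2 \<le> (\<Sum>v\<in>V. (y v)\<^sup>2)" using V that by (intro member_le_sum) auto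
      then have "\<bar>y v\<bar> \<le> 1" using y(1) by (simp add: abs_square_le_1)
      then show ?thesis by auto
    qed
    then show "f y \<le> f x" using y by (intro x(2)) auto
  qed (use x in auto)
qed

text \<open>
  A maximiser of \<open>\<bar>C x\<bar>\<close> on the unit sphere may be replaced by its absolute value \<open>w\<close>. With
  \<open>s\<close> the maximum, \<open>C\<^sup>2 w = s\<^sup>2 w\<close>, and the nonnegative vector \<open>C w + s w\<close> is an eigenvector for \<open>s\<close>.
\<close>

lemma nonneg_symmetric_eigenvector:
  fixes c :: "'v \<Rightarrow> 'v \<Rightarrow> real"
  assumes V: "finite V" "V \<noteq> {}" and sym: "\<And>u v. c u v = c v u" and nn: "\<And>u v. 0 \<le> c u v"
  shows "\<exists>s w. 0 \<le> s \<and> (\<exists>v\<in>V. w v \<noteq> 0) \<and> (\<forall>v\<in>V. (\<Sum>u\<in>V. c v u * w u) = s * w v) \<and>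
    (\<forall>y. (\<Sum>v\<in>V. (\<Sum>u\<in>V. c v u * y u)\<^sup>2) \<le> s\<^sup>2 * (\<Sum>v\<in>V. (y v)\<^sup>2))"
proof -
  define T where "T = (\<lambda>x v. \<Sum>u\<in>V. c v u * x u)"
  define f where "f = (\<lambda>x. \<Sum>v\<in>V. (T x v)\<^sup>2)"
  define N where "N = (\<lambda>x :: 'v \<Rightarrow> real. \<Sum>v\<in>V. (x v)\<^sup>2)"
  have "continuous_on UNIV f" unfolding f_def T_def
    by (intro continuous_intros continuous_on_product_coordinates)
  from sphere_attains_sup[OF V this] obtain x0 where x0: "N x0 = 1"
    "\<And>y. N y = 1 \<Longrightarrow> (\<forall>v. v \<notin> V \<longrightarrow> y v = 0) \<Longrightarrow> f y \<le> f x0" unfolding N_def by blast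
  define M where "M = f x0"
  have M0: "0 \<le> M" unfolding M_def f_def by (intro sum_nonneg) auto
  have Tadd: "T (\<lambda>v. a * x v + b * y v) v = a * T x v + b * T y v" for a b x y v
    unfolding T_def by (simp add: sum.distrib sum_distrib_left algebra_simps)
  have bound: "f y \<le> M * N y" for y
  proof (cases "N y = 0")
    case True
    then have "y v = 0" if "v \<in> V" for v using V that unfolding N_def by (simp add: sum_nonneg_eq_0_iff)
    then show ?thesis using True by (simp add: f_def T_def)
  next
    case False
    have N: "N y > 0" using False unfolding N_def by (simp add: sum_nonneg less_le)
    define z where "z = (\<lambda>v. if v \<in> V then (1 / sqrt (N y)) * y v else 0)"
    have Tz: "T z v = (1 / sqrt (N y)) * T y v" for v
      unfolding T_def z_def by (simp add: sum_distrib_left mult.commute mult.left_commute)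
    have "N z = (\<Sum>v\<in>V. (z v)\<^sup>2)" by (simp add: N_def)
    also have "\<dots> = (\<Sum>v\<in>V. (1 / N y) * (y v)\<^sup>2)" unfolding z_def
      using N by (intro sum.cong) (auto simp: power_mult_distrib power_divide)
    also have "\<dots> = (1 / N y) * N y" by (simp add: N_def sum_distrib_left)
    finally have "N z = 1" using N by simp
    then have "f z \<le> M" unfolding M_def by (intro x0(2)) (auto simp: z_def)
    moreover have "f z = (1 / N y) * f y" unfolding f_def Tz sum_distrib_left
      using N by (intro sum.cong) (auto simp: power_mult_distrib power_divide)
    ultimately show ?thesis using N by (simp add: field_simps)
  qed
  define w where "w = (\<lambda>v. \<bar>x0 v\<bar>)"
  have Nw: "N w = 1" using x0(1) by (simp add: N_def w_def)
  have "\<bar>T x0 v\<bar> \<le> T w v" for v unfolding T_def w_def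
    by (rule order_trans[OF sum_abs]) (simp add: abs_mult nn)
  then have "f x0 \<le> f w" unfolding f_def
    by (intro sum_mono) (metis abs_le_square_iff abs_of_nonneg abs_ge_zero order_trans)
  with bound[of w] Nw have fw: "f w = M" unfolding M_def by simp
  \<comment> \<open>The form \<open>M * N y - f y\<close> is nonnegative and vanishes at
    \<open>w\<close>, so its first variation at \<open>w\<close> in the direction of each unit
    vector is 0; by symmetry of \<open>c\<close> this variation is a multiple of
    \<open>M * w a - T (T w) a\<close>.\<close>
  have TT: "T (T w) a = M * w a" if a: "a \<in> V" for a
  proof -
    define e where "e = (\<lambda>v. if v = a then 1 else 0 :: real)"
    have Te: "T e v = c v a" for v
    proof -
      have "T e v = (\<Sum>u\<in>V. if u = a then c v u else 0)" unfolding T_def e_def by (intro sum.cong) auto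
      then show ?thesis using V(1) a by simp
    qed
    have "M * w a - T (T w) a = 0"
    proof (rule quadratic_nonneg_imp_zero[of _ "M * N e - f e"])
      fix t :: real
      have "N (\<lambda>v. 1 * w v + t * e v) = N w + 2 * t * (\<Sum>v\<in>V. w v * e v) + t\<^sup>2 * N e"
        unfolding N_def by (simp add: power2_sum sum.distrib sum_distrib_left power_mult_distrib algebra_simps)
      moreover have "(\<Sum>v\<in>V. w v * e v) = w a"
      proof -
        have "(\<Sum>v\<in>V. w v * e v) = (\<Sum>u\<in>V. if u = a then w u else 0)" unfolding e_def by (intro sum.cong) auto
        then show ?thesis using V(1) a by simp
      qed
      moreover have "f (\<lambda>v. 1 * w v + t * e v) = f w + 2 * t * (\<Sum>v\<in>V. T w v * T e v) + t\<^sup>2 * f e"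
        unfolding f_def Tadd by (simp add: power2_sum sum.distrib sum_distrib_left power_mult_distrib algebra_simps)
      moreover have "(\<Sum>v\<in>V. T w v * T e v) = T (T w) a"
        unfolding Te by (subst (2) T_def) (simp add: sym mult.commute)
      ultimately show "0 \<le> 2 * t * (M * w a - T (T w) a) + t\<^sup>2 * (M * N e - f e)"
        using bound[of "\<lambda>v. 1 * w v + t * e v"] Nw fw by (simp add: algebra_simps)
    qed
    then show ?thesis by simp
  qed
  define s where "s = sqrt M"
  have s: "0 \<le> s" "s\<^sup>2 = M" using M0 by (auto simp: s_def)
  have wnn: "0 \<le> w v" for v by (simp add: w_def)
  have wne: "\<exists>v\<in>V. w v \<noteq> 0"
  proof (rule ccontr)
    assume "\<not> ?thesis"
    then have "N w = 0" by (simp add: N_def)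
    with Nw show False by simp
  qed
  have "\<exists>z. (\<exists>v\<in>V. z v \<noteq> 0) \<and> (\<forall>v\<in>V. T z v = s * z v)"
  \<comment> \<open>For \<open>s = 0\<close> the sum \<open>T w + s w\<close> vanishes, but then
    \<open>w\<close> itself lies in the kernel.\<close>
  proof (cases "s = 0")
    case True
    then have "f w = 0" using fw s by simp
    then have "T w v = 0" if "v \<in> V" for v using V that unfolding f_def by (simp add: sum_nonneg_eq_0_iff)
    then show ?thesis using wne True by auto
  next
    case False
    define z where "z = (\<lambda>v. 1 * T w v + s * w v)"
    have "0 \<le> T w v" for v unfolding T_def by (intro sum_nonneg mult_nonneg_nonneg nn wnn)
    moreover obtain v where v: "v \<in> V" "w v \<noteq> 0" using wne by blast
    ultimately have "z v > 0" unfolding z_def using False s(1) wnn[of v]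
      by (simp add: add_nonneg_pos)
    moreover have "T z v = s * z v" if "v \<in> V" for v
      unfolding z_def Tadd TT[OF that] using s(2) by (simp add: power2_eq_square algebra_simps)
    ultimately show ?thesis using v(1) by (intro exI[of _ z] conjI bexI[of _ v] ballI) auto
  qed
  then show ?thesis using s bound unfolding T_def f_def N_def by blast
qed

section \<open>The eigenvalue gap of integer matrices\<close>

text \<open>
  The product of the nonzero eigenvalues of an integer matrix is, up to sign, a coefficient of the
  characteristic polynomial, hence an integer.
\<close>

lemma prod_nonzero_roots:
  fixes as :: "complex list"
  defines "nz \<equiv> filter (\<lambda>a. a \<noteq> 0) as"
  shows "coeff (\<Prod>a\<leftarrow>as. [:- a, 1:]) (length as - length nz) = (\<Prod>a\<leftarrow>nz. - a)"
proof -
  have 1: "(\<Prod>a\<leftarrow>as. [:- a, 1:]) = monom 1 (length as - length nz) * (\<Prod>a\<leftarrow>nz. [:- a, 1:])"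
    unfolding nz_def
  proof (induction as)
    case (Cons a as)
    have "length as \<ge> length (filter (\<lambda>a. a \<noteq> 0) as)" by simp
    moreover have "[:0, 1:] = monom (1::complex) 1" by (simp add: monom_altdef)
    ultimately show ?case using Cons by (cases "a = 0") (auto simp: Suc_diff_le mult_monom mult.assoc[symmetric] simp del: length_filter_le, simp_all add: algebra_simps)
  qed (simp add: monom_altdef)
  have 2: "coeff (\<Prod>a\<leftarrow>nz. [:- a, 1:]) 0 = (\<Prod>a\<leftarrow>nz. - a)"
    by (induction nz) (auto simp: coeff_mult)
  show ?thesis unfolding 1 using 2 by (subst coeff_monom_mult) simp
qed

lemma norm_prod_list_le:
  fixes xs :: "complex list"
  assumes "\<And>a. a \<in> set xs \<Longrightarrow> norm a \<le> B" "1 \<le> B"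
  shows "norm (\<Prod>a\<leftarrow>xs. - a) \<le> B ^ length xs"
    and "m \<in> set xs \<Longrightarrow> norm (\<Prod>a\<leftarrow>xs. - a) \<le> norm m * B ^ length xs"
proof -
  have 1: "norm (\<Prod>a\<leftarrow>xs. - a) \<le> B ^ length xs" if "\<And>a. a \<in> set xs \<Longrightarrow> norm a \<le> B" for xs :: "complex list"
    using that
  proof (induction xs)
    case (Cons a xs)
    then have "norm a * norm (\<Prod>a\<leftarrow>xs. - a) \<le> B * B ^ length xs" using assms(2) by (intro mult_mono) auto
    then show ?case by (simp add: norm_mult)
  qed simp
  show "norm (\<Prod>a\<leftarrow>xs. - a) \<le> B ^ length xs" by (rule 1[OF assms(1)])
  show "norm (\<Prod>a\<leftarrow>xs. - a) \<le> norm m * B ^ length xs" if "m \<in> set xs"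
    using that assms(1)
  proof (induction xs)
    case (Cons a xs)
    show ?case
    proof (cases "m = a")
      case True
      have "norm (\<Prod>a\<leftarrow>xs. - a) \<le> B ^ length xs" using Cons.prems by (intro 1) auto
      also have "\<dots> \<le> B ^ length (a # xs)" using assms(2) by simp
      finally show ?thesis using True by (simp add: norm_mult mult_left_mono)
    next
      case False
      then have "norm (\<Prod>a\<leftarrow>xs. - a) \<le> norm m * B ^ length xs" using Cons by auto
      moreover have "norm a \<le> B" using Cons.prems by auto
      ultimately have "norm a * norm (\<Prod>a\<leftarrow>xs. - a) \<le> B * (norm m * B ^ length xs)"
        using assms(2) by (intro mult_mono) auto
      then show ?thesis by (simp add: norm_mult mult.left_commute)
    qed
  qed simp
qed

text \<open>The product of the nonzero complex eigenvalues is up to sign a nonzero integer, so its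
  modulus is at least 1. Each eigenvalue is at most \<open>B\<close> in modulus, as the row of an
  entry of maximal modulus of an eigenvector shows, and so the single factor \<open>m\<close> cannot
  be too small.\<close>

lemma integer_eigenvalue_gap_aux:
  fixes c :: "nat \<Rightarrow> nat \<Rightarrow> int" and x :: "nat \<Rightarrow> real"
  assumes x: "\<exists>v<n. x v \<noteq> 0" "\<And>v. v < n \<Longrightarrow> (\<Sum>u<n. c v u * x u) = m * x v" and m: "m \<noteq> 0"
    and B: "1 \<le> B" "\<And>v. v < n \<Longrightarrow> (\<Sum>u<n. \<bar>real_of_int (c v u)\<bar>) \<le> B"
  shows "1 \<le> \<bar>m\<bar> * B ^ n"
proof -
  define C where "C = mat n n (\<lambda>(i, j). c i j)"
  have C: "C \<in> carrier_mat n n" by (simp add: C_def)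
  define D :: "complex mat" where "D = map_mat of_int C"
  have D: "D \<in> carrier_mat n n" by (simp add: D_def C)
  have Dv: "(D *\<^sub>v z) $ v = (\<Sum>u<n. of_int (c v u) * z $ u)" if "z \<in> carrier_vec n" "v < n" for z v
    using that by (simp add: D_def C_def scalar_prod_def lessThan_atLeast0)
  obtain as where as: "char_poly D = (\<Prod>a\<leftarrow>as. [:- a, 1:])" "length as = n"
    using char_poly_factorized[OF D] by blast
  define nz where "nz = filter (\<lambda>a. a \<noteq> 0) as"
  have root: "a \<in> set as \<longleftrightarrow> eigenvalue D a" for a
    unfolding eigenvalue_root_char_poly[OF D] as(1) poly_prod_list prod_list_zero_iff by auto
  have "of_real m \<in> set nz"
  proof -
    define z where "z = vec n (\<lambda>v. complex_of_real (x v))"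
    have z: "z \<in> carrier_vec n" by (simp add: z_def)
    have "D *\<^sub>v z = of_real m \<cdot>\<^sub>v z"
    proof (rule eq_vecI)
      fix v assume "v < dim_vec (of_real m \<cdot>\<^sub>v z)"
      then have v: "v < n" by (simp add: z_def)
      have "(D *\<^sub>v z) $ v = of_real (\<Sum>u<n. c v u * x u)"
        unfolding Dv[OF z v] by (simp add: z_def)
      then show "(D *\<^sub>v z) $ v = (of_real m \<cdot>\<^sub>v z) $ v" using x(2)[OF v] v by (simp add: z_def)
    qed (simp add: z_def D_def C_def)
    moreover obtain v where "v < n" "x v \<noteq> 0" using x(1) by blast
    then have "z \<noteq> 0\<^sub>v n" by (auto simp: z_def vec_eq_iff)
    ultimately have "eigenvalue D (of_real m)" unfolding eigenvalue_def eigenvector_def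
      using z D by auto
    then show ?thesis using m root by (simp add: nz_def)
  qed
  moreover have "norm a \<le> B" if "a \<in> set nz" for a
  proof -
    have "eigenvalue D a" using that root by (simp add: nz_def)
    then obtain z where z: "z \<in> carrier_vec n" "z \<noteq> 0\<^sub>v n" "D *\<^sub>v z = a \<cdot>\<^sub>v z"
      unfolding eigenvalue_def eigenvector_def using D by auto
    obtain i where i: "i < n" "z $ i \<noteq> 0" using z(1,2) by (auto simp: vec_eq_iff)
    have "\<exists>v\<in>{..<n}. \<forall>u\<in>{..<n}. norm (z $ u) \<le> norm (z $ v)"
      using i by (intro finite_argmax) auto
    then obtain v where v: "v < n" "\<And>u. u < n \<Longrightarrow> norm (z $ u) \<le> norm (z $ v)" by auto
    have zv: "norm (z $ v) > 0" using v(2)[OF i(1)] i(2) by (meson norm_le_zero_iff not_le order_trans)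
    have "norm a * norm (z $ v) = norm ((D *\<^sub>v z) $ v)" using z v by (simp add: norm_mult)
    also have "\<dots> \<le> (\<Sum>u<n. norm (of_int (c v u) * z $ u))" unfolding Dv[OF z(1) v(1)] by (rule norm_sum)
    also have "\<dots> \<le> (\<Sum>u<n. \<bar>real_of_int (c v u)\<bar> * norm (z $ v))"
      by (intro sum_mono) (simp add: norm_mult mult_left_mono v(2))
    also have "\<dots> = (\<Sum>u<n. \<bar>real_of_int (c v u)\<bar>) * norm (z $ v)" by (simp add: sum_distrib_right)
    also have "\<dots> \<le> B * norm (z $ v)" using B(2)[OF v(1)] by (simp add: mult_right_mono)
    finally show ?thesis using zv by simp
  qed
  ultimately have le: "norm (\<Prod>a\<leftarrow>nz. - a) \<le> norm (complex_of_real m) * B ^ length nz"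
    by (intro norm_prod_list_le(2) B(1))
  have "char_poly D = map_poly of_int (char_poly C)"
    unfolding D_def by (rule of_int_hom.char_poly_hom[OF C])
  then have "(\<Prod>a\<leftarrow>nz. - a) = of_int (coeff (char_poly C) (length as - length nz))"
    using prod_nonzero_roots[of as] by (simp add: as(1) nz_def)
  moreover have "(\<Prod>a\<leftarrow>nz. - a) \<noteq> 0" by (auto simp: prod_list_zero_iff nz_def)
  ultimately have "1 \<le> norm (\<Prod>a\<leftarrow>nz. - a)" by (auto simp del: of_int_eq_0_iff)
  also note le
  also have "norm (complex_of_real m) * B ^ length nz \<le> \<bar>m\<bar> * B ^ n"
    using as(2) B(1) by (auto simp: nz_def intro!: mult_left_mono power_increasing)
  finally show ?thesis .
qed

lemma integer_eigenvalue_gap: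
  fixes c :: "'v \<Rightarrow> 'v \<Rightarrow> int" and x :: "'v \<Rightarrow> real"
  assumes V: "finite V" and x: "\<exists>v\<in>V. x v \<noteq> 0" "\<And>v. v \<in> V \<Longrightarrow> (\<Sum>u\<in>V. c v u * x u) = m * x v" and m: "m \<noteq> 0"
    and B: "1 \<le> B" "\<And>v. v \<in> V \<Longrightarrow> (\<Sum>u\<in>V. \<bar>real_of_int (c v u)\<bar>) \<le> B"
  shows "1 \<le> \<bar>m\<bar> * B ^ card V"
proof -
  obtain h where h: "bij_betw h {..<card V} V"
    using ex_bij_betw_nat_finite[OF V] by (auto simp: lessThan_atLeast0)
  have hV: "h v \<in> V" if "v < card V" for v using h that by (auto dest: bij_betwE)
  have sum: "(\<Sum>u<card V. g (h u)) = (\<Sum>u\<in>V. g u)" for g :: "'v \<Rightarrow> real"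
    by (rule sum.reindex_bij_betw[OF h])
  show ?thesis
  proof (rule integer_eigenvalue_gap_aux[where c = "\<lambda>i j. c (h i) (h j)" and x = "\<lambda>i. x (h i)", OF _ _ m B(1)])
    obtain v where "v \<in> V" "x v \<noteq> 0" using x(1) by blast
    then show "\<exists>v<card V. x (h v) \<noteq> 0" using h by (metis bij_betw_iff_bijections lessThan_iff)
    show "(\<Sum>u<card V. c (h v) (h u) * x (h u)) = m * x (h v)" if "v < card V" for v
      using sum[of "\<lambda>u. c (h v) u * x u"] x(2)[OF hV[OF that]] by simp
    show "(\<Sum>u<card V. \<bar>real_of_int (c (h v) (h u))\<bar>) \<le> B" if "v < card V" for v
      using sum[of "\<lambda>u. \<bar>real_of_int (c (h v) u)\<bar>"] B(2)[OF hV[OF that]] by simp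
  qed
qed

section \<open>The spectral radius of a graph\<close>

lemma simple_graph_iff:
  "simple_graph H \<longleftrightarrow> finite (pverts H) \<and> pverts H \<noteq> {} \<and> parcs H \<subseteq> pverts H \<times> pverts H \<and>
     (\<forall>u v. (u, v) \<in> parcs H \<longrightarrow> (v, u) \<in> parcs H) \<and> (\<forall>v. (v, v) \<notin> parcs H)"
proof
  assume "simple_graph H"
  then interpret pair_graph H by (simp add: simple_graph_def)
  show "finite (pverts H) \<and> pverts H \<noteq> {} \<and> parcs H \<subseteq> pverts H \<times> pverts H \<and>
     (\<forall>u v. (u, v) \<in> parcs H \<longrightarrow> (v, u) \<in> parcs H) \<and> (\<forall>v. (v, v) \<notin> parcs H)"
    using \<open>simple_graph H\<close> in_arcsD1 in_arcsD2 arcs_symmetric no_loops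
    by (auto simp: simple_graph_def) blast
next
  assume *: "finite (pverts H) \<and> pverts H \<noteq> {} \<and> parcs H \<subseteq> pverts H \<times> pverts H \<and>
     (\<forall>u v. (u, v) \<in> parcs H \<longrightarrow> (v, u) \<in> parcs H) \<and> (\<forall>v. (v, v) \<notin> parcs H)"
  then have "finite (parcs H)" by (meson finite_SigmaI finite_subset)
  then have "pair_graph H" using *
    by unfold_locales (auto simp: symmetric_def arcs_ends_def arc_to_ends_def sym_def image_iff)
  then show "simple_graph H" using * by (simp add: simple_graph_def)
qed

definition degree_in :: "('v \<times> 'v) set \<Rightarrow> 'v \<Rightarrow> nat" where
  "degree_in E v = card {u. (v, u) \<in> E}"

lemma out_degree_eq: "out_degree (with_proj H) v = degree_in (parcs H) v"
proof -
  have "out_arcs (with_proj H) v = Pair v ` {u. (v, u) \<in> parcs H}" by (auto simp: out_arcs_def)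
  then show ?thesis by (simp add: out_degree_def degree_in_def card_image inj_on_def)
qed

lemma max_degree:
  assumes "simple_graph H"
  shows "v \<in> pverts H \<Longrightarrow> degree_in (parcs H) v \<le> max_degree H"
    and "\<exists>v\<in>pverts H. degree_in (parcs H) v = max_degree H"
proof -
  have *: "finite (pverts H)" "pverts H \<noteq> {}" using assms by (auto simp: simple_graph_iff)
  show "degree_in (parcs H) v \<le> max_degree H" if "v \<in> pverts H"
    unfolding max_degree_def out_degree_eq using * that by (intro Max_ge) auto
  have "max_degree H \<in> (\<lambda>v. degree_in (parcs H) v) ` pverts H"
    unfolding max_degree_def out_degree_eq using * by (intro Max_in) auto
  then show "\<exists>v\<in>pverts H. degree_in (parcs H) v = max_degree H" by auto
qed

lemma subgraph_iff:
  assumes "simple_graph H" "simple_graph G"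
  shows "subgraph (with_proj H) (with_proj G) \<longleftrightarrow> pverts H \<subseteq> pverts G \<and> parcs H \<subseteq> parcs G"
proof -
  interpret H: pair_graph H using assms by (simp add: simple_graph_def)
  interpret G: pair_graph G using assms by (simp add: simple_graph_def)
  show ?thesis
    by (auto simp: subgraph_def compatible_def intro: H.wf_digraph_axioms G.wf_digraph_axioms)
qed

text \<open>From here on eigenvectors are functions on the vertices and sums run over
  neighbourhoods; the numbering of the rows disappears.\<close>

lemma adjacency_eigenvalue_iff:
  fixes H :: "'v :: linorder pair_pre_digraph"
  assumes V: "finite (pverts H)" and E: "parcs H \<subseteq> pverts H \<times> pverts H"
  shows "eigenvalue (adjacency_matrix H) k \<longleftrightarrow>
    (\<exists>x. (\<exists>v\<in>pverts H. x v \<noteq> 0) \<and> (\<forall>v\<in>pverts H. (\<Sum>u | (v, u) \<in> parcs H. x u) = k * x v))"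
proof -
  define n vs where "n = card (pverts H)" and "vs = sorted_list_of_set (pverts H)"
  let ?A = "adjacency_matrix H"
  have vs: "distinct vs" "set vs = pverts H" "length vs = n" using V by (auto simp: vs_def n_def)
  have bij: "bij_betw ((!) vs) {..<n} (pverts H)"
    using bij_betw_nth[OF vs(1), of "{..<n}" "pverts H"] vs by auto
  have A: "?A \<in> carrier_mat n n" by (simp add: adjacency_matrix_def Let_def n_def)
  have sum: "(?A *\<^sub>v z) $ i = (\<Sum>u | (vs ! i, u) \<in> parcs H. x u)"
    if "i < n" "z \<in> carrier_vec n" "\<And>j. j < n \<Longrightarrow> z $ j = x (vs ! j)" for i z and x :: "'v \<Rightarrow> real"
  proof -
    have "(?A *\<^sub>v z) $ i = (\<Sum>j<n. (if (vs ! i, vs ! j) \<in> parcs H then 1 else 0) * z $ j)"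
      using that(1,2) by (simp add: adjacency_matrix_def Let_def scalar_prod_def lessThan_atLeast0 n_def vs_def)
    also have "\<dots> = (\<Sum>j<n. (if (vs ! i, vs ! j) \<in> parcs H then x (vs ! j) else 0))"
      using that(3) by (intro sum.cong) auto
    also have "\<dots> = (\<Sum>u\<in>pverts H. if (vs ! i, u) \<in> parcs H then x u else 0)"
      by (rule sum.reindex_bij_betw[OF bij])
    also have "\<dots> = (\<Sum>u | (vs ! i, u) \<in> parcs H. x u)"
      using V E by (intro sum.mono_neutral_cong_right) auto
    finally show ?thesis .
  qed
  show ?thesis
  proof
    assume "eigenvalue ?A k"
    then obtain z where z: "z \<in> carrier_vec n" "z \<noteq> 0\<^sub>v n" "?A *\<^sub>v z = k \<cdot>\<^sub>v z"
      unfolding eigenvalue_def eigenvector_def using A by auto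
    define x where "x = (\<lambda>u. z $ (inv_into {..<n} ((!) vs) u))"
    have x: "z $ j = x (vs ! j)" if "j < n" for j
      unfolding x_def using bij that by (simp add: bij_betw_def inv_into_f_f)
    show "\<exists>x. (\<exists>v\<in>pverts H. x v \<noteq> 0) \<and> (\<forall>v\<in>pverts H. (\<Sum>u | (v, u) \<in> parcs H. x u) = k * x v)"
    proof (intro exI[of _ x] conjI ballI)
      obtain i where "i < n" "z $ i \<noteq> 0" using z by (auto simp: vec_eq_iff)
      then show "\<exists>v\<in>pverts H. x v \<noteq> 0" using x bij by (auto dest: bij_betwE)
      fix v assume "v \<in> pverts H"
      then obtain i where i: "i < n" "v = vs ! i" using bij by (metis bij_betw_iff_bijections lessThan_iff)
      show "(\<Sum>u | (v, u) \<in> parcs H. x u) = k * x v"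
        using sum[OF i(1) z(1) x] z i x[of i] by simp
    qed
  next
    assume "\<exists>x. (\<exists>v\<in>pverts H. x v \<noteq> 0) \<and> (\<forall>v\<in>pverts H. (\<Sum>u | (v, u) \<in> parcs H. x u) = k * x v)"
    then obtain x where x: "\<exists>v\<in>pverts H. x v \<noteq> 0" "\<And>v. v \<in> pverts H \<Longrightarrow> (\<Sum>u | (v, u) \<in> parcs H. x u) = k * x v" by blast
    define z where "z = vec n (\<lambda>i. x (vs ! i))"
    have z: "z \<in> carrier_vec n" by (simp add: z_def)
    have "?A *\<^sub>v z = k \<cdot>\<^sub>v z"
    proof (rule eq_vecI)
      fix i assume "i < dim_vec (k \<cdot>\<^sub>v z)"
      then have i: "i < n" by (simp add: z_def)
      then have "vs ! i \<in> pverts H" using bij by (auto dest: bij_betwE)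
      then show "(?A *\<^sub>v z) $ i = (k \<cdot>\<^sub>v z) $ i" using sum[OF i z, of x] x(2) i by (simp add: z_def)
    qed (use A in \<open>simp add: z_def\<close>)
    moreover obtain v where "v \<in> pverts H" "x v \<noteq> 0" using x(1) by blast
    then obtain i where "i < n" "x (vs ! i) \<noteq> 0" using bij by (metis bij_betw_iff_bijections lessThan_iff)
    then have "z \<noteq> 0\<^sub>v n" by (auto simp: z_def vec_eq_iff)
    ultimately show "eigenvalue ?A k" unfolding eigenvalue_def eigenvector_def using z A by auto
  qed
qed

lemma sum_adjacency:
  fixes x :: "'v \<Rightarrow> real"
  assumes "finite V" "E \<subseteq> V \<times> V"
  shows "(\<Sum>u\<in>V. (if (v, u) \<in> E then 1 else 0) * x u) = (\<Sum>u | (v, u) \<in> E. x u)"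
  using assms by (intro sum.mono_neutral_cong_right) auto

text \<open>The value \<open>s\<close> of \<open>nonneg_symmetric_eigenvector\<close> is an
  eigenvalue, and its norm bound applied to any other eigenvector gives
  \<open>k\<^sup>2 \<le> s\<^sup>2\<close>, so \<open>s\<close> is the largest eigenvalue. The three
  claims are all that the sequel uses about spectral radii.\<close>

theorem graph_spectral_radius:
  fixes H :: "'v :: linorder pair_pre_digraph"
  assumes H: "simple_graph H"
  defines "r \<equiv> graph_spectral_radius H"
  shows "0 \<le> r"
    and "\<exists>x. (\<exists>v\<in>pverts H. x v \<noteq> 0) \<and> (\<forall>v\<in>pverts H. (\<Sum>u | (v, u) \<in> parcs H. x u) = r * x v)"
    and "(\<Sum>v\<in>pverts H. (\<Sum>u | (v, u) \<in> parcs H. y u)\<^sup>2) \<le> r\<^sup>2 * (\<Sum>v\<in>pverts H. (y v)\<^sup>2)"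
proof -
  have V: "finite (pverts H)" "pverts H \<noteq> {}" and E: "parcs H \<subseteq> pverts H \<times> pverts H"
    and sym: "\<And>u v. (u, v) \<in> parcs H \<longleftrightarrow> (v, u) \<in> parcs H" using H by (auto simp: simple_graph_iff)
  obtain s :: real and w where s: "0 \<le> s" "\<exists>v\<in>pverts H. w v \<noteq> 0" "\<And>v. v \<in> pverts H \<Longrightarrow> (\<Sum>u | (v, u) \<in> parcs H. w u) = s * w v"
    "\<And>y. (\<Sum>v\<in>pverts H. (\<Sum>u | (v, u) \<in> parcs H. y u)\<^sup>2) \<le> s\<^sup>2 * (\<Sum>v\<in>pverts H. (y v)\<^sup>2)"
  proof -
    have c: "(if (u, v) \<in> parcs H then 1 else 0 :: real) = (if (v, u) \<in> parcs H then 1 else 0)" for u v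
      by (rule if_cong[OF sym refl refl])
    have nn: "0 \<le> (if (u, v) \<in> parcs H then 1 else 0 :: real)" for u v by simp
    note * = nonneg_symmetric_eigenvector[OF V, of "\<lambda>v u. if (v, u) \<in> parcs H then 1 else 0", OF c nn]
    from *[unfolded sum_adjacency[OF V(1) E]] obtain s :: real and w where
      sw: "0 \<le> s" "\<exists>v\<in>pverts H. w v \<noteq> 0" "\<forall>v\<in>pverts H. (\<Sum>u | (v, u) \<in> parcs H. w u) = s * w v"
        "\<forall>y. (\<Sum>v\<in>pverts H. (\<Sum>u | (v, u) \<in> parcs H. y u)\<^sup>2) \<le> s\<^sup>2 * (\<Sum>v\<in>pverts H. (y v)\<^sup>2)"
      by (elim exE conjE) (rule that)
    show ?thesis by (rule that[OF sw(1,2) bspec[OF sw(3)] spec[OF sw(4)]])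
  qed
  have spec: "spectrum (adjacency_matrix H) = {k. eigenvalue (adjacency_matrix H) k}" by (simp add: spectrum_def)
  have "finite (spectrum (adjacency_matrix H))"
    by (rule card_finite_spectrum(1)[of _ "card (pverts H)"]) (simp add: adjacency_matrix_def Let_def)
  moreover have "s \<in> spectrum (adjacency_matrix H)"
    unfolding spec mem_Collect_eq adjacency_eigenvalue_iff[OF V(1) E] using s by blast
  moreover have "k \<le> s" if k: "k \<in> spectrum (adjacency_matrix H)" for k
  proof -
    obtain x where x: "\<exists>v\<in>pverts H. x v \<noteq> 0" "\<And>v. v \<in> pverts H \<Longrightarrow> (\<Sum>u | (v, u) \<in> parcs H. x u) = k * x v"
      using k unfolding spec mem_Collect_eq adjacency_eigenvalue_iff[OF V(1) E] by blast
    have "k\<^sup>2 * (\<Sum>v\<in>pverts H. (x v)\<^sup>2) \<le> s\<^sup>2 * (\<Sum>v\<in>pverts H. (x v)\<^sup>2)"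
      using s(4)[of x] x(2) by (simp add: power_mult_distrib sum_distrib_left)
    moreover have "0 < (\<Sum>v\<in>pverts H. (x v)\<^sup>2)"
      using x(1) V(1) by (metis (mono_tags, lifting) sum_pos2 zero_le_power2 zero_less_power2)
    ultimately have "k\<^sup>2 \<le> s\<^sup>2" by simp
    then show ?thesis using s(1) by (rule power2_le_imp_le)
  qed
  ultimately have "r = s" unfolding r_def graph_spectral_radius_def by (intro Max_eqI) auto
  then show "0 \<le> r" "\<exists>x. (\<exists>v\<in>pverts H. x v \<noteq> 0) \<and> (\<forall>v\<in>pverts H. (\<Sum>u | (v, u) \<in> parcs H. x u) = r * x v)"
    "(\<Sum>v\<in>pverts H. (\<Sum>u | (v, u) \<in> parcs H. y u)\<^sup>2) \<le> r\<^sup>2 * (\<Sum>v\<in>pverts H. (y v)\<^sup>2)"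
    using s by auto
qed

section \<open>Integral certificates\<close>

text \<open>The estimate \<open>(p - n)\<^sup>2 \<ge> p\<^sup>2 - 2 n p\<close>, kept valid for
  \<open>p < n\<close>, where \<open>p - n \<le> t\<close> cannot be squared but the left-hand side
  is at most 0.\<close>

lemma square_ge_lower:
  fixes t p n :: real
  assumes "0 \<le> t" "0 \<le> p" "0 \<le> n" "p - n \<le> t"
  shows "p\<^sup>2 - 2 * n * p \<le> t\<^sup>2"
proof (cases "p \<ge> n")
  case True
  then have "(p - n)\<^sup>2 \<le> t\<^sup>2" using assms by (intro power_mono) auto
  moreover have "(p - n)\<^sup>2 = p\<^sup>2 - 2 * n * p + n\<^sup>2" by (simp add: power2_diff)
  ultimately show ?thesis by (smt (verit) zero_le_power2)
next
  case False
  then have "p * p \<le> n * p" using assms by (intro mult_right_mono) auto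
  moreover have "0 \<le> n * p" using assms by simp
  moreover have "0 \<le> t\<^sup>2" by simp
  ultimately show ?thesis unfolding power2_eq_square by linarith
qed

text \<open>The certificate is the absolute value of a real eigenvector, scaled and rounded down.\<close>

lemma rounded_certificate:
  fixes W :: "'v set" and x :: "'v \<Rightarrow> real" and K :: nat
  assumes W: "finite W" "W \<noteq> {}" and E: "E \<subseteq> W \<times> W" and r: "0 \<le> r"
    and x: "\<exists>v\<in>W. x v \<noteq> 0" "\<And>v. v \<in> W \<Longrightarrow> (\<Sum>u | (v, u) \<in> E. x u) = r * x v"
    and b: "0 \<le> b" and K: "2 * b * real (card W) ^ 3 < (b * r\<^sup>2 - q) * K" and q: "0 \<le> q"
    and m: "0 \<le> b * r\<^sup>2 - q"
  shows "\<exists>y :: 'v \<Rightarrow> nat. (\<forall>v. y v \<le> K) \<and> (\<forall>v. v \<notin> W \<longrightarrow> y v = 0) \<and>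
    q * (\<Sum>v\<in>W. (y v)\<^sup>2) < b * (\<Sum>v\<in>W. (\<Sum>u | (v, u) \<in> E. y u)\<^sup>2)"
proof -
  define n where "n = real (card W)"
  have n0: "0 \<le> n" by (simp add: n_def)
  obtain t where t: "t \<in> W" "\<And>u. u \<in> W \<Longrightarrow> \<bar>x u\<bar> \<le> \<bar>x t\<bar>" using finite_argmax[OF W, of "\<lambda>u. \<bar>x u\<bar>"] by blast
  have xt: "\<bar>x t\<bar> > 0" using x(1) t(2) by (smt (verit) abs_eq_0)
  define w where "w = (\<lambda>v. if v \<in> W then \<bar>x v\<bar> / \<bar>x t\<bar> else 0)"
  have w01: "0 \<le> w v" "w v \<le> 1" for v using t(2) xt by (auto simp: w_def)
  have wt: "w t = 1" using t xt by (simp add: w_def)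
  have fin: "finite {u. (v, u) \<in> E}" for v by (rule finite_subset[OF _ W(1)]) (use E in auto)
  have card: "real (card {u. (v, u) \<in> E}) \<le> n" for v
    unfolding n_def using E W(1) by (intro of_nat_mono card_mono) auto
  define T where "T = (\<lambda>y v. \<Sum>u | (v, u) \<in> E. y u :: real)"
  \<comment> \<open>Passing to absolute values leaves only an inequality, in the direction that a
    lower bound for the image requires.\<close>
  have Tw: "r * w v \<le> T w v" if "v \<in> W" for v
  proof -
    have "r * \<bar>x v\<bar> = \<bar>\<Sum>u | (v, u) \<in> E. x u\<bar>" using x(2)[OF that] r by (simp add: abs_mult)
    also have "\<dots> \<le> (\<Sum>u | (v, u) \<in> E. \<bar>x u\<bar>)" by (rule sum_abs)
    also have "\<dots> = (\<Sum>u | (v, u) \<in> E. \<bar>x t\<bar> * w u)" using E xt by (intro sum.cong) (auto simp: w_def)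
    also have "\<dots> = \<bar>x t\<bar> * T w v" by (simp add: T_def sum_distrib_left)
    finally show ?thesis using that xt by (simp add: w_def field_simps)
  qed
  have "r \<le> n"
  proof -
    have "r \<le> T w t" using Tw[OF t(1)] wt by simp
    also have "\<dots> \<le> (\<Sum>u | (t, u) \<in> E. 1)" unfolding T_def by (intro sum_mono w01)
    also have "\<dots> \<le> n" using card by simp
    finally show ?thesis .
  qed
  define y where "y = (\<lambda>v. nat \<lfloor>K * w v\<rfloor>)"
  have y: "real (y v) \<le> K * w v" "K * w v - 1 \<le> real (y v)" for v
  proof -
    have "0 \<le> K * w v" using w01 by simp
    then show "real (y v) \<le> K * w v" "K * w v - 1 \<le> real (y v)" unfolding y_def by linarith+
  qed
  let ?y = "\<lambda>v. real (y v)"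
  \<comment> \<open>Rounding down lowers each of the at most \<open>n\<close> summands by at most
    1.\<close>
  have Ty: "K * T w v - n \<le> T ?y v" for v
  proof -
    have "K * T w v - n \<le> (\<Sum>u | (v, u) \<in> E. K * w u - 1)"
      using card[of v] by (simp add: T_def sum_subtractf sum_distrib_left)
    also have "\<dots> \<le> T ?y v" unfolding T_def by (intro sum_mono y(2))
    finally show ?thesis .
  qed
  have Tnn: "0 \<le> T ?y v" for v unfolding T_def by (intro sum_nonneg) auto
  define S where "S = (\<Sum>v\<in>W. (w v)\<^sup>2)"
  have "(w t)\<^sup>2 \<le> S" unfolding S_def using W t by (intro member_le_sum) auto
  then have S1: "1 \<le> S" using wt by simp
  have "(K * r * w v)\<^sup>2 - 2 * n * (K * r * w v) \<le> (T ?y v)\<^sup>2" if "v \<in> W" for v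
  proof (rule square_ge_lower[OF Tnn _ n0])
    have "K * (r * w v) \<le> K * T w v" using Tw[OF that] by (intro mult_left_mono) auto
    then show "K * r * w v - n \<le> T ?y v" using Ty[of v] by (simp add: mult.assoc)
  qed (use r w01 in simp)
  then have "(\<Sum>v\<in>W. (K * r * w v)\<^sup>2 - 2 * n * (K * r * w v)) \<le> (\<Sum>v\<in>W. (T ?y v)\<^sup>2)"
    by (intro sum_mono)
  moreover have "(\<Sum>v\<in>W. (K * r * w v)\<^sup>2 - 2 * n * (K * r * w v)) = K\<^sup>2 * r\<^sup>2 * S - 2 * n * K * r * (\<Sum>v\<in>W. w v)"
    unfolding S_def by (simp add: sum_subtractf sum_distrib_left power_mult_distrib mult.assoc)
  moreover have "2 * n * K * r * (\<Sum>v\<in>W. w v) \<le> 2 * n * K * n * n"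
  proof -
    have "(\<Sum>v\<in>W. w v) \<le> (\<Sum>v\<in>W. 1)" by (intro sum_mono w01)
    then have "(\<Sum>v\<in>W. w v) \<le> n" by (simp add: n_def)
    moreover have "0 \<le> (\<Sum>v\<in>W. w v)" by (intro sum_nonneg w01)
    ultimately show ?thesis using \<open>r \<le> n\<close> r n0 by (intro mult_mono) auto
  qed
  ultimately have 1: "K\<^sup>2 * r\<^sup>2 * S - 2 * n * K * n * n \<le> (\<Sum>v\<in>W. (T ?y v)\<^sup>2)" by linarith
  have "(\<Sum>v\<in>W. (?y v)\<^sup>2) \<le> (\<Sum>v\<in>W. (K * w v)\<^sup>2)"
    by (intro sum_mono power_mono y) auto
  then have 2: "(\<Sum>v\<in>W. (?y v)\<^sup>2) \<le> K\<^sup>2 * S" by (simp add: S_def power_mult_distrib sum_distrib_left)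
  have K0: "0 < real K" using K m b n0 unfolding n_def
    by (smt (verit) mult_nonneg_nonneg mult_not_zero of_nat_0_le_iff zero_le_power)
  \<comment> \<open>The rounding loss is linear in \<open>K\<close>, namely
    \<open>2 * n ^ 3 * K\<close>, whereas the margin grows like \<open>K\<^sup>2\<close>. Scaling
    \<open>w\<close> to maximum 1 gives \<open>S \<ge> 1\<close>, so the hypothesis on
    \<open>K\<close> is strong enough.\<close>
  have "2 * b * n ^ 3 < (b * r\<^sup>2 - q) * K * S"
  proof -
    have "(b * r\<^sup>2 - q) * K * 1 \<le> (b * r\<^sup>2 - q) * K * S" using S1 m by (intro mult_left_mono) auto
    then show ?thesis using K unfolding n_def by linarith
  qed
  then have "K * (2 * b * n ^ 3) < K * ((b * r\<^sup>2 - q) * K * S)" using K0 by simp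
  then have "q * (K\<^sup>2 * S) < b * (K\<^sup>2 * r\<^sup>2 * S - 2 * n * K * n * n)"
    by (simp add: power2_eq_square power3_eq_cube algebra_simps)
  also have "\<dots> \<le> b * (\<Sum>v\<in>W. (T ?y v)\<^sup>2)" using 1 b by (intro mult_left_mono)
  finally have "q * (\<Sum>v\<in>W. (?y v)\<^sup>2) < b * (\<Sum>v\<in>W. (T ?y v)\<^sup>2)"
    using mult_left_mono[OF 2 q] by linarith
  moreover have "y v \<le> K" for v
  proof -
    have "real K * w v \<le> real K * 1" using w01 by (intro mult_left_mono) auto
    then have "real (y v) \<le> real K" using y(1)[of v] by linarith
    then show ?thesis by simp
  qed
  moreover have "y v = 0" if "v \<notin> W" for v using that by (simp add: y_def w_def)
  ultimately show ?thesis unfolding T_def by (intro exI[of _ y]) simp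
qed

text \<open>The gap is applied to the integer matrix \<open>b A^2 - a I\<close>, which has
  \<open>x\<close> as an eigenvector for \<open>b r\<^sup>2 - a\<close>. The entries of
  \<open>A^2\<close> are at most \<open>card W\<close>, which yields the bound on the row
  sums.\<close>

lemma square_kernel_gap:
  fixes W :: "'v set" and x :: "'v \<Rightarrow> real" and a b :: nat and B r :: real
  assumes W: "finite W" and E: "E \<subseteq> W \<times> W"
    and x: "\<exists>v\<in>W. x v \<noteq> 0" "\<And>v. v \<in> W \<Longrightarrow> (\<Sum>u | (v, u) \<in> E. x u) = r * x v"
    and m: "b * r\<^sup>2 - a \<noteq> 0" and B: "1 \<le> B" "b * real (card W) ^ 2 + a \<le> B"
  shows "1 \<le> \<bar>b * r\<^sup>2 - a\<bar> * B ^ card W"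
proof (rule integer_eigenvalue_gap[OF W x(1) _ m B(1)])
  define A :: "'v \<Rightarrow> 'v \<Rightarrow> int" where "A = (\<lambda>v u. if (v, u) \<in> E then 1 else 0)"
  let ?c = "\<lambda>v u. int b * (\<Sum>w\<in>W. A v w * A w u) - (if u = v then int a else 0)"
  have A: "(\<Sum>u\<in>W. real_of_int (A v u) * z u) = (\<Sum>u | (v, u) \<in> E. z u)" for z :: "'v \<Rightarrow> real" and v
    using sum_adjacency[OF W E, of v z] by (simp add: A_def if_distrib[of real_of_int] cong: if_cong)
  show "(\<Sum>u\<in>W. real_of_int (?c v u) * x u) = (b * r\<^sup>2 - a) * x v" if v: "v \<in> W" for v
  proof -
    have "(\<Sum>u\<in>W. real_of_int (?c v u) * x u) =
      b * (\<Sum>u\<in>W. (\<Sum>w\<in>W. real_of_int (A v w) * real_of_int (A w u)) * x u) - (\<Sum>u\<in>W. if u = v then a * x u else 0)"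
      unfolding sum_distrib_left sum_subtractf[symmetric] by (intro sum.cong) (auto simp: algebra_simps sum_distrib_left)
    also have "(\<Sum>u\<in>W. if u = v then a * x u else 0) = a * x v" using W v by simp
    also have "(\<Sum>u\<in>W. (\<Sum>w\<in>W. real_of_int (A v w) * real_of_int (A w u)) * x u) =
      (\<Sum>w\<in>W. real_of_int (A v w) * (\<Sum>u\<in>W. real_of_int (A w u) * x u))"
      unfolding sum_distrib_left sum_distrib_right by (subst sum.swap) (simp add: mult.assoc)
    also have "\<dots> = (\<Sum>w\<in>W. real_of_int (A v w) * (r * x w))"
      by (intro sum.cong) (auto simp: A x(2))
    also have "\<dots> = r * (\<Sum>w | (v, w) \<in> E. x w)" unfolding A by (simp add: sum_distrib_left)
    also have "\<dots> = r\<^sup>2 * x v" using x(2)[OF v] by (simp add: power2_eq_square)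
    finally show ?thesis by (simp add: algebra_simps)
  qed
  show "(\<Sum>u\<in>W. \<bar>real_of_int (?c v u)\<bar>) \<le> B" if v: "v \<in> W" for v
  proof -
    have "\<bar>real_of_int (?c v u)\<bar> \<le> b * card W + (if u = v then a else 0)" for u
    proof -
      have "(\<Sum>w\<in>W. A v w * A w u) \<le> (\<Sum>w\<in>W. 1)" by (intro sum_mono) (simp add: A_def)
      then have "int b * (\<Sum>w\<in>W. A v w * A w u) \<le> int b * int (card W)" by (intro mult_left_mono) auto
      moreover have "0 \<le> int b * (\<Sum>w\<in>W. A v w * A w u)" by (intro mult_nonneg_nonneg sum_nonneg) (auto simp: A_def)
      ultimately have "\<bar>?c v u\<bar> \<le> int b * int (card W) + (if u = v then int a else 0)" by (auto split: if_splits)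
      then have "real_of_int \<bar>?c v u\<bar> \<le> real_of_int (int b * int (card W) + (if u = v then int a else 0))"
        by (simp only: of_int_le_iff)
      then show ?thesis by (auto split: if_splits)
    qed
    then have "(\<Sum>u\<in>W. \<bar>real_of_int (?c v u)\<bar>) \<le> (\<Sum>u\<in>W. real (b * card W + (if u = v then a else 0)))"
      by (intro sum_mono)
    also have "\<dots> = b * real (card W) ^ 2 + a"
      using W v by (simp add: sum.distrib power2_eq_square if_distrib[of real] cong: if_cong)
    finally show ?thesis using B(2) by simp
  qed
qed

lemma degree_in_le: "finite W \<Longrightarrow> E \<subseteq> W \<times> W \<Longrightarrow> degree_in E v \<le> card W"
  unfolding degree_in_def by (intro card_mono) auto

text \<open>By the gap the margin is at least \<open>B ^ (- N)\<close> with
  \<open>B = b N^2 + a N\<close>, where \<open>a N\<close> covers \<open>a \<Delta>\<close>. Hence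
  this \<open>K\<close> exceeds the value \<open>2 b N^3 / margin\<close> that
  \<open>rounded_certificate\<close> requires.\<close>

definition certificate_bound :: "nat \<Rightarrow> nat \<Rightarrow> nat \<Rightarrow> nat" where
  "certificate_bound a b N = 2 * b * N ^ 3 * (b * N ^ 2 + a * N) ^ N + 1"

text \<open>The maximum degree is expressed by the inequality for every vertex \<open>w\<close>, a
  form that the verifier can test. Vertices of \<open>G\<close> outside \<open>H\<close> have degree
  0 and value 0, so all sums may run over \<open>G\<close> and no vertex set has to be
  guessed.\<close>

lemma spectral_certificate:
  fixes G :: "'v :: linorder pair_pre_digraph"
  assumes G: "simple_graph G" and ab: "0 < a" "0 < b" and nd: "\<not> spectrally_degenerate (real a / real b) G"
  shows "\<exists>E y. E \<subseteq> parcs G \<and> (\<forall>u v. (u, v) \<in> E \<longrightarrow> (v, u) \<in> E) \<and>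
    (\<forall>u. y u \<le> certificate_bound a b (card (pverts G))) \<and>
    (\<forall>w\<in>pverts G. a * degree_in E w * (\<Sum>v\<in>pverts G. (y v)\<^sup>2) < b * (\<Sum>v\<in>pverts G. (\<Sum>u | (v, u) \<in> E. y u)\<^sup>2))"
proof -
  obtain H where H: "simple_graph H" "subgraph (with_proj H) (with_proj G)"
    "graph_spectral_radius H > sqrt (real a / real b * real (max_degree H))"
    using nd unfolding spectrally_degenerate_def by (auto simp: not_le)
  define r D N n where "r = graph_spectral_radius H" and "D = max_degree H" and "N = card (pverts G)" and "n = card (pverts H)"
  have sub: "pverts H \<subseteq> pverts G" "parcs H \<subseteq> parcs G" using H(2) subgraph_iff[OF H(1) G] by auto
  have fG: "finite (pverts G)" using G by (simp add: simple_graph_iff)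
  have W: "finite (pverts H)" "pverts H \<noteq> {}" and E: "parcs H \<subseteq> pverts H \<times> pverts H"
    and sym: "\<And>u v. (u, v) \<in> parcs H \<Longrightarrow> (v, u) \<in> parcs H" using H(1) by (auto simp: simple_graph_iff)
  have nN: "n \<le> N" unfolding n_def N_def using sub(1) fG by (rule card_mono[rotated])
  have n1: "1 \<le> n" using W by (simp add: n_def Suc_le_eq card_gt_0_iff)
  have Dn: "D \<le> n" using max_degree(2)[OF H(1)] degree_in_le[OF W(1) E] unfolding D_def n_def by metis
  have r0: "0 \<le> r" unfolding r_def by (rule graph_spectral_radius(1)[OF H(1)])
  obtain x where x: "\<exists>v\<in>pverts H. x v \<noteq> 0" "\<And>v. v \<in> pverts H \<Longrightarrow> (\<Sum>u | (v, u) \<in> parcs H. x u) = r * x v"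
    using graph_spectral_radius(2)[OF H(1)] unfolding r_def by blast
  have "real a / real b * real D < r\<^sup>2"
  proof -
    have "(sqrt (real a / real b * real D))\<^sup>2 < r\<^sup>2" using H(3) unfolding r_def D_def
      by (intro power_strict_mono) auto
    then show ?thesis by simp
  qed
  then have m: "0 < b * r\<^sup>2 - (a * D :: nat)" using ab by (simp add: field_simps)
  define B where "B = real (b * N ^ 2 + a * N)"
  have N1: "1 \<le> N" using nN n1 by simp
  have "1 \<le> b * N ^ 2 + a * N" using ab N1 by (simp add: Suc_le_eq)
  then have B1: "1 \<le> B" unfolding B_def by (metis of_nat_1 of_nat_mono)
  have "b * n ^ 2 + a * D \<le> b * N ^ 2 + a * N" using nN Dn by (intro add_mono mult_left_mono power_mono) auto
  then have "real (b * n ^ 2 + a * D) \<le> B" unfolding B_def by (rule of_nat_mono)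
  then have "1 \<le> \<bar>b * r\<^sup>2 - (a * D :: nat)\<bar> * B ^ n" unfolding n_def
    using m B1 by (intro square_kernel_gap[OF W(1) E x]) (auto simp: n_def)
  also have "\<dots> \<le> (b * r\<^sup>2 - (a * D :: nat)) * B ^ N"
    using m B1 nN by (auto intro!: mult_left_mono power_increasing)
  finally have gap: "1 \<le> (b * r\<^sup>2 - (a * D :: nat)) * B ^ N" .
  define K where "K = certificate_bound a b N"
  have "2 * real b * real n ^ 3 < (b * r\<^sup>2 - (a * D :: nat)) * K"
  proof -
    have "2 * real b * real n ^ 3 * 1 \<le> 2 * real b * real N ^ 3 * ((b * r\<^sup>2 - (a * D :: nat)) * B ^ N)"
      using nN gap by (intro mult_mono power_mono) auto
    also have "\<dots> < (b * r\<^sup>2 - (a * D :: nat)) * (2 * real b * real N ^ 3 * B ^ N + 1)"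
      using m by (simp add: algebra_simps)
    also have "2 * real b * real N ^ 3 * B ^ N + 1 = K" by (simp add: K_def certificate_bound_def B_def)
    finally show ?thesis by simp
  qed
  from rounded_certificate[OF W E r0 x _ this[unfolded n_def]] m obtain y :: "'v \<Rightarrow> nat" where
    y: "\<And>v. y v \<le> K" "\<And>v. v \<notin> pverts H \<Longrightarrow> y v = 0"
      "real (a * D) * (\<Sum>v\<in>pverts H. (y v)\<^sup>2) < b * (\<Sum>v\<in>pverts H. (\<Sum>u | (v, u) \<in> parcs H. y u)\<^sup>2)" by auto
  have y3: "a * D * (\<Sum>v\<in>pverts H. (y v)\<^sup>2) < b * (\<Sum>v\<in>pverts H. (\<Sum>u | (v, u) \<in> parcs H. y u)\<^sup>2)"
    using y(3) by (simp only: of_nat_mult[symmetric] of_nat_less_iff)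
  have s1: "(\<Sum>v\<in>pverts G. (y v)\<^sup>2) = (\<Sum>v\<in>pverts H. (y v)\<^sup>2)"
    using y(2) fG sub by (intro sum.mono_neutral_right) auto
  have "{u. (v, u) \<in> parcs H} = {}" if "v \<notin> pverts H" for v using E that by auto
  then have s2: "(\<Sum>v\<in>pverts G. (\<Sum>u | (v, u) \<in> parcs H. y u)\<^sup>2) = (\<Sum>v\<in>pverts H. (\<Sum>u | (v, u) \<in> parcs H. y u)\<^sup>2)"
    using fG sub by (intro sum.mono_neutral_right) auto
  have deg: "degree_in (parcs H) w \<le> D" for w
  proof (cases "w \<in> pverts H")
    case True
    then show ?thesis using max_degree(1)[OF H(1)] by (simp add: D_def)
  next
    case False
    then have "{u. (w, u) \<in> parcs H} = {}" using E by auto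
    then show ?thesis by (simp add: degree_in_def)
  qed
  show ?thesis
  proof (intro exI[of _ "parcs H"] exI[of _ y] conjI allI impI ballI)
    show "parcs H \<subseteq> parcs G" by (rule sub)
    show "(v, u) \<in> parcs H" if "(u, v) \<in> parcs H" for u v using that by (rule sym)
    show "y u \<le> certificate_bound a b (card (pverts G))" for u using y(1) by (simp add: K_def N_def)
    fix w
    have "a * degree_in (parcs H) w * (\<Sum>v\<in>pverts H. (y v)\<^sup>2) \<le> a * D * (\<Sum>v\<in>pverts H. (y v)\<^sup>2)"
      using deg by (intro mult_right_mono mult_left_mono) auto
    then show "a * degree_in (parcs H) w * (\<Sum>v\<in>pverts G. (y v)\<^sup>2) < b * (\<Sum>v\<in>pverts G. (\<Sum>u | (v, u) \<in> parcs H. y u)\<^sup>2)"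
      unfolding s1 s2 using y3 by linarith
  qed
qed

text \<open>The edges together with all vertices of \<open>G\<close> form a subgraph, and
  \<open>|A y|\<^sup>2 \<le> \<rho>\<^sup>2 |y|\<^sup>2\<close> turns the strict inequality at a
  vertex of maximum degree into a violation.\<close>

lemma certificate_sound:
  fixes G :: "'v :: linorder pair_pre_digraph" and y :: "'v \<Rightarrow> nat"
  assumes G: "simple_graph G" and ab: "0 < a" "0 < b"
    and E: "E \<subseteq> parcs G" "\<And>u v. (u, v) \<in> E \<Longrightarrow> (v, u) \<in> E"
    and y: "\<And>w. w \<in> pverts G \<Longrightarrow> a * degree_in E w * (\<Sum>v\<in>pverts G. (y v)\<^sup>2) < b * (\<Sum>v\<in>pverts G. (\<Sum>u | (v, u) \<in> E. y u)\<^sup>2)"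
  shows "\<not> spectrally_degenerate (real a / real b) G"
proof
  assume sd: "spectrally_degenerate (real a / real b) G"
  define H where "H = \<lparr>pverts = pverts G, parcs = E\<rparr>"
  have H: "simple_graph H" using G E by (auto simp: simple_graph_iff H_def)
  then have sub: "subgraph (with_proj H) (with_proj G)" using subgraph_iff[OF H G] E by (simp add: H_def)
  define r D where "r = graph_spectral_radius H" and "D = max_degree H"
  have "r \<le> sqrt (real a / real b * real D)" using sd H sub unfolding spectrally_degenerate_def r_def D_def by blast
  moreover have r0: "0 \<le> r" unfolding r_def by (rule graph_spectral_radius(1)[OF H])
  ultimately have "r\<^sup>2 \<le> (sqrt (real a / real b * real D))\<^sup>2" by (intro power_mono)
  then have br: "b * r\<^sup>2 \<le> real (a * D)" using ab by (simp add: field_simps)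
  obtain w where w: "w \<in> pverts G" "degree_in E w = D"
    using max_degree(2)[OF H] by (auto simp: H_def D_def)
  let ?S = "\<Sum>v\<in>pverts G. (y v)\<^sup>2"
  let ?T = "\<Sum>v\<in>pverts G. (\<Sum>u | (v, u) \<in> E. y u)\<^sup>2"
  have "real ?T \<le> r\<^sup>2 * real ?S"
    using graph_spectral_radius(3)[OF H, of "\<lambda>v. real (y v)"] by (simp add: r_def H_def)
  then have "b * real ?T \<le> b * (r\<^sup>2 * real ?S)" by (intro mult_left_mono) auto
  also have "\<dots> = (b * r\<^sup>2) * real ?S" by simp
  also have "\<dots> \<le> real (a * D) * real ?S" using br by (intro mult_right_mono) (auto intro: sum_nonneg)
  finally have "real (b * ?T) \<le> real (a * D * ?S)" by simp
  then have "b * ?T \<le> a * D * ?S" by (simp only: of_nat_le_iff)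
  with y[OF w(1)] w(2) show False by simp
qed

section \<open>Membership in co-NP\<close>

text \<open>State 0 reads doubled bits, state 1 is reached by the terminator \<open>01\<close> and
  state 2 by anything malformed; 1 and 2 are final.\<close>

definition unpair_step :: "nat \<times> bool list \<times> bool list \<Rightarrow> nat \<times> bool list \<times> bool list" where
  "unpair_step = (\<lambda>(st, acc, rest). if st = 0 then
     (case rest of [] \<Rightarrow> (2, acc, []) | c # r \<Rightarrow>
       (case r of [] \<Rightarrow> (2, acc, []) | d # r' \<Rightarrow>
          if c = d then (0, c # acc, r') else if d then (1, acc, r') else (2, acc, r')))
     else (st, acc, rest))"

definition unpair :: "bool list \<Rightarrow> bool \<times> bool list \<times> bool list" where
  "unpair z = (case (unpair_step ^^ length z) (0, [], z) of (st, acc, rest) \<Rightarrow> (st = 1, rev acc, rest))"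

lemma unpair_step_halt: "st \<noteq> 0 \<Longrightarrow> (unpair_step ^^ n) (st, acc, rest) = (st, acc, rest)"
  by (induction n) (auto simp: unpair_step_def)

lemma unpair_pair_code: "unpair (pair_code x y) = (True, x, y)"
proof -
  have *: "(unpair_step ^^ (length x + 1 + k)) (0, acc, pair_code x y) = (1, rev x @ acc, y)" for k acc
  proof (induction x arbitrary: acc)
    case Nil
    have "(unpair_step ^^ Suc k) (0, acc, pair_code [] y) = (unpair_step ^^ k) (1, acc, y)"
      by (simp only: funpow_Suc_right o_apply) (simp add: pair_code_def unpair_step_def)
    then show ?case using unpair_step_halt[of 1 k] by simp
  next
    case (Cons b x)
    have "(unpair_step ^^ Suc (length x + 1 + k)) (0, acc, pair_code (b # x) y) = (unpair_step ^^ (length x + 1 + k)) (0, b # acc, pair_code x y)"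
      by (simp only: funpow_Suc_right o_apply) (simp add: pair_code_def unpair_step_def)
    then show ?case using Cons by simp
  qed
  have "length (pair_code x y) = length x + 1 + (length x + 1 + length y)"
    by (simp add: pair_code_def length_concat comp_def sum_list_triv)
  then show ?thesis using *[of "length x + 1 + length y" "[]"] by (simp add: unpair_def)
qed

lemma unpair_imp_pair_code: "unpair z = (True, x, y) \<Longrightarrow> z = pair_code x y"
proof -
  have *: "\<exists>x. a = rev x @ acc \<and> rest = pair_code x y" if "(unpair_step ^^ n) (0, acc, rest) = (1, a, y)" for n acc rest a
    using that
  proof (induction n arbitrary: acc rest)
    case (Suc n)
    then have s: "(unpair_step ^^ n) (unpair_step (0, acc, rest)) = (1, a, y)" by (simp only: funpow_Suc_right o_apply)
    show ?case
    proof (cases rest)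
      case Nil
      then show ?thesis using s unpair_step_halt[of 2 n] by (simp add: unpair_step_def)
    next
      case (Cons c r)
      note c = Cons
      show ?thesis
      proof (cases r)
        case Nil
        then show ?thesis using c s unpair_step_halt[of 2 n] by (simp add: unpair_step_def)
      next
        case (Cons d r')
        show ?thesis
        proof (cases "c = d")
          case True
          then have "(unpair_step ^^ n) (0, c # acc, r') = (1, a, y)" using s c Cons by (simp add: unpair_step_def)
          from Suc.IH[OF this] obtain x where "a = rev x @ c # acc" "r' = pair_code x y" by blast
          then show ?thesis using c Cons True by (intro exI[of _ "c # x"]) (simp add: pair_code_def)
        next
          case False
          then show ?thesis using s c Cons unpair_step_halt[of 1 n] unpair_step_halt[of 2 n]
            by (cases d) (auto simp: unpair_step_def pair_code_def)
        qed
      qed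
    qed
  qed simp
  assume "unpair z = (True, x, y)"
  then obtain acc where "(unpair_step ^^ length z) (0, [], z) = (1, acc, y)" "x = rev acc"
    by (auto simp: unpair_def split: prod.splits)
  then show ?thesis using *[of "length z" "[]" z acc] by auto
qed

lemma pt_unpair [pt_intros]: "pt f \<Longrightarrow> pt (\<lambda>x. unpair (f x))"
  unfolding unpair_def
proof (intro pt_intros pt_funpow[where D = "\<lambda>x. 10"] pbd_rules)
  show "pt (\<lambda>q :: 'a \<times> _. unpair_step (snd q))" unfolding unpair_step_def by (intro pt_intros)
  show "sz (unpair_step s) \<le> sz s + 10" for s
  proof (cases s)
    case (fields st acc rest)
    then show ?thesis
      by (auto simp: unpair_step_def sz_pair ser_bool sz_nat split: list.splits)
  qed
qed

text \<open>Integer square root by counting: if the length is \<open>n * n\<close>, exactly the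
  indices below \<open>n\<close> are counted. Other lengths are rejected by
  \<open>valid_matrix\<close>.\<close>

definition side :: "bool list \<Rightarrow> nat" where
  "side g = length (filter (\<lambda>i. i * i < length g) [0..<length g])"

definition gbit :: "nat \<Rightarrow> bool list \<Rightarrow> nat \<Rightarrow> nat \<Rightarrow> bool" where
  "gbit n g i j = nthd False g (i * n + j)"

definition valid_matrix :: "bool list \<Rightarrow> bool" where
  "valid_matrix g \<longleftrightarrow> (let n = side g in n * n = length g \<and> 0 < n \<and>
     list_all (\<lambda>i. \<not> gbit n g i i \<and> list_all (\<lambda>j. gbit n g i j \<longrightarrow> gbit n g j i) [0..<n]) [0..<n])"

definition matrix_graph :: "bool list \<Rightarrow> nat pair_pre_digraph" where
  "matrix_graph g = \<lparr>pverts = {0..<side g}, parcs = {(i, j). i < side g \<and> j < side g \<and> gbit (side g) g i j}\<rparr>"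

text \<open>The top bit has to be \<open>True\<close>, which excludes leading zeros; by the default
  \<open>False\<close> the empty string, the numeral of 0, is rejected too.\<close>

definition positive_code :: "bool list \<Rightarrow> bool" where
  "positive_code x \<longleftrightarrow> nthd False (rev x) 0"

definition valid_instance :: "bool list \<Rightarrow> bool" where
  "valid_instance z \<longleftrightarrow> (case unpair z of (s, g, r) \<Rightarrow> case unpair r of (t, x, y) \<Rightarrow>
     s \<and> t \<and> valid_matrix g \<and> positive_code x \<and> positive_code y)"

lemma pt_side [pt_intros]: "pt f \<Longrightarrow> pt (\<lambda>x. side (f x))"
proof (rule pt_comp[of side])
  show "pt side" unfolding side_def by (intro pt_intros)
qed

lemma pt_gbit [pt_intros]: "pt n \<Longrightarrow> pt f \<Longrightarrow> pt i \<Longrightarrow> pt j \<Longrightarrow> pt (\<lambda>x. gbit (n x) (f x) (i x) (j x))"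
  unfolding gbit_def by (intro pt_intros; assumption)

lemma pt_valid_matrix [pt_intros]: "pt f \<Longrightarrow> pt (\<lambda>x. valid_matrix (f x))"
proof (rule pt_comp[of valid_matrix])
  show "pt valid_matrix" unfolding valid_matrix_def by (intro pt_intros)
qed

lemma pt_valid_instance [pt_intros]: "pt f \<Longrightarrow> pt (\<lambda>x. valid_instance (f x))"
proof (rule pt_comp[of valid_instance])
  show "pt valid_instance" unfolding valid_instance_def positive_code_def by (intro pt_intros)
qed

lemma positive_code: "positive_code x \<longleftrightarrow> x \<noteq> [] \<and> last x"
  by (auto simp: positive_code_def nthd hd_rev[symmetric] hd_conv_nth)

lemma positive_code_bval: "positive_code x \<Longrightarrow> 0 < bval x \<and> binary (bval x) = x"
  using binary_bval[of x] by (cases "bval x = 0") (auto simp: positive_code binary.simps[of 0])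

lemma side_square:
  assumes "length g = n * n"
  shows "side g = n"
proof -
  have "side g = card {i. i < n * n \<and> i * i < n * n}"
    by (simp add: side_def length_filter_conv_card assms cong: conj_cong)
  also have "{i. i < n * n \<and> i * i < n * n} = {..<n}"
  proof -
    have "i * i < n * n \<longleftrightarrow> i < n" for i :: nat
      using mult_strict_mono[of i n i n] mult_le_mono[of n i n i] by (cases "i < n") auto
    moreover have "i < n * n" if "i < n" for i using that by (metis less_le_trans le_square)
    ultimately show ?thesis by auto
  qed
  finally show ?thesis by simp
qed

lemma length_graph_code: "length (graph_code G) = card (pverts G) * card (pverts G)"
  by (simp add: graph_code_def Let_def length_concat comp_def sum_list_triv)

lemma gbit_graph_code:
  assumes "i < card (pverts G)" "j < card (pverts G)"
  shows "gbit (card (pverts G)) (graph_code G) i j \<longleftrightarrow> (i, j) \<in> parcs G"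
proof -
  let ?n = "card (pverts G)"
  have "i * ?n + j < ?n * ?n"
    using assms by (metis add.commute add_less_cancel_left less_le_trans mult_Suc mult_le_mono1 Suc_leI)
  then show ?thesis using nth_concat_rows[OF assms, of "\<lambda>i j. (i, j) \<in> parcs G"]
    by (simp add: gbit_def nthd length_graph_code) (simp add: graph_code_def Let_def)
qed

lemma graph_code_eqI:
  assumes "length g = n * n" "card (pverts G) = n" "\<And>i j. i < n \<Longrightarrow> j < n \<Longrightarrow> (i, j) \<in> parcs G \<longleftrightarrow> gbit n g i j"
  shows "graph_code G = g"
proof (rule nth_equalityI)
  show "length (graph_code G) = length g" using assms by (simp add: length_graph_code)
  fix k assume "k < length (graph_code G)"
  then have k: "k < n * n" using assms by (simp add: length_graph_code)
  then have n: "0 < n" by (cases n) auto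
  have i: "k div n < n" "k mod n < n" using k n by (auto simp: less_mult_imp_div_less)
  have "graph_code G ! k = graph_code G ! (k div n * n + k mod n)" by simp
  also have "\<dots> = ((k div n, k mod n) \<in> parcs G)"
    using nth_concat_rows[OF i, of "\<lambda>i j. (i, j) \<in> parcs G"] assms(2) by (simp add: graph_code_def Let_def)
  also have "\<dots> = g ! k" using assms(1,3) i k by (simp add: gbit_def nthd)
  finally show "graph_code G ! k = g ! k" .
qed

lemma valid_matrix_graph:
  assumes "valid_matrix g"
  shows "simple_graph (matrix_graph g)" "graph_code (matrix_graph g) = g"
proof -
  have v: "side g * side g = length g" "0 < side g" "\<And>i. i < side g \<Longrightarrow> \<not> gbit (side g) g i i"
    "\<And>i j. i < side g \<Longrightarrow> j < side g \<Longrightarrow> gbit (side g) g i j \<Longrightarrow> gbit (side g) g j i"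
    using assms by (auto simp: valid_matrix_def Let_def list_all_iff)
  show "simple_graph (matrix_graph g)"
    using v(2,3) by (auto simp: simple_graph_iff matrix_graph_def intro: v(4))
  show "graph_code (matrix_graph g) = g"
    by (rule graph_code_eqI[of _ "side g"]) (use v(1) in \<open>auto simp: matrix_graph_def\<close>)
qed

lemma valid_graph_code:
  assumes G: "simple_graph G" and n: "pverts G = {0..<card (pverts G)}"
  shows "valid_matrix (graph_code G)"
proof -
  have s: "side (graph_code G) = card (pverts G)" by (rule side_square) (rule length_graph_code)
  have "0 < card (pverts G)" using G by (auto simp: simple_graph_iff card_gt_0_iff)
  then show ?thesis using G
    by (auto simp: valid_matrix_def Let_def list_all_iff s length_graph_code gbit_graph_code simple_graph_iff)
qed

lemma valid_instance_code:
  assumes "simple_graph G" "pverts G = {0..<card (pverts G)}" "0 < a" "0 < b"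
  shows "valid_instance (instance_code G a b)"
  using assms last_binary[of a] last_binary[of b]
  by (simp add: valid_instance_def instance_code_def unpair_pair_code valid_graph_code positive_code)

definition instance_matrix :: "bool list \<Rightarrow> bool list" where
  "instance_matrix z = fst (snd (unpair z))"

definition instance_num :: "bool list \<Rightarrow> bool list" where
  "instance_num z = fst (snd (unpair (snd (snd (unpair z)))))"

definition instance_den :: "bool list \<Rightarrow> bool list" where
  "instance_den z = snd (snd (unpair (snd (snd (unpair z)))))"

lemma valid_instance:
  assumes "valid_instance z"
  shows "valid_matrix (instance_matrix z)" "0 < bval (instance_num z)" "0 < bval (instance_den z)"
    "z = instance_code (matrix_graph (instance_matrix z)) (bval (instance_num z)) (bval (instance_den z))"
    "z = pair_code (instance_matrix z) (pair_code (instance_num z) (instance_den z))"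
proof -
  obtain g r x y where u: "unpair z = (True, g, r)" "unpair r = (True, x, y)" "valid_matrix g" "positive_code x" "positive_code y"
    using assms by (auto simp: valid_instance_def split: prod.splits)
  have p: "instance_matrix z = g" "instance_num z = x" "instance_den z = y"
    using u by (simp_all add: instance_matrix_def instance_num_def instance_den_def)
  have z: "z = pair_code g (pair_code x y)" using unpair_imp_pair_code[OF u(1)] unpair_imp_pair_code[OF u(2)] by simp
  show "z = pair_code (instance_matrix z) (pair_code (instance_num z) (instance_den z))" unfolding p by (rule z)
  show "valid_matrix (instance_matrix z)" "0 < bval (instance_num z)" "0 < bval (instance_den z)"
    using u positive_code_bval by (auto simp: p)
  show "z = instance_code (matrix_graph (instance_matrix z)) (bval (instance_num z)) (bval (instance_den z))"
    unfolding instance_code_def p valid_matrix_graph(2)[OF u(3)]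
      conjunct2[OF positive_code_bval[OF u(4)]] conjunct2[OF positive_code_bval[OF u(5)]] by (rule z)
qed

text \<open>Injectivity of the instance code lets the existential in the definition of the language
  be replaced by the decoded graph and fraction.\<close>

lemma spectral_degeneracy_problem_iff:
  "z \<in> spectral_degeneracy_problem \<longleftrightarrow> valid_instance z \<and>
     spectrally_degenerate (real (bval (instance_num z)) / real (bval (instance_den z))) (matrix_graph (instance_matrix z))"
proof
  assume "z \<in> spectral_degeneracy_problem"
  then obtain G a b where G: "z = instance_code G a b" "simple_graph G" "pverts G = {0..<card (pverts G)}" "0 < a" "0 < b"
    "spectrally_degenerate (real a / real b) G" by (auto simp: spectral_degeneracy_problem_def)
  have v: "valid_instance z" unfolding G(1) by (rule valid_instance_code) (use G in auto)
  note w = valid_instance[OF v]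
  have "G = matrix_graph (instance_matrix z) \<and> a = bval (instance_num z) \<and> b = bval (instance_den z)"
  proof (rule instance_code_inject)
    show "pverts (matrix_graph (instance_matrix z)) = {0..<card (pverts (matrix_graph (instance_matrix z)))}"
      by (simp add: matrix_graph_def)
  qed (use G w valid_matrix_graph in auto)
  then show "valid_instance z \<and>
     spectrally_degenerate (real (bval (instance_num z)) / real (bval (instance_den z))) (matrix_graph (instance_matrix z))"
    using v G by simp
next
  assume *: "valid_instance z \<and>
     spectrally_degenerate (real (bval (instance_num z)) / real (bval (instance_den z))) (matrix_graph (instance_matrix z))"
  note w = valid_instance[OF conjunct1[OF *]]
  have "pverts (matrix_graph (instance_matrix z)) = {0..<card (pverts (matrix_graph (instance_matrix z)))}"
    by (simp add: matrix_graph_def)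
  then show "z \<in> spectral_degeneracy_problem" unfolding spectral_degeneracy_problem_def
    using * w valid_matrix_graph(1)[OF w(1)] by blast
qed

section \<open>Certificates and the verifier\<close>

text \<open>A certificate is a list of bit lists: the rows of the edge set, then the entries of the vector.\<close>

definition decode_step :: "bool \<Rightarrow> nat \<times> bool list \<times> bool list list \<Rightarrow> nat \<times> bool list \<times> bool list list" where
  "decode_step c = (\<lambda>(p, cur, out). if p = 0 then (if c then (1, cur, out) else (2, cur, out))
     else if p = 1 then (0, c # cur, out) else (0, [], rev cur # out))"

definition decode :: "bool list \<Rightarrow> bool list list" where
  "decode u = rev (snd (snd (fold decode_step u (0, [], []))))"

text \<open>Pairs of bits: a leading \<open>True\<close> announces a data bit, a leading
  \<open>False\<close> closes the current list.\<close>

definition encode :: "bool list list \<Rightarrow> bool list" where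
  "encode L = concat (map (\<lambda>r. concat (map (\<lambda>b. [True, b]) r) @ [False, False]) L)"

lemma decode_encode: "decode (encode L) = L"
proof -
  have 1: "fold decode_step (concat (map (\<lambda>b. [True, b]) r)) (0, cur, out) = (0, rev r @ cur, out)" for r cur out
    by (induction r arbitrary: cur) (auto simp: decode_step_def)
  have "fold decode_step (encode L) (0, [], out) = (0, [], rev L @ out)" for out
    unfolding encode_def by (induction L arbitrary: out) (auto simp: 1 decode_step_def)
  then show ?thesis by (simp add: decode_def)
qed

lemma length_encode: "length (encode L) = sum_list (map (\<lambda>r. 2 * length r + 2) L)"
  by (induction L) (auto simp: encode_def length_concat comp_def sum_list_triv)

lemma sz_rev: "sz (rev xs) = sz xs"
proof (induction xs)
  case (Cons x xs)
  then show ?case using sz_append[of "rev xs" "[x]"] by simp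
qed simp

lemma pt_decode [pt_intros]: "pt f \<Longrightarrow> pt (\<lambda>x. decode (f x))"
  unfolding decode_def
proof (intro pt_intros pt_fold[where D = "\<lambda>x. 10"] pbd_rules)
  show "pt (\<lambda>q :: 'a \<times> _. decode_step (fst (snd q)) (snd (snd q)))" unfolding decode_step_def by (intro pt_intros)
  show "sz (decode_step e s) \<le> sz s + 10" for e s
  proof (cases s)
    case (fields p cur out)
    then show ?thesis
      by (auto simp: decode_step_def sz_pair ser_bool sz_nat sz_rev)
  qed
qed

definition bsum :: "bool list list \<Rightarrow> bool list" where
  "bsum l = fold badd l []"

lemma bval_bsum: "bval (bsum l) = sum_list (map bval l)"
proof -
  have "bval (fold badd l s) = sum_list (map bval l) + bval s" for s
    by (induction l arbitrary: s) (auto simp: badd)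
  then show ?thesis by (simp add: bsum_def)
qed

lemma pt_bsum [pt_intros]:
  assumes f: "pt f"
  shows "pt (\<lambda>x. bsum (f x))"
  unfolding bsum_def
proof (rule pt_fold_bounded[where B = "\<lambda>x. 4 * sz (f x) + 1"])
  show "pbd (\<lambda>x. 4 * sz (f x) + 1)" by (intro pbd_rules pt_pbd f)
  fix x i
  have len: "length (fold badd l s) \<le> length s + sz l" for l s
  proof (induction l arbitrary: s)
    case (Cons e l)
    show ?case using Cons[of "badd e s"] sz_bools_ge[of e] by (simp add: badd)
  qed simp
  have "sz (take i (f x)) \<le> sz (f x)" using sz_append[of "take i (f x)" "drop i (f x)"] sz_pos[of "drop i (f x)"] by simp
  then show "sz (fold badd (take i (f x)) []) \<le> 4 * sz (f x) + 1"
    using len[of "take i (f x)" "[]"] sz_bools[of "fold badd (take i (f x)) []"] by simp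
qed (intro pt_intros f)+

definition cbit :: "bool list list \<Rightarrow> nat \<Rightarrow> nat \<Rightarrow> bool" where
  "cbit L i j = nthd False (nthd [] L i) j"

definition cvec :: "nat \<Rightarrow> bool list list \<Rightarrow> nat \<Rightarrow> bool list" where
  "cvec n L i = nthd [] L (n + i)"

definition cert_norm :: "nat \<Rightarrow> bool list list \<Rightarrow> bool list" where
  "cert_norm n L = bsum (map (\<lambda>i. bmul (cvec n L i) (cvec n L i)) [0..<n])"

definition cert_image :: "nat \<Rightarrow> bool list list \<Rightarrow> bool list" where
  "cert_image n L = bsum (map (\<lambda>i. let s = bsum (map (cvec n L) (filter (cbit L i) [0..<n])) in bmul s s) [0..<n])"

definition check_certificate :: "bool list \<Rightarrow> bool list \<Rightarrow> bool list \<Rightarrow> bool list list \<Rightarrow> bool" where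
  "check_certificate g x y L \<longleftrightarrow> (let n = side g in
     list_all (\<lambda>i. list_all (\<lambda>j. cbit L i j \<longrightarrow> gbit n g i j \<and> cbit L j i) [0..<n]) [0..<n] \<and>
     list_all (\<lambda>i. bless (bmul (bmul x (bofnat (length (filter (cbit L i) [0..<n])))) (cert_norm n L))
       (bmul y (cert_image n L))) [0..<n])"

lemma pt_cert [pt_intros]:
  "pt f \<Longrightarrow> pt i \<Longrightarrow> pt j \<Longrightarrow> pt (\<lambda>x. cbit (f x) (i x) (j x))"
  "pt n \<Longrightarrow> pt f \<Longrightarrow> pt i \<Longrightarrow> pt (\<lambda>x. cvec (n x) (f x) (i x))"
  unfolding cbit_def cvec_def by (intro pt_intros; assumption)+

lemma pt_cert2 [pt_intros]:
  "pt n \<Longrightarrow> pt f \<Longrightarrow> pt (\<lambda>x. cert_norm (n x) (f x))"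
  "pt n \<Longrightarrow> pt f \<Longrightarrow> pt (\<lambda>x. cert_image (n x) (f x))"
proof -
  have 1: "pt (\<lambda>p. cert_norm (fst p) (snd p))" unfolding cert_norm_def by (intro pt_intros)
  have 2: "pt (\<lambda>p. cert_image (fst p) (snd p))" unfolding cert_image_def by (intro pt_intros)
  show "pt n \<Longrightarrow> pt f \<Longrightarrow> pt (\<lambda>x. cert_norm (n x) (f x))" by (rule pt_comp2[OF 1])
  show "pt n \<Longrightarrow> pt f \<Longrightarrow> pt (\<lambda>x. cert_image (n x) (f x))" by (rule pt_comp2[OF 2])
qed

lemma sum_list_upt: "sum_list (map f [0..<n]) = (\<Sum>i\<in>{0..<n}. f i)"
  by (simp add: interv_sum_list_conv_sum_set_nat)

lemma sum_list_filter_upt: "sum_list (map f (filter P [0..<n])) = (\<Sum>i | i < n \<and> P i. f i)"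
  by (subst sum_list_distinct_conv_sum_set) (auto intro: sum.cong)

lemma check_certificate:
  fixes L :: "bool list list"
  assumes g: "valid_matrix g"
  defines "n \<equiv> side g" and "E \<equiv> {(i, j). i < side g \<and> j < side g \<and> cbit L i j}" and "v \<equiv> \<lambda>i. bval (cvec (side g) L i)"
  shows "check_certificate g x y L \<longleftrightarrow> E \<subseteq> parcs (matrix_graph g) \<and> (\<forall>i j. (i, j) \<in> E \<longrightarrow> (j, i) \<in> E) \<and>
    (\<forall>w\<in>pverts (matrix_graph g). bval x * degree_in E w * (\<Sum>i\<in>pverts (matrix_graph g). (v i)\<^sup>2) <
       bval y * (\<Sum>i\<in>pverts (matrix_graph g). (\<Sum>j | (i, j) \<in> E. v j)\<^sup>2))"
proof -
  have E: "{j. (i, j) \<in> E} = {j. j < n \<and> cbit L i j}" if "i < n" for i using that by (auto simp: E_def n_def)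
  have 1: "bval (cert_norm n L) = (\<Sum>i\<in>{0..<n}. (v i)\<^sup>2)"
    by (simp add: cert_norm_def bval_bsum comp_def bval_bmul sum_list_upt v_def n_def power2_eq_square)
  have 2: "bval (cert_image n L) = (\<Sum>i\<in>{0..<n}. (\<Sum>j | (i, j) \<in> E. v j)\<^sup>2)"
    by (simp add: cert_image_def Let_def bval_bsum comp_def bval_bmul sum_list_upt sum_list_filter_upt E power2_eq_square v_def n_def[symmetric])
  have 3: "length (filter (cbit L i) [0..<n]) = degree_in E i" if "i < n" for i
    unfolding degree_in_def E[OF that] length_filter_conv_card by (rule arg_cong[of _ _ card]) auto
  have 4: "pverts (matrix_graph g) = {0..<n}" by (simp add: matrix_graph_def n_def)
  have 5: "list_all (\<lambda>i. list_all (\<lambda>j. cbit L i j \<longrightarrow> gbit n g i j \<and> cbit L j i) [0..<n]) [0..<n] \<longleftrightarrow>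
    E \<subseteq> parcs (matrix_graph g) \<and> (\<forall>i j. (i, j) \<in> E \<longrightarrow> (j, i) \<in> E)"
    by (auto simp: list_all_iff E_def matrix_graph_def n_def subset_iff)
  show ?thesis unfolding check_certificate_def Let_def n_def[symmetric] 5 4
    by (auto simp: list_all_iff bless bval_bmul bval_bofnat 1 2 3)
qed

text \<open>Strings that encode no instance belong to the complement of the language, so they are
  accepted with every certificate.\<close>

definition verifier :: "bool list \<Rightarrow> bool" where
  "verifier z \<longleftrightarrow> (case unpair z of (s, x, u) \<Rightarrow> s \<and> (valid_instance x \<longrightarrow>
     check_certificate (instance_matrix x) (instance_num x) (instance_den x) (decode u)))"

lemma pt_verifier: "pt verifier"
proof -
  have 1: "pt (\<lambda>p. check_certificate (fst p) (fst (snd p)) (fst (snd (snd p))) (snd (snd (snd p))))"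
    unfolding check_certificate_def by (intro pt_intros)
  have 2: "pt (\<lambda>x. instance_matrix (f x))" "pt (\<lambda>x. instance_num (f x))" "pt (\<lambda>x. instance_den (f x))" if "pt f" for f :: "'a::enc \<Rightarrow> _"
    unfolding instance_matrix_def instance_num_def instance_den_def by (intro pt_intros that)+
  have 3: "pt (\<lambda>x. check_certificate (e x) (f x) (g x) (h x))" if "pt e" "pt f" "pt g" "pt h" for e f g and h :: "'a::enc \<Rightarrow> _"
    using pt_comp[OF 1 pt_pair[OF that(1) pt_pair[OF that(2) pt_pair[OF that(3,4)]]]] by simp
  show ?thesis unfolding verifier_def by (intro pt_intros 2 3)
qed

lemma length_binary_le: "n < 2 ^ m \<Longrightarrow> length (binary n) \<le> m"
proof (induction m arbitrary: n)
  case 0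
  then show ?case by (simp add: binary.simps[of 0])
next
  case (Suc m)
  then have "length (binary (n div 2)) \<le> m" by auto
  then show ?case by (subst binary.simps) auto
qed

lemma less_two_power: "(n::nat) < 2 ^ n"
  by simp

text \<open>With \<open>l\<close> the length of the input, an entry of the vector has quadratically
  many bits, although the bound itself is exponential.\<close>

lemma certificate_bound_less:
  assumes "a < 2 ^ l" "b < 2 ^ l" "N \<le> l" "1 \<le> l"
  shows "certificate_bound a b N < 2 ^ (4 * l * l + 4 * l + 2)"
proof -
  have N: "N \<le> 2 ^ l" using assms(3) less_two_power[of l] by linarith
  have B: "b * N ^ 2 + a * N \<le> 2 ^ (4 * l)"
  proof -
    have "b * N ^ 2 + a * N \<le> 2 ^ l * (2 ^ l) ^ 2 + 2 ^ l * 2 ^ l"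
      using assms N by (intro add_mono mult_mono power_mono) auto
    also have "\<dots> = 2 ^ (3 * l) + 2 ^ (2 * l)" by (simp add: power_add[symmetric] power_mult[symmetric] algebra_simps)
    also have "\<dots> \<le> 2 ^ (3 * l) + 2 ^ (3 * l)" by (intro add_left_mono power_increasing) auto
    also have "\<dots> = 2 ^ (3 * l + 1)" by simp
    also have "\<dots> \<le> 2 ^ (4 * l)" using assms(4) by (intro power_increasing) auto
    finally show ?thesis .
  qed
  have "(b * N ^ 2 + a * N) ^ N \<le> (2 ^ (4 * l)) ^ N" by (intro power_mono B) auto
  also have "\<dots> \<le> (2 ^ (4 * l)) ^ l" using assms(3) by (intro power_increasing) auto
  finally have "2 * b * N ^ 3 * (b * N ^ 2 + a * N) ^ N \<le> 2 * 2 ^ l * (2 ^ l) ^ 3 * (2 ^ (4 * l)) ^ l"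
    using assms N by (intro mult_mono power_mono) auto
  also have "\<dots> = 2 ^ (1 + l + l * 3 + 4 * l * l)" by (simp only: power_add power_mult power_one_right)
  also have "1 + l + l * 3 + 4 * l * l = 4 * l * l + 4 * l + 1" by simp
  finally have "certificate_bound a b N \<le> 2 ^ (4 * l * l + 4 * l + 1) + 1" by (simp add: certificate_bound_def)
  also have "\<dots> < 2 ^ (4 * l * l + 4 * l + 1) + 2 ^ (4 * l * l + 4 * l + 1)"
    by (intro add_strict_left_mono one_less_power) auto
  finally show ?thesis by simp
qed

lemma length_pair_code: "length (pair_code x y) = 2 * length x + 2 + length y"
  by (simp add: pair_code_def length_concat comp_def sum_list_triv)

theorem spectral_degeneracy_in_coNP: "spectral_degeneracy_problem \<in> class_coNP"
proof -
  define R where "R = {z. verifier z}"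
  have "pt (\<lambda>z. [verifier z])" by (intro pt_intros pt_verifier)
  then have R: "R \<in> class_P" unfolding class_P_def R_def using pt_polynomial_time by auto
  \<comment> \<open>The code of the edge rows has length at most \<open>l * (2 * l + 2)\<close> and
    that of the numerals at most \<open>l * (2 * (4 * l * l + 4 * l + 2) + 2)\<close>; this is their
    sum.\<close>
  define p :: "nat poly" where "p = [:0, 8, 10, 8:]"
  have "z \<in> - spectral_degeneracy_problem \<longleftrightarrow> (\<exists>u. length u \<le> poly p (length z) \<and> pair_code z u \<in> R)" for z
  proof (cases "valid_instance z")
    case False
    then show ?thesis by (auto simp: spectral_degeneracy_problem_iff R_def verifier_def unpair_pair_code intro!: exI[of _ "[]"])
  next
    case True
    define g x y G n where "g = instance_matrix z" and "x = instance_num z" and "y = instance_den z"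
      and "G = matrix_graph g" and "n = side g"
    note w = valid_instance[OF True, folded g_def x_def y_def, folded G_def]
    have G: "simple_graph G" unfolding G_def by (rule valid_matrix_graph[OF w(1)])
    have V: "pverts G = {0..<n}" by (simp add: G_def n_def matrix_graph_def)
    have mem: "pair_code z u \<in> R \<longleftrightarrow> check_certificate g x y (decode u)" for u
      using True by (simp add: R_def verifier_def unpair_pair_code g_def x_def y_def)
    have sd: "z \<in> - spectral_degeneracy_problem \<longleftrightarrow> \<not> spectrally_degenerate (real (bval x) / real (bval y)) G"
      using True by (simp add: spectral_degeneracy_problem_iff g_def x_def y_def G_def)
    show ?thesis
    proof
      assume "z \<in> - spectral_degeneracy_problem"
      then have "\<not> spectrally_degenerate (real (bval x) / real (bval y)) G" by (rule iffD1[OF sd])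
      from spectral_certificate[OF G w(2,3) this] obtain E v where E: "E \<subseteq> parcs G" "\<And>u v. (u, v) \<in> E \<Longrightarrow> (v, u) \<in> E"
        and v: "\<And>u. v u \<le> certificate_bound (bval x) (bval y) (card (pverts G))"
        and s: "\<forall>w\<in>pverts G. bval x * degree_in E w * (\<Sum>i\<in>pverts G. (v i)\<^sup>2) < bval y * (\<Sum>i\<in>pverts G. (\<Sum>j | (i, j) \<in> E. v j)\<^sup>2)"
        by blast
      have E': "i < n \<and> j < n" if "(i, j) \<in> E" for i j
        using that E(1) by (auto simp: G_def matrix_graph_def n_def)
      define L where "L = map (\<lambda>i. map (\<lambda>j. (i, j) \<in> E) [0..<n]) [0..<n] @ map (\<lambda>i. binary (v i)) [0..<n]"
      have c: "cbit L i j \<longleftrightarrow> (i, j) \<in> E" if "i < n" "j < n" for i j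
        using that by (simp add: cbit_def nthd L_def nth_append)
      have cv: "bval (cvec n L i) = v i" if "i < n" for i
        using that by (simp add: cvec_def nthd L_def nth_append bval_binary)
      have EL: "{(i, j). i < n \<and> j < n \<and> cbit L i j} = E" using c E' by auto
      have "check_certificate g x y L"
        unfolding check_certificate[OF w(1)] G_def[symmetric] n_def[symmetric] EL
      proof (intro conjI allI impI)
        have "(\<Sum>i\<in>pverts G. (bval (cvec n L i))\<^sup>2) = (\<Sum>i\<in>pverts G. (v i)\<^sup>2)" by (intro sum.cong) (auto simp: V cv)
        moreover have "(\<Sum>j | (i, j) \<in> E. bval (cvec n L j)) = (\<Sum>j | (i, j) \<in> E. v j)" for i
          by (intro sum.cong) (auto simp: cv dest: E')
        ultimately show "\<forall>w\<in>pverts G. bval x * degree_in E w * (\<Sum>i\<in>pverts G. (bval (cvec n L i))\<^sup>2) <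
           bval y * (\<Sum>i\<in>pverts G. (\<Sum>j | (i, j) \<in> E. bval (cvec n L j))\<^sup>2)" using s by simp
      qed (use E in auto)
      then have "pair_code z (encode L) \<in> R" by (simp add: mem decode_encode)
      moreover have "length (encode L) \<le> poly p (length z)"
      proof -
        define l where "l = length z"
        have "n * n = length g" using w(1) by (simp add: valid_matrix_def Let_def n_def)
        then have lz: "n * n + length x + length y < l" using arg_cong[OF w(5), of length] by (simp add: length_pair_code l_def)
        have nl: "n \<le> l" using lz le_square[of n] by linarith
        have "bval x < 2 ^ l" using bval_less[of x] lz by (meson less_le_trans power_increasing one_le_numeral add_leD1 add_leD2 less_imp_le)
        moreover have "bval y < 2 ^ l" using bval_less[of y] lz by (meson less_le_trans power_increasing one_le_numeral add_leD2 less_imp_le)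
        ultimately have "certificate_bound (bval x) (bval y) n < 2 ^ (4 * l * l + 4 * l + 2)"
          using nl lz by (intro certificate_bound_less) auto
        then have lv: "length (binary (v i)) \<le> 4 * l * l + 4 * l + 2" for i
          using v[of i] by (intro length_binary_le) (simp add: V)
        have "length (encode L) \<le> (\<Sum>i\<in>{0..<n}. 2 * n + 2) + (\<Sum>i\<in>{0..<n}. 2 * (4 * l * l + 4 * l + 2) + 2)"
          unfolding length_encode L_def map_append sum_list_append map_map comp_def sum_list_upt
          by (intro add_mono sum_mono mult_le_mono order.refl lv) auto
        also have "\<dots> \<le> l * (2 * l + 2) + l * (2 * (4 * l * l + 4 * l + 2) + 2)"
          using nl by (simp only: sum_constant card_atLeastLessThan) (intro add_mono mult_le_mono; simp)
        also have "\<dots> = poly p l" by (simp add: p_def algebra_simps)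
        finally show ?thesis by (simp add: l_def)
      qed
      ultimately show "\<exists>u. length u \<le> poly p (length z) \<and> pair_code z u \<in> R" by blast
    next
      assume "\<exists>u. length u \<le> poly p (length z) \<and> pair_code z u \<in> R"
      then obtain u where "check_certificate g x y (decode u)" using mem by blast
      note c = this[unfolded check_certificate[OF w(1)] G_def[symmetric]]
      have "\<not> spectrally_degenerate (real (bval x) / real (bval y)) G"
        by (rule certificate_sound[OF G w(2,3) conjunct1[OF c] _ bspec[OF conjunct2[OF conjunct2[OF c]]]])
          (use conjunct1[OF conjunct2[OF c]] in simp_all)
      then show "z \<in> - spectral_degeneracy_problem" by (rule iffD2[OF sd])
    qed
  qed
  then have "- spectral_degeneracy_problem \<in> class_NP" unfolding class_NP_def using R by blast
  then show ?thesis by (simp add: class_coNP_def)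
qed

section \<open>Biregular subgraphs of bipartite graphs\<close>

text \<open>Compare both sides of the eigenvector equation at an entry of maximal absolute
  value.\<close>

lemma eigenvalue_le_max_degree:
  fixes x :: "'v \<Rightarrow> real"
  assumes W: "finite W" "W \<noteq> {}" and E: "E \<subseteq> W \<times> W" and deg: "\<And>v. v \<in> W \<Longrightarrow> degree_in E v \<le> D"
    and x: "\<exists>v\<in>W. x v \<noteq> 0" "\<And>v. v \<in> W \<Longrightarrow> (\<Sum>u | (v, u) \<in> E. x u) = r * x v" and r: "0 \<le> r"
  shows "r \<le> D"
proof -
  obtain t where t: "t \<in> W" "\<And>u. u \<in> W \<Longrightarrow> \<bar>x u\<bar> \<le> \<bar>x t\<bar>" using finite_argmax[OF W, of "\<lambda>u. \<bar>x u\<bar>"] by blast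
  have xt: "\<bar>x t\<bar> > 0" using x(1) t(2) by (smt (verit) abs_eq_0)
  have "r * \<bar>x t\<bar> = \<bar>\<Sum>u | (t, u) \<in> E. x u\<bar>" using x(2)[OF t(1)] r by (simp add: abs_mult)
  also have "\<dots> \<le> (\<Sum>u | (t, u) \<in> E. \<bar>x u\<bar>)" by (rule sum_abs)
  also have "\<dots> \<le> (\<Sum>u | (t, u) \<in> E. \<bar>x t\<bar>)" using E t by (intro sum_mono) auto
  also have "\<dots> = degree_in E t * \<bar>x t\<bar>" by (simp add: degree_in_def)
  also have "\<dots> \<le> D * \<bar>x t\<bar>" using deg[OF t(1)] by (intro mult_right_mono) auto
  finally show ?thesis using xt by simp
qed

text \<open>
  Weighting the two sides by \<open>sqrt k\<close> and \<open>sqrt D\<close> turns the eigenvector equation into a mean value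
  property, so that for the extremal eigenvalue \<open>sqrt (k D)\<close> the vertices where the weighted vector
  is maximal form a union of biregular components.
\<close>

lemma bipartite_eigenvalue:
  fixes x :: "'v \<Rightarrow> real" and k D :: nat
  assumes W: "finite W" "W \<noteq> {}" and E: "E \<subseteq> W \<times> W" and bip: "\<And>u v. (u, v) \<in> E \<Longrightarrow> u \<in> A \<longleftrightarrow> v \<notin> A"
    and degA: "\<And>v. v \<in> W \<Longrightarrow> v \<in> A \<Longrightarrow> degree_in E v \<le> k" and degB: "\<And>v. v \<in> W \<Longrightarrow> degree_in E v \<le> D"
    and x: "\<exists>v\<in>W. x v \<noteq> 0" "\<And>v. v \<in> W \<Longrightarrow> (\<Sum>u | (v, u) \<in> E. x u) = r * x v" and r: "0 \<le> r"
    and kD: "0 < k" "0 < D"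
  shows "r\<^sup>2 \<le> k * D"
    and "r\<^sup>2 = k * D \<Longrightarrow> \<exists>S. S \<noteq> {} \<and> S \<subseteq> W \<and> (\<forall>v\<in>S. (\<forall>u. (v, u) \<in> E \<longrightarrow> u \<in> S) \<and>
      degree_in E v = (if v \<in> A then k else D))"
proof -
  define p q where "p = (\<lambda>v. if v \<in> A then sqrt k else sqrt D)" and "q = (\<lambda>v. if v \<in> A then sqrt D else sqrt k)"
  define y where "y = (\<lambda>v. x v / p v)"
  have pq: "0 < p v" "0 < q v" "p v * q v = sqrt (k * D)" "(p v)\<^sup>2 = (if v \<in> A then k else D)" for v
    using kD by (auto simp: p_def q_def real_sqrt_mult)
  have xy: "x v = p v * y v" for v using pq(1)[of v] by (simp add: y_def)
  have deg: "real (degree_in E v) \<le> (p v)\<^sup>2" if "v \<in> W" for v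
    using degA[OF that] degB[OF that] by (simp add: pq(4))
  have eq: "q v * (\<Sum>u | (v, u) \<in> E. y u) = r * p v * y v" if "v \<in> W" for v
  proof -
    have "(\<Sum>u | (v, u) \<in> E. x u) = (\<Sum>u | (v, u) \<in> E. q v * y u)"
      using bip by (intro sum.cong) (auto simp: xy p_def q_def)
    then show ?thesis using x(2)[OF that] by (simp add: sum_distrib_left xy)
  qed
  obtain t where t: "t \<in> W" "\<And>u. u \<in> W \<Longrightarrow> \<bar>y u\<bar> \<le> \<bar>y t\<bar>" using finite_argmax[OF W, of "\<lambda>u. \<bar>y u\<bar>"] by blast
  obtain a where a: "a \<in> W" "x a \<noteq> 0" using x(1) by blast
  then have yt: "\<bar>y t\<bar> > 0" using t(2)[OF a(1)] xy[of a] by auto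
  have "r * p t * \<bar>y t\<bar> = q t * \<bar>\<Sum>u | (t, u) \<in> E. y u\<bar>"
    using arg_cong[OF eq[OF t(1)], of abs] r pq(1,2)[of t] by (simp add: abs_mult)
  also have "\<dots> \<le> q t * (\<Sum>u | (t, u) \<in> E. \<bar>y t\<bar>)"
    using pq(2)[of t] E t by (intro mult_left_mono order_trans[OF sum_abs] sum_mono) auto
  also have "\<dots> = q t * (degree_in E t * \<bar>y t\<bar>)" by (simp add: degree_in_def)
  also have "\<dots> \<le> q t * ((p t)\<^sup>2 * \<bar>y t\<bar>)"
    using pq(2)[of t] deg[OF t(1)] by (intro mult_left_mono mult_right_mono) auto
  finally have "(r * p t) * \<bar>y t\<bar> \<le> (q t * (p t)\<^sup>2) * \<bar>y t\<bar>" by (simp add: mult.assoc)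
  then have "r * p t \<le> q t * (p t)\<^sup>2" using yt by (simp add: mult_le_cancel_right)
  then have "r * p t \<le> sqrt (k * D) * p t" using pq(3)[of t] by (simp add: power2_eq_square mult.commute mult.left_commute)
  then have le: "r \<le> sqrt (k * D)" using pq(1)[of t] by (simp add: mult_le_cancel_right)
  then have "r\<^sup>2 \<le> (sqrt (k * D))\<^sup>2" using r by (intro power_mono) auto
  then show "r\<^sup>2 \<le> k * D" by simp
  assume "r\<^sup>2 = k * D"
  then have rkD: "r = sqrt (k * D)" using r by (simp add: real_sqrt_unique)
  have mean: "(\<Sum>u | (v, u) \<in> E. y u) = (p v)\<^sup>2 * y v" if "v \<in> W" for v
  proof -
    have "q v * (\<Sum>u | (v, u) \<in> E. y u) = q v * ((p v)\<^sup>2 * y v)"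
      using eq[OF that] unfolding rkD pq(3)[of v, symmetric] by (simp add: power2_eq_square mult.assoc mult.left_commute)
    then show ?thesis using pq(2)[of v] by simp
  qed
  define z where "z = (\<lambda>v. sgn (y t) * y v)"
  have z: "z v \<le> \<bar>y t\<bar>" if "v \<in> W" for v using t(2)[OF that] unfolding z_def by (smt (verit) mult_minus_left mult_cancel_right1 sgn_real_def)
  have zt: "z t = \<bar>y t\<bar>" by (simp add: z_def abs_sgn mult.commute)
  have zmean: "(\<Sum>u | (v, u) \<in> E. z u) = (p v)\<^sup>2 * z v" if "v \<in> W" for v
    using mean[OF that] unfolding z_def sum_distrib_left[symmetric] by simp
  define S where "S = {v \<in> W. z v = \<bar>y t\<bar>}"
  have main: "(\<forall>u. (v, u) \<in> E \<longrightarrow> u \<in> S) \<and> degree_in E v = (if v \<in> A then k else D)" if "v \<in> S" for v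
  proof -
    have v: "v \<in> W" "z v = \<bar>y t\<bar>" using that by (auto simp: S_def)
    have fin: "finite {u. (v, u) \<in> E}" by (rule finite_subset[OF _ W(1)]) (use E in auto)
    \<comment> \<open>The deficits of the neighbours are nonnegative, but their sum is at most 0
      because the degree is at most \<open>(p v)\<^sup>2\<close>. So all deficits vanish and the
      degree is extremal.\<close>
    have s: "(\<Sum>u | (v, u) \<in> E. \<bar>y t\<bar> - z u) = degree_in E v * \<bar>y t\<bar> - (p v)\<^sup>2 * \<bar>y t\<bar>"
      using zmean[OF v(1)] by (simp add: sum_subtractf degree_in_def v(2))
    have nn: "0 \<le> \<bar>y t\<bar> - z u" if "u \<in> {u. (v, u) \<in> E}" for u using that E z by auto
    have "0 \<le> degree_in E v * \<bar>y t\<bar> - (p v)\<^sup>2 * \<bar>y t\<bar>" unfolding s[symmetric] by (intro sum_nonneg nn)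
    then have "(p v)\<^sup>2 * \<bar>y t\<bar> \<le> degree_in E v * \<bar>y t\<bar>" by simp
    then have "(p v)\<^sup>2 \<le> degree_in E v" using yt by (simp add: mult_le_cancel_right)
    then have d: "real (degree_in E v) = (p v)\<^sup>2" using deg[OF v(1)] by simp
    then have "(\<Sum>u | (v, u) \<in> E. \<bar>y t\<bar> - z u) = 0" using s by simp
    then have "\<forall>u\<in>{u. (v, u) \<in> E}. \<bar>y t\<bar> - z u = 0" 
      using sum_nonneg_eq_0_iff[OF fin, of "\<lambda>u. \<bar>y t\<bar> - z u"] nn by blast
    moreover have "degree_in E v = (if v \<in> A then k else D)" using d unfolding pq(4) by simp
    ultimately show ?thesis using E by (auto simp: S_def)
  qed
  have tS: "t \<in> S" using t zt by (simp add: S_def)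
  show "\<exists>S. S \<noteq> {} \<and> S \<subseteq> W \<and> (\<forall>v\<in>S. (\<forall>u. (v, u) \<in> E \<longrightarrow> u \<in> S) \<and> degree_in E v = (if v \<in> A then k else D))"
  proof (intro exI[of _ S] conjI[rotated])
    show "\<forall>v\<in>S. (\<forall>u. (v, u) \<in> E \<longrightarrow> u \<in> S) \<and> degree_in E v = (if v \<in> A then k else D)" using main by blast
    show "S \<subseteq> W" unfolding S_def by blast
    show "S \<noteq> {}" using tS by blast
  qed
qed

text \<open>
  The threshold \<open>k - 1 / b\<close> is so close to \<open>k\<close> that \<open>\<rho>\<^sup>2 > (k - 1 / b) \<Delta>\<close> forces \<open>\<rho>\<^sup>2 = k \<Delta>\<close>,
  by the eigenvalue gap for integer matrices.
\<close>

lemma biregular_of_violation: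
  fixes G :: "'v :: linorder pair_pre_digraph" and k b :: nat
  assumes G: "simple_graph G" and bip: "\<And>u v. (u, v) \<in> parcs G \<Longrightarrow> u \<in> A \<longleftrightarrow> v \<notin> A"
    and degA: "\<And>v. v \<in> pverts G \<Longrightarrow> v \<in> A \<Longrightarrow> degree_in (parcs G) v \<le> k" and k: "0 < k"
    and b: "0 < b" "card (pverts G) * (card (pverts G) ^ 2 + k * card (pverts G)) ^ card (pverts G) \<le> b"
    and nd: "\<not> spectrally_degenerate (real (k * b - 1) / real b) G"
  shows "\<exists>S E D. S \<noteq> {} \<and> S \<subseteq> pverts G \<and> E \<subseteq> parcs G \<and> (\<forall>u v. (u, v) \<in> E \<longrightarrow> (v, u) \<in> E) \<and> k \<le> D \<and>
    (\<forall>v\<in>S. (\<forall>u. (v, u) \<in> E \<longrightarrow> u \<in> S) \<and> degree_in E v = (if v \<in> A then k else D))"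
proof -
  obtain H where H: "simple_graph H" "subgraph (with_proj H) (with_proj G)"
    "graph_spectral_radius H > sqrt (real (k * b - 1) / real b * real (max_degree H))"
    using nd unfolding spectrally_degenerate_def by (auto simp: not_le)
  define r D N n where "r = graph_spectral_radius H" and "D = max_degree H" and "N = card (pverts G)" and "n = card (pverts H)"
  have sub: "pverts H \<subseteq> pverts G" "parcs H \<subseteq> parcs G" using H(2) subgraph_iff[OF H(1) G] by auto
  have fG: "finite (pverts G)" and EG: "parcs G \<subseteq> pverts G \<times> pverts G" using G by (auto simp: simple_graph_iff)
  have W: "finite (pverts H)" "pverts H \<noteq> {}" and E: "parcs H \<subseteq> pverts H \<times> pverts H"
    and sym: "\<And>u v. (u, v) \<in> parcs H \<Longrightarrow> (v, u) \<in> parcs H" using H(1) by (auto simp: simple_graph_iff)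
  have nN: "n \<le> N" unfolding n_def N_def using sub(1) fG by (rule card_mono[rotated])
  have n1: "1 \<le> n" using W by (simp add: n_def Suc_le_eq card_gt_0_iff)
  have Dn: "D \<le> n" using max_degree(2)[OF H(1)] degree_in_le[OF W(1) E] unfolding D_def n_def by metis
  have r0: "0 \<le> r" unfolding r_def by (rule graph_spectral_radius(1)[OF H(1)])
  obtain x where x: "\<exists>v\<in>pverts H. x v \<noteq> 0" "\<And>v. v \<in> pverts H \<Longrightarrow> (\<Sum>u | (v, u) \<in> parcs H. x u) = r * x v"
    using graph_spectral_radius(2)[OF H(1)] unfolding r_def by blast
  have dB: "degree_in (parcs H) v \<le> D" if "v \<in> pverts H" for v using max_degree(1)[OF H(1) that] by (simp add: D_def)
  have dA: "degree_in (parcs H) v \<le> k" if "v \<in> pverts H" "v \<in> A" for v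
  proof -
    have "finite {u. (v, u) \<in> parcs G}" by (rule finite_subset[OF _ fG]) (use EG in auto)
    then have "degree_in (parcs H) v \<le> degree_in (parcs G) v" unfolding degree_in_def using sub(2) by (intro card_mono) auto
    then show ?thesis using degA[of v] that sub(1) by fastforce
  qed
  have lower: "real (k * b - 1) / real b * real D < r\<^sup>2"
  proof -
    have "(sqrt (real (k * b - 1) / real b * real D))\<^sup>2 < r\<^sup>2" using H(3) unfolding r_def D_def
      by (intro power_strict_mono) auto
    then show ?thesis by simp
  qed
  have kb: "real (k * b - 1) / real b = k - 1 / b" using k b(1) by (simp add: of_nat_diff Suc_le_eq field_simps)
  have rD: "k * D - D / b < r\<^sup>2" using lower unfolding kb by (simp add: left_diff_distrib)
  have rle: "r \<le> D" by (rule eigenvalue_le_max_degree[OF W E dB x r0])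
  have D0: "0 < D"
  proof (rule ccontr)
    assume "\<not> 0 < D"
    then have "r = 0" using rle r0 by simp
    then show False using rD \<open>\<not> 0 < D\<close> by simp
  qed
  \<comment> \<open>If \<open>D < k\<close>, then \<open>D \<le> k - 1 / b\<close>, and the trivial
    bound \<open>r \<le> D\<close> already gives \<open>r\<^sup>2 \<le> (k - 1 / b) D\<close>, so
    there is no violation.\<close>
  have kD: "k \<le> D"
  proof (rule ccontr)
    assume "\<not> k \<le> D"
    then have "real D + 1 \<le> k" by linarith
    moreover have "1 / real b \<le> 1" using b(1) by simp
    ultimately have "real D \<le> k - 1 / b" by linarith
    then have "real D * D \<le> (k - 1 / b) * D" by (intro mult_right_mono) auto
    moreover have "r\<^sup>2 \<le> real D * D" using power_mono[OF rle r0, of 2] by (simp add: power2_eq_square)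
    ultimately show False using rD by (simp add: algebra_simps)
  qed
  note bip' = bip[OF subsetD[OF sub(2)]]
  have ev1: "r\<^sup>2 \<le> k * D" by (rule bipartite_eigenvalue(1)[OF W E bip' dA dB x r0 k D0])
  have ev2: "\<exists>S. S \<noteq> {} \<and> S \<subseteq> pverts H \<and> (\<forall>v\<in>S. (\<forall>u. (v, u) \<in> parcs H \<longrightarrow> u \<in> S) \<and>
      degree_in (parcs H) v = (if v \<in> A then k else D))" if "r\<^sup>2 = k * D"
    by (rule bipartite_eigenvalue(2)[OF W E bip' dA dB x r0 k D0 that])
  have "r\<^sup>2 = k * D"
  proof (rule ccontr)
    assume ne: "r\<^sup>2 \<noteq> k * D"
    \<comment> \<open>Otherwise \<open>k D - r\<^sup>2\<close> is at least \<open>B ^ (- N)\<close>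
      by the gap for \<open>A^2 - k D I\<close>, but less than \<open>D / b\<close> by the
      violation; the choice of \<open>b\<close> excludes this.\<close>
    define B where "B = real (N ^ 2 + k * N)"
    have N1: "1 \<le> N" using nN n1 by simp
    then have "1 \<le> N ^ 2 + k * N" by (simp add: Suc_le_eq)
    then have B1: "1 \<le> B" unfolding B_def by (metis of_nat_1 of_nat_mono)
    have "n ^ 2 + k * D \<le> N ^ 2 + k * N" using nN Dn by (intro add_mono power_mono mult_left_mono) auto
    then have "real (n ^ 2 + k * D) \<le> B" unfolding B_def by (rule of_nat_mono)
    then have "1 \<le> \<bar>(1::nat) * r\<^sup>2 - (k * D :: nat)\<bar> * B ^ card (pverts H)"
      using ne B1 by (intro square_kernel_gap[OF W(1) E x]) (auto simp: n_def)
    also have "\<dots> \<le> (k * D - r\<^sup>2) * B ^ N"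
      using ev1 B1 nN by (auto intro!: mult_mono power_increasing simp: n_def)
    also have "\<dots> < (D / b) * B ^ N" using rD B1 by (intro mult_strict_right_mono) auto
    also have "\<dots> \<le> (N / b) * B ^ N" using Dn nN B1 by (intro mult_right_mono divide_right_mono) auto
    also have "\<dots> = real (N * (N ^ 2 + k * N) ^ N) / b" by (simp add: B_def)
    also have "\<dots> \<le> real b / b" using b(2) unfolding N_def[symmetric] by (intro divide_right_mono) (auto simp del: of_nat_mult of_nat_power of_nat_add)
    also have "\<dots> = 1" using b(1) by simp
    finally show False by simp
  qed
  from ev2[OF this] obtain S where "S \<noteq> {}" "S \<subseteq> pverts H"
    "\<forall>v\<in>S. (\<forall>u. (v, u) \<in> parcs H \<longrightarrow> u \<in> S) \<and> degree_in (parcs H) v = (if v \<in> A then k else D)" by blast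
  then show ?thesis using sub sym kD by (intro exI[of _ S] exI[of _ "parcs H"] exI[of _ D]) blast
qed

text \<open>The all-ones vector shows that a \<open>k\<close>-regular subgraph has spectral radius
  at least \<open>k\<close>, whereas \<open>d < k\<close> pushes the bound below
  \<open>k\<close>.\<close>

lemma violation_of_regular:
  fixes G :: "'v :: linorder pair_pre_digraph" and d :: real
  assumes G: "simple_graph G" and S: "S \<noteq> {}" "S \<subseteq> pverts G" and E: "E \<subseteq> parcs G" "E \<subseteq> S \<times> S"
    and sym: "\<And>u v. (u, v) \<in> E \<Longrightarrow> (v, u) \<in> E" and deg: "\<And>v. v \<in> S \<Longrightarrow> degree_in E v = k" and d: "d < k" "0 < k"
  shows "\<not> spectrally_degenerate d G"
proof
  assume sd: "spectrally_degenerate d G"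
  define H where "H = \<lparr>pverts = S, parcs = E\<rparr>"
  have fS: "finite S" using S(2) G by (auto simp: simple_graph_iff intro: finite_subset)
  have H: "simple_graph H" using G S(1) E sym fS by (auto simp: simple_graph_iff H_def)
  then have sub: "subgraph (with_proj H) (with_proj G)" using subgraph_iff[OF H G] E S by (simp add: H_def)
  define r where "r = graph_spectral_radius H"
  have "max_degree H = k" using max_degree(2)[OF H] deg by (auto simp: H_def)
  then have "r \<le> sqrt (d * k)" using sd H sub unfolding spectrally_degenerate_def r_def by metis
  also have "\<dots> < sqrt (real k * k)" using d by (intro real_sqrt_less_mono mult_strict_right_mono) auto
  finally have "r < k" by simp
  moreover have "0 \<le> r" unfolding r_def by (rule graph_spectral_radius(1)[OF H])
  ultimately have "r\<^sup>2 < (real k)\<^sup>2" by (intro power_strict_mono) auto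
  moreover have "(\<Sum>v\<in>S. (\<Sum>u | (v, u) \<in> E. 1 :: real)\<^sup>2) \<le> r\<^sup>2 * (\<Sum>v\<in>S. 1\<^sup>2)"
    using graph_spectral_radius(3)[OF H, of "\<lambda>_. 1"] by (simp only: r_def H_def pair_pre_digraph.simps)
  moreover have "(\<Sum>v\<in>S. (\<Sum>u | (v, u) \<in> E. 1 :: real)\<^sup>2) = (\<Sum>v\<in>S. (real k)\<^sup>2)"
    using deg by (intro sum.cong) (auto simp: degree_in_def)
  ultimately show False using S(1) fS by (simp add: card_gt_0_iff mult.commute)
qed

section \<open>Row systems as graphs\<close>

text \<open>
  A row system consists of lists of variables below \<open>n\<close>; a nonempty set \<open>X\<close> of variables solves it if
  every row has 0 or exactly \<open>k\<close> entries in \<open>X\<close>. In the graph of the system, a variable \<open>i\<close> is represented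
  by the vertices \<open>(0, i, t)\<close> and a row \<open>c\<close> by the vertices \<open>(1, c, s)\<close>, where \<open>t, s < k\<close>. Each \<open>(0, i, t)\<close>
  is adjacent to as many copies of \<open>c\<close> as \<open>i\<close> has occurrences in \<open>c\<close>, in a circulant pattern, and its
  degree is raised to \<open>k\<close> by the vertices \<open>(2, i, r)\<close>, which have degree \<open>k\<close> and force the copies of \<open>i\<close>
  to be chosen together.
\<close>

definition wrap :: "nat \<Rightarrow> nat \<Rightarrow> nat \<Rightarrow> nat \<Rightarrow> bool" where
  "wrap k t s m \<longleftrightarrow> t + s < m \<or> (k \<le> t + s \<and> t + s < k + m)"

text \<open>For \<open>s, t < k\<close> the pattern says \<open>(t + s) mod k < m\<close>, so for
  fixed \<open>s\<close> exactly \<open>m\<close> residues \<open>t\<close> qualify.\<close>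

lemma card_wrap:
  assumes "s < k" "m \<le> k"
  shows "card {t. t < k \<and> wrap k t s m} = m"
proof -
  have "{t. t < k \<and> wrap k t s m} = {..<m - s} \<union> {k - s..<min k (k + m - s)}"
    using assms by (auto simp: wrap_def)
  moreover have "{..<m - s} \<inter> {k - s..<min k (k + m - s)} = {}" using assms by auto
  ultimately have "card {t. t < k \<and> wrap k t s m} = (m - s) + (min k (k + m - s) - (k - s))"
    by (simp add: card_Un_disjoint)
  also have "\<dots> = m" using assms by (auto simp: min_def)
  finally show ?thesis .
qed

lemma wrap_commute: "wrap k t s m \<longleftrightarrow> wrap k s t m"
  by (simp add: wrap_def add.commute)

definition mult :: "nat list list \<Rightarrow> nat \<Rightarrow> nat \<Rightarrow> nat" where
  "mult rws c i = length (filter (\<lambda>j. j = i) (nthd [] rws c))"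

definition colsum :: "nat list list \<Rightarrow> nat \<Rightarrow> nat" where
  "colsum rws i = length (filter (\<lambda>j. j = i) (concat rws))"

type_synonym vertex = "nat \<times> nat \<times> nat"

definition inc :: "nat \<Rightarrow> nat list list \<Rightarrow> vertex \<Rightarrow> vertex \<Rightarrow> bool" where
  "inc k rws p q \<longleftrightarrow> fst p = 0 \<and>
     (fst q = 1 \<and> wrap k (snd (snd p)) (snd (snd q)) (mult rws (fst (snd q)) (fst (snd p))) \<or>
      fst q = 2 \<and> fst (snd p) = fst (snd q) \<and> snd (snd q) < k - colsum rws (fst (snd p)))"

definition grid :: "nat \<Rightarrow> nat \<Rightarrow> nat \<Rightarrow> vertex list" where
  "grid g n k = concat (map (\<lambda>i. map (\<lambda>t. (g, i, t)) [0..<k]) [0..<n])"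

text \<open>Vertices \<open>(2, i, r)\<close> are listed for all \<open>r < k\<close>; those with
  \<open>r \<ge> k - colsum rws i\<close> are isolated, and the grids stay uniform.\<close>

definition sys_verts :: "nat \<Rightarrow> nat \<Rightarrow> nat list list \<Rightarrow> vertex list" where
  "sys_verts k n rws = grid 0 n k @ grid 1 (length rws) k @ grid 2 n k"

lemma set_grid: "set (grid g n k) = {(g, i, t) | i t. i < n \<and> t < k}"
  by (auto simp: grid_def)

lemma distinct_grid: "distinct (grid g n k)"
proof -
  have "grid g n k = map (Pair g) (List.product [0..<n] [0..<k])"
    by (simp add: grid_def product_concat_map map_concat comp_def)
  then show ?thesis by (simp add: distinct_map distinct_product inj_on_def)
qed

lemma length_grid: "length (grid g n k) = n * k"
  by (simp add: grid_def length_concat comp_def sum_list_triv)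

lemma distinct_sys_verts: "distinct (sys_verts k n rws)"
  by (auto simp: sys_verts_def distinct_grid set_grid)

lemma card_triples:
  fixes n k :: nat
  shows "card {p :: vertex. \<exists>i t. p = (g, i, t) \<and> i < n \<and> t < k \<and> Q i t} = (\<Sum>i<n. card {t. t < k \<and> Q i t})"
proof -
  have "{p :: vertex. \<exists>i t. p = (g, i, t) \<and> i < n \<and> t < k \<and> Q i t} =
      (\<lambda>(i, t). (g, i, t)) ` (SIGMA i:{..<n}. {t. t < k \<and> Q i t})" by auto
  moreover have "inj_on (\<lambda>(i, t). (g, i, t)) (SIGMA i:{..<n}. {t. t < k \<and> Q i t})" by (auto simp: inj_on_def)
  ultimately show ?thesis by (simp add: card_image)
qed

lemma sum_filter_eq:
  assumes "set xs \<subseteq> {..<n}"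
  shows "(\<Sum>i<n. length (filter (\<lambda>j. j = i) xs)) = length (xs :: nat list)"
  using assms
proof (induction xs)
  case (Cons x xs)
  have "(\<Sum>i<n. length (filter (\<lambda>j. j = i) (x # xs))) = (\<Sum>i<n. (if i = x then 1 else 0) + length (filter (\<lambda>j. j = i) xs))"
    by (intro sum.cong) auto
  also have "\<dots> = 1 + (\<Sum>i<n. length (filter (\<lambda>j. j = i) xs))" using Cons.prems by (simp add: sum.distrib)
  finally show ?case using Cons by simp
qed simp

lemma sum_mult_row:
  fixes rw :: "nat list"
  assumes "set rw \<subseteq> {..<n}"
  shows "(\<Sum>i<n. if i \<in> X then length (filter (\<lambda>j. j = i) rw) else 0) = length (filter (\<lambda>j. j \<in> X) rw)"
proof -
  have "(if i \<in> X then length (filter (\<lambda>j. j = i) rw) else 0) = length (filter (\<lambda>j. j = i) (filter (\<lambda>j. j \<in> X) rw))" for i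
    by (auto simp: filter_empty_conv intro!: arg_cong[of _ _ length] filter_cong)
  then show ?thesis using sum_filter_eq[of "filter (\<lambda>j. j \<in> X) rw" n] assms by auto
qed

lemma sum_mult_col: "(\<Sum>c<length rws. mult rws c i) = colsum rws i"
proof -
  have "colsum rws i = sum_list (map (\<lambda>r. length (filter (\<lambda>j. j = i) r)) rws)"
    by (induction rws) (auto simp: colsum_def)
  also have "\<dots> = (\<Sum>c<length rws. length (filter (\<lambda>j. j = i) (rws ! c)))"
    by (simp add: sum_list_sum_nth lessThan_atLeast0)
  also have "\<dots> = (\<Sum>c<length rws. mult rws c i)" by (intro sum.cong) (auto simp: mult_def nthd)
  finally show ?thesis by simp
qed

text \<open>The strict inequality in \<open>occ\<close> guarantees that the auxiliary vertex
  \<open>(2, i, 0)\<close> is adjacent to all copies of \<open>i\<close>.\<close>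

locale row_system =
  fixes k n :: nat and rws :: "nat list list"
  assumes vars: "\<And>rw. rw \<in> set rws \<Longrightarrow> set rw \<subseteq> {..<n}"
    and occ: "\<And>i. i < n \<Longrightarrow> colsum rws i < k"
    and k: "0 < k" and n: "0 < n"
begin

abbreviation "P \<equiv> set (sys_verts k n rws)"

definition solution :: "nat set \<Rightarrow> bool" where
  "solution X \<longleftrightarrow> X \<noteq> {} \<and> X \<subseteq> {..<n} \<and> (\<forall>rw\<in>set rws. length (filter (\<lambda>j. j \<in> X) rw) \<in> {0, k})"

definition Gi :: "(vertex \<times> vertex) set" where
  "Gi = {(p, q). p \<in> P \<and> q \<in> P \<and> (inc k rws p q \<or> inc k rws q p)}"

lemma P_cases:
  assumes "p \<in> P"
  obtains i t where "p = (0, i, t)" "i < n" "t < k"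
  | c s where "p = (1, c, s)" "c < length rws" "s < k"
  | i r where "p = (2, i, r)" "i < n" "r < k"
  using assms by (auto simp: sys_verts_def set_grid)

lemma P_iff:
  "(0, i, t) \<in> P \<longleftrightarrow> i < n \<and> t < k"
  "(Suc 0, c, s) \<in> P \<longleftrightarrow> c < length rws \<and> s < k"
  "(2, i, r) \<in> P \<longleftrightarrow> i < n \<and> r < k"
  by (auto simp: sys_verts_def set_grid)

lemma mult_le: "i < n \<Longrightarrow> mult rws c i \<le> k"
proof (cases "c < length rws")
  case True
  assume i: "i < n"
  have "mult rws c i \<le> (\<Sum>c<length rws. mult rws c i)" using True by (intro member_le_sum) auto
  then show ?thesis using occ[OF i] by (simp add: sum_mult_col)
qed (simp add: mult_def nthd)

lemma nbrs_A:
  assumes "i < n" "t < k"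
  shows "{q. ((0, i, t), q) \<in> Gi} = {q. \<exists>c s. q = (1, c, s) \<and> c < length rws \<and> s < k \<and> wrap k t s (mult rws c i)} \<union>
    Pair 2 ` Pair i ` {..<k - colsum rws i}"
  using assms by (auto simp: Gi_def inc_def P_iff elim!: P_cases)

lemma degree_A:
  assumes "i < n" "t < k"
  shows "card {q. ((0, i, t), q) \<in> Gi} = k"
proof -
  have "card {q :: vertex. \<exists>c s. q = (1, c, s) \<and> c < length rws \<and> s < k \<and> wrap k t s (mult rws c i)} =
    (\<Sum>c<length rws. card {s. s < k \<and> wrap k t s (mult rws c i)})" by (rule card_triples)
  also have "\<dots> = (\<Sum>c<length rws. mult rws c i)"
    using assms mult_le[OF assms(1)] by (intro sum.cong) (auto simp: wrap_commute[of k t] card_wrap)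
  also have "\<dots> = colsum rws i" by (rule sum_mult_col)
  finally have 1: "card {q :: vertex. \<exists>c s. q = (1, c, s) \<and> c < length rws \<and> s < k \<and> wrap k t s (mult rws c i)} = colsum rws i" .
  have 2: "card (Pair (2::nat) ` Pair i ` {..<k - colsum rws i}) = k - colsum rws i"
    by (simp add: card_image inj_on_def)
  have "finite {q. ((0, i, t), q) \<in> Gi}" by (rule finite_subset[of _ P]) (auto simp: Gi_def)
  then show ?thesis unfolding nbrs_A[OF assms]
    by (subst card_Un_disjoint) (use 1 2 occ[OF assms(1)] in auto)
qed

text \<open>By the circulant pattern each copy of a row meets as many copies of a variable as the
  row has occurrences of it, so the degree of a row copy counts its chosen entries.\<close>

lemma card_row_nbrs:
  assumes c: "c < length rws" and s: "s < k"
  shows "card {p :: vertex. \<exists>i t. p = (0, i, t) \<and> i < n \<and> t < k \<and> i \<in> X \<and> wrap k t s (mult rws c i)} =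
    length (filter (\<lambda>j. j \<in> X) (rws ! c))"
proof -
  have "card {p :: vertex. \<exists>i t. p = (0, i, t) \<and> i < n \<and> t < k \<and> i \<in> X \<and> wrap k t s (mult rws c i)} =
    (\<Sum>i<n. card {t. t < k \<and> i \<in> X \<and> wrap k t s (mult rws c i)})" by (rule card_triples)
  also have "\<dots> = (\<Sum>i<n. if i \<in> X then mult rws c i else 0)"
    using s mult_le by (intro sum.cong) (auto simp: card_wrap)
  also have "\<dots> = (\<Sum>i<n. if i \<in> X then length (filter (\<lambda>j. j = i) (rws ! c)) else 0)"
    using c by (intro sum.cong) (auto simp: mult_def nthd)
  also have "\<dots> = length (filter (\<lambda>j. j \<in> X) (rws ! c))"
    using vars c by (intro sum_mult_row) auto
  finally show ?thesis .
qed

text \<open>A chosen variable copy has degree \<open>k\<close> in \<open>E\<close> and in the whole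
  graph, so it keeps all its edges. Hence \<open>(2, i, 0)\<close> is chosen; it has only the
  \<open>k\<close> copies of \<open>i\<close> as neighbours, which gives \<open>D = k\<close> and
  forces all of them into \<open>S\<close>. The degree of a chosen row copy is then the count of the
  row.\<close>

lemma solution_of_biregular:
  assumes S: "S \<noteq> {}" "S \<subseteq> P" and E: "E \<subseteq> Gi" "\<And>p q. (p, q) \<in> E \<Longrightarrow> (q, p) \<in> E" and D: "k \<le> D"
    and closed: "\<And>p q. p \<in> S \<Longrightarrow> (p, q) \<in> E \<Longrightarrow> q \<in> S"
    and deg: "\<And>p. p \<in> S \<Longrightarrow> degree_in E p = (if fst p = 0 then k else D)"
  shows "\<exists>X. solution X"
proof -
  have fin: "finite {q. (p, q) \<in> Gi}" for p by (rule finite_subset[of _ P]) (auto simp: Gi_def)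
  have EA: "((0, i, t), q) \<in> E \<longleftrightarrow> ((0, i, t), q) \<in> Gi" if "(0, i, t) \<in> S" for i t q
  proof -
    have it: "i < n" "t < k" using that S(2) P_iff by blast+
    have "{q. ((0, i, t), q) \<in> E} = {q. ((0, i, t), q) \<in> Gi}"
      using deg[OF that] degree_A[OF it] E(1) fin by (intro card_subset_eq) (auto simp: degree_in_def)
    then show ?thesis by blast
  qed
  obtain p0 where p0: "p0 \<in> S" using S by blast
  have "\<exists>p\<in>S. fst p = 0"
  proof (cases "fst p0 = 0")
    case False
    then have "card {q. (p0, q) \<in> E} > 0" using deg[OF p0] D k by (simp add: degree_in_def)
    then obtain q where q: "(p0, q) \<in> E" by (auto simp: card_gt_0_iff)
    then have "q \<in> S" using closed p0 by blast
    moreover have "fst q = 0" using q E(1) False by (auto simp: Gi_def inc_def)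
    ultimately show ?thesis by blast
  qed (use p0 in blast)
  then obtain i0 t0 where A0: "(0, i0, t0) \<in> S" by auto
  have all: "D = k \<and> (\<forall>t'<k. (0, i, t') \<in> S)" if "(0, i, t) \<in> S" for i t
  proof -
    have it: "i < n" "t < k" using that S(2) P_iff by blast+
    have "((0, i, t), (2, i, 0)) \<in> Gi" using it occ[OF it(1)] k by (auto simp: Gi_def inc_def P_iff)
    then have e: "((0, i, t), (2, i, 0)) \<in> E" using EA[OF that] by simp
    then have qS: "(2, i, 0) \<in> S" using closed that by blast
    have sub: "{p. ((2, i, 0), p) \<in> E} \<subseteq> Pair 0 ` Pair i ` {..<k}"
      using E(1) by (auto simp: Gi_def inc_def P_iff elim!: P_cases)
    have c: "card (Pair (0::nat) ` Pair i ` {..<k}) = k" by (simp add: card_image inj_on_def)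
    have d: "card {p. ((2, i, 0), p) \<in> E} = D" using deg[OF qS] by (simp add: degree_in_def)
    have "D \<le> k" using card_mono[OF _ sub] c d by simp
    then have "D = k" using D by simp
    then have "{p. ((2, i, 0), p) \<in> E} = Pair 0 ` Pair i ` {..<k}" using sub c d by (intro card_subset_eq) auto
    then have "(0, i, t') \<in> S" if "t' < k" for t' using closed[OF qS] that by blast
    then show ?thesis using \<open>D = k\<close> by blast
  qed
  then have Dk: "D = k" using A0 by blast
  define X where "X = {i. (0, i, 0) \<in> S}"
  have X: "(0, i, t) \<in> S \<longleftrightarrow> i \<in> X" if "t < k" for i t
    using all that k by (auto simp: X_def)
  have Xn: "X \<subseteq> {..<n}" using S(2) P_iff(1) by (auto simp: X_def)
  have "length (filter (\<lambda>j. j \<in> X) (rws ! c)) \<in> {0, k}" if c: "c < length rws" for c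
  proof (cases "\<exists>s<k. (1, c, s) \<in> S")
    case True
    then obtain s where s: "s < k" "(1, c, s) \<in> S" by blast
    have "{p. ((1, c, s), p) \<in> E} = {p :: vertex. \<exists>i t. p = (0, i, t) \<and> i < n \<and> t < k \<and> i \<in> X \<and> wrap k t s (mult rws c i)}"
    proof (intro equalityI subsetI)
      fix p assume "p \<in> {p. ((1, c, s), p) \<in> E}"
      then have e: "((1, c, s), p) \<in> E" by simp
      then have "p \<in> S" using closed s by blast
      moreover from e E(1) have "((1, c, s), p) \<in> Gi" by blast
      ultimately show "p \<in> {p. \<exists>i t. p = (0, i, t) \<and> i < n \<and> t < k \<and> i \<in> X \<and> wrap k t s (mult rws c i)}"
        using X by (auto simp: Gi_def inc_def P_iff elim!: P_cases)
    next
      fix p assume "p \<in> {p :: vertex. \<exists>i t. p = (0, i, t) \<and> i < n \<and> t < k \<and> i \<in> X \<and> wrap k t s (mult rws c i)}"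
      then obtain i t where p: "p = (0, i, t)" "i < n" "t < k" "i \<in> X" "wrap k t s (mult rws c i)" by blast
      then have "p \<in> S" using X by simp
      moreover have "(p, (1, c, s)) \<in> Gi" using p c s by (auto simp: Gi_def inc_def P_iff)
      ultimately have "(p, (1, c, s)) \<in> E" using EA p(1) by simp
      then show "p \<in> {p. ((1, c, s), p) \<in> E}" using E(2) by blast
    qed
    then have "length (filter (\<lambda>j. j \<in> X) (rws ! c)) = degree_in E (1, c, s)"
      using card_row_nbrs[OF c s(1), of X] by (simp add: degree_in_def)
    then show ?thesis using deg[OF s(2)] Dk by simp
  next
    case False
    \<comment> \<open>A chosen variable keeps all its edges, among them the one from
      \<open>(0, i, 0)\<close> to \<open>(1, c, 0)\<close> if \<open>i\<close> occurs in the
      row.\<close>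
    have "i \<notin> X" if i: "i \<in> set (rws ! c)" for i
    proof
      assume iX: "i \<in> X"
      then have S0: "(0, i, 0) \<in> S" by (simp add: X_def)
      have "filter (\<lambda>j. j = i) (rws ! c) \<noteq> []" using i by (auto simp: filter_empty_conv)
      then have "0 < mult rws c i" using c by (simp add: mult_def nthd)
      then have "((0, i, 0), (1, c, 0)) \<in> Gi" using iX Xn c k by (auto simp: Gi_def inc_def P_iff wrap_def)
      then have "(1, c, 0) \<in> S" using EA[OF S0] closed[OF S0] by blast
      then show False using False k by blast
    qed
    then show ?thesis by (simp add: filter_empty_conv)
  qed
  then have "\<forall>rw\<in>set rws. length (filter (\<lambda>j. j \<in> X) rw) \<in> {0, k}" by (metis in_set_conv_nth)
  moreover have "i0 \<in> X" using all[OF A0] k by (simp add: X_def)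
  ultimately show ?thesis using Xn unfolding solution_def by blast
qed

text \<open>Take all copies of the chosen variables together with all their neighbours. A row copy
  that is reached has a positive number of chosen neighbours, and for a solution this number can
  only be \<open>k\<close>.\<close>

lemma regular_of_solution:
  assumes X: "solution X"
  shows "\<exists>S E. S \<noteq> {} \<and> S \<subseteq> P \<and> E \<subseteq> Gi \<and> E \<subseteq> S \<times> S \<and> (\<forall>p q. (p, q) \<in> E \<longrightarrow> (q, p) \<in> E) \<and>
    (\<forall>p\<in>S. degree_in E p = k)"
proof -
  define SA where "SA = {p :: vertex. \<exists>i t. p = (0, i, t) \<and> i < n \<and> t < k \<and> i \<in> X}"
  define S where "S = SA \<union> {q. \<exists>p\<in>SA. (p, q) \<in> Gi}"
  define E where "E = {(p, q) \<in> Gi. p \<in> S \<and> q \<in> S}"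
  have sym: "(q, p) \<in> Gi" if "(p, q) \<in> Gi" for p q using that by (auto simp: Gi_def)
  have SP: "S \<subseteq> P" by (auto simp: S_def SA_def Gi_def P_iff)
  have S0: "(0, i, t) \<in> S \<longleftrightarrow> i < n \<and> t < k \<and> i \<in> X" for i t
    by (auto simp: S_def SA_def Gi_def inc_def)
  obtain i0 where i0: "i0 \<in> X" "i0 < n" using X by (auto simp: solution_def)
  have "(0, i0, 0) \<in> S" using i0 k by (simp add: S0)
  then have "S \<noteq> {}" by blast
  moreover have "degree_in E p = k" if pS: "p \<in> S" for p
  proof -
    have "p \<in> P" using SP pS by blast
    then show ?thesis
    proof (cases rule: P_cases)
      case (1 i t)
      then have "p \<in> SA" using pS by (simp add: S0 SA_def)
      then have "{q. (p, q) \<in> E} = {q. (p, q) \<in> Gi}" using pS by (auto simp: E_def S_def)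
      then show ?thesis using degree_A[OF 1(2,3)] 1(1) by (simp add: degree_in_def)
    next
      case (2 c s)
      have "{q. (p, q) \<in> E} = {q :: vertex. \<exists>i t. q = (0, i, t) \<and> i < n \<and> t < k \<and> i \<in> X \<and> wrap k t s (mult rws c i)}"
      proof (intro equalityI subsetI)
        fix q assume "q \<in> {q. (p, q) \<in> E}"
        then have "(p, q) \<in> Gi" "q \<in> S" by (auto simp: E_def)
        then show "q \<in> {q. \<exists>i t. q = (0, i, t) \<and> i < n \<and> t < k \<and> i \<in> X \<and> wrap k t s (mult rws c i)}"
          using 2(1) by (auto simp: Gi_def inc_def P_iff S0 elim!: P_cases)
      next
        fix q assume "q \<in> {q :: vertex. \<exists>i t. q = (0, i, t) \<and> i < n \<and> t < k \<and> i \<in> X \<and> wrap k t s (mult rws c i)}"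
        then obtain i t where q: "q = (0, i, t)" "i < n" "t < k" "i \<in> X" "wrap k t s (mult rws c i)" by blast
        then have "q \<in> S" by (simp add: S0)
        moreover have "(p, q) \<in> Gi" using 2 q by (auto simp: Gi_def inc_def P_iff)
        ultimately show "q \<in> {q. (p, q) \<in> E}" using pS by (simp add: E_def)
      qed
      then have d: "degree_in E p = length (filter (\<lambda>j. j \<in> X) (rws ! c))"
        using card_row_nbrs[OF 2(2,3), of X] by (simp add: degree_in_def)
      have "p \<notin> SA" using 2 by (auto simp: SA_def)
      then obtain q where "q \<in> SA" "(q, p) \<in> Gi" using pS by (auto simp: S_def)
      then have "q \<in> {q. (p, q) \<in> E}" using sym pS by (auto simp: E_def S_def)
      moreover have "finite {q. (p, q) \<in> E}" by (rule finite_subset[of _ P]) (auto simp: E_def Gi_def)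
      ultimately have "0 < card {q. (p, q) \<in> E}" by (subst card_gt_0_iff) blast
      then have "degree_in E p \<noteq> 0" by (simp add: degree_in_def)
      moreover have "length (filter (\<lambda>j. j \<in> X) (rws ! c)) \<in> {0, k}" using X 2(2) by (auto simp: solution_def)
      ultimately show ?thesis using d by auto
    next
      case (3 i r)
      have "p \<notin> SA" using 3 by (auto simp: SA_def)
      then obtain q where q: "q \<in> SA" "(q, p) \<in> Gi" using pS by (auto simp: S_def)
      then have i: "i \<in> X" "r < k - colsum rws i" using 3 by (auto simp: SA_def Gi_def inc_def)
      have "{q. (p, q) \<in> E} = Pair (0::nat) ` Pair i ` {..<k}"
      proof (intro equalityI subsetI)
        fix q assume "q \<in> {q. (p, q) \<in> E}"
        then have "(p, q) \<in> Gi" by (simp add: E_def)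
        then show "q \<in> Pair (0::nat) ` Pair i ` {..<k}" using 3(1) by (auto simp: Gi_def inc_def P_iff elim!: P_cases)
      next
        fix q assume "q \<in> Pair (0::nat) ` Pair i ` {..<k}"
        then obtain t where t: "q = (0, i, t)" "t < k" by auto
        then have "q \<in> S" using i 3(2) by (simp add: S0)
        moreover have "(p, q) \<in> Gi" using t 3 i by (auto simp: Gi_def inc_def P_iff)
        ultimately show "q \<in> {q. (p, q) \<in> E}" using pS by (simp add: E_def)
      qed
      then show ?thesis by (simp add: degree_in_def card_image inj_on_def)
    qed
  qed
  moreover have "E \<subseteq> Gi" "E \<subseteq> S \<times> S" "\<forall>p q. (p, q) \<in> E \<longrightarrow> (q, p) \<in> E" using sym by (auto simp: E_def)
  ultimately show ?thesis using SP by blast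
qed

end

definition sys_edge :: "nat \<Rightarrow> nat list list \<Rightarrow> vertex \<Rightarrow> vertex \<Rightarrow> bool" where
  "sys_edge k rws p q \<longleftrightarrow> inc k rws p q \<or> inc k rws q p"

definition sys_graph :: "nat \<Rightarrow> nat \<Rightarrow> nat list list \<Rightarrow> nat pair_pre_digraph" where
  "sys_graph k n rws = (let V = sys_verts k n rws in
     \<lparr>pverts = {0..<length V}, parcs = {(a, b). a < length V \<and> b < length V \<and> sys_edge k rws (V ! a) (V ! b)}\<rparr>)"

text \<open>Chosen so that \<open>2 ^ sys_exp N\<close> exceeds the threshold
  \<open>N * (N ^ 2 + k * N) ^ N\<close> of \<open>biregular_of_violation\<close> for
  \<open>k \<le> N\<close>; a power of two is easy to write in binary.\<close>

definition sys_exp :: "nat \<Rightarrow> nat" where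
  "sys_exp N = 3 * N * N + N"

context row_system
begin

lemma sys_size: "0 < length (sys_verts k n rws)" "k \<le> length (sys_verts k n rws)"
  using n k by (cases n; auto simp: sys_verts_def length_grid)+

lemma simple_sys_graph: "simple_graph (sys_graph k n rws)"
  using sys_size by (auto simp: simple_graph_iff sys_graph_def Let_def sys_edge_def inc_def)

lemma image_degree:
  assumes f: "inj_on f V" and E: "E \<subseteq> V \<times> V" and v: "v \<in> V"
  shows "degree_in (map_prod f f ` E) (f v) = degree_in E v"
proof -
  have "{u. (f v, u) \<in> map_prod f f ` E} = f ` {u. (v, u) \<in> E}"
  proof (intro equalityI subsetI)
    fix u assume "u \<in> {u. (f v, u) \<in> map_prod f f ` E}"
    then obtain a b where ab: "(a, b) \<in> E" "f v = f a" "u = f b" by auto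
    then have "v = a" using E v by (intro inj_onD[OF f]) auto
    then show "u \<in> f ` {u. (v, u) \<in> E}" using ab by simp
  next
    fix u assume "u \<in> f ` {u. (v, u) \<in> E}"
    then obtain b where "(v, b) \<in> E" "u = f b" by blast
    then show "u \<in> {u. (f v, u) \<in> map_prod f f ` E}" by (auto intro: rev_image_eqI)
  qed
  moreover have "inj_on f {u. (v, u) \<in> E}" using f E by (auto simp: inj_on_def)
  ultimately show ?thesis by (simp add: degree_in_def card_image)
qed

lemma sys_exp_bound:
  assumes "0 < N" "k' \<le> N"
  shows "N * (N ^ 2 + k' * N) ^ N \<le> 2 ^ sys_exp N"
proof -
  have N: "N \<le> 2 ^ N" by (simp add: less_imp_le)
  have "N ^ 2 + k' * N \<le> 2 ^ N * 2 ^ N + 2 ^ N * 2 ^ N"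
    unfolding power2_eq_square using N order_trans[OF assms(2) N] by (intro add_mono mult_mono) auto
  also have "\<dots> = 2 ^ (N + N + 1)" by (simp add: power_add)
  also have "\<dots> \<le> 2 ^ (3 * N)" using assms(1) by (intro power_increasing) auto
  finally have "N * (N ^ 2 + k' * N) ^ N \<le> 2 ^ N * (2 ^ (3 * N)) ^ N"
    using N by (intro mult_mono power_mono) auto
  also have "\<dots> = 2 ^ (N + 3 * N * N)" by (simp only: power_add power_mult)
  finally show ?thesis by (simp add: sys_exp_def add.commute)
qed

text \<open>A solution gives a \<open>k\<close>-regular subgraph, and \<open>d < k\<close> is
  violated by it; conversely \<open>b\<close> is large enough for
  \<open>biregular_of_violation\<close>. The rest moves subgraphs between positions in the vertex
  list and triples.\<close>

theorem sys_graph_degenerate_iff: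
  defines "b \<equiv> 2 ^ sys_exp (length (sys_verts k n rws))"
  shows "spectrally_degenerate (real (k * b - 1) / real b) (sys_graph k n rws) \<longleftrightarrow> (\<nexists>X. solution X)"
proof -
  define V G where "V = sys_verts k n rws" and "G = sys_graph k n rws"
  define f where "f = (!) V"
  have G: "simple_graph G" unfolding G_def by (rule simple_sys_graph)
  have GV: "pverts G = {0..<length V}" and GE: "parcs G = {(a, b). a < length V \<and> b < length V \<and> sys_edge k rws (f a) (f b)}"
    by (simp_all add: G_def V_def sys_graph_def Let_def f_def)
  have f: "inj_on f (pverts G)" "f ` pverts G = P"
    using distinct_sys_verts[of k n rws] by (auto simp: f_def GV V_def[symmetric] inj_on_nth set_conv_nth)
  have EG: "parcs G \<subseteq> pverts G \<times> pverts G" by (auto simp: GE GV)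
  have img: "map_prod f f ` parcs G = Gi"
  proof
    show "map_prod f f ` parcs G \<subseteq> Gi" using f(2) by (fastforce simp: GE GV Gi_def sys_edge_def)
    show "Gi \<subseteq> map_prod f f ` parcs G"
    proof
      fix e assume "e \<in> Gi"
      then obtain p q where e: "e = (p, q)" "p \<in> P" "q \<in> P" "sys_edge k rws p q" by (auto simp: Gi_def sys_edge_def)
      then obtain a b where ab: "a \<in> pverts G" "b \<in> pverts G" "p = f a" "q = f b" using f(2) by blast
      then have "(a, b) \<in> parcs G" using e by (simp add: GE GV)
      then show "e \<in> map_prod f f ` parcs G" using e ab by (auto simp: image_iff intro!: bexI[of _ "(a, b)"])
    qed
  qed
  have cV: "card (pverts G) = length V" by (simp add: GV)
  have b: "0 < b" by (simp add: b_def)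
  have kb: "real (k * b - 1) / real b < k" using k b by (simp add: field_simps of_nat_diff Suc_le_eq)
  have bip: "u \<in> {a. fst (f a) = 0} \<longleftrightarrow> v \<notin> {a. fst (f a) = 0}" if "(u, v) \<in> parcs G" for u v
    using that by (auto simp: GE sys_edge_def inc_def)
  have degA: "degree_in (parcs G) v \<le> k" if v: "v \<in> pverts G" "v \<in> {a. fst (f a) = 0}" for v
  proof -
    have "f v \<in> P" using f(2) v by blast
    then obtain i t where it: "f v = (0, i, t)" "i < n" "t < k" using v(2) by (auto elim!: P_cases)
    have "degree_in (parcs G) v = degree_in Gi (f v)" unfolding img[symmetric] by (rule image_degree[OF f(1) EG v(1), symmetric])
    then show ?thesis using degree_A[OF it(2,3)] it(1) by (simp add: degree_in_def)
  qed
  show ?thesis unfolding G_def[symmetric]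
  proof (intro iffI notI)
    assume sd: "spectrally_degenerate (real (k * b - 1) / real b) G" and "\<exists>X. solution X"
    then obtain X where "solution X" by blast
    from regular_of_solution[OF this] obtain S E where SE: "S \<noteq> {}" "S \<subseteq> P" "E \<subseteq> Gi" "E \<subseteq> S \<times> S"
      and SE5: "\<forall>p q. (p, q) \<in> E \<longrightarrow> (q, p) \<in> E" and SE6: "\<forall>p\<in>S. degree_in E p = k"
      by (elim exE conjE) (rule that)
    define S' E' where "S' = {a \<in> pverts G. f a \<in> S}" and "E' = {(a, b) \<in> parcs G. (f a, f b) \<in> E}"
    have fE: "map_prod f f ` E' = E"
    proof
      show "E \<subseteq> map_prod f f ` E'"
      proof
        fix e assume e: "e \<in> E"
        then have "e \<in> map_prod f f ` parcs G" using SE(3) img by blast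
        then show "e \<in> map_prod f f ` E'" using e by (auto simp: E'_def)
      qed
    qed (auto simp: E'_def)
    have E'V: "E' \<subseteq> pverts G \<times> pverts G" using EG unfolding E'_def by blast
    have d: "degree_in E' v = degree_in E (f v)" if "v \<in> pverts G" for v
      using image_degree[OF f(1) E'V that] unfolding fE by simp
    have "\<not> spectrally_degenerate (real (k * b - 1) / real b) G"
    proof (rule violation_of_regular[OF G _ _ _ _ _ _ kb k])
      obtain p where p: "p \<in> S" using SE(1) by blast
      then obtain a where "a \<in> pverts G" "p = f a" using SE(2) f(2) by blast
      then show "S' \<noteq> {}" using p by (auto simp: S'_def)
      show "S' \<subseteq> pverts G" "E' \<subseteq> parcs G" by (auto simp: S'_def E'_def)
      show "E' \<subseteq> S' \<times> S'" using EG SE(4) by (auto simp: S'_def E'_def)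
      show "(v, u) \<in> E'" if "(u, v) \<in> E'" for u v
      proof -
        have "(u, v) \<in> parcs G" "(f u, f v) \<in> E" using that by (auto simp: E'_def)
        then have "(v, u) \<in> parcs G" "(f v, f u) \<in> E" using G SE5 unfolding simple_graph_iff by blast+
        then show ?thesis by (simp add: E'_def)
      qed
      show "degree_in E' v = k" if "v \<in> S'" for v using that d SE6 by (auto simp: S'_def)
    qed
    then show False using sd by blast
  next
    assume ns: "\<nexists>X. solution X"
    show "spectrally_degenerate (real (k * b - 1) / real b) G"
    proof (rule ccontr)
      assume nd: "\<not> spectrally_degenerate (real (k * b - 1) / real b) G"
      have "card (pverts G) * (card (pverts G) ^ 2 + k * card (pverts G)) ^ card (pverts G) \<le> b"
        unfolding cV b_def V_def by (rule sys_exp_bound[OF sys_size])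
      from biregular_of_violation[OF G bip degA k b this nd] obtain S E D where SE: "S \<noteq> {}" "S \<subseteq> pverts G" "E \<subseteq> parcs G"
        "\<And>u v. (u, v) \<in> E \<Longrightarrow> (v, u) \<in> E" "k \<le> D"
        "\<And>v u. v \<in> S \<Longrightarrow> (v, u) \<in> E \<Longrightarrow> u \<in> S"
        "\<And>v. v \<in> S \<Longrightarrow> degree_in E v = (if fst (f v) = 0 then k else D)"
        unfolding mem_Collect_eq by blast
      have "\<exists>X. solution X"
      proof (rule solution_of_biregular)
        show "f ` S \<noteq> {}" "f ` S \<subseteq> P" using SE(1,2) f(2) by auto
        show "map_prod f f ` E \<subseteq> Gi" using SE(3) img by blast
        show "(q, p) \<in> map_prod f f ` E" if pq: "(p, q) \<in> map_prod f f ` E" for p q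
        proof -
          obtain u v where uv: "(u, v) \<in> E" "p = f u" "q = f v" using pq by auto
          have "map_prod f f (v, u) \<in> map_prod f f ` E" by (rule imageI[OF SE(4)[OF uv(1)]])
          then show ?thesis using uv by simp
        qed
        show "k \<le> D" by (rule SE)
        show "q \<in> f ` S" if pq: "p \<in> f ` S" "(p, q) \<in> map_prod f f ` E" for p q
        proof -
          obtain v where v: "v \<in> S" "p = f v" using pq(1) by blast
          obtain a b where ab: "(a, b) \<in> E" "p = f a" "q = f b" using pq(2) by auto
          have "a = v" using f(1) v ab SE(2,3) EG by (auto simp: inj_on_def)
          then show ?thesis using SE(6)[OF v(1)] ab by blast
        qed
        show "degree_in (map_prod f f ` E) p = (if fst p = 0 then k else D)" if pS: "p \<in> f ` S" for p
        proof -
          obtain v where v: "v \<in> S" "p = f v" using pS by blast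
          have "degree_in (map_prod f f ` E) (f v) = degree_in E v"
            by (rule image_degree[OF f(1)]) (use SE(2,3) EG v in auto)
          then show ?thesis using SE(7)[OF v(1)] v by simp
        qed
      qed
      then show False using ns by blast
    qed
  qed
qed

end

text \<open>With \<open>b = 2 ^ e\<close> the numerator is
  \<open>k * b - 1 = (2 ^ e - 1) + 2 ^ e * (k - 1)\<close>, that is, \<open>e\<close> ones followed
  by the bits of \<open>k - 1\<close>.\<close>

definition sys_code :: "nat \<Rightarrow> nat \<Rightarrow> nat list list \<Rightarrow> bool list" where
  "sys_code k n rws = (let V = sys_verts k n rws; e = sys_exp (length V) in
     pair_code (concat (map (\<lambda>p. map (\<lambda>q. sys_edge k rws p q) V) V))
       (pair_code (btrim (replicate e True @ bofnat (k - 1))) (btrim (replicate e False @ [True]))))"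

lemma pt_pair_code [pt_intros]: "pt f \<Longrightarrow> pt g \<Longrightarrow> pt (\<lambda>x. pair_code (f x) (g x))"
  unfolding pair_code_def by (intro pt_intros)

lemma pt_mult_rows [pt_intros]: "pt r \<Longrightarrow> pt c \<Longrightarrow> pt i \<Longrightarrow> pt (\<lambda>x. mult (r x) (c x) (i x))"
proof (rule pt_comp3[of mult])
  show "pt (\<lambda>p. mult (fst p) (fst (snd p)) (snd (snd p)))" unfolding mult_def by (intro pt_intros)
qed

lemma pt_colsum [pt_intros]: "pt r \<Longrightarrow> pt i \<Longrightarrow> pt (\<lambda>x. colsum (r x) (i x))"
proof (rule pt_comp2[of colsum])
  show "pt (\<lambda>p. colsum (fst p) (snd p))" unfolding colsum_def by (intro pt_intros)
qed

lemma pt_sys_code: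
  assumes "pt k" "pt n" "pt r"
  shows "pt (\<lambda>x. sys_code (k x) (n x) (r x))"
proof (rule pt_comp3[OF _ assms])
  have e: "pt (\<lambda>q. sys_edge (fst q) (fst (snd q)) (fst (snd (snd q))) (snd (snd (snd q))))"
    unfolding sys_edge_def inc_def wrap_def by (intro pt_intros)
  have e': "pt (\<lambda>x. sys_edge (f1 x) (f2 x) (f3 x) (f4 x))" if "pt f1" "pt f2" "pt f3" "pt f4" for f1 f2 f3 and f4 :: "'b::enc \<Rightarrow> _"
    using pt_comp[OF e pt_pair[OF that(1) pt_pair[OF that(2) pt_pair[OF that(3,4)]]]] by simp
  have g: "pt (\<lambda>x. grid c (f1 x) (f2 x))" if "pt f1" "pt f2" for c f1 and f2 :: "'b::enc \<Rightarrow> _"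
  proof (rule pt_comp2[of "grid c", OF _ that])
    show "pt (\<lambda>p. grid c (fst p) (snd p))" unfolding grid_def by (intro pt_intros)
  qed
  have v: "pt (\<lambda>q. sys_verts (fst q) (fst (snd q)) (snd (snd q)))"
    unfolding sys_verts_def by (intro pt_intros g)
  show "pt (\<lambda>p. sys_code (fst p) (fst (snd p)) (snd (snd p)))"
    unfolding sys_code_def sys_exp_def by (intro pt_intros v e')
qed

lemma bval_ones: "bval (replicate e True @ xs) = 2 ^ e - 1 + 2 ^ e * bval xs"
proof -
  have "bval (replicate e True) + 1 = 2 ^ e" by (induction e) auto
  then have "bval (replicate e True) = 2 ^ e - 1" by linarith
  then show ?thesis by (simp add: bval_append)
qed

lemma bval_zeros: "bval (replicate e False @ xs) = 2 ^ e * bval xs"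
  by (induction e) auto

lemma (in row_system) sys_code:
  defines "b \<equiv> 2 ^ sys_exp (length (sys_verts k n rws))"
  shows "sys_code k n rws = instance_code (sys_graph k n rws) (k * b - 1) b"
proof -
  let ?V = "sys_verts k n rws"
  have m: "map (\<lambda>j. g (?V ! j)) [0..<length ?V] = map g ?V" for g :: "vertex \<Rightarrow> 'a"
    by (subst (3) map_nth[symmetric]) (simp add: comp_def)
  have "graph_code (sys_graph k n rws) =
    concat (map (\<lambda>i. map (\<lambda>j. sys_edge k rws (?V ! i) (?V ! j)) [0..<length ?V]) [0..<length ?V])"
    unfolding graph_code_def sys_graph_def Let_def by (auto intro!: arg_cong[of _ _ concat])
  also have "\<dots> = concat (map (\<lambda>p. map (\<lambda>q. sys_edge k rws p q) ?V) ?V)"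
    unfolding m[of "\<lambda>q. sys_edge k rws _ q"] m[of "\<lambda>p. map (\<lambda>q. sys_edge k rws p q) ?V"] by simp
  finally have 1: "graph_code (sys_graph k n rws) = concat (map (\<lambda>p. map (\<lambda>q. sys_edge k rws p q) ?V) ?V)" .
  have "2 ^ sys_exp (length ?V) - 1 + 2 ^ sys_exp (length ?V) * (k - 1) = k * b - 1"
    using k unfolding b_def by (cases k) (auto simp: algebra_simps)
  then have 2: "btrim (replicate (sys_exp (length ?V)) True @ bofnat (k - 1)) = binary (k * b - 1)"
    by (simp only: btrim bval_ones bval_bofnat)
  have 3: "btrim (replicate (sys_exp (length ?V)) False @ [True]) = binary b"
    by (simp add: btrim bval_zeros b_def)
  show ?thesis by (simp only: sys_code_def Let_def 1 2 3 instance_code_def)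
qed

lemma (in row_system) sys_code_iff:
  "sys_code k n rws \<in> spectral_degeneracy_problem \<longleftrightarrow> (\<nexists>X. solution X)"
proof -
  define b :: nat where "b = 2 ^ sys_exp (length (sys_verts k n rws))"
  let ?G = "sys_graph k n rws"
  have V: "pverts ?G = {0..<card (pverts ?G)}" by (simp add: sys_graph_def Let_def)
  have b: "0 < b" by (simp add: b_def)
  \<comment> \<open>This gives \<open>b \<ge> 2\<close>, so the numerator is positive even for
    \<open>k = 1\<close>.\<close>
  have "sys_exp (length (sys_verts k n rws)) \<ge> 1" using sys_size(1) unfolding sys_exp_def by linarith
  then have "2 ^ 1 \<le> b" unfolding b_def by (intro power_increasing) auto
  then have "2 \<le> b" by simp
  moreover have "1 * b \<le> k * b" using k by (intro mult_le_mono1) simp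
  then have "b \<le> k * b" by (simp only: mult_1)
  ultimately have a: "0 < k * b - 1" by linarith
  have "sys_code k n rws \<in> spectral_degeneracy_problem \<longleftrightarrow> spectrally_degenerate (real (k * b - 1) / real b) ?G"
  proof
    assume "sys_code k n rws \<in> spectral_degeneracy_problem"
    then obtain G a' b' where G: "sys_code k n rws = instance_code G a' b'" "simple_graph G" "pverts G = {0..<card (pverts G)}"
      "spectrally_degenerate (real a' / real b') G" by (auto simp: spectral_degeneracy_problem_def)
    have "G = ?G \<and> a' = k * b - 1 \<and> b' = b"
      by (rule instance_code_inject[OF G(2,3) simple_sys_graph V]) (use G(1) sys_code in \<open>simp add: b_def\<close>)
    then show "spectrally_degenerate (real (k * b - 1) / real b) ?G" using G(4) by simp
  next
    assume "spectrally_degenerate (real (k * b - 1) / real b) ?G"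
    then show "sys_code k n rws \<in> spectral_degeneracy_problem"
      unfolding spectral_degeneracy_problem_def using sys_code simple_sys_graph V a b unfolding b_def by blast
  qed
  then show ?thesis using sys_graph_degenerate_iff unfolding b_def by simp
qed

section \<open>Computations as propositional formulas\<close>

text \<open>
  A propositional variable is a quintuple: a kind, a time, and up to three further numbers. Position
  \<open>p\<close> of a tape stands for the cell \<open>p - T\<close>, where \<open>T\<close> is the number of steps. Apart from the guessed
  part of the input and the final clause all clauses are definite, so every satisfying assignment
  makes at least the variables true that describe the computation.
\<close>

type_synonym atom = "nat \<times> nat \<times> nat \<times> nat \<times> nat"
type_synonym cnf = "(bool \<times> atom) list list"

definition sat :: "(atom \<Rightarrow> bool) \<Rightarrow> cnf \<Rightarrow> bool" where
  "sat \<alpha> F \<longleftrightarrow> (\<forall>C\<in>set F. \<exists>l\<in>set C. \<alpha> (snd l) = fst l)"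

text \<open>In order: state, head position, cell content, scanned symbol, written symbol, head
  movement. The last three keep positions out of the transition clauses, where all tapes
  meet.\<close>

definition St :: "nat \<Rightarrow> nat \<Rightarrow> atom" where "St t q = (0, t, q, 0, 0)"
definition Hd :: "nat \<Rightarrow> nat \<Rightarrow> nat \<Rightarrow> atom" where "Hd t j p = (1, t, j, p, 0)"
definition Ce :: "nat \<Rightarrow> nat \<Rightarrow> nat \<Rightarrow> nat \<Rightarrow> atom" where "Ce t j p s = (2, t, j, p, s)"
definition Sc :: "nat \<Rightarrow> nat \<Rightarrow> nat \<Rightarrow> atom" where "Sc t j s = (3, t, j, s, 0)"
definition Wr :: "nat \<Rightarrow> nat \<Rightarrow> nat \<Rightarrow> atom" where "Wr t j s = (4, t, j, s, 0)"
definition Mv :: "nat \<Rightarrow> nat \<Rightarrow> nat \<Rightarrow> atom" where "Mv t j d = (5, t, j, d, 0)"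

lemmas atom_defs = St_def Hd_def Ce_def Sc_def Wr_def Mv_def

definition horn :: "atom list \<Rightarrow> atom \<Rightarrow> (bool \<times> atom) list" where
  "horn as b = map (Pair False) as @ [(True, b)]"

lemma sat_horn: "(\<exists>l\<in>set (horn as b). \<alpha> (snd l) = fst l) \<longleftrightarrow> ((\<forall>a\<in>set as. \<alpha> a) \<longrightarrow> \<alpha> b)"
  by (auto simp: horn_def)

lemma sat_append: "sat \<alpha> (F @ G) \<longleftrightarrow> sat \<alpha> F \<and> sat \<alpha> G"
  by (auto simp: sat_def)

lemma sat_Cons: "sat \<alpha> (C # F) \<longleftrightarrow> (\<exists>l\<in>set C. \<alpha> (snd l) = fst l) \<and> sat \<alpha> F"
  by (simp add: sat_def)

lemma sat_concat: "sat \<alpha> (concat (map f xs)) \<longleftrightarrow> (\<forall>x\<in>set xs. sat \<alpha> (f x))"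
  by (auto simp: sat_def)

lemma sat_map_horn: "sat \<alpha> (map (\<lambda>x. horn (f x) (g x)) xs) \<longleftrightarrow> (\<forall>x\<in>set xs. (\<forall>a\<in>set (f x). \<alpha> a) \<longrightarrow> \<alpha> (g x))"
  by (simp add: sat_def sat_horn)

text \<open>Offset by one, so that the new head position \<open>p + d - 1\<close> is computed within
  the natural numbers.\<close>

fun mvcode :: "move \<Rightarrow> nat" where
  "mvcode Left = 0"
| "mvcode Stay = 1"
| "mvcode Right = 2"

lemma move_head_mvcode: "move_head d h = h + int (mvcode d) - 1"
  by (cases d) auto

lemma mvcode_less: "mvcode d < 3"
  by (cases d) auto

text \<open>The halting state becomes an idle transition, as in \<open>tm_step\<close>, so that
  every configuration has a table entry.\<close>

definition dl :: "tm \<Rightarrow> nat \<Rightarrow> nat list \<Rightarrow> nat \<times> (nat \<times> move) list" where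
  "dl M q rs = (if q = tm_halt M then (q, noop rs) else tm_delta M q rs)"

text \<open>Depends on the machine only and is therefore a constant of the reduction, however
  large.\<close>

definition table :: "tm \<Rightarrow> (nat \<times> nat list \<times> nat \<times> (nat \<times> nat) list) list" where
  "table M = concat (map (\<lambda>q. map (\<lambda>rs. (q, rs, fst (dl M q rs), map (\<lambda>(s, d). (s, mvcode d)) (snd (dl M q rs))))
     (List.n_lists (tm_tapes M) [0..<tm_symbols M])) [0..<tm_states M])"

definition cook_init :: "nat \<Rightarrow> nat \<Rightarrow> nat \<Rightarrow> cnf" where
  "cook_init K q0 T = horn [] (St 0 q0) # map (\<lambda>j. horn [] (Hd 0 j T)) [0..<K] @
     concat (map (\<lambda>j. map (\<lambda>p. horn [] (Ce 0 (Suc j) p 0)) [0..<2 * T + 1]) [0..<K - 1])"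

text \<open>Behind the fixed word \<open>w\<close> there are \<open>P\<close> guessed cells. Each
  holds a blank or a bit, and a blank propagates to the right, so they spell a bit string of length
  at most \<open>P\<close> padded with blanks. The other positions up to \<open>2 * T\<close> are
  blank.\<close>

definition cook_input :: "bool list \<Rightarrow> nat \<Rightarrow> nat \<Rightarrow> cnf" where
  "cook_input w P T = map (\<lambda>p. horn [] (Ce 0 0 p 0)) [0..<T] @
     map (\<lambda>i. horn [] (Ce 0 0 (T + i) (if nthd False w i then 2 else 1))) [0..<length w] @
     map (\<lambda>i. horn [] (Ce 0 0 (T + length w + P + i) 0)) [0..<T + 1 - length w - P] @
     map (\<lambda>i. [(True, Ce 0 0 (T + length w + i) 0), (True, Ce 0 0 (T + length w + i) 1), (True, Ce 0 0 (T + length w + i) 2)]) [0..<P] @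
     map (\<lambda>i. horn [Ce 0 0 (T + length w + i) 0] (Ce 0 0 (T + length w + Suc i) 0)) [0..<P - 1]"

definition cook_scan :: "nat \<Rightarrow> nat \<Rightarrow> nat \<Rightarrow> cnf" where
  "cook_scan K S T = concat (map (\<lambda>t. concat (map (\<lambda>j. concat (map (\<lambda>p.
     map (\<lambda>s. horn [Hd t j p, Ce t j p s] (Sc t j s)) [0..<S]) [0..<2 * T + 1])) [0..<K])) [0..<T])"

definition cook_trans :: "nat \<Rightarrow> (nat \<times> nat list \<times> nat \<times> (nat \<times> nat) list) list \<Rightarrow> nat \<Rightarrow> cnf" where
  "cook_trans K tab T = concat (map (\<lambda>t. concat (map (\<lambda>e.
     (let pre = St t (fst e) # map (\<lambda>j. Sc t j (nthd 0 (fst (snd e)) j)) [0..<K]; as = snd (snd (snd e)) in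
      horn pre (St (Suc t) (fst (snd (snd e)))) #
      map (\<lambda>j. horn pre (Wr t j (fst (nthd (0, 0) as j)))) [0..<K] @
      map (\<lambda>j. horn pre (Mv t j (snd (nthd (0, 0) as j)))) [0..<K])) tab)) [0..<T])"

definition cook_write :: "nat \<Rightarrow> nat \<Rightarrow> nat \<Rightarrow> cnf" where
  "cook_write K S T = concat (map (\<lambda>t. concat (map (\<lambda>j. concat (map (\<lambda>p.
     map (\<lambda>s. horn [Hd t j p, Wr t j s] (Ce (Suc t) j p s)) [0..<S]) [0..<2 * T + 1])) [0..<K])) [0..<T])"

definition cook_move :: "nat \<Rightarrow> nat \<Rightarrow> cnf" where
  "cook_move K T = concat (map (\<lambda>t. concat (map (\<lambda>j. concat (map (\<lambda>p.
     map (\<lambda>d. horn [Hd t j p, Mv t j d] (Hd (Suc t) j (p + d - 1))) [0..<3]) [0..<2 * T + 1])) [0..<K])) [0..<T])"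

text \<open>That the head is away from \<open>p\<close> is expressed by a true position
  \<open>p' \<noteq> p\<close> instead of a negated head variable at \<open>p\<close>, which keeps
  the clauses definite.\<close>

definition cook_keep :: "nat \<Rightarrow> nat \<Rightarrow> nat \<Rightarrow> cnf" where
  "cook_keep K S T = concat (map (\<lambda>t. concat (map (\<lambda>j. concat (map (\<lambda>p. concat (map (\<lambda>p'.
     map (\<lambda>s. horn [Hd t j p', Ce t j p s] (Ce (Suc t) j p s)) [0..<S])
       (filter (\<lambda>p'. p' \<noteq> p) [0..<2 * T + 1]))) [0..<2 * T + 1])) [0..<K])) [0..<T])"

text \<open>The last clause forbids the symbol 1, the answer \<open>False\<close>, in cell 0 of the
  first tape at time \<open>T\<close>.\<close>

definition cook :: "tm \<Rightarrow> bool list \<Rightarrow> nat \<Rightarrow> nat \<Rightarrow> cnf" where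
  "cook M w P T = cook_init (tm_tapes M) (tm_start M) T @ cook_input w P T @
     cook_scan (tm_tapes M) (tm_symbols M) T @ cook_trans (tm_tapes M) (table M) T @
     cook_write (tm_tapes M) (tm_symbols M) T @ cook_move (tm_tapes M) T @
     cook_keep (tm_tapes M) (tm_symbols M) T @ [[(False, Ce T 0 T 1)]]"

lemma pt_atoms:
  "pt t \<Longrightarrow> pt q \<Longrightarrow> pt (\<lambda>x. St (t x) (q x))"
  "pt t \<Longrightarrow> pt j \<Longrightarrow> pt p \<Longrightarrow> pt (\<lambda>x. Hd (t x) (j x) (p x))"
  "pt t \<Longrightarrow> pt j \<Longrightarrow> pt p \<Longrightarrow> pt s \<Longrightarrow> pt (\<lambda>x. Ce (t x) (j x) (p x) (s x))"
  "pt t \<Longrightarrow> pt j \<Longrightarrow> pt s \<Longrightarrow> pt (\<lambda>x. Sc (t x) (j x) (s x))"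
  "pt t \<Longrightarrow> pt j \<Longrightarrow> pt s \<Longrightarrow> pt (\<lambda>x. Wr (t x) (j x) (s x))"
  "pt t \<Longrightarrow> pt j \<Longrightarrow> pt s \<Longrightarrow> pt (\<lambda>x. Mv (t x) (j x) (s x))"
  unfolding atom_defs by (intro pt_intros; assumption)+

lemma pt_horn:
  assumes "pt f" "pt g"
  shows "pt (\<lambda>x. horn (f x) (g x))"
  unfolding horn_def by (intro pt_intros assms)

lemma pt_cook:
  assumes "pt w" "pt P" "pt T"
  shows "pt (\<lambda>x. cook M (w x) (P x) (T x))"
proof (rule pt_comp3[OF _ assms])
  have T: "pt (\<lambda>p :: bool list \<times> nat \<times> nat. f (snd (snd p)))" if "pt f" for f :: "nat \<Rightarrow> cnf"
    by (rule pt_comp[OF that]) (intro pt_intros)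
  show "pt (\<lambda>p. cook M (fst p) (fst (snd p)) (snd (snd p)))"
    unfolding cook_def
  proof (intro pt_append T)
    show "pt (\<lambda>T. cook_init (tm_tapes M) (tm_start M) T)"
      unfolding cook_init_def by (intro pt_intros pt_atoms pt_horn)
    show "pt (\<lambda>p. cook_input (fst p) (fst (snd p)) (snd (snd p)))"
      unfolding cook_input_def by (intro pt_intros pt_atoms pt_horn)
    show "pt (\<lambda>T. cook_scan (tm_tapes M) (tm_symbols M) T)"
      unfolding cook_scan_def by (intro pt_intros pt_atoms pt_horn)
    show "pt (\<lambda>T. cook_trans (tm_tapes M) (table M) T)"
      unfolding cook_trans_def by (intro pt_intros pt_atoms pt_horn)
    show "pt (\<lambda>T. cook_write (tm_tapes M) (tm_symbols M) T)"
      unfolding cook_write_def by (intro pt_intros pt_atoms pt_horn)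
    show "pt (\<lambda>T. cook_move (tm_tapes M) T)"
      unfolding cook_move_def by (intro pt_intros pt_atoms pt_horn)
    show "pt (\<lambda>T. cook_keep (tm_tapes M) (tm_symbols M) T)"
      unfolding cook_keep_def by (intro pt_intros pt_atoms pt_horn)
    show "pt (\<lambda>T. [[(False, Ce T 0 T 1)]])"
      by (intro pt_intros pt_atoms pt_horn)
  qed
qed

subsection \<open>Correctness\<close>

definition head_pos :: "tm_config \<Rightarrow> nat \<Rightarrow> int" where "head_pos c j = fst (snd c ! j)"
definition cells :: "tm_config \<Rightarrow> nat \<Rightarrow> int \<Rightarrow> nat" where "cells c j = snd (snd c ! j)"

definition action :: "tm \<Rightarrow> tm_config \<Rightarrow> nat \<times> (nat \<times> move) list" where
  "action M c = dl M (fst c) (scan (snd c))"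

definition wf_config :: "tm \<Rightarrow> nat \<Rightarrow> tm_config \<Rightarrow> bool" where
  "wf_config M t c \<longleftrightarrow> fst c < tm_states M \<and> length (snd c) = tm_tapes M \<and>
     (\<forall>j<tm_tapes M. \<bar>head_pos c j\<bar> \<le> int t \<and> (\<forall>p. cells c j p < tm_symbols M))"

lemma scan_nth: "j < length (snd c) \<Longrightarrow> scan (snd c) ! j = cells c j (head_pos c j)"
  by (auto simp: scan_def cells_def head_pos_def split: prod.splits)

lemma length_scan: "length (scan ts) = length ts"
  by (simp add: scan_def)

context
  fixes M :: tm
  assumes M: "turing_machine M"
  notes upt_Suc [simp del]
begin

lemma action_wf:
  assumes "wf_config M t c"
  shows "fst (action M c) < tm_states M" "length (snd (action M c)) = tm_tapes M"
    "j < tm_tapes M \<Longrightarrow> fst (snd (action M c) ! j) < tm_symbols M"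
proof -
  have rs: "length (scan (snd c)) = tm_tapes M" "\<forall>r\<in>set (scan (snd c)). r < tm_symbols M"
    using assms by (auto simp: wf_config_def length_scan in_set_conv_nth scan_nth)
  have *: "fst (action M c) < tm_states M \<and> length (snd (action M c)) = tm_tapes M \<and> (\<forall>(s, d)\<in>set (snd (action M c)). s < tm_symbols M)"
  proof (cases "fst c = tm_halt M")
    case True
    then show ?thesis using rs assms by (auto simp: action_def dl_def noop_def wf_config_def)
  next
    case False
    have q: "fst c < tm_states M" using assms by (simp add: wf_config_def)
    have "\<forall>q rs. q < tm_states M \<and> length rs = tm_tapes M \<and> (\<forall>r\<in>set rs. r < tm_symbols M) \<longrightarrow>
        (case tm_delta M q rs of (q', as) \<Rightarrow>
           q' < tm_states M \<and> length as = tm_tapes M \<and> (\<forall>(s, d)\<in>set as. s < tm_symbols M))"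
      using M unfolding turing_machine_def by (elim conjE)
    from this[THEN spec, THEN spec, THEN mp, OF conjI[OF q conjI[OF rs]]] have "case tm_delta M (fst c) (scan (snd c)) of (q', as) \<Rightarrow>
           q' < tm_states M \<and> length as = tm_tapes M \<and> (\<forall>(s, d)\<in>set as. s < tm_symbols M)"
 .
    then show ?thesis using False by (simp add: action_def dl_def case_prod_beta)
  qed
  then show "fst (action M c) < tm_states M" "length (snd (action M c)) = tm_tapes M" by auto
  show "fst (snd (action M c) ! j) < tm_symbols M" if "j < tm_tapes M"
    using * that nth_mem[of j "snd (action M c)"] by (cases "snd (action M c) ! j") fastforce
qed

lemma step_eq: "tm_step M c = (fst (action M c), map2 tape_act (snd c) (snd (action M c)))"
  by (cases c) (simp add: tm_step_def action_def dl_def scan_def[symmetric] map2_tape_act_noop split: prod.splits)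

lemma step_facts:
  assumes c: "wf_config M t c" and j: "j < tm_tapes M"
  shows "head_pos (tm_step M c) j = head_pos c j + int (mvcode (snd (snd (action M c) ! j))) - 1"
    "cells (tm_step M c) j = (cells c j)(head_pos c j := fst (snd (action M c) ! j))"
  using c j action_wf(2)[OF c]
  by (auto simp: step_eq head_pos_def cells_def wf_config_def tape_act_def move_head_mvcode split: prod.splits)

lemma wf_step: "wf_config M t c \<Longrightarrow> wf_config M (Suc t) (tm_step M c)"
proof -
  assume c: "wf_config M t c"
  have "\<bar>head_pos (tm_step M c) j\<bar> \<le> int (Suc t) \<and> (\<forall>p. cells (tm_step M c) j p < tm_symbols M)" if j: "j < tm_tapes M" for j
  proof -
    have "\<bar>head_pos c j\<bar> \<le> int t" using c j by (auto simp: wf_config_def)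
    then have "\<bar>head_pos (tm_step M c) j\<bar> \<le> int (Suc t)"
      using mvcode_less[of "snd (snd (action M c) ! j)"] unfolding step_facts(1)[OF c j] by linarith
    then show ?thesis using c j action_wf(3)[OF c j] by (auto simp: step_facts(2)[OF c j] wf_config_def)
  qed
  moreover have "length (snd (tm_step M c)) = tm_tapes M"
    using c action_wf(2)[OF c] by (simp add: step_eq wf_config_def)
  moreover have "fst (tm_step M c) < tm_states M" using action_wf(1)[OF c] by (simp add: step_eq)
  ultimately show ?thesis by (simp add: wf_config_def)
qed

lemma init_facts:
  "fst (tm_init M z) = tm_start M" "j < tm_tapes M \<Longrightarrow> head_pos (tm_init M z) j = 0"
  "cells (tm_init M z) 0 = snd (input_tape z)" "Suc j < tm_tapes M \<Longrightarrow> cells (tm_init M z) (Suc j) = (\<lambda>_. 0)"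
  by (cases j; auto simp: tm_init_def head_pos_def cells_def input_tape_def blank_tape_def)+

lemma wf_init: "wf_config M 0 (tm_init M z)"
proof -
  have *: "1 \<le> tm_tapes M" "3 \<le> tm_symbols M" "tm_start M < tm_states M" using M by (auto simp: turing_machine_def)
  have "cells (tm_init M z) j p < tm_symbols M" if "j < tm_tapes M" for j p
    using that * init_facts(3)[where z = z] init_facts(4)[where z = z] by (cases j) (auto simp: input_tape_def bit_symbol_def)
  then show ?thesis using * by (auto simp: wf_config_def init_facts) (simp add: tm_init_def)
qed

lemma wf_run: "wf_config M t ((tm_step M ^^ t) (tm_init M z))"
  by (induction t) (auto intro: wf_init wf_step)

lemma table_mem:
  assumes "wf_config M t c"
  shows "(fst c, scan (snd c), fst (action M c), map (\<lambda>(s, d). (s, mvcode d)) (snd (action M c))) \<in> set (table M)"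
proof -
  have "fst c < tm_states M" "scan (snd c) \<in> set (List.n_lists (tm_tapes M) [0..<tm_symbols M])"
    using assms by (auto simp: wf_config_def set_n_lists length_scan in_set_conv_nth scan_nth)
  then show ?thesis by (auto simp: table_def action_def)
qed

text \<open>Induction along the run: definite clauses pass the atoms of each configuration on to the
  next, and further true atoms do no harm. At time \<open>t\<close> a head is within
  \<open>t\<close> cells of the origin, so the positions up to \<open>2 * T\<close> suffice.\<close>

lemma cook_dominates:
  assumes sat: "sat \<alpha> (cook M w P T)"
    and inp: "\<And>p. p \<le> 2 * T \<Longrightarrow> \<alpha> (Ce 0 0 p (snd (input_tape z) (int p - int T)))"
    and t: "t \<le> T"
  defines "c \<equiv> \<lambda>t. (tm_step M ^^ t) (tm_init M z)"
  shows "\<alpha> (St t (fst (c t))) \<and> (\<forall>j<tm_tapes M. \<alpha> (Hd t j (nat (head_pos (c t) j + T))) \<and>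
    (\<forall>p\<le>2 * T. \<alpha> (Ce t j p (cells (c t) j (int p - int T)))))"
  using t
proof (induction t)
  case 0
  have i: "sat \<alpha> (cook_init (tm_tapes M) (tm_start M) T)" using sat by (simp add: cook_def sat_append)
  have "\<alpha> (Ce 0 j p (cells (c 0) j (int p - int T)))" if "j < tm_tapes M" "p \<le> 2 * T" for j p
  proof (cases j)
    case 0
    then show ?thesis using inp[OF that(2)] by (simp add: c_def init_facts)
  next
    case (Suc j')
    have "\<forall>j\<in>set [0..<tm_tapes M - 1]. \<forall>p\<in>set [0..<2 * T + 1]. \<alpha> (Ce 0 (Suc j) p 0)"
      using i unfolding cook_init_def
      by (simp only: sat_append sat_Cons sat_concat sat_map_horn) simp
    then have "\<alpha> (Ce 0 (Suc j') p 0)" using Suc that by auto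
    then show ?thesis using Suc that by (simp add: c_def init_facts)
  qed
  moreover have "\<alpha> (St 0 (fst (c 0)))" using i by (simp add: c_def init_facts cook_init_def sat_def horn_def)
  moreover have "\<alpha> (Hd 0 j (nat (head_pos (c 0) j + T)))" if "j < tm_tapes M" for j
  proof -
    have "\<forall>j\<in>set [0..<tm_tapes M]. \<alpha> (Hd 0 j T)"
      using i unfolding cook_init_def by (simp only: sat_append sat_Cons sat_map_horn) simp
    then show ?thesis using that by (simp add: c_def init_facts)
  qed
  ultimately show ?case by blast
next
  case (Suc t)
  define ct where "ct = c t"
  have c': "c (Suc t) = tm_step M ct" by (simp add: c_def ct_def)
  have wf: "wf_config M t ct" unfolding ct_def c_def by (rule wf_run)
  have tT: "t < T" using Suc.prems by simp
  have IH: "\<alpha> (St t (fst ct))" "\<And>j. j < tm_tapes M \<Longrightarrow> \<alpha> (Hd t j (nat (head_pos ct j + T)))"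
    "\<And>j p. j < tm_tapes M \<Longrightarrow> p \<le> 2 * T \<Longrightarrow> \<alpha> (Ce t j p (cells ct j (int p - int T)))"
    using Suc.IH tT unfolding ct_def[symmetric] by auto
  define h where "h = (\<lambda>j. nat (head_pos ct j + T))"
  have h: "h j \<le> 2 * T" "int (h j) = head_pos ct j + T" if "j < tm_tapes M" for j
  proof -
    have "\<bar>head_pos ct j\<bar> \<le> int t" using wf that by (auto simp: wf_config_def)
    then show "h j \<le> 2 * T" "int (h j) = head_pos ct j + T" using tT by (auto simp: h_def)
  qed
  have sym: "cells ct j p < tm_symbols M" if "j < tm_tapes M" for j p using wf that by (auto simp: wf_config_def)
  have Sc: "\<alpha> (Sc t j (scan (snd ct) ! j))" if j: "j < tm_tapes M" for j
  proof -
    have "sat \<alpha> (cook_scan (tm_tapes M) (tm_symbols M) T)" using sat by (simp add: cook_def sat_append)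
    note sc = this[unfolded cook_scan_def sat_concat sat_map_horn, THEN bspec, THEN bspec, THEN bspec, THEN bspec, of t j "h j"]
    have "\<alpha> (Hd t j (h j)) \<longrightarrow> \<alpha> (Ce t j (h j) s) \<longrightarrow> \<alpha> (Sc t j s)" if "s < tm_symbols M" for s
      using sc[of s] that j tT h(1)[OF j] by simp
    moreover have "scan (snd ct) ! j = cells ct j (int (h j) - int T)"
      using wf j h(2)[OF j] by (simp add: scan_nth wf_config_def)
    ultimately show ?thesis using IH(2)[OF j] IH(3)[OF j h(1)[OF j]] sym[OF j] by (simp add: h_def)
  qed
  define as where "as = snd (action M ct)"
  have las: "length as = tm_tapes M" using action_wf(2)[OF wf] by (simp add: as_def)
  have len: "length (scan (snd ct)) = tm_tapes M" using wf by (simp add: wf_config_def length_scan)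
  have "sat \<alpha> (cook_trans (tm_tapes M) (table M) T)" using sat by (simp add: cook_def sat_append)
  then have tr: "sat \<alpha> (let pre = St t (fst ct) # map (\<lambda>j. Sc t j (nthd 0 (scan (snd ct)) j)) [0..<tm_tapes M];
      as' = map (\<lambda>(s, d). (s, mvcode d)) as in
      horn pre (St (Suc t) (fst (action M ct))) #
      map (\<lambda>j. horn pre (Wr t j (fst (nthd (0, 0) as' j)))) [0..<tm_tapes M] @
      map (\<lambda>j. horn pre (Mv t j (snd (nthd (0, 0) as' j)))) [0..<tm_tapes M])"
    using table_mem[OF wf] tT unfolding cook_trans_def sat_concat as_def[symmetric] by fastforce
  note tr = tr[unfolded Let_def sat_Cons sat_append sat_map_horn]
  have pre: "\<forall>a\<in>set (St t (fst ct) # map (\<lambda>j. Sc t j (nthd 0 (scan (snd ct)) j)) [0..<tm_tapes M]). \<alpha> a"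
    using IH(1) Sc len by (auto simp: nthd)
  have St': "\<alpha> (St (Suc t) (fst (action M ct)))"
    by (rule tr[THEN conjunct1, unfolded sat_horn, THEN mp, OF pre])
  have Wr: "\<alpha> (Wr t j (fst (as ! j)))" if "j < tm_tapes M" for j
  proof -
    have "\<alpha> (Wr t j (fst (nthd (0, 0) (map (\<lambda>(s, d). (s, mvcode d)) as) j)))"
      by (rule tr[THEN conjunct2, THEN conjunct1, THEN bspec, THEN mp, OF _ pre]) (use that in simp)
    then show ?thesis using that las by (simp add: nthd case_prod_beta)
  qed
  have Mv: "\<alpha> (Mv t j (mvcode (snd (as ! j))))" if "j < tm_tapes M" for j
  proof -
    have "\<alpha> (Mv t j (snd (nthd (0, 0) (map (\<lambda>(s, d). (s, mvcode d)) as) j)))"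
      by (rule tr[THEN conjunct2, THEN conjunct2, THEN bspec, THEN mp, OF _ pre]) (use that in simp)
    then show ?thesis using that las by (simp add: nthd case_prod_beta)
  qed
  show ?case
  proof (intro conjI allI impI)
    show "\<alpha> (St (Suc t) (fst (c (Suc t))))" using St' by (simp add: c' step_eq)
    fix j assume j: "j < tm_tapes M"
    show "\<alpha> (Hd (Suc t) j (nat (head_pos (c (Suc t)) j + T)))"
    proof -
      have "sat \<alpha> (cook_move (tm_tapes M) T)" using sat by (simp add: cook_def sat_append)
      note mv = this[unfolded cook_move_def sat_concat sat_map_horn, THEN bspec, THEN bspec, THEN bspec, THEN bspec, of t j "h j"]
      have "\<alpha> (Hd t j (h j)) \<longrightarrow> \<alpha> (Mv t j d) \<longrightarrow> \<alpha> (Hd (Suc t) j (h j + d - 1))" if "d < 3" for d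
        using mv[of d] that j tT h(1)[OF j] by simp
      from this[OF mvcode_less] have "\<alpha> (Hd (Suc t) j (h j + mvcode (snd (as ! j)) - 1))"
        using IH(2)[OF j] Mv[OF j] by (simp add: h_def)
      moreover have "nat (head_pos (c (Suc t)) j + T) = h j + mvcode (snd (as ! j)) - 1"
        using h(2)[OF j] unfolding c' step_facts(1)[OF wf j] as_def by linarith
      ultimately show ?thesis by simp
    qed
    fix p assume p: "p \<le> 2 * T"
    show "\<alpha> (Ce (Suc t) j p (cells (c (Suc t)) j (int p - int T)))"
    proof (cases "p = h j")
      case True
      have "sat \<alpha> (cook_write (tm_tapes M) (tm_symbols M) T)" using sat by (simp add: cook_def sat_append)
      note wr = this[unfolded cook_write_def sat_concat sat_map_horn, THEN bspec, THEN bspec, THEN bspec, THEN bspec, of t j p]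
      have "\<alpha> (Hd t j p) \<longrightarrow> \<alpha> (Wr t j s) \<longrightarrow> \<alpha> (Ce (Suc t) j p s)" if "s < tm_symbols M" for s
        using wr[of s] that j tT p by simp
      moreover have "fst (as ! j) < tm_symbols M" using action_wf(3)[OF wf j] by (simp add: as_def)
      ultimately have "\<alpha> (Ce (Suc t) j p (fst (as ! j)))" using IH(2)[OF j] Wr[OF j] True by (simp add: h_def)
      moreover have "cells (c (Suc t)) j (int p - int T) = fst (as ! j)"
        using h(2)[OF j] True unfolding c' step_facts(2)[OF wf j] as_def by simp
      ultimately show ?thesis by simp
    next
      case False
      have "sat \<alpha> (cook_keep (tm_tapes M) (tm_symbols M) T)" using sat by (simp add: cook_def sat_append)
      note keep = this[unfolded cook_keep_def sat_concat sat_map_horn, THEN bspec, THEN bspec, THEN bspec, THEN bspec, THEN bspec, of t j p "h j"]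
      have "\<alpha> (Hd t j (h j)) \<longrightarrow> \<alpha> (Ce t j p s) \<longrightarrow> \<alpha> (Ce (Suc t) j p s)" if "s < tm_symbols M" for s
        using keep[of s] that j tT p h(1)[OF j] False by simp
      moreover have "cells (c (Suc t)) j (int p - int T) = cells ct j (int p - int T)"
        using h(2)[OF j] False unfolding c' step_facts(2)[OF wf j] by auto
      ultimately show ?thesis using IH(2)[OF j] IH(3)[OF j p] sym[OF j] by (simp add: h_def)
    qed
  qed
qed

definition run_atom :: "nat \<Rightarrow> bool list \<Rightarrow> atom \<Rightarrow> bool" where
  "run_atom T z = (\<lambda>(m, t, j, p, s). let c = (tm_step M ^^ t) (tm_init M z) in
     if m = 0 then j = fst c
     else if m = 1 then int p - int T = head_pos c j
     else if m = 2 then s = cells c j (int p - int T)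
     else if m = 3 then p = scan (snd c) ! j
     else if m = 4 then p = fst (snd (action M c) ! j)
     else p = mvcode (snd (snd (action M c) ! j)))"

lemma table_entry:
  assumes "e \<in> set (table M)"
  shows "\<exists>q rs. e = (q, rs, fst (dl M q rs), map (\<lambda>(s, d). (s, mvcode d)) (snd (dl M q rs))) \<and> length rs = tm_tapes M"
  using assms by (auto simp: table_def set_n_lists)

lemma run_atom_sat:
  assumes inp: "sat (run_atom T z) (cook_input w P T)"
    and fin: "cells ((tm_step M ^^ T) (tm_init M z)) 0 0 \<noteq> 1"
  shows "sat (run_atom T z) (cook M w P T)"
proof -
  let ?a = "run_atom T z"
  let ?c = "\<lambda>t. (tm_step M ^^ t) (tm_init M z)"
  have wf: "wf_config M t (?c t)" for t by (rule wf_run)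
  have St: "?a (St t q) \<longleftrightarrow> q = fst (?c t)" for t q by (simp add: run_atom_def St_def)
  have Hd: "?a (Hd t j p) \<longleftrightarrow> int p - int T = head_pos (?c t) j" for t j p by (simp add: run_atom_def Hd_def)
  have Ce: "?a (Ce t j p s) \<longleftrightarrow> s = cells (?c t) j (int p - int T)" for t j p s by (simp add: run_atom_def Ce_def)
  have Sc: "?a (Sc t j s) \<longleftrightarrow> s = scan (snd (?c t)) ! j" for t j s by (simp add: run_atom_def Sc_def)
  have Wr: "?a (Wr t j s) \<longleftrightarrow> s = fst (snd (action M (?c t)) ! j)" for t j s by (simp add: run_atom_def Wr_def)
  have Mv: "?a (Mv t j s) \<longleftrightarrow> s = mvcode (snd (snd (action M (?c t)) ! j))" for t j s by (simp add: run_atom_def Mv_def)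
  have 1: "sat ?a (cook_init (tm_tapes M) (tm_start M) T)"
    by (auto simp: cook_init_def sat_def horn_def St Hd Ce init_facts)
  have len: "length (snd (?c t)) = tm_tapes M" for t using wf[of t] by (simp add: wf_config_def)
  have 2: "sat ?a (cook_scan (tm_tapes M) (tm_symbols M) T)"
    unfolding cook_scan_def sat_concat sat_map_horn by (auto simp: Hd Ce Sc scan_nth len)
  have 3: "sat ?a (cook_write (tm_tapes M) (tm_symbols M) T)"
    unfolding cook_write_def sat_concat sat_map_horn by (auto simp: Hd Ce Wr step_facts(2)[OF wf])
  have 4: "sat ?a (cook_move (tm_tapes M) T)"
  proof -
    have "int (p + d - 1) - int T = head_pos (tm_step M (?c t)) j"
      if "j < tm_tapes M" "t < T" "int p - int T = head_pos (?c t) j" "d = mvcode (snd (snd (action M (?c t)) ! j))" for t j p d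
    proof -
      have "\<bar>head_pos (?c t) j\<bar> \<le> int t" using wf[of t] that(1) by (auto simp: wf_config_def)
      \<comment> \<open>Before time \<open>T\<close> no head has reached position 0, so the
        truncated subtraction in \<open>cook_move\<close> is exact.\<close>
      then have "1 \<le> p" using that by linarith
      then show ?thesis unfolding step_facts(1)[OF wf that(1)] that(4)[symmetric] using that(3) by linarith
    qed
    then show ?thesis unfolding cook_move_def sat_concat sat_map_horn by (auto simp: Hd Mv)
  qed
  have 5: "sat ?a (cook_keep (tm_tapes M) (tm_symbols M) T)"
  proof -
    have "cells (tm_step M (?c t)) j (int p - int T) = cells (?c t) j (int p - int T)"
      if "j < tm_tapes M" "int p' - int T = head_pos (?c t) j" "p' \<noteq> p" for t j p p'
      using that unfolding step_facts(2)[OF wf that(1)] by auto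
    then show ?thesis unfolding cook_keep_def sat_concat sat_map_horn by (auto simp: Hd Ce)
  qed
  have 6: "sat ?a (cook_trans (tm_tapes M) (table M) T)"
    unfolding cook_trans_def sat_concat
  proof (intro ballI)
    fix t e assume "e \<in> set (table M)"
    then obtain q rs where e: "e = (q, rs, fst (dl M q rs), map (\<lambda>(s, d). (s, mvcode d)) (snd (dl M q rs)))" "length rs = tm_tapes M"
      using table_entry by blast
    let ?pre = "St t q # map (\<lambda>j. Sc t j (nthd 0 rs j)) [0..<tm_tapes M]"
    have pre: "q = fst (?c t) \<and> rs = scan (snd (?c t))" if "\<forall>a\<in>set ?pre. ?a a"
    proof
      show "q = fst (?c t)" using that by (simp add: St)
      show "rs = scan (snd (?c t))"
        by (rule nth_equalityI) (use that e(2) len in \<open>auto simp: length_scan Sc nthd\<close>)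
    qed
    have lact: "length (snd (action M (?c t))) = tm_tapes M" by (rule action_wf(2)[OF wf])
    show "sat ?a (let pre = St t (fst e) # map (\<lambda>j. Sc t j (nthd 0 (fst (snd e)) j)) [0..<tm_tapes M]; as = snd (snd (snd e)) in
      horn pre (St (Suc t) (fst (snd (snd e)))) #
      map (\<lambda>j. horn pre (Wr t j (fst (nthd (0, 0) as j)))) [0..<tm_tapes M] @
      map (\<lambda>j. horn pre (Mv t j (snd (nthd (0, 0) as j)))) [0..<tm_tapes M])"
    proof (cases "\<forall>a\<in>set ?pre. ?a a")
      case False
      then show ?thesis unfolding sat_def Let_def by (auto simp: e(1) sat_horn)
    next
      case True
      note p = pre[OF True]
      have d: "dl M q rs = action M (?c t)" using p by (simp add: action_def)
      show ?thesis unfolding sat_def Let_def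
        by (auto simp: e(1) sat_horn d St Wr Mv nthd lact case_prod_beta step_eq)
    qed
  qed
  have 7: "sat ?a [[(False, Ce T 0 T 1)]]" using fin by (simp add: sat_def Ce)
  show ?thesis unfolding cook_def sat_append using 1 2 3 4 5 6 7 inp by blast
qed

lemma pair_code_append: "pair_code x u = pair_code x [] @ u"
  by (simp add: pair_code_def)

text \<open>A satisfying assignment yields a certificate, read off the guessed cells, and contains
  the run on it; the final clause then excludes rejection. Conversely an accepting run is a model.
  The bound on \<open>T\<close> places the whole input inside the described positions.\<close>

theorem cook_correct:
  fixes x :: "bool list"
  defines "w \<equiv> pair_code x []"
  assumes out: "\<And>u. length u \<le> P \<Longrightarrow> tm_outputs_within M (pair_code x u) T [pair_code x u \<in> R]"
    and T: "length w + P \<le> T"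
  shows "(\<exists>\<alpha>. sat \<alpha> (cook M w P T)) \<longleftrightarrow> (\<exists>u. length u \<le> P \<and> pair_code x u \<in> R)"
proof -
  have tapes: "1 \<le> tm_tapes M" using M by (simp add: turing_machine_def)
  have final: "cells ((tm_step M ^^ T) (tm_init M (pair_code x u))) 0 0 = bit_symbol (pair_code x u \<in> R)" if "length u \<le> P" for u
  proof -
    let ?c = "(tm_step M ^^ T) (tm_init M (pair_code x u))"
    have "length (snd ?c) = tm_tapes M" using wf_run[of T "pair_code x u"] by (simp add: wf_config_def)
    then have "hd (snd ?c) = snd ?c ! 0" using tapes by (cases "snd ?c") auto
    moreover have "holds_output (hd (snd ?c)) [pair_code x u \<in> R]"
      using out[OF that] by (simp add: tm_outputs_within_def case_prod_beta)
    ultimately show ?thesis by (auto simp: holds_output_def cells_def split: prod.splits)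
  qed
  have inp: "snd (input_tape (pair_code x u)) (int p - int T) =
    (if p < T then 0 else if p < T + length w then bit_symbol (w ! (p - T))
     else if p < T + length w + length u then bit_symbol (u ! (p - T - length w)) else 0)" for u p
  proof (cases "T \<le> p")
    case True
    then obtain i where "p = T + i" by (auto simp: le_iff_add)
    then show ?thesis unfolding pair_code_append[of x u] w_def[symmetric]
      by (simp add: input_tape_def nth_append not_less)
  next
    case False
    then show ?thesis by (simp add: input_tape_def)
  qed
  show ?thesis
  proof
    assume "\<exists>\<alpha>. sat \<alpha> (cook M w P T)"
    then obtain \<alpha> where sat: "sat \<alpha> (cook M w P T)" by blast
    have i: "sat \<alpha> (cook_input w P T)" using sat by (simp add: cook_def sat_append)
    define g where "g = (\<lambda>i s. \<alpha> (Ce 0 0 (T + length w + i) s))"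
    \<comment> \<open>An assignment may allow several symbols in one cell. The certificate ends at
      the first guessed cell that may be blank; before it, a cell counts as \<open>True\<close> if
      it may hold 2, and otherwise it must allow 1.\<close>
    define l where "l = (if \<exists>i<P. g i 0 then LEAST i. i < P \<and> g i 0 else P)"
    have some: "g i 0 \<or> g i 1 \<or> g i 2" if "i < P" for i
      using i that unfolding cook_input_def sat_append by (auto simp: sat_def g_def)
    have chain: "g i 0 \<Longrightarrow> g (Suc i) 0" if "Suc i < P" for i
      using i that unfolding cook_input_def sat_append by (auto simp: sat_map_horn g_def)
    have lP: "l \<le> P" unfolding l_def using LeastI_ex[of "\<lambda>i. i < P \<and> g i 0"] by (auto intro: less_imp_le)
    have lt: "\<not> g i 0" if "i < l" for i
    proof
      assume "g i 0"
      then have "i < P \<and> g i 0" using that lP by simp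
      then have "l \<le> i" unfolding l_def by (auto intro: Least_le)
      then show False using that by simp
    qed
    have ge: "g i 0" if "l \<le> i" "i < P" for i
      using that
    proof (induction i rule: dec_induct)
      case base
      then have "\<exists>i<P. g i 0" unfolding l_def by (auto split: if_splits)
      then show ?case unfolding l_def using LeastI_ex[of "\<lambda>i. i < P \<and> g i 0"] by auto
    next
      case (step i)
      then show ?case using chain[of i] by simp
    qed
    define u where "u = map (\<lambda>i. g i 2) [0..<l]"
    have lu: "length u = l" by (simp add: u_def)
    have "\<alpha> (Ce 0 0 p (snd (input_tape (pair_code x u)) (int p - int T)))" if p: "p \<le> 2 * T" for p
    proof -
      consider "p < T" | "T \<le> p" "p < T + length w" | "T + length w \<le> p" "p < T + length w + l"
        | "T + length w + l \<le> p" "p < T + length w + P" | "T + length w + P \<le> p" by linarith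
      then show ?thesis
      proof cases
        case 1
        then show ?thesis using i unfolding cook_input_def sat_append inp by (auto simp: sat_map_horn)
      next
        case 2
        then obtain i' where "p = T + i'" "i' < length w" by (metis add_less_cancel_left le_Suc_ex)
        then show ?thesis using i unfolding cook_input_def sat_append inp
          by (auto simp: sat_map_horn nthd bit_symbol_def)
      next
        case 3
        then obtain i' where i': "p = T + length w + i'" "i' < l" by (metis add_less_cancel_left le_Suc_ex)
        then have "g i' 1 \<or> g i' 2" using some[of i'] lt[of i'] lP by auto
        then show ?thesis using i' unfolding inp lu by (auto simp: u_def bit_symbol_def g_def)
      next
        case 4
        then obtain i' where i': "p = T + length w + i'" by (metis le_Suc_ex add.assoc)
        then have "g i' 0" using 4 by (intro ge) auto
        then show ?thesis using 4 i' unfolding inp lu by (auto simp: g_def)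
      next
        case 5
        then obtain i' where i': "p = T + length w + P + i'" by (metis le_Suc_ex)
        then have "i' < T + 1 - length w - P" using p by linarith
        then show ?thesis using i lP i' unfolding cook_input_def sat_append inp lu by (auto simp: sat_map_horn)
      qed
    qed
    from cook_dominates[OF sat this order_refl] have "0 < tm_tapes M \<longrightarrow> T \<le> 2 * T \<longrightarrow>
        \<alpha> (Ce T 0 T (cells ((tm_step M ^^ T) (tm_init M (pair_code x u))) 0 (int T - int T)))" by blast
    then have "\<alpha> (Ce T 0 T (cells ((tm_step M ^^ T) (tm_init M (pair_code x u))) 0 0))"
      using tapes by simp
    then have "\<alpha> (Ce T 0 T (bit_symbol (pair_code x u \<in> R)))" using final[of u] lP lu by simp
    moreover have "\<not> \<alpha> (Ce T 0 T 1)" using sat by (simp add: cook_def sat_append) (simp add: sat_def)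
    ultimately have "pair_code x u \<in> R" by (auto simp: bit_symbol_def split: if_splits)
    then show "\<exists>u. length u \<le> P \<and> pair_code x u \<in> R" using lP lu by auto
  next
    assume "\<exists>u. length u \<le> P \<and> pair_code x u \<in> R"
    then obtain u where u: "length u \<le> P" "pair_code x u \<in> R" by blast
    let ?z = "pair_code x u"
    have Ce: "run_atom T ?z (Ce 0 0 p s) \<longleftrightarrow> s = snd (input_tape ?z) (int p - int T)" for p s
      by (simp add: run_atom_def Ce_def init_facts)
    have b: "snd (input_tape ?z) i \<in> {0, 1, 2}" for i by (simp add: input_tape_def bit_symbol_def)
    have "sat (run_atom T ?z) (cook_input w P T)"
      unfolding cook_input_def sat_append
    proof (intro conjI)
      show "sat (run_atom T ?z) (map (\<lambda>p. horn [] (Ce 0 0 p 0)) [0..<T])"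
        by (auto simp: sat_map_horn Ce inp)
      show "sat (run_atom T ?z) (map (\<lambda>i. horn [] (Ce 0 0 (T + i) (if nthd False w i then 2 else 1))) [0..<length w])"
      proof -
        have "snd (input_tape ?z) (int i) = bit_symbol (w ! i)" if "i < length w" for i
          using inp[of u "T + i"] that by simp
        then show ?thesis by (auto simp: sat_map_horn Ce nthd bit_symbol_def)
      qed
      show "sat (run_atom T ?z) (map (\<lambda>i. horn [] (Ce 0 0 (T + length w + P + i) 0)) [0..<T + 1 - length w - P])"
        using u(1) by (simp only: sat_map_horn Ce inp) auto
      show "sat (run_atom T ?z) (map (\<lambda>i. [(True, Ce 0 0 (T + length w + i) 0), (True, Ce 0 0 (T + length w + i) 1), (True, Ce 0 0 (T + length w + i) 2)]) [0..<P])"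
        unfolding sat_def
      proof
        fix C assume "C \<in> set (map (\<lambda>i. [(True, Ce 0 0 (T + length w + i) 0), (True, Ce 0 0 (T + length w + i) 1), (True, Ce 0 0 (T + length w + i) 2)]) [0..<P])"
        then obtain i where C: "C = [(True, Ce 0 0 (T + length w + i) 0), (True, Ce 0 0 (T + length w + i) 1), (True, Ce 0 0 (T + length w + i) 2)]"
          by auto
        show "\<exists>l\<in>set C. run_atom T ?z (snd l) = fst l"
          using b[of "int (T + length w + i) - int T"] unfolding C
          by (simp only: list.set bex_simps fst_conv snd_conv Ce) auto
      qed
      show "sat (run_atom T ?z) (map (\<lambda>i. horn [Ce 0 0 (T + length w + i) 0] (Ce 0 0 (T + length w + Suc i) 0)) [0..<P - 1])"
        by (simp only: sat_map_horn Ce inp list.set ball_simps) (auto simp: bit_symbol_def)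
    qed
    then have "sat (run_atom T ?z) (cook M w P T)"
      using final[OF u(1)] u(2) by (intro run_atom_sat) (simp_all add: bit_symbol_def)
    then show "\<exists>\<alpha>. sat \<alpha> (cook M w P T)" by blast
  qed
qed

end

section \<open>From formulas to row systems\<close>

definition idx :: "'a list \<Rightarrow> 'a \<Rightarrow> nat" where
  "idx vs v = nthd 0 (filter (\<lambda>i. nthd v vs i = v) [0..<length vs]) 0"

lemma idx:
  assumes "v \<in> set vs"
  shows "idx vs v < length vs" "vs ! idx vs v = v"
proof -
  obtain i where i: "i < length vs" "vs ! i = v" using assms by (auto simp: in_set_conv_nth)
  let ?f = "filter (\<lambda>i. nthd v vs i = v) [0..<length vs]"
  have "i \<in> set ?f" using i by (simp add: nthd)
  then have "0 < length ?f" by (cases ?f) auto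
  then have "idx vs v \<in> set ?f" unfolding idx_def nthd[of 0 ?f] using nth_mem by (simp only: if_True)
  then show "idx vs v < length vs" "vs ! idx vs v = v" by (auto simp: nthd)
qed

lemma idx_nth: "distinct vs \<Longrightarrow> i < length vs \<Longrightarrow> idx vs (vs ! i) = i"
  using idx[of "vs ! i" vs] by (simp add: nth_eq_iff_index_eq)

definition number :: "'a list list \<Rightarrow> nat list list" where
  "number rws = (let vs = nubs (concat rws) in map (map (idx vs)) rws)"

definition system_code :: "nat \<Rightarrow> 'a list list \<Rightarrow> bool list" where
  "system_code k rws = sys_code k (length (nubs (concat rws))) (number rws)"

text \<open>Numbering the occurring variables by their position in \<open>nubs\<close> preserves all
  counts, so the solvability of the numbered and the original system agree.\<close>

lemma system_code_iff:
  assumes occ: "\<And>v. length (filter (\<lambda>u. u = v) (concat rws)) < k" and ne: "concat rws \<noteq> []"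
  shows "system_code k rws \<in> spectral_degeneracy_problem \<longleftrightarrow>
    (\<nexists>X. X \<noteq> {} \<and> X \<subseteq> set (concat rws) \<and> (\<forall>rw\<in>set rws. length (filter (\<lambda>v. v \<in> X) rw) \<in> {0, k}))"
proof -
  define vs where "vs = nubs (concat rws)"
  have vs: "distinct vs" "set vs = set (concat rws)" by (simp_all add: vs_def nubs)
  have num: "number rws = map (map (idx vs)) rws" by (simp add: number_def Let_def vs_def)
  have mem: "v \<in> set vs" if "rw \<in> set rws" "v \<in> set rw" for rw v using that vs(2) by auto
  interpret row_system k "length vs" "number rws"
  proof
    show "set rw \<subseteq> {..<length vs}" if "rw \<in> set (number rws)" for rw
      using that idx(1)[OF mem] by (auto simp: num)
    show "colsum (number rws) i < k" if i: "i < length vs" for i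
    proof -
      have "colsum (number rws) i = length (filter (\<lambda>u. idx vs u = i) (concat rws))"
        by (simp add: colsum_def num map_concat[symmetric] filter_map comp_def)
      also have "filter (\<lambda>u. idx vs u = i) (concat rws) = filter (\<lambda>u. u = vs ! i) (concat rws)"
      proof (rule filter_cong[OF refl])
        fix u assume "u \<in> set (concat rws)"
        then have "vs ! idx vs u = u" using vs(2) by (intro idx) simp
        then show "idx vs u = i \<longleftrightarrow> u = vs ! i" using idx_nth[OF vs(1) i] by metis
      qed
      finally show ?thesis using occ by simp
    qed
    show "0 < k" using occ[of undefined] by linarith
    show "0 < length vs" using ne vs(2) by (cases vs) auto
  qed
  have cnt: "length (filter (\<lambda>j. j \<in> X) (map (idx vs) rw)) = length (filter (\<lambda>v. idx vs v \<in> X) rw)" for X rw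
    by (simp add: filter_map comp_def)
  have sol: "solution X \<longleftrightarrow> X \<noteq> {} \<and> X \<subseteq> {..<length vs} \<and> (\<forall>rw\<in>set rws. length (filter (\<lambda>v. idx vs v \<in> X) rw) \<in> {0, k})" for X
    unfolding solution_def unfolding num by (simp only: set_map ball_simps cnt)
  have "(\<exists>X. solution X) \<longleftrightarrow>
    (\<exists>X. X \<noteq> {} \<and> X \<subseteq> set (concat rws) \<and> (\<forall>rw\<in>set rws. length (filter (\<lambda>v. v \<in> X) rw) \<in> {0, k}))"
  proof
    assume "\<exists>X. solution X"
    then obtain X where X: "X \<noteq> {}" "X \<subseteq> {..<length vs}" "\<And>rw. rw \<in> set rws \<Longrightarrow> length (filter (\<lambda>v. idx vs v \<in> X) rw) \<in> {0, k}"
      unfolding sol by blast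
    let ?Y = "(!) vs ` X"
    have "idx vs v \<in> X \<longleftrightarrow> v \<in> ?Y" if "v \<in> set vs" for v
      using that X(2) idx[OF that] idx_nth[OF vs(1)] by (auto simp: image_iff) (metis idx(2))
    then have "filter (\<lambda>v. idx vs v \<in> X) rw = filter (\<lambda>v. v \<in> ?Y) rw" if "rw \<in> set rws" for rw
      using mem[OF that] by (intro filter_cong) auto
    then have "\<forall>rw\<in>set rws. length (filter (\<lambda>v. v \<in> ?Y) rw) \<in> {0, k}" using X(3) by simp
    moreover have "?Y \<subseteq> set vs" using X(2) by auto
    ultimately show "\<exists>X. X \<noteq> {} \<and> X \<subseteq> set (concat rws) \<and> (\<forall>rw\<in>set rws. length (filter (\<lambda>v. v \<in> X) rw) \<in> {0, k})"
      using X(1) vs(2) by (intro exI[of _ ?Y]) simp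
  next
    assume "\<exists>X. X \<noteq> {} \<and> X \<subseteq> set (concat rws) \<and> (\<forall>rw\<in>set rws. length (filter (\<lambda>v. v \<in> X) rw) \<in> {0, k})"
    then obtain X where X: "X \<noteq> {}" "X \<subseteq> set vs" "\<And>rw. rw \<in> set rws \<Longrightarrow> length (filter (\<lambda>v. v \<in> X) rw) \<in> {0, k}"
      unfolding vs(2) by blast
    let ?Y = "idx vs ` X"
    have "idx vs v \<in> ?Y \<longleftrightarrow> v \<in> X" if "v \<in> set vs" for v
    proof
      assume "idx vs v \<in> ?Y"
      then obtain u where u: "u \<in> X" "idx vs v = idx vs u" by auto
      then have "v = u" using idx(2)[OF that] idx(2)[of u vs] X(2) by auto
      then show "v \<in> X" using u by simp
    qed simp
    then have "filter (\<lambda>v. idx vs v \<in> ?Y) rw = filter (\<lambda>v. v \<in> X) rw" if "rw \<in> set rws" for rw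
      using mem[OF that] by (intro filter_cong) auto
    then have "\<forall>rw\<in>set rws. length (filter (\<lambda>v. idx vs v \<in> ?Y) rw) \<in> {0, k}" using X(3) by simp
    moreover have "?Y \<subseteq> {..<length vs}" using X(2) idx(1) by fastforce
    ultimately have "solution ?Y" using X(1) unfolding sol by blast
    then show "\<exists>X. solution X" by blast
  qed
  then show ?thesis unfolding system_code_def vs_def[symmetric] sys_code_iff by simp
qed

lemma pt_system_code:
  assumes "pt (\<lambda>q :: 'b::enc \<times> 'b. fst q = snd q)" "pt k" "pt (r :: 'a::enc \<Rightarrow> 'b list list)"
  shows "pt (\<lambda>x. system_code (k x) (r x))"
proof (rule pt_comp2[OF _ assms(2,3)])
  have "pt (\<lambda>p :: 'b list \<times> 'b. idx (fst p) (snd p))"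
    unfolding idx_def by (intro pt_intros pt_comp2[OF assms(1)])
  note i = pt_comp2[OF this]
  have "pt (\<lambda>r :: 'b list list. number r)"
    unfolding number_def by (intro pt_intros pt_nubs assms(1) i)
  note n = pt_comp[OF this]
  show "pt (\<lambda>p :: nat \<times> 'b list list. system_code (fst p) (snd p))"
    unfolding system_code_def by (intro pt_sys_code pt_intros pt_nubs assms(1) n)
qed

section \<open>Exactly-m constraints as rows\<close>

text \<open>
  A constraint \<open>(m, S)\<close> demands that exactly \<open>m\<close> entries of the list \<open>S\<close> are selected. Doubling \<open>S\<close>
  and padding the row with \<open>k - 2 m\<close> copies of a switch turns this into a row with count \<open>0\<close> or \<open>k\<close>.
  The last row forces all switches to agree, and if all are off then nothing is selected.
\<close>

definition row_bound :: "(nat \<times> 'v list) list \<Rightarrow> nat" where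
  "row_bound cs = 2 * length (concat (map snd cs)) + length cs + 2"

text \<open>The first components keep the entries apart: 0 for variables, \<open>c + 2\<close> for
  the switch of constraint \<open>c\<close> and 1 for the filler of the last row; \<open>z\<close>
  is a dummy.\<close>

definition constraint_rows :: "'v \<Rightarrow> (nat \<times> 'v list) list \<Rightarrow> (nat \<times> 'v) list list" where
  "constraint_rows z cs = (let k = row_bound cs in
     map (\<lambda>c. let e = nthd (0, []) cs c; S = map (Pair 0) (snd e) in S @ S @ replicate (k - 2 * fst e) (c + 2, z)) [0..<length cs] @
     [map (\<lambda>c. (c + 2, z)) [0..<length cs] @ replicate (k - length cs) (1, z)])"

definition exactly :: "(nat \<times> 'v list) list \<Rightarrow> 'v set \<Rightarrow> bool" where
  "exactly cs A \<longleftrightarrow> (\<forall>e\<in>set cs. length (filter (\<lambda>v. v \<in> A) (snd e)) = fst e)"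

context
  fixes cs :: "(nat \<times> 'v list) list" and z :: 'v
  assumes cs: "\<And>e. e \<in> set cs \<Longrightarrow> 1 \<le> fst e \<and> fst e \<le> length (snd e)"
begin

lemma size_constraint: "e \<in> set cs \<Longrightarrow> 2 * length (snd e) < row_bound cs"
proof -
  assume "e \<in> set cs"
  then have "length (snd e) \<le> length (concat (map snd cs))"
    unfolding length_concat by (intro member_le_sum_list) auto
  then show ?thesis by (simp add: row_bound_def)
qed

text \<open>Variables occur at most twice the total length of the constraints, and the filler occurs
  \<open>k - length cs\<close> times. A switch occurs \<open>k - 2 m\<close> times in its own row
  and once in the last row, fewer than \<open>k\<close> times as \<open>m \<ge> 1\<close>; without
  the doubling, \<open>k - m + 1\<close> would reach \<open>k\<close> for
  \<open>m = 1\<close>.\<close>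

lemma count_constraint_rows:
  assumes "cs \<noteq> []"
  shows "length (filter (\<lambda>u. u = v) (concat (constraint_rows z cs))) < row_bound cs"
proof -
  let ?k = "row_bound cs" and ?n = "length cs"
  let ?S = "\<lambda>c. map (Pair (0::nat)) (snd (cs ! c))"
  have n: "0 < ?n" "?n + 2 \<le> ?k" using assms by (simp_all add: row_bound_def)
  have rows: "constraint_rows z cs = map (\<lambda>c. ?S c @ ?S c @ replicate (?k - 2 * fst (cs ! c)) (c + 2, z)) [0..<?n] @
     [map (\<lambda>c. (c + 2, z)) [0..<?n] @ replicate (?k - ?n) (1, z)]"
    by (simp add: constraint_rows_def Let_def nthd)
  have rep: "length (filter (\<lambda>u. u = v) (replicate a b)) = (if b = v then a else 0)" for a and b :: "nat \<times> 'v" by simp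
  have cnt: "length (filter (\<lambda>u. u = v) (concat (constraint_rows z cs))) =
    (\<Sum>c<?n. 2 * length (filter (\<lambda>u. u = v) (?S c)) + (if (c + 2, z) = v then ?k - 2 * fst (cs ! c) else 0)) +
    card {c. c < ?n \<and> (c + 2, z) = v} + (if (1, z) = v then ?k - ?n else 0)"
  proof -
    have "length (filter (\<lambda>u. u = v) (map (\<lambda>c. (c + 2, z)) [0..<?n])) = card {c. c < ?n \<and> (c + 2, z) = v}"
      by (simp only: filter_map length_map length_filter_conv_card comp_def length_upt)
        (intro arg_cong[of _ _ card], auto)
    moreover have "length (filter (\<lambda>u. u = v) (concat (map g [0..<?n]))) = (\<Sum>c<?n. length (filter (\<lambda>u. u = v) (g c)))" for g
      by (simp add: filter_concat length_concat comp_def interv_sum_list_conv_sum_set_nat atLeast0LessThan)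
    ultimately show ?thesis unfolding rows concat_append filter_append length_append
      by (simp only: concat.simps append_Nil2 filter_append length_append rep) (simp add: mult_2)
  qed
  consider (var) u where "v = (0, u)" | (last) "fst v = 1" | (switch) d where "v = (d + 2, snd v)"
  proof (cases "fst v")
    case 0 then show ?thesis using var by (metis prod.collapse)
  next
    case (Suc d)
    then show ?thesis using last switch by (cases d) (auto simp: prod_eq_iff)
  qed
  then show ?thesis
  proof cases
    case var
    have "(\<Sum>c<?n. length (filter (\<lambda>u. u = v) (?S c))) \<le> (\<Sum>c<?n. length (snd (cs ! c)))"
      by (intro sum_mono) (metis length_filter_le length_map)
    also have "\<dots> = length (concat (map snd cs))"
      by (simp add: length_concat sum_list_sum_nth atLeast0LessThan)
    finally have "2 * (\<Sum>c<?n. length (filter (\<lambda>u. u = v) (?S c))) < ?k" by (simp add: row_bound_def)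
    then show ?thesis unfolding cnt using var by (simp add: sum_distrib_left)
  next
    case last
    have "filter (\<lambda>u. u = v) (?S c) = []" for c using last by (auto simp: filter_empty_conv)
    moreover have "(c + 2, z) \<noteq> v" for c using last by auto
    ultimately show ?thesis unfolding cnt using n by simp
  next
    case switch
    have 0: "filter (\<lambda>u. u = v) (?S c) = []" for c by (subst switch) (auto simp: filter_empty_conv)
    have 1: "(c + 2, z) = v \<longleftrightarrow> c = d \<and> z = snd v" for c by (subst switch) auto
    have 2: "(1, z) \<noteq> v" by (subst switch) auto
    have "card {c. c < ?n \<and> (c + 2, z) = v} \<le> card {d}" unfolding 1 by (intro card_mono) auto
    moreover have "(\<Sum>c<?n. if (c + 2, z) = v then ?k - 2 * fst (cs ! c) else 0) \<le> ?k - 2"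
    proof (cases "z = snd v \<and> d < ?n")
      case True
      then have "(\<Sum>c<?n. if (c + 2, z) = v then ?k - 2 * fst (cs ! c) else 0) = ?k - 2 * fst (cs ! d)"
        unfolding 1 by (simp add: sum.delta)
      then show ?thesis using cs[of "cs ! d"] True by auto
    next
      case False
      then show ?thesis unfolding 1 by (auto intro!: sum.neutral)
    qed
    ultimately show ?thesis unfolding cnt 0 using n 2 by simp
  qed
qed

text \<open>As there are fewer than \<open>k\<close> switches, a count of 0 or \<open>k\<close> in
  the last row means that all or none of them are on. If none, the filler is off and
  \<open>2 * length S < k\<close> leaves only the count 0 in the other rows, so nothing is selected.
  If all, the count \<open>2 x + k - 2 m\<close> is positive, hence equal to \<open>k\<close>, and
  \<open>x = m\<close>.\<close>

lemma constraint_rows_iff: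
  assumes "cs \<noteq> []"
  shows "(\<exists>X. X \<noteq> {} \<and> X \<subseteq> set (concat (constraint_rows z cs)) \<and>
      (\<forall>rw\<in>set (constraint_rows z cs). length (filter (\<lambda>v. v \<in> X) rw) \<in> {0, row_bound cs})) \<longleftrightarrow> (\<exists>A. exactly cs A)"
    (is "?l \<longleftrightarrow> ?r")
proof -
  let ?k = "row_bound cs" and ?n = "length cs"
  let ?S = "\<lambda>c. map (Pair (0::nat)) (snd (cs ! c))"
  let ?R = "\<lambda>c. ?S c @ ?S c @ replicate (?k - 2 * fst (cs ! c)) (c + 2, z)"
  let ?L = "map (\<lambda>c. (c + 2, z)) [0..<?n] @ replicate (?k - ?n) (1, z)"
  have n: "0 < ?n" "?n < ?k" using assms by (simp_all add: row_bound_def)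
  have rows: "constraint_rows z cs = map ?R [0..<?n] @ [?L]"
    by (simp add: constraint_rows_def Let_def nthd)
  have rep: "length (filter (\<lambda>u. u \<in> X) (replicate a b)) = (if b \<in> X then a else 0)" for a and b :: "nat \<times> 'v" and X by simp
  have R: "length (filter (\<lambda>v. v \<in> X) (?R c)) = 2 * length (filter (\<lambda>v. (0, v) \<in> X) (snd (cs ! c))) +
      (if (c + 2, z) \<in> X then ?k - 2 * fst (cs ! c) else 0)" for X c
    unfolding filter_append length_append rep by (simp add: filter_map comp_def)
  have L: "length (filter (\<lambda>v. v \<in> X) ?L) = card {c. c < ?n \<and> (c + 2, z) \<in> X} + (if (1, z) \<in> X then ?k - ?n else 0)" for X
  proof -
    have "length (filter (\<lambda>u. u \<in> X) (map (\<lambda>c. (c + 2, z)) [0..<?n])) = card {c. c < ?n \<and> (c + 2, z) \<in> X}"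
      by (simp only: filter_map length_map length_filter_conv_card comp_def length_upt)
        (intro arg_cong[of _ _ card], auto)
    then show ?thesis unfolding filter_append length_append rep by simp
  qed
  have c: "1 \<le> fst (cs ! c)" "fst (cs ! c) \<le> length (snd (cs ! c))" "2 * length (snd (cs ! c)) < ?k" if "c < ?n" for c
    using that cs[of "cs ! c"] size_constraint[of "cs ! c"] by simp_all
  show ?thesis
  proof
    assume ?l
    then obtain X where X: "X \<noteq> {}" "X \<subseteq> set (concat (constraint_rows z cs))"
      "\<And>rw. rw \<in> set (constraint_rows z cs) \<Longrightarrow> length (filter (\<lambda>v. v \<in> X) rw) \<in> {0, ?k}" by blast
    let ?A = "{v. (0, v) \<in> X}"
    have XR: "2 * length (filter (\<lambda>v. (0, v) \<in> X) (snd (cs ! c))) + (if (c + 2, z) \<in> X then ?k - 2 * fst (cs ! c) else 0) \<in> {0, ?k}"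
      if "c < ?n" for c using X(3)[of "?R c"] that unfolding R rows by simp
    have XL: "card {c. c < ?n \<and> (c + 2, z) \<in> X} + (if (1, z) \<in> X then ?k - ?n else 0) \<in> {0, ?k}"
      using X(3)[of ?L] unfolding L rows by simp
    have le: "length (filter (\<lambda>v. (0, v) \<in> X) (snd (cs ! c))) \<le> length (snd (cs ! c))" for c by (rule length_filter_le)
    have card: "card {c. c < ?n \<and> (c + 2, z) \<in> X} \<le> ?n"
      using card_mono[of "{..<?n}" "{c. c < ?n \<and> (c + 2, z) \<in> X}"] by auto
    show ?r
    proof (cases "card {c. c < ?n \<and> (c + 2, z) \<in> X} = ?n")
      case True
      then have "{c. c < ?n \<and> (c + 2, z) \<in> X} = {..<?n}" by (intro card_subset_eq) auto
      then have on: "(c + 2, z) \<in> X" if "c < ?n" for c using that by blast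
      have "length (filter (\<lambda>v. v \<in> ?A) (snd (cs ! i))) = fst (cs ! i)" if "i < ?n" for i
        using XR[OF that] on[OF that] c[OF that] by auto
      then have "exactly cs ?A" unfolding exactly_def by (metis in_set_conv_nth)
      then show ?r by blast
    next
      case False
      then have 0: "card {c. c < ?n \<and> (c + 2, z) \<in> X} = 0" "(1, z) \<notin> X"
        using XL card n by (auto split: if_splits)
      then have off: "(i + 2, z) \<notin> X" if "i < ?n" for i using that by auto
      have "length (filter (\<lambda>v. (0, v) \<in> X) (snd (cs ! i))) = 0" if "i < ?n" for i
      proof -
        have "2 * length (filter (\<lambda>v. (0, v) \<in> X) (snd (cs ! i))) = 0 \<or> 2 * length (filter (\<lambda>v. (0, v) \<in> X) (snd (cs ! i))) = ?k"
          using XR[OF that] off[OF that] by simp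
        then show ?thesis using c(3)[OF that] le[of i] by linarith
      qed
      then have "\<forall>v\<in>set (snd (cs ! i)). (0, v) \<notin> X" if "i < ?n" for i
        using that by (auto simp: filter_empty_conv)
      then have "x \<notin> X" if "x \<in> set (concat (constraint_rows z cs))" for x
        using that off 0(2) unfolding rows by (auto split: if_splits)
      then show ?r using X(1,2) by blast
    qed
  next
    assume ?r
    then obtain A where A: "exactly cs A" by blast
    let ?X = "{x \<in> set (concat (constraint_rows z cs)). fst x = 0 \<longrightarrow> snd x \<in> A}"
    let ?Y = "{x :: nat \<times> 'v. fst x = 0 \<longrightarrow> snd x \<in> A}"
    have "length (filter (\<lambda>v. v \<in> ?Y) rw) = ?k" if "rw \<in> set (constraint_rows z cs)" for rw
    proof -
      have "rw \<in> ?R ` set [0..<?n] \<or> rw = ?L"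
        using that unfolding rows by (simp only: set_append set_map list.set Un_iff insert_iff empty_iff simp_thms)
      then show ?thesis
      proof (elim disjE imageE)
        fix i assume i: "rw = ?R i" "i \<in> set [0..<?n]"
        then have "i < ?n" by simp
        moreover from this have "length (filter (\<lambda>v. v \<in> A) (snd (cs ! i))) = fst (cs ! i)"
          using A unfolding exactly_def by simp
        ultimately show ?thesis unfolding i(1) R using c[of i] by simp
      next
        assume 2: "rw = ?L"
        have "{c. c < ?n \<and> (c + 2, z) \<in> ?Y} = {..<?n}" by auto
        then have "card {c. c < ?n \<and> (c + 2, z) \<in> ?Y} = ?n" by simp
        moreover have "(1, z) \<in> ?Y" by simp
        ultimately show ?thesis unfolding 2 L using n by simp
      qed
    qed
    moreover have "filter (\<lambda>v. v \<in> ?X) rw = filter (\<lambda>v. v \<in> ?Y) rw" if "rw \<in> set (constraint_rows z cs)" for rw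
      using that by (intro filter_cong) auto
    ultimately have r: "\<forall>rw\<in>set (constraint_rows z cs). length (filter (\<lambda>v. v \<in> ?X) rw) \<in> {0, ?k}" by simp
    have "?L \<in> set (constraint_rows z cs)" "(1, z) \<in> set ?L" using n unfolding rows by simp_all
    then have "(1, z) \<in> set (concat (constraint_rows z cs))" unfolding set_concat by (rule UN_I)
    then have "(1, z) \<in> ?X" by simp
    then have "?X \<noteq> {}" by (metis empty_iff)
    moreover have "?X \<subseteq> set (concat (constraint_rows z cs))" by (rule Collect_restrict)
    ultimately show ?l using r by (intro exI[of _ ?X] conjI)
  qed
qed

end

section \<open>Clauses as exactly-m constraints\<close>

text \<open>The slack variables of a clause with \<open>m\<close> literals make up for up to \<open>m - 1\<close> false literals.\<close>

type_synonym lvar = "nat \<times> nat \<times> bool \<times> atom"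

definition no_atom :: atom where "no_atom = (0, 0, 0, 0, 0)"

definition clause_constraint :: "nat \<Rightarrow> (bool \<times> atom) list \<Rightarrow> nat \<times> lvar list" where
  "clause_constraint j C = (length C, map (\<lambda>l. (0, 0, l)) C @ map (\<lambda>i. (Suc j, i, True, no_atom)) [0..<length C - 1])"

definition constraints :: "cnf \<Rightarrow> (nat \<times> lvar list) list" where
  "constraints F = map (\<lambda>v. (1, [(0, 0, True, v), (0, 0, False, v)])) (nubs (map snd (concat F))) @
     map (\<lambda>j. clause_constraint j (nthd [] F j)) [0..<length F]"

lemma exactly_append: "exactly (xs @ ys) A \<longleftrightarrow> exactly xs A \<and> exactly ys A"
  by (auto simp: exactly_def)

lemma constraints_iff:
  assumes "[] \<notin> set F"
  shows "(\<exists>A. exactly (constraints F) A) \<longleftrightarrow> (\<exists>\<alpha>. sat \<alpha> F)"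
proof -
  have ex: "exactly (constraints F) A \<longleftrightarrow>
    (\<forall>v\<in>set (map snd (concat F)). ((0, 0, True, v) \<in> A) \<noteq> ((0, 0, False, v) \<in> A)) \<and>
    (\<forall>j<length F. length (filter (\<lambda>l. (0, 0, l) \<in> A) (F ! j)) +
      length (filter (\<lambda>i. (Suc j, i, True, no_atom) \<in> A) [0..<length (F ! j) - 1]) = length (F ! j))" for A
  proof -
    have "exactly (map (\<lambda>v. (1, [(0, 0, True, v), (0, 0, False, v)])) vs) A \<longleftrightarrow>
      (\<forall>v\<in>set vs. ((0, 0, True, v) \<in> A) \<noteq> ((0, 0, False, v) \<in> A))" for vs
      by (auto simp: exactly_def)
    moreover have "exactly (map (\<lambda>j. clause_constraint j (nthd [] F j)) [0..<length F]) A \<longleftrightarrow>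
      (\<forall>j<length F. length (filter (\<lambda>l. (0, 0, l) \<in> A) (F ! j)) +
        length (filter (\<lambda>i. (Suc j, i, True, no_atom) \<in> A) [0..<length (F ! j) - 1]) = length (F ! j))"
      by (auto simp: exactly_def clause_constraint_def filter_map comp_def nthd)
    ultimately show ?thesis unfolding constraints_def exactly_append by (simp only: nubs)
  qed
  have ne: "0 < length (F ! j)" if "j < length F" for j using assms nth_mem[OF that] by (cases "F ! j") auto
  show ?thesis
  proof
    assume "\<exists>A. exactly (constraints F) A"
    then obtain A where var: "\<And>v. v \<in> set (map snd (concat F)) \<Longrightarrow> ((0, 0, True, v) \<in> A) \<noteq> ((0, 0, False, v) \<in> A)"
      and cl: "\<And>j. j < length F \<Longrightarrow> length (filter (\<lambda>l. (0, 0, l) \<in> A) (F ! j)) +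
      length (filter (\<lambda>i. (Suc j, i, True, no_atom) \<in> A) [0..<length (F ! j) - 1]) = length (F ! j)"
      unfolding ex by blast
    have "sat (\<lambda>v. (0, 0, True, v) \<in> A) F"
      unfolding sat_def
    proof
      fix C assume "C \<in> set F"
      then obtain j where j: "j < length F" "C = F ! j" by (auto simp: in_set_conv_nth)
      have "length (filter (\<lambda>i. (Suc j, i, True, no_atom) \<in> A) [0..<length (F ! j) - 1]) \<le> length (F ! j) - 1"
        using length_filter_le[of _ "[0..<length (F ! j) - 1]"] by simp
      then have "0 < length (filter (\<lambda>l. (0, 0, l) \<in> A) (F ! j))" using cl[OF j(1)] ne[OF j(1)] by linarith
      then obtain l where l: "l \<in> set C" "(0, 0, l) \<in> A" unfolding j(2) by (auto simp: filter_empty_conv)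
      obtain b v where bv: "l = (b, v)" by (cases l)
      then have "v \<in> set (map snd (concat F))" using l(1) \<open>C \<in> set F\<close> by force
      from var[OF this] have "((0, 0, True, v) \<in> A) = b" using l(2) bv by (cases b) auto
      then show "\<exists>l\<in>set C. ((0, 0, True, snd l) \<in> A) = fst l" using l(1) bv by (intro bexI[of _ l]) auto
    qed
    then show "\<exists>\<alpha>. sat \<alpha> F" by (rule exI[of "\<lambda>\<alpha>. sat \<alpha> F"])
  next
    assume "\<exists>\<alpha>. sat \<alpha> F"
    then obtain \<alpha> where \<alpha>: "sat \<alpha> F" by blast
    define t where "t j = length (filter (\<lambda>l. \<alpha> (snd l) = fst l) (F ! j))" for j
    \<comment> \<open>Literals are selected by their truth value. Of the slack variables of a clause
      the first ones are selected, as many as it has false literals.\<close>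
    define A :: "lvar set" where "A = {(j, i, l). if j = 0 then \<alpha> (snd l) = fst l else i < length (F ! (j - 1)) - t (j - 1)}"
    have "exactly (constraints F) A"
      unfolding ex
    proof (intro conjI ballI allI impI)
      show "((0, 0, True, v) \<in> A) \<noteq> ((0, 0, False, v) \<in> A)" for v by (simp add: A_def)
      fix j assume j: "j < length F"
      have "F ! j \<in> set F" using j by simp
      then obtain l where "l \<in> set (F ! j)" "\<alpha> (snd l) = fst l" using \<alpha> unfolding sat_def by blast
      then have "filter (\<lambda>l. \<alpha> (snd l) = fst l) (F ! j) \<noteq> []" by (auto simp: filter_empty_conv)
      then have t: "0 < t j" by (simp add: t_def)
      have tl: "t j \<le> length (F ! j)" by (simp add: t_def)
      have "length (filter (\<lambda>i. (Suc j, i, True, no_atom) \<in> A) [0..<length (F ! j) - 1]) = length (filter (\<lambda>i. i < length (F ! j) - t j) [0..<length (F ! j) - 1])"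
        by (simp add: A_def)
      also have "\<dots> = card {i. i < length (F ! j) - 1 \<and> i < length (F ! j) - t j}"
        by (simp only: length_filter_conv_card length_upt) (intro arg_cong[of _ _ card], auto)
      also have "{i. i < length (F ! j) - 1 \<and> i < length (F ! j) - t j} = {..<length (F ! j) - t j}" using t by auto
      finally have "length (filter (\<lambda>i. (Suc j, i, True, no_atom) \<in> A) [0..<length (F ! j) - 1]) = length (F ! j) - t j" by simp
      moreover have "length (filter (\<lambda>l. (0, 0, l) \<in> A) (F ! j)) = t j" by (simp add: A_def t_def)
      ultimately show "length (filter (\<lambda>l. (0, 0, l) \<in> A) (F ! j)) +
        length (filter (\<lambda>i. (Suc j, i, True, no_atom) \<in> A) [0..<length (F ! j) - 1]) = length (F ! j)" using tl by simp
    qed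
    then show "\<exists>A. exactly (constraints F) A" by blast
  qed
qed

definition formula_code :: "cnf \<Rightarrow> bool list" where
  "formula_code F = (let cs = constraints F in system_code (row_bound cs) (constraint_rows (0, 0, True, no_atom) cs))"

lemma formula_code_iff:
  assumes "[] \<notin> set F" "F \<noteq> []"
  shows "formula_code F \<in> spectral_degeneracy_problem \<longleftrightarrow> (\<nexists>\<alpha>. sat \<alpha> F)"
proof -
  have len: "0 < length C" if "C \<in> set F" for C using that assms(1) by (cases C) auto
  have cs: "1 \<le> fst e \<and> fst e \<le> length (snd e)" if "e \<in> set (constraints F)" for e
    using that len[of "F ! j" for j] by (auto simp: constraints_def clause_constraint_def nthd Suc_le_eq)
  have ne: "constraints F \<noteq> []" using assms(2) by (simp add: constraints_def)
  have "concat (constraint_rows (0, 0, True, no_atom) (constraints F)) \<noteq> []"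
    by (simp add: constraint_rows_def Let_def row_bound_def)
  note s = system_code_iff[OF count_constraint_rows[OF cs ne] this]
  show ?thesis
    by (simp only: formula_code_def Let_def s constraint_rows_iff[OF cs ne] constraints_iff[OF assms(1)])
qed

lemma pt_formula_code: "pt F \<Longrightarrow> pt (\<lambda>x. formula_code (F x))"
proof (rule pt_comp[of formula_code])
  have "pt (\<lambda>q :: nat \<times> (bool \<times> atom) list. clause_constraint (fst q) (snd q))"
    unfolding clause_constraint_def by (intro pt_intros)
  note c = pt_comp2[OF this]
  have c: "pt (\<lambda>F. constraints F)"
    unfolding constraints_def by (intro pt_intros c pt_nubs)
  have b: "pt (\<lambda>cs :: (nat \<times> lvar list) list. row_bound cs)"
    unfolding row_bound_def by (intro pt_intros)
  have r: "pt (\<lambda>cs. constraint_rows z cs)" for z :: lvar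
    unfolding constraint_rows_def by (intro pt_intros pt_comp[OF b])
  have e: "pt (\<lambda>q :: (nat \<times> lvar) \<times> nat \<times> lvar. fst q = snd q)" by (intro pt_intros)
  show "pt (\<lambda>F. formula_code F)"
    unfolding formula_code_def Let_def by (rule pt_system_code[OF e pt_comp[OF b c] pt_comp[OF r c]])
qed

section \<open>Hardness\<close>

lemma cook_nonempty: "[] \<notin> set (cook M w P T)" "cook M w P T \<noteq> []"
proof -
  have "([] = horn as b) = False" for as b by (simp add: horn_def)
  note h = this
  show "[] \<notin> set (cook M w P T)"
    by (auto simp: cook_def cook_init_def cook_input_def cook_scan_def cook_trans_def cook_write_def cook_move_def cook_keep_def Let_def h
      simp del: upt_Suc)
qed (simp add: cook_def)

lemma tm_outputs_within_mono:
  assumes "tm_outputs_within M x m y" "m \<le> n"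
  shows "tm_outputs_within M x n y"
proof -
  obtain ts where ts: "(tm_step M ^^ m) (tm_init M x) = (tm_halt M, ts)"
    using assms(1) by (auto simp: tm_outputs_within_def split: prod.splits)
  have halt: "(tm_step M ^^ d) (tm_halt M, ts) = (tm_halt M, ts)" for d
    by (induction d) (simp_all add: tm_step_def)
  have "(tm_step M ^^ n) (tm_init M x) = (tm_step M ^^ (n - m)) ((tm_step M ^^ m) (tm_init M x))"
    using assms(2) by (metis le_add_diff_inverse2 funpow_add comp_apply)
  then have "(tm_step M ^^ n) (tm_init M x) = (tm_step M ^^ m) (tm_init M x)" by (simp add: ts halt)
  then show ?thesis using assms(1) by (simp add: tm_outputs_within_def)
qed

lemma poly_nat_mono: "a \<le> b \<Longrightarrow> poly p a \<le> poly p (b :: nat)"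
  by (induction p) (auto intro: add_mono mult_mono)

text \<open>For \<open>L\<close> in co-NP the formula states that some certificate proves
  \<open>x \<in> - L\<close>. Its unsatisfiability, equivalent to \<open>x \<in> L\<close>, is the
  same as degeneracy of the constructed instance.\<close>

theorem spectral_degeneracy_coNP_hard: "coNP_hard spectral_degeneracy_problem"
  unfolding coNP_hard_def
proof
  fix L assume "L \<in> class_coNP"
  then obtain R p where R: "R \<in> class_P"
    and L: "\<And>x. x \<in> - L \<longleftrightarrow> (\<exists>u. length u \<le> poly p (length x) \<and> pair_code x u \<in> R)"
    unfolding class_coNP_def class_NP_def by blast
  obtain M q where M: "turing_machine M" and out: "\<And>z. tm_outputs_within M z (poly q (length z)) [z \<in> R]"
    using R unfolding class_P_def polynomial_time_def by blast
  define w where "w x = pair_code x []" for x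
  define P where "P x = poly p (length x)" for x :: "bool list"
  \<comment> \<open>The first summand bounds the running time for all admissible certificates at
    once, as polynomials over the natural numbers are monotone; the second makes room for the
    input.\<close>
  define T where "T x = poly q (length (w x) + P x) + (length (w x) + P x)" for x
  define f where "f x = formula_code (cook M (w x) (P x) (T x))" for x
  have "x \<in> L \<longleftrightarrow> f x \<in> spectral_degeneracy_problem" for x
  proof -
    have "tm_outputs_within M (pair_code x u) (T x) [pair_code x u \<in> R]" if "length u \<le> P x" for u
    proof (rule tm_outputs_within_mono[OF out])
      have "length (pair_code x u) \<le> length (w x) + P x"
        using that by (simp add: w_def pair_code_def)
      then have "poly q (length (pair_code x u)) \<le> poly q (length (w x) + P x)" by (rule poly_nat_mono)
      then show "poly q (length (pair_code x u)) \<le> T x" by (simp add: T_def)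
    qed
    then have "(\<exists>\<alpha>. sat \<alpha> (cook M (w x) (P x) (T x))) \<longleftrightarrow> (\<exists>u. length u \<le> P x \<and> pair_code x u \<in> R)"
      unfolding w_def by (intro cook_correct[OF M]) (simp_all add: T_def w_def)
    then show ?thesis
      using L[of x] unfolding f_def formula_code_iff[OF cook_nonempty] P_def by blast
  qed
  moreover have "polynomial_time f"
    unfolding f_def T_def P_def w_def
    by (intro pt_polynomial_time pt_formula_code pt_cook pt_intros pt_poly)
  ultimately show "poly_reducible L spectral_degeneracy_problem"
    unfolding poly_reducible_def by blast
qed

theorem theorem5p7:
  shows "coNP_complete spectral_degeneracy_problem"
  unfolding coNP_complete_def using spectral_degeneracy_in_coNP spectral_degeneracy_coNP_hard ..

end
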